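(* Let $\Omega\subset\mathbb R^2$ be a bounded simply connected domain with $C^2$ boundary, $T>0$, $\varepsilon>0$, $\lambda>0$, $R_u>0$, $N\in\mathbb N$, let $h_1,\dots,h_N\in C^\infty(\overline\Omega)\cap H_0^1(\Omega)$ be linearly independent, and let $\gamma_0\in W^{2,\infty}([0,1];\overline\Omega)$. Then: (i) (State regularity and well-posedness.) For every $u\in L^2(0,T;\mathbb R^N)$, with associated stream function $\psi(t,x)=\sum_{k=1}^Nu_k(t)h_k(x)$, one has $$\psi\in L^2(0,T;W^{3,\infty}(\overline\Omega)),\qquad \mathbf v=\nabla^\perp\psi\in L^2(0,T;W^{2,\infty}(\Omega;\mathbb R^2));$$ the flow $\Phi_\psi$ maps $\overline\Omega$ into itself; and the state system $$\partial_tX=J\nabla_x\psi(t,X),\quad \partial_ta=J\nabla_x^2\psi(t,X)\,a,\quad X(0,s)=\gamma_0(s),\quad a(0,s)=\gamma_0'(s)$$ admits a unique solution $(X,a)\in C([0,T]\times[0,1];\overline\Omega\times\mathbb R^2)$. Consequently, the cost functional $$\mathcal J_{\lambda,\varepsilon}(\psi)=-\int_0^1\sqrt{|a(T,s)|^2+\varepsilon^2}\,ds+\frac\lambda2\int_0^T\|\psi(t,\cdot)\|_{L^2(\Omega)}^2\,dt$$ is well defined and depends continuously on $u\in L^2(0,T;\mathbb R^N)$. (ii) (Existence of a minimizer.) The minimization problem $$\min_{\psi\in\mathcal U_{\mathrm{ad}}^{R_u}}\mathcal J_{\lambda,\varepsilon}(\psi)$$ admits at least one minimizer $\psi^*\in\mathcal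 U_{\mathrm{ad}}^{R_u}$, where $$\mathcal U_{\mathrm{ad}}^{R_u}=\Bigl\{\psi(t,x)=\sum_{k=1}^Nu_k(t)h_k(x)\;:\;u\in L^2(0,T;\mathbb R^N),\ \|u\|_{L^2(0,T;\mathbb R^N)}\le R_u\Bigr\}.$$
   Context: $J=\begin{pmatrix}0&-1\\1&0\end{pmatrix}$, $\nabla^\perp\psi:=(-\partial_{x_2}\psi,\partial_{x_1}\psi)=J\nabla_x\psi$, and $\nabla_x^2\psi$ is the Hessian in $x$. The flow $\Phi_\psi(t;x)$ is the solution of $\frac{d}{dt}\Phi_\psi(t;x)=J\nabla_x\psi(t,\Phi_\psi(t;x))$, $\Phi_\psi(0;x)=x$. ODEs with coefficients in $L^2$ in time are understood in the Carathéodory (integral) sense, for each $s\in[0,1]$. $\gamma_0'$ is the continuous (Lipschitz) representative. By linear independence of the $h_k$, each $\psi$ of the form $\sum_ku_kh_k$ is identified with its coefficient vector $u$, and $(X,a)$ in the cost is the solution of the state system for that $\psi$. *)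

theory Defs
  imports "HOL-Analysis.Analysis" "HOL-Probability.Essential_Supremum"
begin

section \<open>Classical derivatives and smooth functions\<close>

definition pd :: "'a::euclidean_space \<Rightarrow> ('a \<Rightarrow> 'b::real_normed_vector) \<Rightarrow> 'a \<Rightarrow> 'b" where
  "pd b f x = frechet_derivative f (at x) b"

text \<open>A multi-index is a list of coordinate directions from \<^term>\<open>Basis\<close>;
  its length is the order of the derivative.\<close>

primrec ipd :: "'a::euclidean_space list \<Rightarrow> ('a \<Rightarrow> 'b::real_normed_vector) \<Rightarrow> 'a \<Rightarrow> 'b" where
  "ipd [] f = f"
| "ipd (b # bs) f = pd b (ipd bs f)"

text \<open>\<open>C\<^sup>k(S)\<close>, for open \<open>S\<close>.\<close>

definition Ck :: "nat \<Rightarrow> 'a::euclidean_space set \<Rightarrow> ('a \<Rightarrow> 'b::real_normed_vector) \<Rightarrow> bool" where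
  "Ck k S f \<longleftrightarrow> (\<forall>\<alpha>. set \<alpha> \<subseteq> Basis \<and> length \<alpha> \<le> k \<longrightarrow>
     continuous_on S (ipd \<alpha> f) \<and> (length \<alpha> < k \<longrightarrow> ipd \<alpha> f differentiable_on S))"

definition Cinf :: "'a::euclidean_space set \<Rightarrow> ('a \<Rightarrow> 'b::real_normed_vector) \<Rightarrow> bool" where
  "Cinf S f \<longleftrightarrow> (\<forall>k. Ck k S f)"

text \<open>\<open>C\<^sup>\<infinity>\<close> up to the boundary: every derivative taken in the open set \<open>S\<close> extends continuously
  to the closure; the boundary values of \<open>f\<close> itself are those of its continuous extension.\<close>

definition Cinf_closure :: "'a::euclidean_space set \<Rightarrow> ('a \<Rightarrow> 'b::real_normed_vector) \<Rightarrow> bool" where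
  "Cinf_closure S f \<longleftrightarrow> Cinf S f \<and> continuous_on (closure S) f \<and>
     (\<forall>\<alpha>. set \<alpha> \<subseteq> Basis \<longrightarrow>
        (\<exists>F. continuous_on (closure S) F \<and> (\<forall>x\<in>S. F x = ipd \<alpha> f x)))"

definition test_function :: "'a::euclidean_space set \<Rightarrow> ('a \<Rightarrow> real) \<Rightarrow> bool" where
  "test_function S \<phi> \<longleftrightarrow> Cinf UNIV \<phi> \<and> (\<exists>K. compact K \<and> K \<subseteq> S \<and> (\<forall>x. x \<notin> K \<longrightarrow> \<phi> x = 0))"

section \<open>Lebesgue and Sobolev spaces\<close>

definition L2_on :: "'a::euclidean_space set \<Rightarrow> ('a \<Rightarrow> 'b::euclidean_space) \<Rightarrow> bool" where
  "L2_on S f \<longleftrightarrow> f \<in> borel_measurable (lebesgue_on S) \<and>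
     integrable (lebesgue_on S) (\<lambda>x. (norm (f x))\<^sup>2)"

definition L2norm :: "'a::euclidean_space set \<Rightarrow> ('a \<Rightarrow> 'b::euclidean_space) \<Rightarrow> real" where
  "L2norm S f = sqrt (LINT x|lebesgue_on S. (norm (f x))\<^sup>2)"

definition locally_integrable :: "'a::euclidean_space set \<Rightarrow> ('a \<Rightarrow> 'b::euclidean_space) \<Rightarrow> bool" where
  "locally_integrable S f \<longleftrightarrow> (\<forall>K. compact K \<and> K \<subseteq> S \<longrightarrow> f absolutely_integrable_on K)"

definition has_weak_deriv ::
  "'a::euclidean_space set \<Rightarrow> 'a list \<Rightarrow> ('a \<Rightarrow> 'b::euclidean_space) \<Rightarrow> ('a \<Rightarrow> 'b) \<Rightarrow> bool" where
  "has_weak_deriv S \<alpha> f g \<longleftrightarrow> locally_integrable S f \<and> locally_integrable S g \<and>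
     (\<forall>\<phi>. test_function S \<phi> \<longrightarrow>
        integral S (\<lambda>x. ipd \<alpha> \<phi> x *\<^sub>R f x) = (-1) ^ length \<alpha> *\<^sub>R integral S (\<lambda>x. \<phi> x *\<^sub>R g x))"

text \<open>The norm of \<open>W\<^sup>k\<^sup>,\<^sup>\<infinity>(S)\<close> as an extended number. Weak derivatives are unique up to null sets, so
  the infimum is over a single value; it is \<open>\<infinity>\<close> when the weak derivative does not exist.
  Hence \<open>f \<in> W\<^sup>k\<^sup>,\<^sup>\<infinity>(S)\<close> iff the norm is finite.\<close>

definition Wnorm :: "nat \<Rightarrow> 'a::euclidean_space set \<Rightarrow> ('a \<Rightarrow> 'b::euclidean_space) \<Rightarrow> ennreal" where
  "Wnorm k S f = (SUP \<alpha>\<in>{\<alpha>. set \<alpha> \<subseteq> Basis \<and> length \<alpha> \<le> k}.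
     INF g\<in>{g. has_weak_deriv S \<alpha> f g}. esssup (lebesgue_on S) (\<lambda>x. ennreal (norm (g x))))"

definition W_inf :: "nat \<Rightarrow> 'a::euclidean_space set \<Rightarrow> ('a \<Rightarrow> 'b::euclidean_space) \<Rightarrow> bool" where
  "W_inf k S f \<longleftrightarrow> Wnorm k S f < \<infinity>"

text \<open>\<open>H\<^sup>1\<^sub>0(S)\<close>: the closure of the test functions in \<open>H\<^sup>1(S)\<close>.\<close>

definition H10 :: "'a::euclidean_space set \<Rightarrow> ('a \<Rightarrow> real) \<Rightarrow> bool" where
  "H10 S f \<longleftrightarrow> L2_on S f \<and>
     (\<exists>g. (\<forall>b\<in>Basis. has_weak_deriv S [b] f (g b) \<and> L2_on S (g b)) \<and>
       (\<exists>\<phi>. (\<forall>n::nat. test_function S (\<phi> n)) \<and>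
          (\<lambda>n. L2norm S (\<lambda>x. \<phi> n x - f x)) \<longlonglongrightarrow> 0 \<and>
          (\<forall>b\<in>Basis. (\<lambda>n. L2norm S (\<lambda>x. pd b (\<phi> n) x - g b x)) \<longlonglongrightarrow> 0)))"

text \<open>The Bochner space \<open>L\<^sup>2(0,T;V)\<close> for a space \<open>V\<close> of functions given by its extended norm:
  \<open>f\<close> is the almost everywhere limit in \<open>V\<close> of simple \<open>V\<close>-valued functions,
  and its norm is square integrable.\<close>

definition bochner_L2 ::
  "real \<Rightarrow> (('a \<Rightarrow> 'b::real_normed_vector) \<Rightarrow> ennreal) \<Rightarrow> (real \<Rightarrow> 'a \<Rightarrow> 'b) \<Rightarrow> bool" where
  "bochner_L2 T nrm f \<longleftrightarrow>
     (AE t in lebesgue_on {0..T}. nrm (f t) < \<infinity>) \<and>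
     (\<exists>s. (\<forall>n::nat. finite (s n ` {0..T}) \<and>
             (\<forall>w. {t\<in>{0..T}. s n t = w} \<in> sets lebesgue) \<and>
             (\<forall>t\<in>{0..T}. nrm (s n t) < \<infinity>)) \<and>
          (AE t in lebesgue_on {0..T}. (\<lambda>n. nrm (\<lambda>x. s n t x - f t x)) \<longlonglongrightarrow> 0)) \<and>
     (\<integral>\<^sup>+t. (nrm (f t))\<^sup>2 \<partial>lebesgue_on {0..T}) < \<infinity>"

section \<open>Planar domains with \<open>C\<^sup>2\<close> boundary\<close>

text \<open>Near each boundary point, and in suitable Cartesian coordinates,
  the set is the part of the plane strictly above the graph of a \<open>C\<^sup>2\<close> function.\<close>

definition C2_boundary :: "(real^2) set \<Rightarrow> bool" where
  "C2_boundary \<Omega> \<longleftrightarrow> (\<forall>p\<in>frontier \<Omega>. \<exists>r>0. \<exists>A :: real^2 \<Rightarrow> real^2. \<exists>g :: real \<Rightarrow> real.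
     orthogonal_transformation A \<and> Ck 2 UNIV g \<and>
     \<Omega> \<inter> ball p r = {x \<in> ball p r. A x $ 2 > g (A x $ 1)})"

definition C2_simply_connected_domain :: "(real^2) set \<Rightarrow> bool" where
  "C2_simply_connected_domain \<Omega> \<longleftrightarrow> open \<Omega> \<and> connected \<Omega> \<and> \<Omega> \<noteq> {} \<and> bounded \<Omega> \<and>
     simply_connected \<Omega> \<and> C2_boundary \<Omega>"

section \<open>Stream functions and their derivatives up to the boundary\<close>

definition cl_ext :: "(real^2) set \<Rightarrow> (real^2 \<Rightarrow> 'b::t2_space) \<Rightarrow> real^2 \<Rightarrow> 'b" where
  "cl_ext \<Omega> F x = (if x \<in> \<Omega> then F x else Lim (at x within \<Omega>) F)"

definition grad :: "(real^2) set \<Rightarrow> (real^2 \<Rightarrow> real) \<Rightarrow> real^2 \<Rightarrow> real^2" where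
  "grad \<Omega> f = cl_ext \<Omega> (\<lambda>x. \<chi> i. pd (axis i 1) f x)"

definition hess :: "(real^2) set \<Rightarrow> (real^2 \<Rightarrow> real) \<Rightarrow> real^2 \<Rightarrow> real^2^2" where
  "hess \<Omega> f = cl_ext \<Omega> (\<lambda>x. \<chi> i j. pd (axis j 1) (pd (axis i 1) f) x)"

definition Jmat :: "real^2^2" where
  "Jmat = vector [vector [0, -1], vector [1, 0]]"

definition perp_grad :: "(real^2) set \<Rightarrow> (real^2 \<Rightarrow> real) \<Rightarrow> real^2 \<Rightarrow> real^2" where
  "perp_grad \<Omega> f x = Jmat *v grad \<Omega> f x"

definition stream :: "('n::finite \<Rightarrow> real^2 \<Rightarrow> real) \<Rightarrow> (real \<Rightarrow> real^'n) \<Rightarrow> real \<Rightarrow> real^2 \<Rightarrow> real" where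
  "stream h u t x = (\<Sum>k\<in>UNIV. u t $ k * h k x)"

section \<open>The flow, the state system and the cost\<close>

text \<open>Caratheodory solutions on \<open>[0,T]\<close> of \<open>X' = F(t,X)\<close>, \<open>X(0) = x0\<close>, where the field \<open>F(t,\<cdot>)\<close> is defined
  on \<open>D\<close>; a solution takes its values in \<open>D\<close>, as the equation has no meaning elsewhere.\<close>

definition caratheodory_solution ::
  "'a::euclidean_space set \<Rightarrow> real \<Rightarrow> (real \<Rightarrow> 'a \<Rightarrow> 'a) \<Rightarrow> 'a \<Rightarrow> (real \<Rightarrow> 'a) \<Rightarrow> bool" where
  "caratheodory_solution D T F x0 X \<longleftrightarrow> (\<forall>t\<in>{0..T}. X t \<in> D \<and>
     (\<lambda>\<tau>. F \<tau> (X \<tau>)) absolutely_integrable_on {0..t} \<and>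
     X t = x0 + integral {0..t} (\<lambda>\<tau>. F \<tau> (X \<tau>)))"

definition is_flow ::
  "(real^2) set \<Rightarrow> real \<Rightarrow> (real \<Rightarrow> real^2 \<Rightarrow> real) \<Rightarrow> (real \<Rightarrow> real^2 \<Rightarrow> real^2) \<Rightarrow> bool" where
  "is_flow \<Omega> T \<psi> \<Phi> \<longleftrightarrow> (\<forall>x\<in>closure \<Omega>.
     caratheodory_solution (closure \<Omega>) T (\<lambda>t y. Jmat *v grad \<Omega> (\<psi> t) y) x (\<lambda>t. \<Phi> t x))"

text \<open>The continuous representative on \<open>[0,1]\<close> of the weak derivative of a curve.\<close>

definition curve_deriv :: "(real \<Rightarrow> real^2) \<Rightarrow> real \<Rightarrow> real^2" where
  "curve_deriv \<gamma> = (SOME g. continuous_on {0..1} g \<and> has_weak_deriv {0<..<1} [1] \<gamma> g)"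

definition state_solution ::
  "(real^2) set \<Rightarrow> real \<Rightarrow> (real \<Rightarrow> real^2) \<Rightarrow> (real \<Rightarrow> real^2 \<Rightarrow> real) \<Rightarrow>
   (real \<Rightarrow> real \<Rightarrow> real^2) \<Rightarrow> (real \<Rightarrow> real \<Rightarrow> real^2) \<Rightarrow> bool" where
  "state_solution \<Omega> T \<gamma>0 \<psi> X a \<longleftrightarrow>
     continuous_on ({0..T} \<times> {0..1}) (\<lambda>(t, s). X t s) \<and>
     continuous_on ({0..T} \<times> {0..1}) (\<lambda>(t, s). a t s) \<and>
     (\<forall>s\<in>{0..1}.
        caratheodory_solution (closure \<Omega>) T
          (\<lambda>t y. Jmat *v grad \<Omega> (\<psi> t) y) (\<gamma>0 s) (\<lambda>t. X t s) \<and>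
        caratheodory_solution UNIV T
          (\<lambda>t b. Jmat *v (hess \<Omega> (\<psi> t) (X t s) *v b)) (curve_deriv \<gamma>0 s) (\<lambda>t. a t s))"

definition cost_value ::
  "(real^2) set \<Rightarrow> real \<Rightarrow> (real \<Rightarrow> real^2) \<Rightarrow> real \<Rightarrow> real \<Rightarrow> (real \<Rightarrow> real^2 \<Rightarrow> real) \<Rightarrow> real \<Rightarrow> bool" where
  "cost_value \<Omega> T \<gamma>0 lam eps \<psi> c \<longleftrightarrow> (\<exists>X a. state_solution \<Omega> T \<gamma>0 \<psi> X a \<and>
     c = - (LINT s|lebesgue_on {0..1}. sqrt ((norm (a T s))\<^sup>2 + eps\<^sup>2))
         + lam / 2 * (LINT t|lebesgue_on {0..T}. (L2norm \<Omega> (\<psi> t))\<^sup>2))"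

definition cost ::
  "(real^2) set \<Rightarrow> real \<Rightarrow> (real \<Rightarrow> real^2) \<Rightarrow> real \<Rightarrow> real \<Rightarrow> (real \<Rightarrow> real^2 \<Rightarrow> real) \<Rightarrow> real" where
  "cost \<Omega> T \<gamma>0 lam eps \<psi> = (THE c. cost_value \<Omega> T \<gamma>0 lam eps \<psi> c)"

definition U_ad :: "real \<Rightarrow> ('n::finite \<Rightarrow> real^2 \<Rightarrow> real) \<Rightarrow> real \<Rightarrow> (real \<Rightarrow> real^2 \<Rightarrow> real) set" where
  "U_ad T h R = {\<psi>. \<exists>u. L2_on {0..T} u \<and> L2norm {0..T} u \<le> R \<and> \<psi> = stream h u}"

end

theory Submission
  imports Defs "HOL-Complex_Analysis.Great_Picard"
begin

text \<open>The velocity field has the form \<open>\<Sum>\<^sub>k u\<^sub>k(t) V\<^sub>k(x)\<close> with \<open>V\<^sub>k = J \<nabla> h\<^sub>k\<close>: its dependence on time is merely integrable, but it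
sits in finitely many scalar factors.

\<^bold>\<open>Regularity.\<close> All derivatives of \<open>h\<^sub>k\<close> are bounded in \<open>\<Omega>\<close>, and classical derivatives are weak ones
(\<open>Cinf_has_weak_deriv\<close>). So the \<open>W\<^sup>k\<^sup>,\<^sup>\<infinity>\<close> norm of a linear combination is bounded by its coefficients, and
approximation of \<open>u\<close> by simple functions yields the Bochner regularity (\<open>bochner_L2_linear_combination\<close>).

\<^bold>\<open>Invariance of the closure.\<close> The boundary is locally a graph, so two nearby points of \<open>\<Omega>\<close> are joined in \<open>\<Omega>\<close>
by three segments of comparable length; hence the derivatives of \<open>h\<^sub>k\<close> are Lipschitz on the closure. A
covering argument shows that \<open>h\<^sub>k\<close>, being in \<open>H\<^sup>1\<^sub>0\<close> and continuous, vanishes on the boundary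
(\<open>H10_trace_zero\<close>). Its gradient is then normal to the boundary, and \<open>V\<^sub>k\<close> is orthogonal to every proximal normal of
the closure (\<open>perp_grad_tangential\<close>). Solutions exist for Lipschitz extensions of the \<open>V\<^sub>k\<close> to the plane, by
Picard iteration with an exponential weight, and the squared distance to the closure satisfies a Gronwall
inequality along them (\<open>closed_set_invariant\<close>). So they stay in the closure and solve the original equation.

\<^bold>\<open>Stability.\<close> The difference of two states is estimated by the control integrals of \<open>u - w\<close> along one of them. If
the primitives of \<open>v\<^sub>n - u\<close> tend to zero uniformly and the \<open>L\<^sup>1\<close> norms are bounded, these integrals tend to zero
(\<open>control_integral_small\<close>). Therefore the stretching term of the cost is continuous even for uniform
convergence of primitives (\<open>stretch_gain_converges\<close>), in particular for convergence in \<open>L\<^sup>2\<close>; the penalty term is a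
continuous convex quadratic form.

\<^bold>\<open>Minimizers.\<close> The primitives of a minimizing sequence are equicontinuous, so a subsequence of them converges
uniformly. Nested bounded closed convex sets in \<open>L\<^sup>2\<close> have a common point, which provides a control
with the limiting primitive and no more than the limiting energy (\<open>minimizer_exists\<close>). Neither weak topologies nor
differentiation almost everywhere is needed: the role of the latter is played by \<open>increments_quadratic\<close>.\<close>

section \<open>Gronwall estimates and equations with integrable coefficients\<close>

text \<open>A function whose increments are bounded above by \<open>C\<close> times the squared increments of a continuous
nondecreasing function does not increase. With \<open>A(t) = \<integral>\<^sub>0\<^sup>t m\<close> for an integrable \<open>m \<ge> 0\<close>, this replaces
differentiation almost everywhere: a differential inequality is only needed up to an error that is
quadratic in \<open>A(t) - A(s)\<close>.\<close>

lemma increments_quadratic: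
  fixes G A :: "real \<Rightarrow> real"
  assumes "a \<le> b" and contA: "continuous_on {a..b} A"
    and mono: "\<And>s t. a \<le> s \<Longrightarrow> s \<le> t \<Longrightarrow> t \<le> b \<Longrightarrow> A s \<le> A t"
    and incr: "\<And>s t. a \<le> s \<Longrightarrow> s \<le> t \<Longrightarrow> t \<le> b \<Longrightarrow> G t \<le> G s + C * (A t - A s)\<^sup>2"
  shows "G b \<le> G a"
proof (cases "A b = A a")
  case True
  then show ?thesis using incr[of a b] assms(1) by simp
next
  case False
  then have lt: "A a < A b" using mono[of a b] assms(1) by simp
  define D where "D = A b - A a"
  have D: "D > 0" using lt by (simp add: D_def)
  \<comment> \<open>Cut the range of \<open>A\<close> into \<open>n\<close> equal parts: the \<open>n\<close> errors \<open>C (D/n)\<^sup>2\<close> add up to \<open>C D\<^sup>2 / n\<close>.\<close>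
  have *: "G b \<le> G a + C * D\<^sup>2 / real n" if n: "n > 0" for n :: nat
  proof -
    have "\<exists>t. a \<le> t \<and> t \<le> b \<and> A t = A a + real i * D / real n" if "i \<le> n" for i
    proof (rule IVT')
      show "A a \<le> A a + real i * D / real n" using D by simp
      have "real i * D / real n \<le> D" using D that \<open>n > 0\<close> by (simp add: field_simps)
      then show "A a + real i * D / real n \<le> A b" by (simp add: D_def)
    qed (use assms in auto)
    then obtain t where t: "\<And>i. i \<le> n \<Longrightarrow> a \<le> t i \<and> t i \<le> b \<and> A (t i) = A a + real i * D / real n"
      by metis
    have lt': "t i \<le> t (Suc i)" if "Suc i \<le> n" for i
    proof (rule ccontr)
      assume "\<not> ?thesis"
      then have "A (t (Suc i)) \<le> A (t i)"
        using t[of i] t[of "Suc i"] that by (intro mono) auto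
      then have "real (Suc i) * D / real n \<le> real i * D / real n" using t[of i] t[of "Suc i"] that by simp
      then have "real (Suc i) * D \<le> real i * D" using n by (simp add: divide_le_cancel)
      then show False using D by simp
    qed
    have ind: "G (t i) \<le> G a + real i * (C * (D / real n)\<^sup>2)" if "i \<le> n" for i
      using that
    proof (induction i)
      case 0
      then show ?case using incr[of a "t 0"] t[of 0] by simp
    next
      case (Suc i)
      have "G (t (Suc i)) \<le> G (t i) + C * (A (t (Suc i)) - A (t i))\<^sup>2"
        using lt'[of i] Suc.prems t[of i] t[of "Suc i"] by (intro incr) auto
      also have "A (t (Suc i)) - A (t i) = D / real n"
        using t[of i] t[of "Suc i"] Suc.prems \<open>n > 0\<close> by (simp add: field_simps)
      finally show ?case using Suc by (simp add: algebra_simps)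
    qed
    have "G b \<le> G (t n) + C * (A b - A (t n))\<^sup>2"
      using t[of n] by (intro incr) auto
    also have "A b - A (t n) = 0" using t[of n] \<open>n > 0\<close> by (simp add: D_def)
    finally have "G b \<le> G a + real n * (C * (D / real n)\<^sup>2)" using ind[of n] by simp
    also have "real n * (C * (D / real n)\<^sup>2) = C * D\<^sup>2 / real n"
      using \<open>n > 0\<close> by (simp add: power2_eq_square field_simps)
    finally show ?thesis .
  qed
  have lim: "(\<lambda>n. G a + C * D\<^sup>2 / real n) \<longlonglongrightarrow> G a + 0"
    by (intro tendsto_intros lim_const_over_n)
  show ?thesis
    using LIMSEQ_le_const[OF lim, of "G b"] *
    by (metis add.right_neutral less_le_trans zero_less_one)
qed

lemma absint_sub:
  fixes f :: "real \<Rightarrow> 'a::euclidean_space"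
  assumes "f absolutely_integrable_on {a..b}" "a \<le> s" "t \<le> b"
  shows "f absolutely_integrable_on {s..t}"
  using assms(2,3) by (intro absolutely_integrable_on_subinterval[OF assms(1)]) simp

lemma integral_split:
  fixes f :: "real \<Rightarrow> 'a::euclidean_space"
  assumes "f absolutely_integrable_on {a..b}" "a \<le> s" "s \<le> t" "t \<le> b"
  shows "integral {a..t} f = integral {a..s} f + integral {s..t} f"
  using assms
  by (intro Henstock_Kurzweil_Integration.integral_combine[symmetric]
      set_lebesgue_integral_eq_integral(1)) (auto intro: absint_sub)

lemma absint_integrable:
  fixes f :: "real \<Rightarrow> 'a::euclidean_space"
  shows "f absolutely_integrable_on S \<Longrightarrow> f integrable_on S"
  by (rule set_lebesgue_integral_eq_integral(1))

lemma absint_mult_cont: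
  fixes f :: "real \<Rightarrow> real" and g :: "real \<Rightarrow> 'a::euclidean_space"
  assumes "f absolutely_integrable_on {a..b}" "continuous_on {a..b} g"
  shows "(\<lambda>x. f x *\<^sub>R g x) absolutely_integrable_on {a..b}"
proof -
  have "bilinear (\<lambda>(y::'a) (x::real). x *\<^sub>R y)"
    by (auto simp: bilinear_def linear_iff algebra_simps)
  moreover have "g \<in> borel_measurable (lebesgue_on {a..b})"
    using assms(2) by (intro continuous_imp_measurable_on_sets_lebesgue) auto
  moreover have "bounded (g ` {a..b})"
    using assms(2) by (intro compact_imp_bounded compact_continuous_image) auto
  ultimately show ?thesis
    using absolutely_integrable_bounded_measurable_product[of "\<lambda>y x. x *\<^sub>R y" g "{a..b}" f] assms(1)
    by auto
qed

lemma absint_mult_cont_real: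
  fixes f g :: "real \<Rightarrow> real"
  assumes "f absolutely_integrable_on {a..b}" "continuous_on {a..b} g"
  shows "(\<lambda>x. f x * g x) absolutely_integrable_on {a..b}"
  using absint_mult_cont[OF assms] by simp

lemma integral_mono_ivl:
  fixes m :: "real \<Rightarrow> real"
  assumes "m absolutely_integrable_on {0..T}" "\<And>t. t \<in> {0..T} \<Longrightarrow> 0 \<le> m t"
    "0 \<le> s" "s \<le> t" "t \<le> T"
  shows "integral {0..s} m \<le> integral {0..t} m"
proof -
  have "integral {0..t} m = integral {0..s} m + integral {s..t} m"
    using assms by (intro integral_split[of 0 T m]) auto
  moreover have "0 \<le> integral {s..t} m"
    using assms
    by (intro Henstock_Kurzweil_Integration.integral_nonneg absint_integrable) (auto intro: absint_sub)
  ultimately show ?thesis by simp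
qed

lemma gronwall_L1:
  fixes f m :: "real \<Rightarrow> real"
  assumes f: "continuous_on {0..T} f" "\<And>t. t \<in> {0..T} \<Longrightarrow> 0 \<le> f t"
    and m: "m absolutely_integrable_on {0..T}" "\<And>t. t \<in> {0..T} \<Longrightarrow> 0 \<le> m t"
    and c: "0 \<le> c"
    and ineq: "\<And>t. t \<in> {0..T} \<Longrightarrow> f t \<le> c + integral {0..t} (\<lambda>\<tau>. m \<tau> * f \<tau>)"
    and t: "t \<in> {0..T}"
  shows "f t \<le> c * exp (integral {0..t} m)"
proof -
  define A where "A = (\<lambda>t. integral {0..t} m)"
  define K where "K = (\<lambda>t. c + integral {0..t} (\<lambda>\<tau>. m \<tau> * f \<tau>))"
  have mf: "(\<lambda>\<tau>. m \<tau> * f \<tau>) absolutely_integrable_on {0..T}"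
    by (intro absint_mult_cont_real m f)
  have mf0: "0 \<le> m \<tau> * f \<tau>" if "\<tau> \<in> {0..T}" for \<tau> using that f m by simp
  have monoA: "A s \<le> A r" if "0 \<le> s" "s \<le> r" "r \<le> T" for s r
    unfolding A_def using that m by (intro integral_mono_ivl[of T m]) auto
  have monoK: "K s \<le> K r" if "0 \<le> s" "s \<le> r" "r \<le> T" for s r
    unfolding K_def using integral_mono_ivl[OF mf mf0 that] by simp
  have K0: "0 \<le> K s" if "0 \<le> s" "s \<le> T" for s
    using monoK[of 0 s] that c by (simp add: K_def)
  have A0: "0 \<le> A s" if "0 \<le> s" "s \<le> T" for s
    using monoA[of 0 s] that by (simp add: A_def)
  have fK: "f s \<le> K s" if "0 \<le> s" "s \<le> T" for s
    using ineq[of s] that by (simp add: K_def)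
  have t': "0 \<le> t" "t \<le> T" using t by auto
  \<comment> \<open>The function \<open>K exp (- A)\<close> does not increase: its increments are quadratic in those of \<open>A\<close>,
    because \<open>1 + x \<le> exp x\<close>.\<close>
  have "K t * exp (- A t) \<le> K 0 * exp (- A 0)"
  proof (rule increments_quadratic[of 0 t A _ "K t"])
    show "continuous_on {0..t} A"
      unfolding A_def using t' m by (intro indefinite_integral_continuous_1 absint_integrable) (auto intro: absint_sub)
    fix s r assume sr: "0 \<le> s" "s \<le> r" "r \<le> t"
    then have sr': "s \<le> T" "r \<le> T" using t by auto
    have msr: "m absolutely_integrable_on {s..r}" using sr sr' by (intro absint_sub[OF m(1)]) auto
    have dA: "A r - A s = integral {s..r} m"
      unfolding A_def using sr sr' m by (subst integral_split[of 0 T m s r]) auto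
    have "K r - K s = integral {s..r} (\<lambda>\<tau>. m \<tau> * f \<tau>)"
      unfolding K_def using sr sr' mf by (subst integral_split[of 0 T "\<lambda>\<tau>. m \<tau> * f \<tau>" s r]) auto
    also have "\<dots> \<le> integral {s..r} (\<lambda>\<tau>. m \<tau> * K r)"
    proof (intro integral_le absint_integrable)
      show "(\<lambda>\<tau>. m \<tau> * f \<tau>) absolutely_integrable_on {s..r}" using sr sr' by (intro absint_sub[OF mf]) auto
      show "(\<lambda>\<tau>. m \<tau> * K r) absolutely_integrable_on {s..r}" using msr by (intro absint_mult_cont_real) auto
      show "m x * f x \<le> m x * K r" if "x \<in> {s..r}" for x
        using that sr sr' fK[of x] monoK[of x r] m(2)[of x] by (intro mult_left_mono) auto
    qed
    also have "\<dots> = K r * (A r - A s)" by (simp add: dA)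
    finally have 1: "K r \<le> K s + K r * (A r - A s)" by simp
    have 2: "0 \<le> A r - A s" using monoA[of s r] sr sr' by simp
    have "K r * (A r - A s) \<le> K t * (A r - A s)" using 2 monoK[of r t] sr t' by (intro mult_right_mono) auto
    with 1 have "K r \<le> K s + K t * (A r - A s)" by simp
    then have "K r * (A r - A s) \<le> (K s + K t * (A r - A s)) * (A r - A s)" using 2 by (intro mult_right_mono) auto
    with 1 have 3: "K r \<le> K s * (1 + (A r - A s)) + K t * (A r - A s)\<^sup>2"
      by (simp add: power2_eq_square algebra_simps)
    have "K s * (1 + (A r - A s)) \<le> K s * exp (A r - A s)"
      using K0[of s] sr sr' by (intro mult_left_mono exp_ge_add_one_self) auto
    with 3 have "K r \<le> K s * exp (A r - A s) + K t * (A r - A s)\<^sup>2" by simp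
    then have "K r * exp (- A r) \<le> (K s * exp (A r - A s) + K t * (A r - A s)\<^sup>2) * exp (- A r)"
      by (intro mult_right_mono) auto
    also have "\<dots> = K s * (exp (A r - A s) * exp (- A r)) + K t * (A r - A s)\<^sup>2 * exp (- A r)"
      by (simp only: distrib_right mult.assoc)
    also have "exp (A r - A s) * exp (- A r) = exp (- A s)" by (simp only: exp_add[symmetric]) simp
    also have "K t * (A r - A s)\<^sup>2 * exp (- A r) \<le> K t * (A r - A s)\<^sup>2 * 1"
      using K0[of t] t' A0[of r] sr sr' by (intro mult_left_mono) auto
    finally show "K r * exp (- A r) \<le> K s * exp (- A s) + K t * (A r - A s)\<^sup>2" by simp
  qed (use monoA t' in auto)
  moreover have "A 0 = 0" "K 0 = c" by (simp_all add: A_def K_def)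
  ultimately have "K t * exp (- A t) \<le> c" by simp
  then have "K t * exp (- A t) * exp (A t) \<le> c * exp (A t)" by (intro mult_right_mono) auto
  then have "K t \<le> c * exp (A t)" by (simp add: exp_minus field_simps)
  then show ?thesis using fK[of t] t' by (simp add: A_def)
qed

text \<open>The derivative of \<open>exp (2 A)\<close> is \<open>2 m exp (2 A)\<close>; only this inequality is needed for the contraction
estimate below.\<close>

lemma integral_weight_exp:
  fixes m :: "real \<Rightarrow> real"
  assumes m: "m absolutely_integrable_on {0..T}" "\<And>t. t \<in> {0..T} \<Longrightarrow> 0 \<le> m t"
    and t: "t \<in> {0..T}"
  defines "A \<equiv> \<lambda>t. integral {0..t} m"
  shows "2 * integral {0..t} (\<lambda>\<tau>. m \<tau> * exp (2 * A \<tau>)) \<le> exp (2 * A t) - 1"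
proof -
  have t': "0 \<le> t" "t \<le> T" using t by auto
  have contA: "continuous_on {0..T} A"
    unfolding A_def using m by (intro indefinite_integral_continuous_1 absint_integrable) auto
  have monoA: "A s \<le> A r" if "0 \<le> s" "s \<le> r" "r \<le> T" for s r
    unfolding A_def using that m by (intro integral_mono_ivl[of T m]) auto
  have me: "(\<lambda>\<tau>. m \<tau> * exp (2 * A \<tau>)) absolutely_integrable_on {0..T}"
    by (intro absint_mult_cont_real m continuous_intros contA)
  define G where "G = (\<lambda>r. 2 * integral {0..r} (\<lambda>\<tau>. m \<tau> * exp (2 * A \<tau>)) - exp (2 * A r))"
  have "G t \<le> G 0"
  proof (rule increments_quadratic[of 0 t A _ "4 * exp (2 * A t)"])
    show "continuous_on {0..t} A" using contA by (rule continuous_on_subset) (use t' in auto)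
    fix s r assume sr: "0 \<le> s" "s \<le> r" "r \<le> t"
    then have sr': "s \<le> T" "r \<le> T" using t by auto
    have msr: "m absolutely_integrable_on {s..r}" using sr sr' by (intro absint_sub[OF m(1)]) auto
    have dA: "A r - A s = integral {s..r} m"
      unfolding A_def using sr sr' m by (subst integral_split[of 0 T m s r]) auto
    have "integral {0..r} (\<lambda>\<tau>. m \<tau> * exp (2 * A \<tau>)) - integral {0..s} (\<lambda>\<tau>. m \<tau> * exp (2 * A \<tau>))
        = integral {s..r} (\<lambda>\<tau>. m \<tau> * exp (2 * A \<tau>))"
      using sr sr' me by (subst integral_split[of 0 T _ s r]) auto
    also have "\<dots> \<le> integral {s..r} (\<lambda>\<tau>. m \<tau> * exp (2 * A r))"
    proof (intro integral_le absint_integrable)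
      show "(\<lambda>\<tau>. m \<tau> * exp (2 * A \<tau>)) absolutely_integrable_on {s..r}" using sr sr' by (intro absint_sub[OF me]) auto
      show "(\<lambda>\<tau>. m \<tau> * exp (2 * A r)) absolutely_integrable_on {s..r}" using msr by (intro absint_mult_cont_real) auto
      show "m x * exp (2 * A x) \<le> m x * exp (2 * A r)" if "x \<in> {s..r}" for x
        using that sr sr' monoA[of x r] m(2)[of x] by (intro mult_left_mono) auto
    qed
    also have "\<dots> = exp (2 * A r) * (A r - A s)" by (simp add: dA)
    finally have 1: "2 * (integral {0..r} (\<lambda>\<tau>. m \<tau> * exp (2 * A \<tau>)) - integral {0..s} (\<lambda>\<tau>. m \<tau> * exp (2 * A \<tau>)))
       \<le> 2 * exp (2 * A r) * (A r - A s)" by simp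
    have 2: "0 \<le> A r - A s" using monoA[of s r] sr sr' by simp
    have ee: "exp y - exp x \<le> exp y * (y - x)" for x y :: real
    proof -
      have "exp y * (1 + (x - y)) \<le> exp y * exp (x - y)"
        by (intro mult_left_mono exp_ge_add_one_self) auto
      also have "exp y * exp (x - y) = exp x" by (simp only: exp_add[symmetric]) simp
      finally show ?thesis by (simp add: algebra_simps)
    qed
    have 3: "exp (2 * A r) - exp (2 * A s) \<ge> exp (2 * A s) * (2 * (A r - A s))"
      using ee[of "2 * A s" "2 * A r"] by (simp add: algebra_simps)
    have 4: "exp (2 * A r) - exp (2 * A s) \<le> exp (2 * A r) * (2 * (A r - A s))"
      using ee[of "2 * A r" "2 * A s"] by (simp add: algebra_simps)
    have "G r - G s \<le> 2 * (A r - A s) * (exp (2 * A r) - exp (2 * A s))"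
      using 1 3 by (simp add: G_def algebra_simps)
    also have "\<dots> \<le> 2 * (A r - A s) * (exp (2 * A r) * (2 * (A r - A s)))"
      using 2 4 by (intro mult_left_mono) auto
    also have "\<dots> = exp (2 * A r) * (4 * (A r - A s)\<^sup>2)" by (simp add: power2_eq_square algebra_simps)
    also have "\<dots> \<le> exp (2 * A t) * (4 * (A r - A s)\<^sup>2)"
      using monoA[of r t] sr t' by (intro mult_right_mono) auto
    finally show "G r \<le> G s + 4 * exp (2 * A t) * (A r - A s)\<^sup>2" by (simp add: algebra_simps)
  qed (use monoA t' in auto)
  then show ?thesis by (simp add: G_def A_def)
qed

text \<open>Picard iteration for a field that is Lipschitz in space with a constant \<open>m(t)\<close> integrable in time.
The weight \<open>exp (- 2 A)\<close>, \<open>A(t) = \<integral>\<^sub>0\<^sup>t m\<close>, turns the Picard operator into a contraction on all of \<open>[0,T]\<close> at once.\<close>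

lemma caratheodory_exists:
  fixes F :: "real \<Rightarrow> 'a::euclidean_space \<Rightarrow> 'a" and m :: "real \<Rightarrow> real"
  assumes T: "0 \<le> T"
    and m: "m absolutely_integrable_on {0..T}" "\<And>t. t \<in> {0..T} \<Longrightarrow> 0 \<le> m t"
    and int: "\<And>Y. continuous_on {0..T} Y \<Longrightarrow> (\<lambda>\<tau>. F \<tau> (Y \<tau>)) absolutely_integrable_on {0..T}"
    and lip: "\<And>t x y. t \<in> {0..T} \<Longrightarrow> norm (F t x - F t y) \<le> m t * norm (x - y)"
  shows "\<exists>X. continuous_on {0..T} X \<and> (\<forall>t\<in>{0..T}. X t = x0 + integral {0..t} (\<lambda>\<tau>. F \<tau> (X \<tau>)))"
proof -
  define A where "A = (\<lambda>t. integral {0..t} m)"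
  \<comment> \<open>Bounded continuous functions are defined on the whole line; times are clamped to \<open>[0,T]\<close>.\<close>
  define c where "c = (\<lambda>t. max 0 (min T t))"
  have cT: "c t \<in> {0..T}" for t using T by (auto simp: c_def)
  have cid: "c t = t" if "t \<in> {0..T}" for t using that by (auto simp: c_def)
  have contA: "continuous_on {0..T} A"
    unfolding A_def using m by (intro indefinite_integral_continuous_1 absint_integrable) auto
  \<comment> \<open>The Picard operator in terms of \<open>Z = exp (- 2 A) X\<close>.\<close>
  define Q where "Q = (\<lambda>Z :: real \<Rightarrow>\<^sub>C 'a. \<lambda>t. exp (- 2 * A t) *\<^sub>R
      (x0 + integral {0..t} (\<lambda>\<tau>. F \<tau> (exp (2 * A \<tau>) *\<^sub>R Z \<tau>))))"
  have FZ: "(\<lambda>\<tau>. F \<tau> (exp (2 * A \<tau>) *\<^sub>R Z \<tau>)) absolutely_integrable_on {0..T}" for Z :: "real \<Rightarrow>\<^sub>C 'a"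
    by (intro int continuous_intros contA) auto
  have contQ: "continuous_on {0..T} (Q Z)" for Z
    unfolding Q_def
    by (intro continuous_intros contA indefinite_integral_continuous_1 absint_integrable FZ)
  have "(\<lambda>t. Q Z (c t)) \<in> bcontfun" for Z
    unfolding bcontfun_def
  proof (intro CollectI conjI)
    show "continuous_on UNIV (\<lambda>t. Q Z (c t))"
      by (rule continuous_on_compose2[OF contQ]) (use cT in \<open>auto simp: c_def intro!: continuous_intros\<close>)
    have "bounded (Q Z ` {0..T})"
      by (intro compact_imp_bounded compact_continuous_image contQ) auto
    then show "bounded (range (\<lambda>t. Q Z (c t)))"
      by (rule bounded_subset) (use cT in auto)
  qed
  then have P: "apply_bcontfun (Bcontfun (\<lambda>t. Q Z (c t))) = (\<lambda>t. Q Z (c t))" for Z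
    by (simp add: Bcontfun_inverse)
  have "\<exists>!Z. Bcontfun (\<lambda>t. Q Z (c t)) = Z"
  proof (rule banach_fix_type[of "1/2"]; (intro allI)?)
    fix Z W :: "real \<Rightarrow>\<^sub>C 'a"
    have *: "dist (Q Z t) (Q W t) \<le> 1/2 * dist Z W" if t: "t \<in> {0..T}" for t
    proof -
      have st: "{0..t} \<subseteq> {0..T}" using t by auto
      have i1: "(\<lambda>\<tau>. F \<tau> (exp (2 * A \<tau>) *\<^sub>R U \<tau>)) integrable_on {0..t}" for U :: "real \<Rightarrow>\<^sub>C 'a"
        using t by (intro absint_integrable absint_sub[OF FZ]) auto
      have me: "(\<lambda>\<tau>. m \<tau> * exp (2 * A \<tau>)) absolutely_integrable_on {0..T}"
        by (intro absint_mult_cont_real m continuous_intros contA)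
      have "Q Z t - Q W t = exp (- 2 * A t) *\<^sub>R integral {0..t}
          (\<lambda>\<tau>. F \<tau> (exp (2 * A \<tau>) *\<^sub>R Z \<tau>) - F \<tau> (exp (2 * A \<tau>) *\<^sub>R W \<tau>))"
        unfolding Q_def by (subst integral_diff[OF i1 i1]) (simp add: algebra_simps)
      then have "dist (Q Z t) (Q W t) = exp (- 2 * A t) * norm (integral {0..t}
          (\<lambda>\<tau>. F \<tau> (exp (2 * A \<tau>) *\<^sub>R Z \<tau>) - F \<tau> (exp (2 * A \<tau>) *\<^sub>R W \<tau>)))"
        by (simp add: dist_norm)
      also have "norm (integral {0..t} (\<lambda>\<tau>. F \<tau> (exp (2 * A \<tau>) *\<^sub>R Z \<tau>) - F \<tau> (exp (2 * A \<tau>) *\<^sub>R W \<tau>)))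
          \<le> integral {0..t} (\<lambda>\<tau>. m \<tau> * exp (2 * A \<tau>) * dist Z W)"
      proof (rule Henstock_Kurzweil_Integration.integral_norm_bound_integral)
        show "(\<lambda>\<tau>. F \<tau> (exp (2 * A \<tau>) *\<^sub>R Z \<tau>) - F \<tau> (exp (2 * A \<tau>) *\<^sub>R W \<tau>)) integrable_on {0..t}"
          by (intro integrable_diff i1)
        show "(\<lambda>\<tau>. m \<tau> * exp (2 * A \<tau>) * dist Z W) integrable_on {0..t}"
          using t by (intro absint_integrable absint_mult_cont_real absint_sub[OF me]) auto
        fix \<tau> assume \<tau>: "\<tau> \<in> {0..t}"
        have "norm (F \<tau> (exp (2 * A \<tau>) *\<^sub>R Z \<tau>) - F \<tau> (exp (2 * A \<tau>) *\<^sub>R W \<tau>))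
            \<le> m \<tau> * norm (exp (2 * A \<tau>) *\<^sub>R Z \<tau> - exp (2 * A \<tau>) *\<^sub>R W \<tau>)"
          using \<tau> t by (intro lip) auto
        also have "norm (exp (2 * A \<tau>) *\<^sub>R Z \<tau> - exp (2 * A \<tau>) *\<^sub>R W \<tau>) = exp (2 * A \<tau>) * dist (Z \<tau>) (W \<tau>)"
          by (simp add: dist_norm flip: scaleR_diff_right)
        also have "m \<tau> * (exp (2 * A \<tau>) * dist (Z \<tau>) (W \<tau>)) \<le> m \<tau> * (exp (2 * A \<tau>) * dist Z W)"
          using m(2)[of \<tau>] \<tau> t by (intro mult_left_mono dist_bounded) auto
        finally show "norm (F \<tau> (exp (2 * A \<tau>) *\<^sub>R Z \<tau>) - F \<tau> (exp (2 * A \<tau>) *\<^sub>R W \<tau>))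
            \<le> m \<tau> * exp (2 * A \<tau>) * dist Z W" by (simp add: mult.assoc)
      qed
      also have "integral {0..t} (\<lambda>\<tau>. m \<tau> * exp (2 * A \<tau>) * dist Z W)
          = integral {0..t} (\<lambda>\<tau>. m \<tau> * exp (2 * A \<tau>)) * dist Z W" by simp
      also have "\<dots> \<le> (exp (2 * A t) / 2) * dist Z W"
        using integral_weight_exp[OF m t] by (intro mult_right_mono) (auto simp: A_def)
      also have "exp (- 2 * A t) * ((exp (2 * A t) / 2) * dist Z W) = 1/2 * dist Z W"
        by (simp flip: exp_add mult.assoc)
      finally show ?thesis by (simp add: mult_left_mono)
    qed
    show "dist (Bcontfun (\<lambda>t. Q Z (c t))) (Bcontfun (\<lambda>t. Q W (c t))) \<le> 1/2 * dist Z W"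
      by (intro dist_bound) (unfold P, intro * cT)
  qed auto
  then obtain Z where "Bcontfun (\<lambda>t. Q Z (c t)) = Z" by blast
  then have Z: "apply_bcontfun Z t = Q Z (c t)" for t using P[of Z] by metis
  define X where "X = (\<lambda>t. exp (2 * A t) *\<^sub>R Z t)"
  have "continuous_on {0..T} X"
    unfolding X_def by (intro continuous_intros contA) auto
  moreover have "X t = x0 + integral {0..t} (\<lambda>\<tau>. F \<tau> (X \<tau>))" if "t \<in> {0..T}" for t
  proof -
    have "X t = exp (2 * A t) *\<^sub>R Q Z t" unfolding X_def using Z[of t] cid[OF that] by simp
    also have "\<dots> = x0 + integral {0..t} (\<lambda>\<tau>. F \<tau> (X \<tau>))"
      unfolding Q_def X_def by (simp add: exp_minus)
    finally show ?thesis .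
  qed
  ultimately show ?thesis by blast
qed

section \<open>Classical derivatives are weak derivatives\<close>

lemma pd_eq: "(f has_derivative D) (at x) \<Longrightarrow> pd b f x = D b"
  by (simp add: pd_def flip: frechet_derivative_at)

lemma ipd_append: "ipd (as @ bs) f = ipd as (ipd bs f)"
  by (induction as) auto

lemma frechet_derivative_cong_open:
  assumes "open S" "x \<in> S" "\<And>y. y \<in> S \<Longrightarrow> f y = g y"
  shows "frechet_derivative f (at x) = frechet_derivative g (at x)"
proof -
  have "(f has_derivative D) (at x) = (g has_derivative D) (at x)" for D
    using assms by (metis has_derivative_transform_within_open)
  then show ?thesis unfolding frechet_derivative_def by simp
qed

lemma pd_cong_open:
  assumes "open S" "x \<in> S" "\<And>y. y \<in> S \<Longrightarrow> f y = g y"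
  shows "pd b f x = pd b g x"
  using frechet_derivative_cong_open[of S x f g] assms by (simp add: pd_def)

lemma pd_zero_off_compact:
  assumes K: "compact K" "\<And>x. x \<notin> K \<Longrightarrow> f x = 0" and x: "x \<notin> K"
  shows "pd b f x = 0"
proof -
  have "pd b f x = pd b (\<lambda>x. 0) x"
    using x K by (intro pd_cong_open[of "- K"]) (auto intro: compact_imp_closed)
  also have "\<dots> = 0" by (rule pd_eq[where D="\<lambda>_. 0"]) auto
  finally show ?thesis .
qed

lemma Cinf_iff:
  "Cinf S f \<longleftrightarrow> (\<forall>\<alpha>. set \<alpha> \<subseteq> Basis \<longrightarrow> ipd \<alpha> f differentiable_on S)"
proof (intro iffI allI impI)
  fix \<alpha> :: "'a list" assume "Cinf S f" "set \<alpha> \<subseteq> Basis"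
  then show "ipd \<alpha> f differentiable_on S"
    unfolding Cinf_def Ck_def by (elim allE[of _ "Suc (length \<alpha>)"]) auto
next
  assume "\<forall>\<alpha>. set \<alpha> \<subseteq> Basis \<longrightarrow> ipd \<alpha> f differentiable_on S"
  then show "Cinf S f" unfolding Cinf_def Ck_def
    by (auto intro: differentiable_imp_continuous_on)
qed

lemma Cinf_ipd: "Cinf S f \<Longrightarrow> set \<beta> \<subseteq> Basis \<Longrightarrow> Cinf S (ipd \<beta> f)"
  by (auto simp: Cinf_iff simp flip: ipd_append)

lemma Cinf_pd: "Cinf S f \<Longrightarrow> b \<in> Basis \<Longrightarrow> Cinf S (pd b f)"
  using Cinf_ipd[of S f "[b]"] by simp

lemma Cinf_continuous: "Cinf S f \<Longrightarrow> continuous_on S f"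
  by (metis Cinf_iff ipd.simps(1) differentiable_imp_continuous_on empty_set empty_subsetI)

lemma Cinf_differentiable:
  assumes "Cinf S f" "open S" "x \<in> S" shows "f differentiable (at x)"
proof -
  have "ipd [] f differentiable_on S" using assms(1) by (simp add: Cinf_iff del: ipd.simps)
  then show ?thesis using assms by (simp add: differentiable_on_eq_differentiable_at)
qed

lemma test_function_pd:
  assumes "test_function S \<phi>" "b \<in> Basis"
  shows "test_function S (pd b \<phi>)"
proof -
  obtain K where K: "compact K" "K \<subseteq> S" "\<And>x. x \<notin> K \<Longrightarrow> \<phi> x = 0"
    using assms by (auto simp: test_function_def)
  have "pd b \<phi> x = 0" if "x \<notin> K" for x
    by (rule pd_zero_off_compact[OF K(1) _ that]) (rule K(3))
  with K assms show ?thesis unfolding test_function_def by (auto intro: Cinf_pd)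
qed

lemma test_function_ipd:
  assumes "test_function S \<phi>" "set \<beta> \<subseteq> Basis"
  shows "test_function S (ipd \<beta> \<phi>)"
  using assms(2) by (induction \<beta>) (auto intro: test_function_pd assms)

lemma absint_continuous_compact:
  fixes g :: "'a::euclidean_space \<Rightarrow> 'b::euclidean_space"
  assumes "compact K" "continuous_on K g"
  shows "g absolutely_integrable_on K"
proof -
  have "integrable lborel (\<lambda>x. indicator K x *\<^sub>R g x)"
    using assms by (rule borel_integrable_compact)
  then show ?thesis
    unfolding set_integrable_def by (subst integrable_completion) (auto dest: borel_measurable_integrable)
qed

lemma compact_support_absint:
  fixes g :: "'a::euclidean_space \<Rightarrow> 'b::euclidean_space"
  assumes "compact K" "K \<subseteq> S" "continuous_on K g" "\<And>x. x \<in> S - K \<Longrightarrow> g x = 0"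
  shows "g absolutely_integrable_on S"
proof -
  have "g absolutely_integrable_on K"
    using assms absint_continuous_compact by blast
  then have "(\<lambda>x. if x \<in> K then g x else 0) absolutely_integrable_on UNIV"
    by (simp add: absolutely_integrable_restrict_UNIV)
  moreover have "(\<lambda>x. if x \<in> K then g x else 0) = (\<lambda>x. if x \<in> S then g x else 0)"
    using assms by fastforce
  ultimately show ?thesis by (simp add: absolutely_integrable_restrict_UNIV)
qed

lemma has_derivative_line:
  fixes F :: "'a::real_normed_vector \<Rightarrow> real"
  assumes "F differentiable (at (x + s *\<^sub>R b))"
  shows "((\<lambda>s. F (x + s *\<^sub>R b)) has_real_derivative frechet_derivative F (at (x + s *\<^sub>R b)) b) (at s)"
proof -
  let ?D = "frechet_derivative F (at (x + s *\<^sub>R b))"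
  have D: "(F has_derivative ?D) (at (x + s *\<^sub>R b))"
    using assms frechet_derivative_works by blast
  have "((\<lambda>s. F (x + s *\<^sub>R b)) has_derivative (\<lambda>r. ?D (r *\<^sub>R b))) (at s)"
    by (rule has_derivative_compose[where g=F and f="\<lambda>s. x + s *\<^sub>R b" and g'="?D" and f'="\<lambda>r. r *\<^sub>R b"])
      (use D in \<open>auto intro!: derivative_eq_intros\<close>)
  moreover have "(\<lambda>r. ?D (r *\<^sub>R b)) = (\<lambda>r. ?D b * r)"
    using linear_scale[OF has_derivative_linear[OF D]] by (auto simp: mult.commute)
  ultimately show ?thesis by (simp only: has_field_derivative_def)
qed

lemma integral_shift_UNIV:
  fixes F :: "'a::euclidean_space \<Rightarrow> 'b::euclidean_space"
  assumes "continuous_on UNIV F" "F absolutely_integrable_on UNIV"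
  shows "(\<lambda>x. F (x + c)) absolutely_integrable_on UNIV" "integral UNIV (\<lambda>x. F (x + c)) = integral UNIV F"
proof -
  have m: "F \<in> borel_measurable borel" using assms(1) by (rule borel_measurable_continuous_onI)
  have i: "integrable lborel F"
    using assms(2) m by (simp add: set_integrable_def integrable_completion)
  have eq: "(\<lambda>x. F (x + c)) = (\<lambda>x. F (c + x))" by (simp add: add.commute)
  have m': "(\<lambda>x. F (x + c)) \<in> borel_measurable borel"
    using m by measurable
  have i': "integrable lborel (\<lambda>x. F (x + c))"
    unfolding eq using i m
    by (subst integrable_distr_eq[of "(+) c" lborel borel F, symmetric]) (auto simp: lborel_distr_plus)
  show "(\<lambda>x. F (x + c)) absolutely_integrable_on UNIV"
    using i' m' by (simp add: set_integrable_def integrable_completion)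
  have "integral\<^sup>L lborel (\<lambda>x. F (c + x)) = integral\<^sup>L (distr lborel borel ((+) c)) F"
    by (subst integral_distr) (use m in auto)
  then have "integral\<^sup>L lborel (\<lambda>x. F (x + c)) = integral\<^sup>L lborel F"
    by (simp add: lborel_distr_plus eq)
  then show "integral UNIV (\<lambda>x. F (x + c)) = integral UNIV F"
    using has_integral_integral_lborel[OF i] has_integral_integral_lborel[OF i'] by (metis integral_unique)
qed

text \<open>Proved without iterated integrals: the integral of each difference quotient vanishes by translation
invariance, and dominated convergence passes this on to the derivative.\<close>

lemma integral_pd_compact_support:
  fixes F :: "'a::euclidean_space \<Rightarrow> real"
  assumes dF: "\<And>x. F differentiable (at x)" and cF: "continuous_on UNIV (pd b F)"
    and K: "compact K" "\<And>x. x \<notin> K \<Longrightarrow> F x = 0"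
  shows "integral UNIV (pd b F) = 0"
proof -
  have contF: "continuous_on UNIV F"
    using dF by (simp add: continuous_at_imp_continuous_on differentiable_imp_continuous_within)
  have iF: "F absolutely_integrable_on UNIV"
    using K contF by (intro compact_support_absint[of K]) (auto intro: continuous_on_subset)
  obtain R where R: "\<And>x. x \<in> K \<Longrightarrow> norm x \<le> R"
    using K(1) compact_imp_bounded bounded_iff by metis
  \<comment> \<open>\<open>C\<close> contains the supports of all the difference quotients \<open>g n\<close>, whose steps are positive multiples of \<open>b\<close> by at most \<open>1\<close>.\<close>
  define C where "C = cball (0::'a) (R + norm b)"
  have dz: "pd b F x = 0" if "x \<notin> K" for x
    by (rule pd_zero_off_compact[OF K(1) _ that]) (rule K(2))
  obtain B where B: "\<And>x. x \<in> K \<Longrightarrow> norm (pd b F x) \<le> B"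
    using compact_imp_bounded[OF compact_continuous_image[OF continuous_on_subset[OF cF subset_UNIV] K(1)]]
    by (auto simp: bounded_iff)
  define B' where "B' = max B 0"
  have B': "norm (pd b F x) \<le> B'" for x
    using B[of x] dz[of x] by (cases "x \<in> K") (auto simp: B'_def)
  define g where "g = (\<lambda>(n::nat) x. (F (x + (1 / real (Suc n)) *\<^sub>R b) - F x) / (1 / real (Suc n)))"
  define h where "h = (\<lambda>x. if x \<in> C then B' else 0)"
  have sh: "(\<lambda>x. F (x + (1 / real (Suc n)) *\<^sub>R b)) absolutely_integrable_on UNIV"
    "integral UNIV (\<lambda>x. F (x + (1 / real (Suc n)) *\<^sub>R b)) = integral UNIV F" for n
    using integral_shift_UNIV[OF contF iF] by auto
  have gi: "g n integrable_on UNIV" for n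
    unfolding g_def
    by (intro integrable_on_divide Henstock_Kurzweil_Integration.integrable_diff
        set_lebesgue_integral_eq_integral(1)[OF sh(1)] set_lebesgue_integral_eq_integral(1)[OF iF])
  have g0: "integral UNIV (g n) = 0" for n
    unfolding g_def integral_divide using sh(1)[of n] sh(2)[of n] iF
    by (subst Henstock_Kurzweil_Integration.integral_diff) (auto intro: set_lebesgue_integral_eq_integral(1))
  have hint: "h integrable_on UNIV"
    unfolding h_def C_def integrable_restrict_UNIV by (intro integrable_on_const) (simp add: lmeasurable_cball)
  have le: "norm (g n x) \<le> h x" for n x
  proof (cases "x \<in> C")
    case True
    let ?t = "1 / real (Suc n)"
    have "\<exists>z. 0 < z \<and> z < ?t \<and> F (x + ?t *\<^sub>R b) - F (x + 0 *\<^sub>R b) = (?t - 0) * frechet_derivative F (at (x + z *\<^sub>R b)) b"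
      by (intro MVT2 has_derivative_line dF) auto
    then obtain z where "F (x + ?t *\<^sub>R b) - F x = ?t * pd b F (x + z *\<^sub>R b)"
      by (auto simp: pd_def)
    then have "g n x = pd b F (x + z *\<^sub>R b)" by (simp add: g_def field_simps)
    then show ?thesis using B'[of "x + z *\<^sub>R b"] True by (simp add: h_def)
  next
    case False
    have nb: "norm ((1 / real (Suc n)) *\<^sub>R b) \<le> norm b"
      by (simp add: divide_le_eq mult_left_mono mult_le_cancel_left1)
    have "x \<notin> K"
    proof
      assume "x \<in> K"
      then show False using False R[of x] norm_ge_zero[of b] by (simp add: C_def del: norm_ge_zero)
    qed
    moreover have "x + (1 / real (Suc n)) *\<^sub>R b \<notin> K"
    proof
      assume "x + (1 / real (Suc n)) *\<^sub>R b \<in> K"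
      then have "norm (x + (1 / real (Suc n)) *\<^sub>R b) \<le> R" by (rule R)
      then have "norm x \<le> R + norm b"
        using nb norm_triangle_ineq4[of "x + (1 / real (Suc n)) *\<^sub>R b" "(1 / real (Suc n)) *\<^sub>R b"] by simp
      then show False using False by (simp add: C_def)
    qed
    ultimately show ?thesis using K(2) by (simp add: g_def h_def B'_def)
  qed
  have conv: "(\<lambda>n. g n x) \<longlonglongrightarrow> pd b F x" for x
  proof -
    have "((\<lambda>s. F (x + s *\<^sub>R b)) has_real_derivative pd b F x) (at 0)"
      using has_derivative_line[of F x 0 b] dF by (simp add: pd_def)
    then have "((\<lambda>t. (F (x + t *\<^sub>R b) - F x) / t) \<longlongrightarrow> pd b F x) (at 0)"
      by (simp add: has_field_derivative_iff)
    moreover have "filterlim (\<lambda>n. 1 / real (Suc n)) (at 0) sequentially"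
      unfolding filterlim_at using LIMSEQ_inverse_real_of_nat by (auto simp: field_simps inverse_eq_divide)
    ultimately show ?thesis unfolding g_def
      by (rule filterlim_compose[where g="\<lambda>t. (F (x + t *\<^sub>R b) - F x) / t"])
  qed
  have "(\<lambda>n. integral UNIV (g n)) \<longlonglongrightarrow> integral UNIV (pd b F)"
    using gi hint le conv by (intro dominated_convergence(2)[of g UNIV h]) auto
  then show ?thesis by (simp add: g0 LIMSEQ_const_iff)
qed

lemma integral_by_parts_test_function:
  fixes f \<phi> :: "'a::euclidean_space \<Rightarrow> real"
  assumes S: "open S" and \<phi>: "test_function S \<phi>" and b: "b \<in> Basis"
    and f: "f differentiable_on S" "continuous_on S (pd b f)"
  shows "integral S (\<lambda>x. pd b \<phi> x * f x) = - integral S (\<lambda>x. \<phi> x * pd b f x)"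
proof -
  obtain K where K: "compact K" "K \<subseteq> S" "\<And>x. x \<notin> K \<Longrightarrow> \<phi> x = 0"
    using \<phi> by (auto simp: test_function_def)
  have C: "Cinf UNIV \<phi>" using \<phi> by (simp add: test_function_def)
  have d\<phi>: "\<phi> differentiable (at x)" for x using C by (rule Cinf_differentiable) auto
  have c\<phi>: "continuous_on A \<phi>" for A using Cinf_continuous[OF C] by (rule continuous_on_subset) auto
  have cp\<phi>: "continuous_on A (pd b \<phi>)" for A
    using Cinf_continuous[OF Cinf_pd[OF C b]] by (rule continuous_on_subset) auto
  have df: "f differentiable (at x)" if "x \<in> S" for x
    using f(1) S that by (simp add: differentiable_on_eq_differentiable_at)
  have cf: "continuous_on S f" using f(1) by (rule differentiable_imp_continuous_on)
  have dz: "pd b \<phi> x = 0" if "x \<notin> K" for x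
    by (rule pd_zero_off_compact[OF K(1) _ that]) (rule K(3))
  \<comment> \<open>Nothing is known about \<open>f\<close> outside \<open>S\<close>; the product is extended by zero.\<close>
  define F where "F = (\<lambda>x. if x \<in> S then \<phi> x * f x else 0)"
  have 1: "(F has_derivative (\<lambda>v. \<phi> x * frechet_derivative f (at x) v + frechet_derivative \<phi> (at x) v * f x)) (at x)"
    if "x \<in> S" for x
  proof -
    have "((\<lambda>x. \<phi> x * f x) has_derivative (\<lambda>v. \<phi> x * frechet_derivative f (at x) v + frechet_derivative \<phi> (at x) v * f x)) (at x)"
      by (intro has_derivative_mult) (use df[OF that] d\<phi>[of x] frechet_derivative_works in blast)+
    then show ?thesis by (rule has_derivative_transform_within_open[OF _ S that]) (simp add: F_def)
  qed
  have 2: "(F has_derivative (\<lambda>v. 0)) (at x)" if "x \<notin> K" for x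
  proof -
    have "((\<lambda>x. 0) has_derivative (\<lambda>v. 0)) (at x)" by simp
    then show ?thesis
      by (rule has_derivative_transform_within_open[of _ _ _ _ "- K"]) (use that K in \<open>auto simp: F_def intro: compact_imp_closed\<close>)
  qed
  have dF: "F differentiable (at x)" for x
    using 1[of x] 2[of x] K(2) by (cases "x \<in> S") (auto simp: differentiable_def)
  have p1: "pd b F x = \<phi> x * pd b f x + pd b \<phi> x * f x" if "x \<in> S" for x
    using pd_eq[OF 1[OF that]] by (simp add: pd_def)
  have p2: "pd b F x = 0" if "x \<notin> K" for x using pd_eq[OF 2[OF that]] by simp
  have "continuous_on S (pd b F)"
    by (rule iffD2[OF continuous_on_cong[OF refl p1]]) (auto intro!: continuous_intros cf c\<phi> cp\<phi> f)
  moreover have "continuous_on (- K) (pd b F)"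
    by (rule iffD2[OF continuous_on_cong[OF refl p2]]) (auto)
  ultimately have "continuous_on (S \<union> - K) (pd b F)"
    using S K(1) by (intro continuous_on_open_Un) (auto intro: compact_imp_closed)
  moreover have "S \<union> - K = UNIV" using K(2) by auto
  ultimately have cF: "continuous_on UNIV (pd b F)" by simp
  have "integral UNIV (pd b F) = 0"
    using K by (intro integral_pd_compact_support[OF dF cF, of K]) (auto simp: F_def)
  moreover have "integral UNIV (pd b F) = integral S (\<lambda>x. \<phi> x * pd b f x + pd b \<phi> x * f x)"
  proof -
    have "pd b F = (\<lambda>x. if x \<in> S then \<phi> x * pd b f x + pd b \<phi> x * f x else 0)"
      using p1 p2 K(2) by force
    then show ?thesis by (simp add: integral_restrict_UNIV)
  qed
  moreover have "(\<lambda>x. \<phi> x * pd b f x) absolutely_integrable_on S"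
    using K dz f(2) by (intro compact_support_absint[of K]) (auto intro!: continuous_intros c\<phi> intro: continuous_on_subset)
  moreover have "(\<lambda>x. pd b \<phi> x * f x) absolutely_integrable_on S"
    using K dz cf by (intro compact_support_absint[of K]) (auto intro!: continuous_intros cp\<phi> intro: continuous_on_subset)
  ultimately show ?thesis
    by (simp add: Henstock_Kurzweil_Integration.integral_add set_lebesgue_integral_eq_integral(1))
qed

text \<open>Integration by parts moves the outermost derivative first, so that the multi-index is reversed on the
other side. This spares an appeal to the symmetry of mixed derivatives.\<close>

lemma Cinf_weak_identity:
  fixes f :: "'a::euclidean_space \<Rightarrow> real"
  assumes S: "open S" and f: "Cinf S f" and \<phi>: "test_function S \<phi>" and \<alpha>: "set \<alpha> \<subseteq> Basis"
  shows "integral S (\<lambda>x. ipd \<alpha> \<phi> x * f x) = (-1) ^ length \<alpha> * integral S (\<lambda>x. \<phi> x * ipd (rev \<alpha>) f x)"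
  using f \<alpha>
proof (induction \<alpha> arbitrary: f)
  case (Cons b bs)
  have b: "b \<in> Basis" using Cons by auto
  have "integral S (\<lambda>x. ipd (b # bs) \<phi> x * f x) = - integral S (\<lambda>x. ipd bs \<phi> x * pd b f x)"
    unfolding ipd.simps
  proof (rule integral_by_parts_test_function[OF S _ b])
    show "test_function S (ipd bs \<phi>)" using Cons.prems \<phi> by (auto intro: test_function_ipd)
    show "f differentiable_on S"
      using Cons.prems(1) Cinf_iff[of S f] by (metis ipd.simps(1) empty_set empty_subsetI)
    show "continuous_on S (pd b f)" using Cons.prems b by (intro Cinf_continuous Cinf_pd) auto
  qed
  also have "\<dots> = - ((-1) ^ length bs * integral S (\<lambda>x. \<phi> x * ipd (rev bs) (pd b f) x))"
    using Cons.prems b by (subst Cons.IH) (auto intro: Cinf_pd)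
  finally show ?case by (simp add: ipd_append)
qed simp

lemma locally_integrable_continuous:
  "continuous_on S f \<Longrightarrow> locally_integrable S f"
  unfolding locally_integrable_def
  using absint_continuous_compact continuous_on_subset by blast

lemma Cinf_has_weak_deriv:
  fixes f :: "'a::euclidean_space \<Rightarrow> real"
  assumes S: "open S" and f: "Cinf S f" and \<alpha>: "set \<alpha> \<subseteq> Basis"
  shows "has_weak_deriv S \<alpha> f (ipd (rev \<alpha>) f)"
  unfolding has_weak_deriv_def
  using Cinf_weak_identity[OF S f _ \<alpha>] \<alpha> f
  by (auto intro!: locally_integrable_continuous Cinf_continuous Cinf_ipd)

lemma has_weak_deriv_cong:
  assumes "\<And>x. x \<in> S \<Longrightarrow> f x = f' x" "\<And>x. x \<in> S \<Longrightarrow> g x = g' x"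
  shows "has_weak_deriv S \<alpha> f g \<longleftrightarrow> has_weak_deriv S \<alpha> f' g'"
proof -
  have 1: "integral S (\<lambda>x. c x *\<^sub>R f x) = integral S (\<lambda>x. c x *\<^sub>R f' x)"
    "integral S (\<lambda>x. c x *\<^sub>R g x) = integral S (\<lambda>x. c x *\<^sub>R g' x)" for c
    using assms by (auto intro: integral_cong)
  have 2: "h absolutely_integrable_on K \<longleftrightarrow> h' absolutely_integrable_on K"
    if "K \<subseteq> S" "\<And>x. x \<in> S \<Longrightarrow> h x = h' x" for K and h h' :: "'a \<Rightarrow> 'b"
    using that by (intro set_integrable_cong) auto
  show ?thesis
    unfolding has_weak_deriv_def locally_integrable_def using 1 2[of _ f f'] 2[of _ g g'] assms by auto
qed

lemma weak_product_integrable: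
  fixes f :: "'a::euclidean_space \<Rightarrow> 'b::euclidean_space"
  assumes "locally_integrable S f" "test_function S \<phi>"
  shows "(\<lambda>x. \<phi> x *\<^sub>R f x) integrable_on S"
proof -
  obtain K where K: "compact K" "K \<subseteq> S" "\<And>x. x \<notin> K \<Longrightarrow> \<phi> x = 0"
    using assms by (auto simp: test_function_def)
  have c: "continuous_on K \<phi>"
    using assms(2) by (auto simp: test_function_def intro: continuous_on_subset Cinf_continuous)
  have "bilinear (\<lambda>(x::real) (y::'b). x *\<^sub>R y)"
    by (auto simp: bilinear_def linear_iff algebra_simps)
  moreover have "\<phi> \<in> borel_measurable (lebesgue_on K)"
    using c K by (intro continuous_imp_measurable_on_sets_lebesgue) (auto intro: lmeasurable_compact fmeasurableD)
  moreover have "bounded (\<phi> ` K)"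
    using c K by (intro compact_imp_bounded compact_continuous_image) auto
  moreover have "f absolutely_integrable_on K" using assms(1) K by (auto simp: locally_integrable_def)
  moreover have "K \<in> sets lebesgue" using K by (auto intro: lmeasurable_compact fmeasurableD)
  ultimately have "(\<lambda>x. \<phi> x *\<^sub>R f x) absolutely_integrable_on K"
    using absolutely_integrable_bounded_measurable_product[of "\<lambda>x y. x *\<^sub>R y" \<phi> K f] by blast
  then have "(\<lambda>x. \<phi> x *\<^sub>R f x) integrable_on K" by (rule set_lebesgue_integral_eq_integral(1))
  then show ?thesis
    by (rule integrable_on_superset) (use K in auto)
qed

lemma has_weak_deriv_scaleR_const:
  fixes f g :: "'a::euclidean_space \<Rightarrow> real" and v :: "'b::euclidean_space"
  assumes "has_weak_deriv S \<alpha> f g" "set \<alpha> \<subseteq> Basis"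
  shows "has_weak_deriv S \<alpha> (\<lambda>x. f x *\<^sub>R v) (\<lambda>x. g x *\<^sub>R v)"
proof -
  have li: "locally_integrable S f" "locally_integrable S g" using assms by (auto simp: has_weak_deriv_def)
  have li': "locally_integrable S (\<lambda>x. h x *\<^sub>R v)" if "locally_integrable S h" for h
    using that unfolding locally_integrable_def by (auto intro: absolutely_integrable_scaleR_right)
  have "integral S (\<lambda>x. c x *\<^sub>R (h x *\<^sub>R v)) = integral S (\<lambda>x. c x *\<^sub>R h x) *\<^sub>R v"
    if "test_function S c" "locally_integrable S h" for c h
  proof -
    have "((\<lambda>x. c x *\<^sub>R h x) has_integral integral S (\<lambda>x. c x *\<^sub>R h x)) S"
      using weak_product_integrable[OF that(2,1)] by (simp add: has_integral_integral)
    from has_integral_linear[OF this bounded_linear_scaleR_left[of v]] show ?thesis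
      by (auto simp: o_def intro: integral_unique)
  qed
  then show ?thesis
    using assms li li' unfolding has_weak_deriv_def by (simp add: test_function_ipd)
qed

lemma has_weak_deriv_sum:
  fixes f g :: "'i \<Rightarrow> 'a::euclidean_space \<Rightarrow> 'b::euclidean_space"
  assumes "finite I" "\<And>i. i \<in> I \<Longrightarrow> has_weak_deriv S \<alpha> (f i) (g i)" "set \<alpha> \<subseteq> Basis"
  shows "has_weak_deriv S \<alpha> (\<lambda>x. \<Sum>i\<in>I. f i x) (\<lambda>x. \<Sum>i\<in>I. g i x)"
proof -
  have li: "\<And>i. i \<in> I \<Longrightarrow> locally_integrable S (f i)" "\<And>i. i \<in> I \<Longrightarrow> locally_integrable S (g i)"
    using assms by (auto simp: has_weak_deriv_def)
  have "integral S (\<lambda>x. c x *\<^sub>R (\<Sum>i\<in>I. h i x)) = (\<Sum>i\<in>I. integral S (\<lambda>x. c x *\<^sub>R h i x))"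
    if "test_function S c" "\<And>i. i \<in> I \<Longrightarrow> locally_integrable S (h i)" for c and h :: "'i \<Rightarrow> 'a \<Rightarrow> 'b"
    unfolding scaleR_sum_right using that assms(1) by (intro integral_sum weak_product_integrable) auto
  moreover have "locally_integrable S (\<lambda>x. \<Sum>i\<in>I. h i x)"
    if "\<And>i. i \<in> I \<Longrightarrow> locally_integrable S (h i)" for h :: "'i \<Rightarrow> 'a \<Rightarrow> 'b"
    using that assms(1) unfolding locally_integrable_def by (auto intro!: absolutely_integrable_sum)
  ultimately show ?thesis
    using li assms unfolding has_weak_deriv_def by (simp add: test_function_ipd scaleR_sum_right)
qed

lemma has_weak_deriv_scaleR:
  fixes f g :: "'a::euclidean_space \<Rightarrow> 'b::euclidean_space"
  assumes "has_weak_deriv S \<alpha> f g"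
  shows "has_weak_deriv S \<alpha> (\<lambda>x. c *\<^sub>R f x) (\<lambda>x. c *\<^sub>R g x)"
proof -
  have "integral S (\<lambda>x. a x *\<^sub>R c *\<^sub>R h x) = c *\<^sub>R integral S (\<lambda>x. a x *\<^sub>R h x)" for a :: "'a \<Rightarrow> real" and h :: "'a \<Rightarrow> 'b"
    using integral_cmul[of S c "\<lambda>x. a x *\<^sub>R h x"] by (simp add: mult.commute)
  then show ?thesis
    using assms unfolding has_weak_deriv_def locally_integrable_def
    by (auto intro: absolutely_integrable_scaleR_left)
qed

section \<open>Linear combinations in Sobolev and Bochner spaces\<close>

text \<open>All weak derivatives, of every order, exist and have a bounded measurable representative. This
implies membership in every \<open>W\<^sup>k\<^sup>,\<^sup>\<infinity>(S)\<close>, and it is stable under linear combinations.\<close>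

definition bounded_weak_derivs :: "'a::euclidean_space set \<Rightarrow> ('a \<Rightarrow> 'b::euclidean_space) \<Rightarrow> bool" where
  "bounded_weak_derivs S f \<longleftrightarrow> (\<forall>\<alpha>. set \<alpha> \<subseteq> Basis \<longrightarrow>
     (\<exists>g C. has_weak_deriv S \<alpha> f g \<and> g \<in> borel_measurable (lebesgue_on S) \<and> (\<forall>x\<in>S. norm (g x) \<le> C)))"

lemma bounded_weak_derivs_cong:
  assumes "\<And>x. x \<in> S \<Longrightarrow> f x = f' x"
  shows "bounded_weak_derivs S f \<longleftrightarrow> bounded_weak_derivs S f'"
  unfolding bounded_weak_derivs_def using has_weak_deriv_cong[of S f f', OF assms refl] by simp

lemma bounded_weak_derivs_scaleR_const:
  fixes f :: "'a::euclidean_space \<Rightarrow> real" and v :: "'b::euclidean_space"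
  assumes "bounded_weak_derivs S f"
  shows "bounded_weak_derivs S (\<lambda>x. f x *\<^sub>R v)"
  unfolding bounded_weak_derivs_def
proof (intro allI impI)
  fix \<alpha> :: "'a list" assume \<alpha>: "set \<alpha> \<subseteq> Basis"
  obtain g C where g: "has_weak_deriv S \<alpha> f g" "g \<in> borel_measurable (lebesgue_on S)" "\<forall>x\<in>S. norm (g x) \<le> C"
    using assms \<alpha> unfolding bounded_weak_derivs_def by meson
  have "has_weak_deriv S \<alpha> (\<lambda>x. f x *\<^sub>R v) (\<lambda>x. g x *\<^sub>R v)"
    by (rule has_weak_deriv_scaleR_const[OF g(1) \<alpha>])
  moreover have "(\<lambda>x. g x *\<^sub>R v) \<in> borel_measurable (lebesgue_on S)" using g(2) by measurable
  moreover have "\<forall>x\<in>S. norm (g x *\<^sub>R v) \<le> C * norm v" using g(3) by (auto intro: mult_right_mono)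
  ultimately show "\<exists>g C. has_weak_deriv S \<alpha> (\<lambda>x. f x *\<^sub>R v) g \<and> g \<in> borel_measurable (lebesgue_on S) \<and> (\<forall>x\<in>S. norm (g x) \<le> C)"
    by blast
qed

lemma bounded_weak_derivs_sum:
  fixes f :: "'i \<Rightarrow> 'a::euclidean_space \<Rightarrow> 'b::euclidean_space"
  assumes "finite I" "\<And>i. i \<in> I \<Longrightarrow> bounded_weak_derivs S (f i)"
  shows "bounded_weak_derivs S (\<lambda>x. \<Sum>i\<in>I. f i x)"
  unfolding bounded_weak_derivs_def
proof (intro allI impI)
  fix \<alpha> :: "'a list" assume \<alpha>: "set \<alpha> \<subseteq> Basis"
  have "\<forall>i\<in>I. \<exists>g C. has_weak_deriv S \<alpha> (f i) g \<and> g \<in> borel_measurable (lebesgue_on S) \<and> (\<forall>x\<in>S. norm (g x) \<le> C)"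
    using assms \<alpha> unfolding bounded_weak_derivs_def by meson
  then obtain g C where g: "\<And>i. i \<in> I \<Longrightarrow> has_weak_deriv S \<alpha> (f i) (g i)"
     "\<And>i. i \<in> I \<Longrightarrow> g i \<in> borel_measurable (lebesgue_on S)" "\<And>i x. i \<in> I \<Longrightarrow> x \<in> S \<Longrightarrow> norm (g i x) \<le> C i"
    by metis
  have "has_weak_deriv S \<alpha> (\<lambda>x. \<Sum>i\<in>I. f i x) (\<lambda>x. \<Sum>i\<in>I. g i x)"
    by (rule has_weak_deriv_sum[OF assms(1) g(1) \<alpha>])
  moreover have "(\<lambda>x. \<Sum>i\<in>I. g i x) \<in> borel_measurable (lebesgue_on S)" using g(2) by measurable
  moreover have "\<forall>x\<in>S. norm (\<Sum>i\<in>I. g i x) \<le> (\<Sum>i\<in>I. C i)" using g(3) by (auto intro: sum_norm_le)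
  ultimately show "\<exists>g C. has_weak_deriv S \<alpha> (\<lambda>x. \<Sum>i\<in>I. f i x) g \<and> g \<in> borel_measurable (lebesgue_on S) \<and> (\<forall>x\<in>S. norm (g x) \<le> C)"
    by blast
qed

text \<open>A finite-dimensional family is controlled in \<open>W\<^sup>k\<^sup>,\<^sup>\<infinity>\<close> by its coefficients; hence the Bochner
regularity of \<open>t \<mapsto> \<Sum>\<^sub>i u\<^sub>i(t) f\<^sub>i\<close> reduces to that of the coefficient function.\<close>

lemma Wnorm_linear_combination_le:
  fixes f :: "'n::finite \<Rightarrow> 'a::euclidean_space \<Rightarrow> 'b::euclidean_space"
  assumes f: "\<And>i. bounded_weak_derivs S (f i)"
  shows "\<exists>C\<ge>0. \<forall>c::real^'n. Wnorm k S (\<lambda>x. \<Sum>i\<in>UNIV. (c $ i) *\<^sub>R f i x) \<le> ennreal (C * norm c)"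
proof -
  define L where "L = {\<alpha> :: 'a list. set \<alpha> \<subseteq> Basis \<and> length \<alpha> \<le> k}"
  have finL: "finite L" unfolding L_def by (intro finite_lists_length_le) auto
  have "\<forall>i. \<forall>\<alpha>\<in>L. \<exists>g C. has_weak_deriv S \<alpha> (f i) g \<and> g \<in> borel_measurable (lebesgue_on S) \<and> (\<forall>x\<in>S. norm (g x) \<le> C)"
    using f unfolding bounded_weak_derivs_def L_def by blast
  then obtain g C where g: "\<And>i \<alpha>. \<alpha> \<in> L \<Longrightarrow> has_weak_deriv S \<alpha> (f i) (g i \<alpha>)"
     "\<And>i \<alpha>. \<alpha> \<in> L \<Longrightarrow> g i \<alpha> \<in> borel_measurable (lebesgue_on S)"
     "\<And>i \<alpha> x. \<alpha> \<in> L \<Longrightarrow> x \<in> S \<Longrightarrow> norm (g i \<alpha> x) \<le> C i \<alpha>"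
    by metis
  define B where "B = (\<Sum>\<alpha>\<in>L. \<Sum>i\<in>UNIV. \<bar>C i \<alpha>\<bar>)"
  have "Wnorm k S (\<lambda>x. \<Sum>i\<in>UNIV. (c $ i) *\<^sub>R f i x) \<le> ennreal (B * norm c)" for c :: "real^'n"
    unfolding Wnorm_def
  proof (rule SUP_least, fold L_def)
    fix \<alpha> assume \<alpha>: "\<alpha> \<in> L"
    let ?g = "\<lambda>x. \<Sum>i\<in>UNIV. (c $ i) *\<^sub>R g i \<alpha> x"
    have "has_weak_deriv S \<alpha> (\<lambda>x. \<Sum>i\<in>UNIV. (c $ i) *\<^sub>R f i x) ?g"
      using \<alpha> by (intro has_weak_deriv_sum has_weak_deriv_scaleR g) (auto simp: L_def)
    then have "(INF g\<in>{g. has_weak_deriv S \<alpha> (\<lambda>x. \<Sum>i\<in>UNIV. (c $ i) *\<^sub>R f i x) g}.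
        esssup (lebesgue_on S) (\<lambda>x. ennreal (norm (g x)))) \<le> esssup (lebesgue_on S) (\<lambda>x. ennreal (norm (?g x)))"
      by (intro INF_lower) simp
    also have "\<dots> \<le> ennreal (B * norm c)"
    proof (rule esssup_I)
      show "(\<lambda>x. ennreal (norm (?g x))) \<in> borel_measurable (lebesgue_on S)"
        using g(2)[OF \<alpha>] by measurable
      have "norm (?g x) \<le> B * norm c" if "x \<in> S" for x
      proof -
        have "norm (?g x) \<le> (\<Sum>i\<in>UNIV. norm c * \<bar>C i \<alpha>\<bar>)"
        proof (rule sum_norm_le)
          fix i
          have "\<bar>c $ i\<bar> \<le> norm c" by (rule component_le_norm_cart)
          moreover have "norm (g i \<alpha> x) \<le> \<bar>C i \<alpha>\<bar>" using g(3)[OF \<alpha> that, of i] by simp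
          ultimately show "norm ((c $ i) *\<^sub>R g i \<alpha> x) \<le> norm c * \<bar>C i \<alpha>\<bar>"
            unfolding norm_scaleR by (intro mult_mono) auto
        qed
        also have "\<dots> = norm c * (\<Sum>i\<in>UNIV. \<bar>C i \<alpha>\<bar>)" by (simp add: sum_distrib_left)
        also have "\<dots> \<le> norm c * B"
          unfolding B_def using \<alpha> finL
          by (intro mult_left_mono member_le_sum[of \<alpha> L "\<lambda>\<alpha>. \<Sum>i\<in>UNIV. \<bar>C i \<alpha>\<bar>"] sum_nonneg) auto
        finally show ?thesis by (simp add: mult.commute)
      qed
      then show "AE x in lebesgue_on S. ennreal (norm (?g x)) \<le> ennreal (B * norm c)"
        by (intro AE_I2 ennreal_leI) (auto simp: space_restrict_space)
    qed
    finally show "(INF g\<in>{g. has_weak_deriv S \<alpha> (\<lambda>x. \<Sum>i\<in>UNIV. (c $ i) *\<^sub>R f i x) g}.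
        esssup (lebesgue_on S) (\<lambda>x. ennreal (norm (g x)))) \<le> ennreal (B * norm c)" .
  qed
  moreover have "B \<ge> 0" unfolding B_def by (intro sum_nonneg) auto
  ultimately show ?thesis by blast
qed

lemma Wnorm_cong:
  assumes "\<And>x. x \<in> S \<Longrightarrow> f x = f' x"
  shows "Wnorm k S f = Wnorm k S f'"
proof -
  have "has_weak_deriv S \<alpha> f = has_weak_deriv S \<alpha> f'" for \<alpha>
    using has_weak_deriv_cong[of S f f', OF assms refl] by blast
  then show ?thesis unfolding Wnorm_def by simp
qed

text \<open>The function \<open>G\<close> is only required to agree with the linear combination on \<open>S\<close>, as for functions
with prescribed values on the boundary.\<close>

lemma bochner_L2_linear_combination:
  fixes f :: "'n::finite \<Rightarrow> 'a::euclidean_space \<Rightarrow> 'b::euclidean_space"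
    and G :: "real^'n \<Rightarrow> 'a \<Rightarrow> 'b"
  assumes f: "\<And>i. bounded_weak_derivs S (f i)"
    and G: "\<And>c x. x \<in> S \<Longrightarrow> G c x = (\<Sum>i\<in>UNIV. (c $ i) *\<^sub>R f i x)"
    and u: "L2_on {0..T} u"
  shows "bochner_L2 T (Wnorm k S) (\<lambda>t. G (u t))"
proof -
  obtain C where C: "C \<ge> 0" "\<And>c::real^'n. Wnorm k S (\<lambda>x. \<Sum>i\<in>UNIV. (c $ i) *\<^sub>R f i x) \<le> ennreal (C * norm c)"
    using Wnorm_linear_combination_le[of S f k, OF f] by auto
  have W: "Wnorm k S (G c) \<le> ennreal (C * norm c)" for c
    using C(2)[of c] Wnorm_cong[of S "G c" "\<lambda>x. \<Sum>i\<in>UNIV. (c $ i) *\<^sub>R f i x" k, OF G] by simp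
  have W': "Wnorm k S (\<lambda>x. G c x - G d x) \<le> ennreal (C * norm (c - d))" for c d
  proof -
    have "Wnorm k S (\<lambda>x. G c x - G d x) = Wnorm k S (G (c - d))"
      by (rule Wnorm_cong) (simp add: G sum_subtractf scaleR_left_diff_distrib)
    then show ?thesis using W by simp
  qed
  have um: "u \<in> borel_measurable (lebesgue_on {0..T})" and ui: "integrable (lebesgue_on {0..T}) (\<lambda>t. (norm (u t))\<^sup>2)"
    using u by (auto simp: L2_on_def)
  \<comment> \<open>Simple coefficient functions converging to \<open>u\<close> give the simple approximations required in
    \<open>W\<^sup>k\<^sup>,\<^sup>\<infinity>\<close>.\<close>
  obtain s where s': "\<forall>i. simple_function (lebesgue_on {0..T}) (s i)"
    "\<forall>t\<in>space (lebesgue_on {0..T}). (\<lambda>i. s i t) \<longlonglongrightarrow> u t"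
    using borel_measurable_implies_sequence_metric[OF um, of 0] by blast
  have s: "simple_function (lebesgue_on {0..T}) (s n)" for n using s'(1) by blast
  have slim: "(\<lambda>n. s n t) \<longlonglongrightarrow> u t" if "t \<in> {0..T}" for t
    using s'(2) that by (simp add: space_restrict_space)
  have 1: "AE t in lebesgue_on {0..T}. Wnorm k S (G (u t)) < \<infinity>"
    by (intro AE_I2) (simp add: le_less_trans[OF W ennreal_less_top])
  have 2: "finite ((\<lambda>t. G (s n t)) ` {0..T})" for n
  proof -
    have "finite (s n ` {0..T})" using simple_functionD(1)[OF s[of n]] by (simp add: space_restrict_space)
    then have "finite (G ` (s n ` {0..T}))" by (rule finite_imageI)
    then show ?thesis by (simp add: image_image)
  qed
  have 3: "{t\<in>{0..T}. G (s n t) = w} \<in> sets lebesgue" for n w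
  proof -
    have "s n -` {c. G c = w} \<inter> {0..T} \<in> sets (lebesgue_on {0..T})"
      using simple_functionD(2)[OF s[of n], of "{c. G c = w}"] by (simp add: space_restrict_space)
    then have "s n -` {c. G c = w} \<inter> {0..T} \<in> sets lebesgue"
      by (subst (asm) sets_restrict_space_iff) auto
    moreover have "s n -` {c. G c = w} \<inter> {0..T} = {t\<in>{0..T}. G (s n t) = w}" by auto
    ultimately show ?thesis by simp
  qed
  have 4: "Wnorm k S (G (s n t)) < \<infinity>" for n t by (simp add: le_less_trans[OF W ennreal_less_top])
  have 5: "(\<lambda>n. Wnorm k S (\<lambda>x. G (s n t) x - G (u t) x)) \<longlonglongrightarrow> 0" if "t \<in> {0..T}" for t
  proof (rule tendsto_sandwich[OF _ _ tendsto_const])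
    show "\<forall>\<^sub>F n in sequentially. 0 \<le> Wnorm k S (\<lambda>x. G (s n t) x - G (u t) x)" by simp
    show "\<forall>\<^sub>F n in sequentially. Wnorm k S (\<lambda>x. G (s n t) x - G (u t) x) \<le> ennreal (C * norm (s n t - u t))"
      using W' by simp
    have "(\<lambda>n. C * norm (s n t - u t)) \<longlonglongrightarrow> C * norm (u t - u t)"
      by (intro tendsto_intros slim that)
    then have "(\<lambda>n. ennreal (C * norm (s n t - u t))) \<longlonglongrightarrow> ennreal 0" by (intro tendsto_ennrealI) simp
    then show "(\<lambda>n. ennreal (C * norm (s n t - u t))) \<longlonglongrightarrow> 0" by simp
  qed
  have "(\<integral>\<^sup>+t. (Wnorm k S (G (u t)))\<^sup>2 \<partial>lebesgue_on {0..T}) \<le> (\<integral>\<^sup>+t. ennreal (C\<^sup>2 * (norm (u t))\<^sup>2) \<partial>lebesgue_on {0..T})"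
  proof (rule nn_integral_mono)
    fix t
    have "(Wnorm k S (G (u t)))\<^sup>2 \<le> (ennreal (C * norm (u t)))\<^sup>2" by (intro power_mono W) auto
    also have "\<dots> = ennreal (C\<^sup>2 * (norm (u t))\<^sup>2)" using C by (simp add: ennreal_power power_mult_distrib)
    finally show "(Wnorm k S (G (u t)))\<^sup>2 \<le> ennreal (C\<^sup>2 * (norm (u t))\<^sup>2)" .
  qed
  also have "\<dots> < \<infinity>"
    using integrableD(2)[OF integrable_mult_right[OF ui, of "C\<^sup>2"]] by (simp add: less_top)
  finally have 6: "(\<integral>\<^sup>+t. (Wnorm k S (G (u t)))\<^sup>2 \<partial>lebesgue_on {0..T}) < \<infinity>" .
  show ?thesis
    unfolding bochner_L2_def
  proof (intro conjI exI[of _ "\<lambda>n t. G (s n t)"] allI ballI)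
    show "AE t in lebesgue_on {0..T}. (\<lambda>n. Wnorm k S (\<lambda>x. G (s n t) x - G (u t) x)) \<longlonglongrightarrow> 0"
      by (intro AE_I2 5) (simp add: space_restrict_space)
  qed (use 1 2 3 4 6 in auto)
qed

lemma Cinf_bounded_weak_derivs:
  fixes f :: "'a::euclidean_space \<Rightarrow> real"
  assumes S: "open S" and f: "Cinf S f"
    and b: "\<And>\<alpha>. set \<alpha> \<subseteq> Basis \<Longrightarrow> \<exists>C. \<forall>x\<in>S. norm (ipd \<alpha> f x) \<le> C"
  shows "bounded_weak_derivs S f"
  unfolding bounded_weak_derivs_def
proof (intro allI impI)
  fix \<alpha> :: "'a list" assume \<alpha>: "set \<alpha> \<subseteq> Basis"
  obtain C where "\<forall>x\<in>S. norm (ipd (rev \<alpha>) f x) \<le> C" using b[of "rev \<alpha>"] \<alpha> by auto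
  moreover have "ipd (rev \<alpha>) f \<in> borel_measurable (lebesgue_on S)"
    using S \<alpha> f by (intro continuous_imp_measurable_on_sets_lebesgue Cinf_continuous Cinf_ipd) auto
  ultimately show "\<exists>g C. has_weak_deriv S \<alpha> f g \<and> g \<in> borel_measurable (lebesgue_on S) \<and> (\<forall>x\<in>S. norm (g x) \<le> C)"
    using Cinf_has_weak_deriv[OF S f \<alpha>] by blast
qed

section \<open>Square integrable functions\<close>

lemma norm_add_sq_le: "(norm (x + y))\<^sup>2 \<le> 2 * (norm x)\<^sup>2 + 2 * (norm y)\<^sup>2" for x y :: "'a::real_normed_vector"
proof -
  have "(norm (x + y))\<^sup>2 \<le> (norm x + norm y)\<^sup>2"
    by (intro power_mono norm_triangle_ineq) auto
  also have "\<dots> \<le> 2 * (norm x)\<^sup>2 + 2 * (norm y)\<^sup>2"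
    using sum_squares_bound[of "norm x" "norm y"] by (simp add: power2_sum)
  finally show ?thesis .
qed

lemma L2_on_add:
  fixes f g :: "'a::euclidean_space \<Rightarrow> 'b::euclidean_space"
  assumes "L2_on S f" "L2_on S g"
  shows "L2_on S (\<lambda>x. f x + g x)"
proof -
  have [measurable]: "f \<in> borel_measurable (lebesgue_on S)" "g \<in> borel_measurable (lebesgue_on S)"
    using assms by (auto simp: L2_on_def)
  have "integrable (lebesgue_on S) (\<lambda>x. (norm (f x + g x))\<^sup>2)"
  proof (rule Bochner_Integration.integrable_bound)
    show "integrable (lebesgue_on S) (\<lambda>x. 2 * (norm (f x))\<^sup>2 + 2 * (norm (g x))\<^sup>2)"
      using assms by (auto simp: L2_on_def)
    show "AE x in lebesgue_on S. norm ((norm (f x + g x))\<^sup>2) \<le> norm (2 * (norm (f x))\<^sup>2 + 2 * (norm (g x))\<^sup>2)"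
      using norm_add_sq_le by (intro AE_I2) auto
  qed measurable
  then show ?thesis by (simp add: L2_on_def)
qed

lemma L2_on_scaleR:
  fixes f :: "'a::euclidean_space \<Rightarrow> 'b::euclidean_space"
  assumes "L2_on S f"
  shows "L2_on S (\<lambda>x. c *\<^sub>R f x)"
  using assms by (auto simp: L2_on_def power_mult_distrib)

lemma L2_on_diff:
  fixes f g :: "'a::euclidean_space \<Rightarrow> 'b::euclidean_space"
  assumes "L2_on S f" "L2_on S g"
  shows "L2_on S (\<lambda>x. f x - g x)"
  using L2_on_add[OF assms(1) L2_on_scaleR[OF assms(2), of "-1"]] by simp

text \<open>The square of the \<open>L\<^sup>2\<close> norm.\<close>

abbreviation sqint :: "'a::euclidean_space set \<Rightarrow> ('a \<Rightarrow> 'b::euclidean_space) \<Rightarrow> real" where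
  "sqint S f \<equiv> (LINT x|lebesgue_on S. (norm (f x))\<^sup>2)"

lemma sqint_nonneg: "0 \<le> sqint S f" by (rule integral_nonneg_AE) auto

lemma L2norm_sq: "(L2norm S f)\<^sup>2 = sqint S f"
  by (simp add: L2norm_def sqint_nonneg)

lemma L2norm_le_iff: "0 \<le> R \<Longrightarrow> L2norm S f \<le> R \<longleftrightarrow> sqint S f \<le> R\<^sup>2"
  unfolding L2norm_def using sqint_nonneg[of S f] by (intro real_sqrt_le_iff') auto

lemma sqint_parallelogram:
  fixes f g :: "'a::euclidean_space \<Rightarrow> 'b::euclidean_space"
  assumes "L2_on S f" "L2_on S g"
  shows "sqint S (\<lambda>x. (1/2) *\<^sub>R (f x + g x)) + (1/4) * sqint S (\<lambda>x. f x - g x) = (sqint S f + sqint S g) / 2"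
proof -
  have i: "integrable (lebesgue_on S) (\<lambda>x. (norm ((1/2) *\<^sub>R (f x + g x)))\<^sup>2)"
    "integrable (lebesgue_on S) (\<lambda>x. (norm (f x - g x))\<^sup>2)"
    "integrable (lebesgue_on S) (\<lambda>x. (norm (f x))\<^sup>2)" "integrable (lebesgue_on S) (\<lambda>x. (norm (g x))\<^sup>2)"
    using L2_on_scaleR[OF L2_on_add[OF assms], of "1/2"] L2_on_diff[OF assms] assms
    by (auto simp: L2_on_def simp del: norm_scaleR)
  have "sqint S (\<lambda>x. (1/2) *\<^sub>R (f x + g x)) + (1/4) * sqint S (\<lambda>x. f x - g x)
      = (LINT x|lebesgue_on S. (norm ((1/2) *\<^sub>R (f x + g x)))\<^sup>2 + (1/4) * (norm (f x - g x))\<^sup>2)"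
    using i(1,2) by simp
  also have "\<dots> = (LINT x|lebesgue_on S. (1/2) * (norm (f x))\<^sup>2 + (1/2) * (norm (g x))\<^sup>2)"
  proof (rule Bochner_Integration.integral_cong[OF refl])
    fix x
    show "(norm ((1/2) *\<^sub>R (f x + g x)))\<^sup>2 + (1/4) * (norm (f x - g x))\<^sup>2 = (1/2) * (norm (f x))\<^sup>2 + (1/2) * (norm (g x))\<^sup>2"
      unfolding power2_norm_eq_inner by (simp add: inner_simps inner_commute algebra_simps)
  qed
  also have "\<dots> = (sqint S f + sqint S g) / 2" using i(3,4) by simp
  finally show ?thesis .
qed

text \<open>The triangle inequality with a constant, which is enough for convergence arguments.\<close>

lemma sqint_triangle:
  fixes f g h :: "'a::euclidean_space \<Rightarrow> 'b::euclidean_space"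
  assumes "L2_on S f" "L2_on S g" "L2_on S h"
  shows "sqint S (\<lambda>x. f x - h x) \<le> 2 * sqint S (\<lambda>x. f x - g x) + 2 * sqint S (\<lambda>x. g x - h x)"
proof -
  have i: "integrable (lebesgue_on S) (\<lambda>x. (norm (f x - h x))\<^sup>2)"
    "integrable (lebesgue_on S) (\<lambda>x. (norm (f x - g x))\<^sup>2)"  "integrable (lebesgue_on S) (\<lambda>x. (norm (g x - h x))\<^sup>2)"
    using L2_on_diff assms by (auto simp: L2_on_def)
  have "sqint S (\<lambda>x. f x - h x) \<le> (LINT x|lebesgue_on S. 2 * (norm (f x - g x))\<^sup>2 + 2 * (norm (g x - h x))\<^sup>2)"
  proof (rule integral_mono)
    fix x
    show "(norm (f x - h x))\<^sup>2 \<le> 2 * (norm (f x - g x))\<^sup>2 + 2 * (norm (g x - h x))\<^sup>2"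
      using norm_add_sq_le[of "f x - g x" "g x - h x"] by simp
  qed (use i in auto)
  also have "\<dots> = 2 * sqint S (\<lambda>x. f x - g x) + 2 * sqint S (\<lambda>x. g x - h x)" using i by simp
  finally show ?thesis .
qed

lemma L2_on_absolutely_integrable:
  fixes f :: "'a::euclidean_space \<Rightarrow> 'b::euclidean_space"
  assumes f: "L2_on S f" and S: "S \<in> lmeasurable"
  shows "f absolutely_integrable_on S"
proof -
  have "integrable (lebesgue_on S) f"
  proof (rule Bochner_Integration.integrable_bound)
    show "integrable (lebesgue_on S) (\<lambda>x. 1 + (norm (f x))\<^sup>2)"
      using f finite_measure.integrable_const[OF finite_measure_lebesgue_on[OF S], of "1::real"]
      by (intro Bochner_Integration.integrable_add) (auto simp: L2_on_def)
    have "norm y \<le> 1 + (norm y)\<^sup>2" for y :: 'b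
      using sum_squares_bound[of 1 "norm y"] norm_ge_zero[of y]
      by (simp add: power2_eq_square del: norm_ge_zero)
    then show "AE x in lebesgue_on S. norm (f x) \<le> norm (1 + (norm (f x))\<^sup>2)"
      by (intro AE_I2) (auto intro: order_trans)
  qed (use f in \<open>auto simp: L2_on_def\<close>)
  then show ?thesis
    using S by (simp add: set_integrable_def integrable_restrict_space fmeasurableD)
qed

text \<open>The Cauchy--Schwarz inequality against the constant function; it makes primitives of \<open>L\<^sup>2\<close> functions
uniformly Hoelder continuous.\<close>

lemma norm_integral_ivl_le:
  fixes f :: "real \<Rightarrow> 'b::euclidean_space"
  assumes f: "L2_on {0..T} f" and st: "0 \<le> s" "s \<le> t" "t \<le> T"
  shows "(integral {s..t} (\<lambda>\<tau>. norm (f \<tau>)))\<^sup>2 \<le> (t - s) * sqint {0..T} f"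
proof (cases "s = t")
  case False
  then have "s < t" using st by simp
  let ?M = "lebesgue_on {s..t}"
  have fa: "f absolutely_integrable_on {0..T}" using f by (rule L2_on_absolutely_integrable) auto
  have fa': "f absolutely_integrable_on {s..t}" using st by (intro absint_sub[OF fa]) auto
  have ni: "integrable ?M (\<lambda>\<tau>. norm (f \<tau>))"
    using absolutely_integrable_norm[OF fa']
    by (simp add: set_integrable_def integrable_restrict_space o_def)
  have i2: "integrable ?M (\<lambda>\<tau>. (norm (f \<tau>))\<^sup>2)"
    using f st integrable_subinterval[of 0 T "\<lambda>\<tau>. (norm (f \<tau>))\<^sup>2" s t] by (auto simp: L2_on_def)
  have c: "integral {s..t} (\<lambda>\<tau>. norm (f \<tau>)) = (LINT \<tau>|?M. norm (f \<tau>))"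
    using ni by (subst lebesgue_integral_eq_integral) auto
  define I where "I = (LINT \<tau>|?M. norm (f \<tau>))"
  \<comment> \<open>\<open>c\<close> is the mean of the norm of \<open>f\<close>; expand the integral of \<open>(|f| - c)\<^sup>2 \<ge> 0\<close>.\<close>
  define c where "c = I / (t - s)"
  have "0 \<le> (LINT \<tau>|?M. (norm (f \<tau>) - c)\<^sup>2)" by (rule integral_nonneg_AE) auto
  also have "\<dots> = (LINT \<tau>|?M. (norm (f \<tau>))\<^sup>2 - 2 * c * norm (f \<tau>) + c\<^sup>2)"
    by (rule Bochner_Integration.integral_cong) (auto simp: power2_diff)
  also have "\<dots> = sqint {s..t} f - 2 * c * I + c\<^sup>2 * (t - s)"
    using ni i2 st by (simp add: I_def measure_restrict_space)
  also have "\<dots> = sqint {s..t} f - I\<^sup>2 / (t - s)"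
  proof -
    have "c * (t - s) = I" using \<open>s < t\<close> by (simp add: c_def)
    then have "c\<^sup>2 * (t - s) = c * I" by (simp add: power2_eq_square mult.assoc)
    moreover have "c * I = I\<^sup>2 / (t - s)" by (simp add: c_def power2_eq_square)
    ultimately show ?thesis by simp
  qed
  finally have "I\<^sup>2 \<le> (t - s) * sqint {s..t} f" using \<open>s < t\<close> by (simp add: field_simps)
  also have "sqint {s..t} f \<le> sqint {0..T} f"
  proof -
    have e: "sqint {a..b} f = integral {a..b} (\<lambda>\<tau>. (norm (f \<tau>))\<^sup>2)" if "0 \<le> a" "b \<le> T" for a b
      using f that integrable_subinterval[of 0 T "\<lambda>\<tau>. (norm (f \<tau>))\<^sup>2" a b]
      by (subst lebesgue_integral_eq_integral) (auto simp: L2_on_def)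
    show ?thesis
      unfolding e[OF st(1,3)] e[OF order_refl order_refl]
      using f st integrable_subinterval[of 0 T "\<lambda>\<tau>. (norm (f \<tau>))\<^sup>2" s t]
      by (intro integral_subset_le integrable_on_lebesgue_on) (auto simp: L2_on_def)
  qed
  finally show ?thesis using st c by (simp add: I_def mult_left_mono)
qed (use st sqint_nonneg in auto)

lemma norm_integral_ivl_le':
  fixes f :: "real \<Rightarrow> 'b::euclidean_space"
  assumes f: "L2_on {0..T} f" and st: "0 \<le> s" "s \<le> t" "t \<le> T"
  shows "integral {s..t} (\<lambda>\<tau>. norm (f \<tau>)) \<le> sqrt (t - s) * L2norm {0..T} f"
    "norm (integral {s..t} f) \<le> sqrt (t - s) * L2norm {0..T} f"
proof -
  have "sqrt ((integral {s..t} (\<lambda>\<tau>. norm (f \<tau>)))\<^sup>2) \<le> sqrt ((t - s) * sqint {0..T} f)"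
    using norm_integral_ivl_le[OF assms] by (rule real_sqrt_le_mono)
  then show 1: "integral {s..t} (\<lambda>\<tau>. norm (f \<tau>)) \<le> sqrt (t - s) * L2norm {0..T} f"
    by (simp add: L2norm_def real_sqrt_mult)
  have fa: "f absolutely_integrable_on {0..T}" using f by (rule L2_on_absolutely_integrable) auto
  have fa': "f absolutely_integrable_on {s..t}" using st by (intro absint_sub[OF fa]) auto
  have "norm (integral {s..t} f) \<le> integral {s..t} (\<lambda>\<tau>. norm (f \<tau>))"
    using fa' absolutely_integrable_norm[OF fa']
    by (intro Henstock_Kurzweil_Integration.integral_norm_bound_integral)
      (auto simp: o_def intro: set_lebesgue_integral_eq_integral(1))
  with 1 show "norm (integral {s..t} f) \<le> sqrt (t - s) * L2norm {0..T} f" by simp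
qed

lemma L2_complete:
  fixes f :: "nat \<Rightarrow> real \<Rightarrow> 'b::euclidean_space"
  assumes f: "\<And>n. L2_on {0..T} (f n)"
    and Cauchy: "\<And>e. e > 0 \<Longrightarrow> \<exists>N. \<forall>m\<ge>N. \<forall>n\<ge>N. sqint {0..T} (\<lambda>x. f m x - f n x) < e"
    and T: "0 \<le> T"
  obtains g where "L2_on {0..T} g" "(\<lambda>n. sqint {0..T} (\<lambda>x. f n x - g x)) \<longlonglongrightarrow> 0"
proof -
  let ?M = "lebesgue_on {0..T}"
  have fm[measurable]: "f n \<in> borel_measurable ?M" for n using f by (simp add: L2_on_def)
  have "\<exists>N. \<forall>m\<ge>N. \<forall>n\<ge>N. sqint {0..T} (\<lambda>x. f m x - f n x) < (1/4) ^ k" for k :: nat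
    by (rule Cauchy) simp
  then obtain N where N: "\<And>k m n. m \<ge> N k \<Longrightarrow> n \<ge> N k \<Longrightarrow> sqint {0..T} (\<lambda>x. f m x - f n x) < (1/4) ^ k"
    by metis
  \<comment> \<open>A subsequence with summable steps converges almost everywhere; Fatou's lemma then identifies its
    limit as the limit in \<open>L\<^sup>2\<close>.\<close>
  define r where "r = (\<lambda>k. Max (N ` {..k}) + k)"
  have rN: "r k \<ge> N k" for k unfolding r_def by (intro trans_le_add1 Max_ge) auto
  have r_mono: "r k \<le> r (Suc k)" for k
    unfolding r_def by (intro add_mono Max_mono) auto
  have r_ge: "r k \<ge> k" for k by (simp add: r_def)
  define d where "d = (\<lambda>k x. f (r (Suc k)) x - f (r k) x)"
  have dL: "L2_on {0..T} (d k)" for k unfolding d_def by (intro L2_on_diff f)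
  have dm[measurable]: "d k \<in> borel_measurable ?M" for k unfolding d_def by measurable
  have ds: "sqint {0..T} (d k) < (1/4) ^ k" for k
    unfolding d_def using rN[of k] r_mono[of k] by (intro N) auto
  have dint: "integrable ?M (\<lambda>x. norm (d k x))" for k
    using absolutely_integrable_norm[OF L2_on_absolutely_integrable[OF dL]]
    by (simp add: set_integrable_def integrable_restrict_space o_def)
  have dn: "(LINT x|?M. norm (d k x)) \<le> sqrt T * (1/2) ^ k" for k
  proof -
    have "(LINT x|?M. norm (d k x)) = integral {0..T} (\<lambda>x. norm (d k x))"
      using dint by (subst lebesgue_integral_eq_integral) auto
    also have "\<dots> \<le> sqrt (T - 0) * L2norm {0..T} (d k)"
      using T by (intro norm_integral_ivl_le' dL) auto
    also have "L2norm {0..T} (d k) \<le> (1/2) ^ k"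
    proof (subst L2norm_le_iff)
      have "((1/2) ^ k)\<^sup>2 = (1/4 :: real) ^ k"
        by (simp add: power2_eq_square flip: power_mult_distrib)
      then show "sqint {0..T} (d k) \<le> ((1/2) ^ k)\<^sup>2" using ds[of k] by simp
    qed simp
    finally show ?thesis using T by (simp add: mult_left_mono)
  qed
  have nnd: "(\<integral>\<^sup>+x. ennreal (norm (d k x)) \<partial>?M) \<le> ennreal (sqrt T * (1/2) ^ k)" for k
    using dn[of k] by (subst nn_integral_eq_integral[OF dint]) (auto intro: ennreal_leI)
  have "(\<integral>\<^sup>+x. (\<Sum>k. ennreal (norm (d k x))) \<partial>?M) = (\<Sum>k. \<integral>\<^sup>+x. ennreal (norm (d k x)) \<partial>?M)"
    by (intro nn_integral_suminf) measurable
  also have "\<dots> \<le> (\<Sum>k. ennreal (sqrt T * (1/2) ^ k))"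
    by (intro suminf_le nnd) auto
  also have "\<dots> = ennreal (\<Sum>k. sqrt T * (1/2) ^ k)"
    using T by (intro suminf_ennreal2 summable_mult summable_geometric) auto
  also have "\<dots> < \<infinity>" by simp
  finally have "AE x in ?M. (\<Sum>k. ennreal (norm (d k x))) \<noteq> \<infinity>"
    by (intro nn_integral_noteq_infinite) (auto simp: less_top)
  then have AE_conv: "AE x in ?M. convergent (\<lambda>k. f (r k) x)"
  proof eventually_elim
    case (elim x)
    then have "summable (\<lambda>k. norm (d k x))"
      by (intro summable_suminf_not_top) auto
    then have "summable (\<lambda>k. d k x)" by (rule summable_norm_cancel)
    then have "convergent (\<lambda>n. \<Sum>k<n. d k x)" by (simp add: summable_iff_convergent)
    moreover have "(\<Sum>k<n. d k x) = f (r n) x - f (r 0) x" for n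
      unfolding d_def by (rule sum_lessThan_telescope)
    ultimately have "convergent (\<lambda>n. f (r n) x - f (r 0) x)" by simp
    then have "convergent (\<lambda>n. (f (r n) x - f (r 0) x) + f (r 0) x)"
      by (intro convergent_add convergent_const)
    then show ?case by simp
  qed
  define g where "g = (\<lambda>x. lim (\<lambda>k. f (r k) x))"
  have gm[measurable]: "g \<in> borel_measurable ?M" unfolding g_def by measurable
  have AE_lim: "AE x in ?M. (\<lambda>k. f (r k) x) \<longlonglongrightarrow> g x"
    using AE_conv by eventually_elim (simp add: g_def convergent_LIMSEQ_iff)
  have fat: "(\<integral>\<^sup>+x. ennreal ((norm (f n x - g x))\<^sup>2) \<partial>?M) \<le> ennreal e"
    if e: "\<And>k. k \<ge> K \<Longrightarrow> sqint {0..T} (\<lambda>x. f n x - f (r k) x) \<le> e" for n K e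
  proof -
    have "(\<integral>\<^sup>+x. ennreal ((norm (f n x - g x))\<^sup>2) \<partial>?M)
        = (\<integral>\<^sup>+x. liminf (\<lambda>k. ennreal ((norm (f n x - f (r k) x))\<^sup>2)) \<partial>?M)"
    proof (rule nn_integral_cong_AE, use AE_lim in eventually_elim)
      case (elim x)
      have "(\<lambda>k. ennreal ((norm (f n x - f (r k) x))\<^sup>2)) \<longlonglongrightarrow> ennreal ((norm (f n x - g x))\<^sup>2)"
        by (intro tendsto_ennrealI tendsto_intros elim)
      then show ?case by (intro lim_imp_Liminf[symmetric]) auto
    qed
    also have "\<dots> \<le> liminf (\<lambda>k. \<integral>\<^sup>+x. ennreal ((norm (f n x - f (r k) x))\<^sup>2) \<partial>?M)"
      by (intro nn_integral_liminf) measurable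
    also have "\<dots> \<le> ennreal e"
    proof (rule Liminf_le)
      show "\<forall>\<^sub>F k in sequentially. (\<integral>\<^sup>+x. ennreal ((norm (f n x - f (r k) x))\<^sup>2) \<partial>?M) \<le> ennreal e"
        using eventually_ge_at_top[of K]
      proof eventually_elim
        case (elim k)
        have "integrable ?M (\<lambda>x. (norm (f n x - f (r k) x))\<^sup>2)"
          using L2_on_diff[OF f f, of n "r k"] by (simp add: L2_on_def)
        then show ?case using e[OF elim] by (subst nn_integral_eq_integral) (auto intro: ennreal_leI)
      qed
    qed simp
    finally show ?thesis .
  qed
  have tail: "\<exists>N. \<forall>n\<ge>N. (\<integral>\<^sup>+x. ennreal ((norm (f n x - g x))\<^sup>2) \<partial>?M) \<le> ennreal e" if epos: "e > 0" for e
  proof -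
    obtain N' where N': "\<forall>m\<ge>N'. \<forall>n\<ge>N'. sqint {0..T} (\<lambda>x. f m x - f n x) < e" using Cauchy[OF epos] by auto
    have "(\<integral>\<^sup>+x. ennreal ((norm (f n x - g x))\<^sup>2) \<partial>?M) \<le> ennreal e" if n: "n \<ge> N'" for n
    proof (rule fat[of N'])
      fix k assume "k \<ge> N'"
      then have "r k \<ge> N'" using r_ge[of k] by simp
      then show "sqint {0..T} (\<lambda>x. f n x - f (r k) x) \<le> e" using N' n by (auto intro: less_imp_le)
    qed
    then show ?thesis by blast
  qed
  obtain n0 where n0: "(\<integral>\<^sup>+x. ennreal ((norm (f n0 x - g x))\<^sup>2) \<partial>?M) \<le> ennreal 1"
    using tail[of 1] by auto
  have "integrable ?M (\<lambda>x. (norm (f n0 x - g x))\<^sup>2)"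
    using le_less_trans[OF n0 ennreal_less_top] by (intro integrableI_bounded) simp_all
  then have "L2_on {0..T} (\<lambda>x. f n0 x - g x)" by (simp add: L2_on_def)
  from L2_on_diff[OF f[of n0] this] have gL: "L2_on {0..T} g" by simp
  have "(\<lambda>n. sqint {0..T} (\<lambda>x. f n x - g x)) \<longlonglongrightarrow> 0"
  proof (rule LIMSEQ_I)
    fix e :: real assume "e > 0"
    then obtain N' where N': "\<And>n. n \<ge> N' \<Longrightarrow> (\<integral>\<^sup>+x. ennreal ((norm (f n x - g x))\<^sup>2) \<partial>?M) \<le> ennreal (e/2)"
      using tail[of "e/2"] by auto
    have "sqint {0..T} (\<lambda>x. f n x - g x) \<le> e / 2" if "n \<ge> N'" for n
    proof -
      have i: "integrable ?M (\<lambda>x. (norm (f n x - g x))\<^sup>2)"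
        using L2_on_diff[OF f gL, of n] by (simp add: L2_on_def)
      show ?thesis using N'[OF that] \<open>e > 0\<close> by (subst (asm) nn_integral_eq_integral[OF i]) auto
    qed
    then show "\<exists>N'. \<forall>n\<ge>N'. norm (sqint {0..T} (\<lambda>x. f n x - g x) - 0) < e"
      using \<open>e > 0\<close> sqint_nonneg by (intro exI[of _ N']) (force simp: abs_of_nonneg)
  qed
  with gL show ?thesis by (rule that)
qed

text \<open>A decreasing sequence of nonempty, bounded, closed convex sets in \<open>L\<^sup>2\<close> has a common point. Convexity
only enters through midpoints. This takes the place of weak compactness of balls.\<close>

lemma L2_nested_convex_nonempty:
  fixes K :: "nat \<Rightarrow> (real \<Rightarrow> 'b::euclidean_space) set"
  assumes T: "0 \<le> T"
    and ne: "\<And>n. K n \<noteq> {}" and L2: "\<And>n v. v \<in> K n \<Longrightarrow> L2_on {0..T} v"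
    and dec: "\<And>n. K (Suc n) \<subseteq> K n"
    and bd: "\<And>n v. v \<in> K n \<Longrightarrow> sqint {0..T} v \<le> B"
    and mid: "\<And>n v w. v \<in> K n \<Longrightarrow> w \<in> K n \<Longrightarrow> (\<lambda>t. (1/2) *\<^sub>R (v t + w t)) \<in> K n"
    and cl: "\<And>n v f. (\<And>i. f i \<in> K n) \<Longrightarrow> L2_on {0..T} v \<Longrightarrow>
        (\<lambda>i. sqint {0..T} (\<lambda>t. f i t - v t)) \<longlonglongrightarrow> 0 \<Longrightarrow> v \<in> K n"
  shows "\<exists>v. \<forall>n. v \<in> K n"
proof -
  \<comment> \<open>Elements of nearly minimal norm in \<open>K n\<close> form a Cauchy sequence, by the parallelogram identity:
    their midpoints lie in \<open>K n\<close> and cannot have much smaller norm.\<close>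
  define r where "r = (\<lambda>n. Inf (sqint {0..T} ` K n))"
  have dec': "K m \<subseteq> K n" if "n \<le> m" for m n
    using lift_Suc_antimono_le[of K n m] dec that by auto
  have bb: "bdd_below (sqint {0..T} ` K n)" for n
    using sqint_nonneg by (intro bdd_belowI[of _ 0]) auto
  have rle: "r n \<le> sqint {0..T} v" if "v \<in> K n" for n v
    unfolding r_def using that bb by (intro cInf_lower) auto
  have rB: "r n \<le> B" for n
  proof -
    obtain w where "w \<in> K n" using ne[of n] by blast
    then show ?thesis using rle[of w n] bd[of w n] by linarith
  qed
  have rmono: "r n \<le> r m" if "n \<le> m" for n m
    unfolding r_def using ne bb dec'[OF that] by (intro cInf_superset_mono) auto
  have "\<exists>v. v \<in> K n \<and> sqint {0..T} v < r n + 1 / real (Suc n)" for n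
  proof -
    have "\<exists>y\<in>sqint {0..T} ` K n. y < r n + 1 / real (Suc n)"
      unfolding r_def using ne by (intro cInf_lessD) (auto simp: r_def)
    then show ?thesis by auto
  qed
  then obtain v where v: "\<And>n. v n \<in> K n" "\<And>n. sqint {0..T} (v n) < r n + 1 / real (Suc n)" by metis
  have "convergent r"
  proof (rule Bseq_mono_convergent)
    have "\<bar>r n\<bar> \<le> \<bar>r 0\<bar> + \<bar>B\<bar>" for n using rmono[of 0 n] rB[of n] by simp
    then show "Bseq r" by (intro BseqI') auto
  qed (use rmono in auto)
  then have rC: "Cauchy r" by (rule convergent_Cauchy)
  have key: "sqint {0..T} (\<lambda>x. v m x - v n x) \<le> 4 * ((r m - r n) / 2 + 1 / real (Suc n))" if "n \<le> m" for m n
  proof -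
    have mK: "v m \<in> K n" using v(1)[of m] dec'[OF that] by auto
    have "r n \<le> sqint {0..T} (\<lambda>x. (1/2) *\<^sub>R (v m x + v n x))" by (intro rle mid mK v)
    moreover have "1 / real (Suc m) \<le> 1 / real (Suc n)" using that by (simp add: frac_le)
    ultimately show ?thesis
      using sqint_parallelogram[OF L2[OF mK] L2[OF v(1)[of n]]] v(2)[of m] v(2)[of n] by argo
  qed
  obtain g where g: "L2_on {0..T} g" "(\<lambda>n. sqint {0..T} (\<lambda>x. v n x - g x)) \<longlonglongrightarrow> 0"
  proof (rule L2_complete[OF L2[OF v(1)] _ T])
    fix e :: real assume e: "e > 0"
    obtain N1 where N1: "\<And>m n. m \<ge> N1 \<Longrightarrow> n \<ge> N1 \<Longrightarrow> norm (r m - r n) < e / 8"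
      using rC[unfolded Cauchy_iff, rule_format, of "e/8"] e by (metis zero_less_divide_iff zero_less_numeral)
    obtain N2 where N2: "1 / real (Suc N2) < e / 8" using e nat_approx_posE[of "e/8"] by auto
    have le: "sqint {0..T} (\<lambda>x. v m x - v n x) < e" if "m \<ge> max N1 N2" "n \<ge> max N1 N2" "n \<le> m" for m n
    proof -
      have "1 / real (Suc n) \<le> 1 / real (Suc N2)" using that by (simp add: frac_le)
      moreover have "\<bar>r m - r n\<bar> < e / 8" using N1[of m n] that by simp
      ultimately show ?thesis using key[OF that(3)] N2 by argo
    qed
    have sym: "sqint {0..T} (\<lambda>x. v m x - v n x) = sqint {0..T} (\<lambda>x. v n x - v m x)" for m n
      by (simp add: norm_minus_commute)
    have "sqint {0..T} (\<lambda>x. v m x - v n x) < e" if "m \<ge> max N1 N2" "n \<ge> max N1 N2" for m n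
      using le[OF that] le[OF that(2,1)] sym[of m n] by (cases "n \<le> m") simp_all
    then show "\<exists>N. \<forall>m\<ge>N. \<forall>n\<ge>N. sqint {0..T} (\<lambda>x. v m x - v n x) < e" by blast
  qed
  have "g \<in> K n" for n
  proof (rule cl[of "\<lambda>i. v (i + n)"])
    show "v (i + n) \<in> K n" for i using v(1)[of "i + n"] dec'[of n "i + n"] by auto
    show "(\<lambda>i. sqint {0..T} (\<lambda>t. v (i + n) t - g t)) \<longlonglongrightarrow> 0"
      using LIMSEQ_ignore_initial_segment[OF g(2)] .
  qed (rule g)
  then show ?thesis by blast
qed

text \<open>Continuity in \<open>L\<^sup>2\<close> of the integral of a function of quadratic growth that is locally Lipschitz with
linear growth of the constant.\<close>

lemma quadratic_integral_continuous:
  fixes q :: "'b::euclidean_space \<Rightarrow> real" and f :: "nat \<Rightarrow> 'a::euclidean_space \<Rightarrow> 'b"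
  assumes qm: "q \<in> borel_measurable borel"
    and qb: "\<And>x. \<bar>q x\<bar> \<le> C * (norm x)\<^sup>2" and C: "0 \<le> C"
    and qd: "\<And>x y. \<bar>q x - q y\<bar> \<le> C * norm (x - y) * (norm x + norm y)"
    and f: "\<And>n. L2_on S (f n)" and g: "L2_on S g"
    and lim: "(\<lambda>n. sqint S (\<lambda>x. f n x - g x)) \<longlonglongrightarrow> 0"
  shows "(\<lambda>n. LINT x|lebesgue_on S. q (f n x)) \<longlonglongrightarrow> (LINT x|lebesgue_on S. q (g x))"
proof -
  have qi: "integrable (lebesgue_on S) (\<lambda>x. q (h x))" if "L2_on S h" for h
  proof (rule Bochner_Integration.integrable_bound)
    show "integrable (lebesgue_on S) (\<lambda>x. C * (norm (h x))\<^sup>2)" using that by (auto simp: L2_on_def)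
    show "(\<lambda>x. q (h x)) \<in> borel_measurable (lebesgue_on S)"
      using that qm by (auto simp: L2_on_def)
    show "AE x in lebesgue_on S. norm (q (h x)) \<le> norm (C * (norm (h x))\<^sup>2)"
      using qb C by (intro AE_I2) auto
  qed
  \<comment> \<open>Young's inequality with a free weight \<open>d\<close>.\<close>
  have est: "\<bar>(LINT x|lebesgue_on S. q (f n x)) - (LINT x|lebesgue_on S. q (g x))\<bar>
     \<le> C * ((1 + 1 / d) * sqint S (\<lambda>x. f n x - g x) + d * sqint S g)" if d: "d > 0" for n d
  proof -
    have i1: "integrable (lebesgue_on S) (\<lambda>x. (norm (f n x - g x))\<^sup>2)"
      using L2_on_diff[OF f g, of n] by (simp add: L2_on_def)
    have i2: "integrable (lebesgue_on S) (\<lambda>x. (norm (g x))\<^sup>2)" using g by (simp add: L2_on_def)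
    have "(LINT x|lebesgue_on S. q (f n x)) - (LINT x|lebesgue_on S. q (g x)) = (LINT x|lebesgue_on S. q (f n x) - q (g x))"
      using qi[OF f] qi[OF g] by simp
    also have "\<bar>\<dots>\<bar> \<le> (LINT x|lebesgue_on S. C * ((1 + 1 / d) * (norm (f n x - g x))\<^sup>2 + d * (norm (g x))\<^sup>2))"
    proof (rule integral_abs_bound_integral)
      fix x
      let ?a = "norm (f n x - g x)" and ?b = "norm (g x)"
      have "\<bar>q (f n x) - q (g x)\<bar> \<le> C * (?a * (norm (f n x) + ?b))" using qd by (simp add: mult.assoc)
      also have "norm (f n x) \<le> ?a + ?b" using norm_triangle_ineq[of "f n x - g x" "g x"] by simp
      also have "?a * (?a + ?b + ?b) \<le> (1 + 1 / d) * ?a\<^sup>2 + d * ?b\<^sup>2"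
      proof -
        have "0 \<le> (?a - d * ?b)\<^sup>2 / d" using d by simp
        also have "\<dots> = ?a\<^sup>2 / d - 2 * ?a * ?b + d * ?b\<^sup>2"
          using d by (simp add: power2_eq_square field_simps)
        finally show ?thesis by (simp add: power2_eq_square algebra_simps)
      qed
      finally show "\<bar>q (f n x) - q (g x)\<bar> \<le> C * ((1 + 1 / d) * ?a\<^sup>2 + d * ?b\<^sup>2)"
        using C by (simp add: mult_left_mono)
    qed (use qi f g i1 i2 in auto)
    also have "\<dots> = C * ((1 + 1 / d) * sqint S (\<lambda>x. f n x - g x) + d * sqint S g)"
      using i1 i2 by simp
    finally show ?thesis .
  qed
  show ?thesis
  proof (rule LIMSEQ_I)
    fix e :: real assume e: "e > 0"
    define d where "d = e / (2 * (C * sqint S g + 1))"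
    have p: "C * sqint S g + 1 > 0" using C sqint_nonneg[of S g] by (simp add: add_nonneg_pos)
    have d: "d > 0" using e p by (simp add: d_def)
    have d2: "C * (d * sqint S g) \<le> e / 2"
    proof -
      have "C * (d * sqint S g) = (e / 2) * ((C * sqint S g) / (C * sqint S g + 1))" by (simp add: d_def)
      also have "\<dots> \<le> (e / 2) * 1" using e p by (intro mult_left_mono) (auto simp: divide_le_eq)
      finally show ?thesis by simp
    qed
    have "(\<lambda>n. C * ((1 + 1 / d) * sqint S (\<lambda>x. f n x - g x))) \<longlonglongrightarrow> C * ((1 + 1 / d) * 0)"
      by (intro tendsto_intros lim)
    then have "\<exists>N. \<forall>n\<ge>N. norm (C * ((1 + 1 / d) * sqint S (\<lambda>x. f n x - g x)) - C * ((1 + 1 / d) * 0)) < e / 2"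
      by (rule LIMSEQ_D) (use e in simp)
    then obtain N where N: "\<And>n. n \<ge> N \<Longrightarrow> norm (C * ((1 + 1 / d) * sqint S (\<lambda>x. f n x - g x)) - 0) < e / 2"
      unfolding mult_zero_right by blast
    have "norm ((LINT x|lebesgue_on S. q (f n x)) - (LINT x|lebesgue_on S. q (g x))) < e" if "n \<ge> N" for n
      using est[OF d, of n] N[OF that] d2 unfolding real_norm_def distrib_left by linarith
    then show "\<exists>N. \<forall>n\<ge>N. norm ((LINT x|lebesgue_on S. q (f n x)) - (LINT x|lebesgue_on S. q (g x))) < e" by blast
  qed
qed

section \<open>Lipschitz continuity up to the boundary\<close>

lemma Ck2_real_C1:
  fixes g :: "real \<Rightarrow> real"
  assumes "Ck 2 UNIV g"
  obtains g' where "\<And>x. (g has_real_derivative g' x) (at x)" "continuous_on UNIV g'"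
proof -
  have d: "g differentiable_on UNIV" and c: "continuous_on UNIV (pd 1 g)"
    using assms[unfolded Ck_def, rule_format, of "[]"] assms[unfolded Ck_def, rule_format, of "[1]"] by auto
  have "(g has_real_derivative pd 1 g x) (at x)" for x
    using has_derivative_line[of g 0 x 1] d by (simp add: pd_def differentiable_on_def)
  then show ?thesis using c that by blast
qed

lemma C1_locally_lipschitz:
  fixes g g' :: "real \<Rightarrow> real"
  assumes "\<And>x. (g has_real_derivative g' x) (at x)" "continuous_on UNIV g'"
  shows "\<exists>L>0. \<forall>s\<in>{a..b}. \<forall>t\<in>{a..b}. \<bar>g s - g t\<bar> \<le> L * \<bar>s - t\<bar>"
proof -
  have "bounded (g' ` {a..b})"
    by (intro compact_imp_bounded compact_continuous_image continuous_on_subset[OF assms(2)]) auto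
  then obtain L where L: "\<And>x. x \<in> {a..b} \<Longrightarrow> \<bar>g' x\<bar> \<le> L"
    unfolding bounded_iff real_norm_def by blast
  define L' where "L' = max L 1"
  have "norm (g s - g t) \<le> L' * norm (s - t)" if "s \<in> {a..b}" "t \<in> {a..b}" for s t
  proof (rule field_differentiable_bound[of "{a..b}" g g'])
    show "(g has_field_derivative g' z) (at z within {a..b})" for z
      using assms(1) by (rule has_field_derivative_at_within)
    show "norm (g' z) \<le> L'" if "z \<in> {a..b}" for z using L[OF that] by (simp add: L'_def)
  qed (use that in auto)
  then show ?thesis by (intro exI[of _ L']) (auto simp: L'_def)
qed

text \<open>Near a point of the closure, two points of \<open>\<Omega>\<close> are joined within \<open>\<Omega>\<close> by three segments whose
lengths are comparable to their distance. In a chart at a boundary point one climbs from both points by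
\<open>k = L |x - y|\<close>, where \<open>L\<close> is a Lipschitz constant of the graph; the segment between the two
elevated points then stays above the graph.\<close>

lemma three_segments:
  fixes \<Omega> :: "(real^2) set"
  assumes op: "open \<Omega>" and C2: "C2_boundary \<Omega>" and p: "p \<in> closure \<Omega>"
  obtains \<rho> M where "\<rho> > 0" "M > 0"
    "\<And>x y. x \<in> \<Omega> \<inter> ball p \<rho> \<Longrightarrow> y \<in> \<Omega> \<inter> ball p \<rho> \<Longrightarrow> \<exists>z w.
     closed_segment x z \<subseteq> \<Omega> \<and> closed_segment z w \<subseteq> \<Omega> \<and> closed_segment w y \<subseteq> \<Omega> \<and>
     norm (z - x) \<le> M * norm (x - y) \<and> norm (w - z) \<le> M * norm (x - y) \<and> norm (y - w) \<le> M * norm (x - y)"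
proof (cases "p \<in> \<Omega>")
  case True
  then obtain \<rho> where \<rho>: "\<rho> > 0" "ball p \<rho> \<subseteq> \<Omega>" using op openE by blast
  have "closed_segment x y \<subseteq> \<Omega>" if "x \<in> ball p \<rho>" "y \<in> ball p \<rho>" for x y
    using closed_segment_subset[OF that convex_ball] \<rho>(2) by auto
  then have "\<exists>z w.
     closed_segment x z \<subseteq> \<Omega> \<and> closed_segment z w \<subseteq> \<Omega> \<and> closed_segment w y \<subseteq> \<Omega> \<and>
     norm (z - x) \<le> 1 * norm (x - y) \<and> norm (w - z) \<le> 1 * norm (x - y) \<and> norm (y - w) \<le> 1 * norm (x - y)"
    if "x \<in> \<Omega> \<inter> ball p \<rho>" "y \<in> \<Omega> \<inter> ball p \<rho>" for x y
    using that by (intro exI[of _ x] exI[of _ y]) (auto simp: norm_minus_commute)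
  then show ?thesis using \<rho>(1) by (rule that[OF _ zero_less_one, rotated])
next
  case False
  then have "p \<in> frontier \<Omega>" using p op by (simp add: frontier_def interior_open)
  then obtain r and A :: "real^2 \<Rightarrow> real^2" and g :: "real \<Rightarrow> real"
    where r: "r > 0" and A: "orthogonal_transformation A" and g: "Ck 2 UNIV g"
    and chart: "\<Omega> \<inter> ball p r = {x \<in> ball p r. A x $ 2 > g (A x $ 1)}"
    using C2[unfolded C2_boundary_def, rule_format, OF \<open>p \<in> frontier \<Omega>\<close>] by blast
  have chartD: "A x $ 2 > g (A x $ 1)" if "x \<in> \<Omega>" "x \<in> ball p r" for x using that chart by blast
  have chartI: "x \<in> \<Omega>" if "x \<in> ball p r" "A x $ 2 > g (A x $ 1)" for x using that chart by blast
  have ball\<rho>: "x \<in> ball p r" if "x \<in> ball p \<rho>'" "\<rho>' \<le> r" for x \<rho>' using that by auto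
  obtain g' where g': "\<And>x. (g has_real_derivative g' x) (at x)" "continuous_on UNIV g'"
    using Ck2_real_C1[OF g] by blast
  define c where "c = A p $ 1"
  obtain L where L: "L > 0" "\<And>s t. s \<in> {c-1..c+1} \<Longrightarrow> t \<in> {c-1..c+1} \<Longrightarrow> \<bar>g s - g t\<bar> \<le> L * \<bar>s - t\<bar>"
    using C1_locally_lipschitz[OF g', of "c-1" "c+1"] by blast
  have linA: "linear A" using A by (rule orthogonal_transformation_linear)
  have nA: "norm (A x) = norm x" for x using A by (rule orthogonal_transformation_norm)
  obtain e where e: "A e = axis 2 1" using orthogonal_transformation_surj[OF A] by (metis surjD)
  have ne: "norm e = 1" using nA[of e] e by (simp add: norm_axis_1)
  have Ae: "A (x + k *\<^sub>R e) $ 1 = A x $ 1" "A (x + k *\<^sub>R e) $ 2 = A x $ 2 + k" for x k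
    by (simp_all add: linear_add[OF linA] linear_scale[OF linA] e axis_def)
  \<comment> \<open>Inside \<open>ball p \<rho>\<close> the elevated points remain in the ball of the chart.\<close>
  define \<rho> where "\<rho> = min r 1 / (1 + 2 * L)"
  have \<rho>: "\<rho> > 0" using r L by (simp add: \<rho>_def)
  have \<rho>2: "\<rho> * (1 + 2 * L) \<le> r" "\<rho> * (1 + 2 * L) \<le> 1" using L by (auto simp: \<rho>_def)
  have \<rho>3: "\<rho> \<le> r" "\<rho> \<le> 1"
    using \<rho>2 mult_left_mono[of 1 "1 + 2 * L" \<rho>] L \<rho> unfolding mult_1_right by linarith+
  have seg: "\<exists>z w.
     closed_segment x z \<subseteq> \<Omega> \<and> closed_segment z w \<subseteq> \<Omega> \<and> closed_segment w y \<subseteq> \<Omega> \<and>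
     norm (z - x) \<le> (L + 1) * norm (x - y) \<and> norm (w - z) \<le> (L + 1) * norm (x - y) \<and> norm (y - w) \<le> (L + 1) * norm (x - y)"
    if xy: "x \<in> \<Omega> \<inter> ball p \<rho>" "y \<in> \<Omega> \<inter> ball p \<rho>" for x y
  proof -
    define d where "d = norm (x - y)"
    define k where "k = L * d"
    have d: "0 \<le> d" "d < 2 * \<rho>"
    proof -
      have "norm (x - y) \<le> norm (x - p) + norm (y - p)"
        using norm_triangle_ineq4[of "x - p" "y - p"] by simp
      then show "d < 2 * \<rho>" using xy by (simp add: d_def dist_norm norm_minus_commute)
    qed (simp add: d_def)
    have k0: "0 \<le> k" using L d by (simp add: k_def)
    have kb: "norm (v + j *\<^sub>R e - p) < r" if "v \<in> ball p \<rho>" "0 \<le> j" "j \<le> k" for v j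
    proof -
      have "norm (v + j *\<^sub>R e - p) \<le> norm (v - p) + norm (j *\<^sub>R e)"
        using norm_triangle_ineq[of "v - p" "j *\<^sub>R e"] by (simp add: algebra_simps)
      also have "norm (j *\<^sub>R e) \<le> k" using that ne by simp
      also have "norm (v - p) < \<rho>" using that by (simp add: dist_norm norm_minus_commute)
      also have "k \<le> L * (2 * \<rho>)" using d L by (simp add: k_def)
      finally show ?thesis using \<rho>2(1) by (simp add: algebra_simps)
    qed
    have inball: "v + j *\<^sub>R e \<in> ball p r" if "v \<in> ball p \<rho>" "0 \<le> j" "j \<le> k" for v j
      using kb[OF that] by (simp add: dist_norm norm_minus_commute)
    have up: "closed_segment v (v + k *\<^sub>R e) \<subseteq> \<Omega>" if v: "v \<in> \<Omega> \<inter> ball p \<rho>" for v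
    proof
      fix q assume "q \<in> closed_segment v (v + k *\<^sub>R e)"
      then obtain \<tau> where \<tau>: "0 \<le> \<tau>" "\<tau> \<le> 1" "q = v + (\<tau> * k) *\<^sub>R e"
        by (auto simp: in_segment algebra_simps)
      have "\<tau> * k \<le> k" using \<tau> k0 by (simp add: mult_left_le_one_le)
      then have qr: "q \<in> ball p r" using inball[of v "\<tau> * k"] \<tau> k0 v by auto
      have "A v $ 2 > g (A v $ 1)" using v ball\<rho>[OF _ \<rho>3(1)] by (intro chartD) blast+
      moreover have "0 \<le> \<tau> * k" using \<tau> k0 by simp
      ultimately have "A q $ 2 > g (A q $ 1)" using \<tau> Ae[of v "\<tau> * k"] by simp
      with qr show "q \<in> \<Omega>" by (rule chartI)
    qed
    have mid: "closed_segment (x + k *\<^sub>R e) (y + k *\<^sub>R e) \<subseteq> \<Omega>"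
    proof
      fix q assume "q \<in> closed_segment (x + k *\<^sub>R e) (y + k *\<^sub>R e)"
      then obtain \<tau> where \<tau>: "0 \<le> \<tau>" "\<tau> \<le> 1" "q = (1 - \<tau>) *\<^sub>R (x + k *\<^sub>R e) + \<tau> *\<^sub>R (y + k *\<^sub>R e)"
        by (auto simp: in_segment)
      define q0 where "q0 = (1 - \<tau>) *\<^sub>R x + \<tau> *\<^sub>R y"
      have qq0: "q = q0 + k *\<^sub>R e" using \<tau> by (simp add: q0_def algebra_simps)
      have q0b: "q0 \<in> ball p \<rho>"
        using xy \<tau> convexD[OF convex_ball, of x p \<rho> y "1 - \<tau>" \<tau>] by (simp add: q0_def)
      have qr: "q \<in> ball p r" unfolding qq0 using q0b k0 by (intro inball) auto
      define s where "s = A q0 $ 1"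
      have Aq0: "A q0 = (1 - \<tau>) *\<^sub>R A x + \<tau> *\<^sub>R A y"
        unfolding q0_def by (simp add: linear_add[OF linA] linear_scale[OF linA])
      have rng: "A v $ 1 \<in> {c-1..c+1}" if "v \<in> ball p \<rho>" for v
      proof -
        have "\<bar>A v $ 1 - A p $ 1\<bar> \<le> norm (A v - A p)"
          using component_le_norm_cart[of "A v - A p" 1] by simp
        also have "\<dots> = norm (v - p)" using nA[of "v - p"] by (simp add: linear_diff[OF linA])
        also have "\<dots> < 1" using that \<rho>3 by (simp add: dist_norm norm_minus_commute)
        finally have "\<bar>A v $ 1 - c\<bar> < 1" by (simp add: c_def)
        then show ?thesis by auto
      qed
      have close: "\<bar>s - A v $ 1\<bar> \<le> d" if "v = x \<or> v = y" for v
      proof -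
        have "\<bar>s - A v $ 1\<bar> \<le> norm (A q0 - A v)"
          using component_le_norm_cart[of "A q0 - A v" 1] by (simp add: s_def)
        also have "\<dots> = norm (q0 - v)" using nA[of "q0 - v"] by (simp add: linear_diff[OF linA])
        also have "\<dots> \<le> norm (x - y)"
        proof -
          have "q0 - x = \<tau> *\<^sub>R (y - x)" "q0 - y = (1 - \<tau>) *\<^sub>R (x - y)"
            by (simp_all add: q0_def algebra_simps)
          then show ?thesis using that \<tau> by (auto simp: norm_minus_commute mult_left_le_one_le)
        qed
        finally show ?thesis by (simp add: d_def)
      qed
      \<comment> \<open>Each end point of the horizontal segment lies above \<open>g s\<close> for every abscissa \<open>s\<close> in between,
        because \<open>s\<close> is at distance at most \<open>d\<close> from its own abscissa.\<close>
      have above: "A v $ 2 + k > g s" if "v = x \<or> v = y" for v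
      proof -
        have vb: "v \<in> \<Omega> \<inter> ball p \<rho>" using that xy by auto
        have "A v $ 2 > g (A v $ 1)" using vb ball\<rho>[OF _ \<rho>3(1)] by (intro chartD) blast+
        moreover have "\<bar>g s - g (A v $ 1)\<bar> \<le> L * \<bar>s - A v $ 1\<bar>"
          using vb rng[of v] rng[OF q0b] by (intro L) (auto simp: s_def)
        moreover have "L * \<bar>s - A v $ 1\<bar> \<le> k" unfolding k_def using close[OF that] L by simp
        ultimately show ?thesis by linarith
      qed
      have "A q $ 2 = (1 - \<tau>) * (A x $ 2 + k) + \<tau> * (A y $ 2 + k)"
        unfolding qq0 using Ae[of q0 k] by (simp add: Aq0 algebra_simps)
      moreover have "A q $ 1 = s" unfolding qq0 s_def using Ae by simp
      moreover have "(1 - \<tau>) * (A x $ 2 + k) + \<tau> * (A y $ 2 + k) > g s"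
      proof -
        have cb: "G < (1 - \<tau>) * X + \<tau> * Y" if "G < X" "G < Y" for G X Y :: real
          using convex_bound_lt[of "- X" "- G" "- Y" "1 - \<tau>" \<tau>] that \<tau> by (simp add: algebra_simps)
        show ?thesis by (rule cb) (use above in auto)
      qed
      ultimately have "A q $ 2 > g (A q $ 1)" by simp
      then show "q \<in> \<Omega>" by (rule chartI[OF qr])
    qed
    have down: "closed_segment (y + k *\<^sub>R e) y \<subseteq> \<Omega>" using up[OF xy(2)] by (simp add: closed_segment_commute)
    have "k \<le> (L + 1) * d" using d by (simp add: k_def algebra_simps)
    moreover have "d \<le> (L + 1) * d" using d L by (simp add: algebra_simps)
    ultimately show ?thesis
      using up[OF xy(1)] mid down k0 ne
      by (intro exI[of _ "x + k *\<^sub>R e"] exI[of _ "y + k *\<^sub>R e"]) (auto simp: d_def norm_minus_commute)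
  qed
  have "L + 1 > 0" using L by simp
  then show ?thesis using seg by (rule that[OF \<rho>])
qed

text \<open>A bound \<open>B\<close> for the derivative on the part of \<open>\<Omega>\<close> within a radius \<open>R\<close> of \<open>p\<close> gives a Lipschitz
constant \<open>M B\<close> within the radius \<open>R / M\<close>, or \<open>\<rho>\<close> if that is smaller, with the same \<open>M\<close> for all functions and all \<open>R\<close>. This
uniformity is what makes the tangential derivative at the boundary computable below.\<close>

lemma quasi_lipschitz:
  fixes \<Omega> :: "(real^2) set"
  assumes op: "open \<Omega>" and C2: "C2_boundary \<Omega>" and p: "p \<in> closure \<Omega>"
  obtains \<rho> M where "\<rho> > 0" "M > 0"
    "\<And>R (F::real^2 \<Rightarrow> real) B x y. R > 0 \<Longrightarrow> \<forall>x\<in>\<Omega>. F differentiable (at x) \<Longrightarrow>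
     \<forall>x\<in>\<Omega> \<inter> ball p R. onorm (frechet_derivative F (at x)) \<le> B \<Longrightarrow>
     x \<in> \<Omega> \<inter> ball p (min \<rho> (R / M)) \<Longrightarrow> y \<in> \<Omega> \<inter> ball p (min \<rho> (R / M)) \<Longrightarrow>
     \<bar>F x - F y\<bar> \<le> M * B * norm (x - y)"
proof -
  obtain \<rho> M where \<rho>: "\<rho> > 0" and M: "M > 0"
    and seg: "\<And>x y. x \<in> \<Omega> \<inter> ball p \<rho> \<Longrightarrow> y \<in> \<Omega> \<inter> ball p \<rho> \<Longrightarrow> \<exists>z w.
     closed_segment x z \<subseteq> \<Omega> \<and> closed_segment z w \<subseteq> \<Omega> \<and> closed_segment w y \<subseteq> \<Omega> \<and>
     norm (z - x) \<le> M * norm (x - y) \<and> norm (w - z) \<le> M * norm (x - y) \<and> norm (y - w) \<le> M * norm (x - y)"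
    by (rule three_segments[OF op C2 p]) blast
  \<comment> \<open>The factor \<open>1 + 6 M\<close> keeps the corners of the three segments in \<open>ball p R\<close>.\<close>
  define M' where "M' = 1 + 6 * M"
  have M': "M' > 0" "3 * M \<le> M'" using M by (auto simp: M'_def)
  have "\<bar>F x - F y\<bar> \<le> M' * B * norm (x - y)"
    if R: "R > 0" and dF: "\<forall>x\<in>\<Omega>. F differentiable (at x)"
      and B: "\<forall>x\<in>\<Omega> \<inter> ball p R. onorm (frechet_derivative F (at x)) \<le> B"
      and x: "x \<in> \<Omega> \<inter> ball p (min \<rho> (R / M'))" and y: "y \<in> \<Omega> \<inter> ball p (min \<rho> (R / M'))"
    for R and F :: "real^2 \<Rightarrow> real" and B x y
  proof -
    obtain z w where zw: "closed_segment x z \<subseteq> \<Omega>" "closed_segment z w \<subseteq> \<Omega>" "closed_segment w y \<subseteq> \<Omega>"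
     "norm (z - x) \<le> M * norm (x - y)" "norm (w - z) \<le> M * norm (x - y)" "norm (y - w) \<le> M * norm (x - y)"
      using seg[of x y] x y by auto
    define d where "d = norm (x - y)"
    define R' where "R' = R / M'"
    have "R' * M' = R" using M' by (simp add: R'_def)
    then have RR: "R = R' + 6 * M * R'" by (simp add: M'_def algebra_simps)
    have "norm (x - y) \<le> norm (x - p) + norm (y - p)"
      using norm_triangle_ineq4[of "x - p" "y - p"] by simp
    then have d: "d < 2 * R'" using x y by (simp add: d_def R'_def dist_norm norm_minus_commute)
    have xp: "norm (x - p) < R'" using x by (simp add: R'_def dist_norm norm_minus_commute)
    have Md: "3 * (M * d) < 6 * M * R'" using d M by simp
    have z: "norm (z - p) \<le> norm (x - p) + M * d"
      using norm_triangle_ineq[of "z - x" "x - p"] zw(4) by (simp add: d_def)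
    have w: "norm (w - p) \<le> norm (x - p) + 2 * (M * d)"
      using norm_triangle_ineq[of "w - z" "z - p"] zw(5) z by (simp add: d_def)
    have yb: "norm (y - p) \<le> norm (x - p) + 3 * (M * d)"
      using norm_triangle_ineq[of "y - w" "w - p"] zw(6) w by (simp add: d_def)
    have Md0: "0 \<le> M * d" using M by (simp add: d_def)
    have b: "x \<in> ball p R" "z \<in> ball p R" "w \<in> ball p R" "y \<in> ball p R"
      using z w yb xp Md Md0 by (simp_all add: RR dist_norm norm_minus_commute)
    have step: "\<bar>F v - F v'\<bar> \<le> B * norm (v - v')" if s: "closed_segment v v' \<subseteq> \<Omega>" "v \<in> ball p R" "v' \<in> ball p R" for v v'
    proof -
      have sb: "closed_segment v v' \<subseteq> ball p R" using that by (intro closed_segment_subset) auto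
      have "norm (F v - F v') \<le> B * norm (v - v')"
      proof (rule differentiable_bound[of "closed_segment v v'" F "\<lambda>x. frechet_derivative F (at x)"])
        show "(F has_derivative frechet_derivative F (at q)) (at q within closed_segment v v')"
          if "q \<in> closed_segment v v'" for q
          using that s(1) dF frechet_derivative_works has_derivative_at_withinI by blast
        show "onorm (frechet_derivative F (at q)) \<le> B" if "q \<in> closed_segment v v'" for q
          using that s(1) sb B by auto
      qed auto
      then show ?thesis by simp
    qed
    have B0: "0 \<le> B"
      using B[rule_format, of x] x b(1) dF frechet_derivative_works[of F "at x"]
        onorm_pos_le[OF has_derivative_bounded_linear, of F "frechet_derivative F (at x)" "at x"] by auto
    have "\<bar>F x - F y\<bar> \<le> \<bar>F x - F z\<bar> + \<bar>F z - F w\<bar> + \<bar>F w - F y\<bar>" by linarith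
    also have "\<dots> \<le> B * norm (z - x) + B * norm (w - z) + B * norm (y - w)"
      using step[OF zw(1) b(1,2)] step[OF zw(2) b(2,3)] step[OF zw(3) b(3,4)] by (simp add: norm_minus_commute)
    also have "\<dots> \<le> B * (M * norm (x - y)) + B * (M * norm (x - y)) + B * (M * norm (x - y))"
      using B0 zw by (intro add_mono mult_left_mono) auto
    also have "\<dots> = (3 * M) * (B * norm (x - y))" by simp
    also have "\<dots> \<le> M' * (B * norm (x - y))" using M' B0 by (intro mult_right_mono) auto
    finally show ?thesis by (simp add: mult.assoc)
  qed
  then show ?thesis by (rule that[OF \<rho> M'(1)])
qed

text \<open>Local Lipschitz constants near each point of the compact closure combine to a global one, even
though \<open>\<Omega>\<close> itself need not be convex.\<close>

lemma lipschitz_on_closure_of_bounded_derivative: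
  fixes \<Omega> :: "(real^2) set" and F :: "real^2 \<Rightarrow> real"
  assumes op: "open \<Omega>" and C2: "C2_boundary \<Omega>" and bd: "bounded \<Omega>"
    and cF: "continuous_on (closure \<Omega>) F" and dF: "\<And>x. x \<in> \<Omega> \<Longrightarrow> F differentiable (at x)"
    and B: "\<And>x. x \<in> \<Omega> \<Longrightarrow> onorm (frechet_derivative F (at x)) \<le> B"
  shows "\<exists>L. L-lipschitz_on (closure \<Omega>) F"
proof -
  have "local_lipschitz {0::real} (closure \<Omega>) (\<lambda>t. F)"
  proof (rule local_lipschitzI)
    fix t :: real and p assume p: "p \<in> closure \<Omega>"
    obtain \<rho> M where \<rho>: "\<rho> > 0" and M: "M > 0" and
     q: "\<And>R (F::real^2 \<Rightarrow> real) B x y. R > 0 \<Longrightarrow> \<forall>x\<in>\<Omega>. F differentiable (at x) \<Longrightarrow>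
     \<forall>x\<in>\<Omega> \<inter> ball p R. onorm (frechet_derivative F (at x)) \<le> B \<Longrightarrow>
     x \<in> \<Omega> \<inter> ball p (min \<rho> (R / M)) \<Longrightarrow> y \<in> \<Omega> \<inter> ball p (min \<rho> (R / M)) \<Longrightarrow>
     \<bar>F x - F y\<bar> \<le> M * B * norm (x - y)"
      by (rule quasi_lipschitz[OF op C2 p]) blast
    have lip: "\<bar>F x - F y\<bar> \<le> M * B * norm (x - y)" if "x \<in> \<Omega> \<inter> ball p \<rho>" "y \<in> \<Omega> \<inter> ball p \<rho>" for x y
      using q[of "\<rho> * M" F B] \<rho> M dF B that by simp
    have "\<bar>M * B\<bar>-lipschitz_on (\<Omega> \<inter> ball p \<rho>) F"
    proof (rule lipschitz_onI)
      fix x y assume "x \<in> \<Omega> \<inter> ball p \<rho>" "y \<in> \<Omega> \<inter> ball p \<rho>"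
      then have "\<bar>F x - F y\<bar> \<le> M * B * norm (x - y)" by (rule lip)
      also have "\<dots> \<le> \<bar>M * B\<bar> * norm (x - y)" by (intro mult_right_mono) auto
      finally show "dist (F x) (F y) \<le> \<bar>M * B\<bar> * dist x y" by (simp add: dist_norm)
    qed simp
    then have l1: "\<bar>M * B\<bar>-lipschitz_on (closure (\<Omega> \<inter> ball p \<rho>)) F"
      by (rule lipschitz_on_closure) (rule continuous_on_subset[OF cF], rule closure_mono, auto)
    have "ball p \<rho> \<inter> closure \<Omega> \<subseteq> closure (ball p \<rho> \<inter> \<Omega>)"
      by (rule open_Int_closure_subset) simp
    then have "cball p (\<rho> / 2) \<inter> closure \<Omega> \<subseteq> closure (\<Omega> \<inter> ball p \<rho>)"
      using \<rho> by (fastforce simp: Int_commute)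
    then have "\<bar>M * B\<bar>-lipschitz_on (cball p (\<rho> / 2) \<inter> closure \<Omega>) F"
      by (rule lipschitz_on_subset[OF l1])
    then show "\<exists>u>0. \<exists>L. \<forall>t\<in>cball t u \<inter> {0}. L-lipschitz_on (cball p u \<inter> closure \<Omega>) F"
      using \<rho> by (intro exI[of _ "\<rho> / 2"]) auto
  qed
  moreover have "compact (closure \<Omega>)" using bd by (simp add: compact_closure)
  ultimately obtain L where "\<And>t. t \<in> {0::real} \<Longrightarrow> L-lipschitz_on (closure \<Omega>) F"
    using local_lipschitz_compact_implies_lipschitz[where X="closure \<Omega>" and T="{0::real}" and f="\<lambda>t. F"]
    by (auto simp: continuous_on_sing)
  then show ?thesis by blast
qed

section \<open>Boundary values of functions in \<open>H\<^sup>1\<^sub>0\<close>\<close>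

lemma test_function_C1:
  fixes \<phi> :: "'a::euclidean_space \<Rightarrow> real"
  assumes "test_function S \<phi>"
  shows "\<phi> differentiable (at x)" "continuous_on A \<phi>" "b \<in> Basis \<Longrightarrow> continuous_on A (pd b \<phi>)"
proof -
  have C: "Cinf UNIV \<phi>" using assms by (simp add: test_function_def)
  show "\<phi> differentiable (at x)" using C by (rule Cinf_differentiable) auto
  show "continuous_on A \<phi>" using Cinf_continuous[OF C] by (rule continuous_on_subset) auto
  show "continuous_on A (pd b \<phi>)" if "b \<in> Basis"
    using Cinf_continuous[OF Cinf_pd[OF C that]] by (rule continuous_on_subset) auto
qed

lemma test_function_L2_on:
  fixes \<phi> :: "'a::euclidean_space \<Rightarrow> real"
  assumes t: "test_function S \<phi>" and S: "S \<in> sets lebesgue"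
  shows "L2_on S \<phi>"
proof -
  obtain K where K: "compact K" "K \<subseteq> S" "\<And>x. x \<notin> K \<Longrightarrow> \<phi> x = 0"
    using t by (auto simp: test_function_def)
  have "(\<lambda>x. (norm (\<phi> x))\<^sup>2) absolutely_integrable_on S"
    using K by (intro compact_support_absint[of K]) (auto intro!: continuous_intros test_function_C1(2)[OF t])
  then have "integrable (lebesgue_on S) (\<lambda>x. (norm (\<phi> x))\<^sup>2)"
    using S by (simp add: set_integrable_def integrable_restrict_space)
  moreover have "\<phi> \<in> borel_measurable (lebesgue_on S)"
    using S by (intro continuous_imp_measurable_on_sets_lebesgue test_function_C1(2)[OF t])
  ultimately show ?thesis by (simp add: L2_on_def)
qed

lemma frechet_derivative_eq_sum_pd:
  fixes \<phi> :: "'a::euclidean_space \<Rightarrow> real"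
  assumes "\<phi> differentiable (at x)"
  shows "frechet_derivative \<phi> (at x) e = (\<Sum>b\<in>Basis. (e \<bullet> b) * pd b \<phi> x)"
proof -
  have lin: "linear (frechet_derivative \<phi> (at x))" using assms by (rule linear_frechet_derivative)
  have "frechet_derivative \<phi> (at x) e = frechet_derivative \<phi> (at x) (\<Sum>b\<in>Basis. (e \<bullet> b) *\<^sub>R b)"
    by (simp add: euclidean_representation)
  also have "\<dots> = (\<Sum>b\<in>Basis. (e \<bullet> b) * pd b \<phi> x)"
    by (simp add: linear_sum[OF lin] linear_scale[OF lin] pd_def)
  finally show ?thesis .
qed

lemma directional_derivative_sq_le:
  fixes \<phi> :: "'a::euclidean_space \<Rightarrow> real"
  assumes "\<phi> differentiable (at x)" "norm e = 1"
  shows "(frechet_derivative \<phi> (at x) e)\<^sup>2 \<le> (\<Sum>b\<in>Basis. (pd b \<phi> x)\<^sup>2)"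
proof -
  let ?v = "\<Sum>b\<in>Basis. pd b \<phi> x *\<^sub>R b"
  have vb: "?v \<bullet> b = pd b \<phi> x" if "b \<in> Basis" for b
    using that by (simp add: inner_sum_left inner_Basis if_distrib cong: if_cong)
  have "frechet_derivative \<phi> (at x) e = e \<bullet> ?v"
    unfolding frechet_derivative_eq_sum_pd[OF assms(1)] by (subst euclidean_inner) (simp add: vb)
  then have "(frechet_derivative \<phi> (at x) e)\<^sup>2 \<le> (e \<bullet> e) * (?v \<bullet> ?v)"
    using Cauchy_Schwarz_ineq[of e ?v] by simp
  also have "\<dots> = (\<Sum>b\<in>Basis. (pd b \<phi> x)\<^sup>2)"
    using assms(2) by (subst euclidean_inner[of ?v ?v]) (simp add: vb power2_eq_square norm_eq_1)
  finally show ?thesis .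
qed

lemma sq_integral_le_integral_sq:
  fixes f :: "real \<Rightarrow> real"
  assumes "continuous_on {0..1} f"
  shows "(integral {0..1} f)\<^sup>2 \<le> integral {0..1} (\<lambda>x. (f x)\<^sup>2)"
proof -
  define c where "c = integral {0..1} f"
  have i: "f integrable_on {0..1}" "(\<lambda>x. (f x)\<^sup>2) integrable_on {0..1}"
    using assms by (auto intro!: integrable_continuous_real continuous_intros)
  have "0 \<le> integral {0..1} (\<lambda>x. (f x - c)\<^sup>2)"
    by (rule Henstock_Kurzweil_Integration.integral_nonneg)
      (auto intro!: integrable_continuous_real continuous_intros assms)
  also have "integral {0..1} (\<lambda>x. (f x - c)\<^sup>2) = integral {0..1} (\<lambda>x. (f x)\<^sup>2) - 2 * c * c + c\<^sup>2"
  proof (rule integral_unique)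
    have "((\<lambda>x. (f x)\<^sup>2 - (2 * c) * f x + c\<^sup>2) has_integral
        (integral {0..1} (\<lambda>x. (f x)\<^sup>2) - (2 * c) * integral {0..1} f + (1 - 0) *\<^sub>R c\<^sup>2)) {0..1}"
      using i by (intro has_integral_add has_integral_diff has_integral_mult_right has_integral_const_real[of _ 0 1, simplified]
          integrable_integral) (auto intro: has_integral_const_real[of _ 0 1, simplified])
    then show "((\<lambda>x. (f x - c)\<^sup>2) has_integral (integral {0..1} (\<lambda>x. (f x)\<^sup>2) - 2 * c * c + c\<^sup>2)) {0..1}"
      by (simp add: power2_diff c_def algebra_simps)
  qed
  finally show ?thesis by (simp add: c_def[symmetric] power2_eq_square)
qed

text \<open>If \<open>\<phi>\<close> vanishes at all points \<open>x - \<sigma> e\<close> with \<open>x\<close> in \<open>S\<close>, then \<open>\<phi>(x)\<close> is the integral of \<open>\<sigma> \<nabla>\<phi> \<cdot> e\<close> along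
a segment, and the \<open>L\<^sup>2\<close> norm of \<open>\<phi>\<close> on \<open>S\<close> is at most \<open>|\<sigma>|\<close> times that of the gradient.\<close>

lemma translation_estimate:
  fixes \<phi> :: "'a::euclidean_space \<Rightarrow> real"
  assumes t: "test_function \<Omega> \<phi>" and e: "norm e = 1"
    and z: "\<And>x. x \<in> S \<Longrightarrow> \<phi> (x - \<sigma> *\<^sub>R e) = 0"
  shows "(\<integral>\<^sup>+x. ennreal ((\<phi> x)\<^sup>2) * indicator S x \<partial>lebesgue)
     \<le> ennreal (\<sigma>\<^sup>2) * (\<integral>\<^sup>+x. ennreal (\<Sum>b\<in>Basis. (pd b \<phi> x)\<^sup>2) \<partial>lborel)"
proof -
  define q where "q = (\<lambda>x. \<Sum>b\<in>Basis. (pd b \<phi> x)\<^sup>2)"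
  have cq: "continuous_on A q" for A
    unfolding q_def by (intro continuous_intros test_function_C1(3)[OF t]) auto
  have [measurable]: "q \<in> borel_measurable borel" by (intro borel_measurable_continuous_onI cq)
  have q0: "0 \<le> q x" for x unfolding q_def by (intro sum_nonneg) auto
  define \<psi> where "\<psi> = (\<lambda>x. frechet_derivative \<phi> (at x) e)"
  have \<psi>_eq: "\<psi> = (\<lambda>x. \<Sum>b\<in>Basis. (e \<bullet> b) * pd b \<phi> x)"
    unfolding \<psi>_def using test_function_C1(1)[OF t] by (simp add: frechet_derivative_eq_sum_pd)
  have c\<psi>: "continuous_on A \<psi>" for A
    unfolding \<psi>_eq by (intro continuous_intros test_function_C1(3)[OF t]) auto
  have pw: "ennreal ((\<phi> x)\<^sup>2) * indicator S x
     \<le> ennreal (\<sigma>\<^sup>2) * (\<integral>\<^sup>+\<tau>. ennreal (q (x + (- \<tau> * \<sigma>) *\<^sub>R e)) * indicator {0..1} \<tau> \<partial>lborel)" for x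
  proof (cases "x \<in> S")
    case True
    define f where "f = (\<lambda>\<tau>. \<psi> (x + (- \<tau> * \<sigma>) *\<^sub>R e))"
    have cf: "continuous_on {0..1} f"
      unfolding f_def by (rule continuous_on_compose2[OF c\<psi>[of UNIV]]) (auto intro!: continuous_intros)
    have "((\<lambda>\<tau>. \<phi> (x + \<tau> *\<^sub>R (- \<sigma> *\<^sub>R e))) has_vector_derivative (- \<sigma> * f \<tau>)) (at \<tau> within {0..1})" for \<tau>
    proof -
      have "frechet_derivative \<phi> (at (x + \<tau> *\<^sub>R (- \<sigma> *\<^sub>R e))) (- \<sigma> *\<^sub>R e) = - \<sigma> * f \<tau>"
        using linear_scale[OF linear_frechet_derivative[OF test_function_C1(1)[OF t]], of _ "- \<sigma>" e]
        by (simp add: f_def \<psi>_def)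
      then show ?thesis
        using has_derivative_line[of \<phi> x \<tau> "- \<sigma> *\<^sub>R e", OF test_function_C1(1)[OF t]]
        by (simp only: has_real_derivative_iff_has_vector_derivative has_vector_derivative_at_within)
    qed
    then have "((\<lambda>\<tau>. - \<sigma> * f \<tau>) has_integral (\<phi> (x + 1 *\<^sub>R (- \<sigma> *\<^sub>R e)) - \<phi> (x + 0 *\<^sub>R (- \<sigma> *\<^sub>R e)))) {0..1}"
      by (intro fundamental_theorem_of_calculus) auto
    then have "integral {0..1} (\<lambda>\<tau>. - \<sigma> * f \<tau>) = - \<phi> x"
      using z[OF True] by (subst integral_unique) auto
    then have "\<phi> x = \<sigma> * integral {0..1} f" by simp
    then have "(\<phi> x)\<^sup>2 = \<sigma>\<^sup>2 * (integral {0..1} f)\<^sup>2" by (simp add: power_mult_distrib)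
    also have "\<dots> \<le> \<sigma>\<^sup>2 * integral {0..1} (\<lambda>\<tau>. (f \<tau>)\<^sup>2)"
      by (intro mult_left_mono sq_integral_le_integral_sq cf) auto
    also have "\<dots> \<le> \<sigma>\<^sup>2 * integral {0..1} (\<lambda>\<tau>. q (x + (- \<tau> * \<sigma>) *\<^sub>R e))"
    proof (intro mult_left_mono integral_le)
      show "(\<lambda>\<tau>. (f \<tau>)\<^sup>2) integrable_on {0..1}" by (intro integrable_continuous_real continuous_intros cf)
      show "(\<lambda>\<tau>. q (x + (- \<tau> * \<sigma>) *\<^sub>R e)) integrable_on {0..1}"
        by (intro integrable_continuous_real continuous_on_compose2[OF cq[of UNIV]]) (auto intro!: continuous_intros)
      show "(f \<tau>)\<^sup>2 \<le> q (x + (- \<tau> * \<sigma>) *\<^sub>R e)" for \<tau>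
        unfolding f_def \<psi>_def q_def by (rule directional_derivative_sq_le[OF test_function_C1(1)[OF t] e])
    qed auto
    finally have "ennreal ((\<phi> x)\<^sup>2) \<le> ennreal (\<sigma>\<^sup>2) * ennreal (integral {0..1} (\<lambda>\<tau>. q (x + (- \<tau> * \<sigma>) *\<^sub>R e)))"
      by (subst ennreal_mult[symmetric])
        (auto intro!: ennreal_leI Henstock_Kurzweil_Integration.integral_nonneg integrable_continuous_real
          continuous_on_compose2[OF cq[of UNIV]] continuous_intros q0)
    also have "ennreal (integral {0..1} (\<lambda>\<tau>. q (x + (- \<tau> * \<sigma>) *\<^sub>R e)))
        = (\<integral>\<^sup>+\<tau>. ennreal (q (x + (- \<tau> * \<sigma>) *\<^sub>R e)) * indicator {0..1} \<tau> \<partial>lborel)"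
      by (rule nn_integral_has_integral_lebesgue'[symmetric])
        (auto intro!: q0 integrable_integral integrable_continuous_real continuous_on_compose2[OF cq[of UNIV]] continuous_intros)
    finally show ?thesis using True by simp
  qed simp
  have joint: "(\<lambda>(x, \<tau>). ennreal (q (x + (- \<tau> * \<sigma>) *\<^sub>R e)) * indicator {0..1} \<tau>) \<in> borel_measurable (lborel \<Otimes>\<^sub>M lborel)"
    by measurable
  have "(\<integral>\<^sup>+x. ennreal ((\<phi> x)\<^sup>2) * indicator S x \<partial>lebesgue)
     \<le> (\<integral>\<^sup>+x. ennreal (\<sigma>\<^sup>2) * (\<integral>\<^sup>+\<tau>. ennreal (q (x + (- \<tau> * \<sigma>) *\<^sub>R e)) * indicator {0..1} \<tau> \<partial>lborel) \<partial>lebesgue)"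
    by (intro nn_integral_mono pw)
  also have "\<dots> = (\<integral>\<^sup>+x. ennreal (\<sigma>\<^sup>2) * (\<integral>\<^sup>+\<tau>. ennreal (q (x + (- \<tau> * \<sigma>) *\<^sub>R e)) * indicator {0..1} \<tau> \<partial>lborel) \<partial>lborel)"
    by (rule nn_integral_completion)
  also have "\<dots> = ennreal (\<sigma>\<^sup>2) * (\<integral>\<^sup>+x. (\<integral>\<^sup>+\<tau>. ennreal (q (x + (- \<tau> * \<sigma>) *\<^sub>R e)) * indicator {0..1} \<tau> \<partial>lborel) \<partial>lborel)"
    by (intro nn_integral_cmult) measurable
  also have "(\<integral>\<^sup>+x. (\<integral>\<^sup>+\<tau>. ennreal (q (x + (- \<tau> * \<sigma>) *\<^sub>R e)) * indicator {0..1} \<tau> \<partial>lborel) \<partial>lborel)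
     = (\<integral>\<^sup>+\<tau>. (\<integral>\<^sup>+x. ennreal (q (x + (- \<tau> * \<sigma>) *\<^sub>R e)) * indicator {0..1} \<tau> \<partial>lborel) \<partial>lborel)"
    using lborel_pair.Fubini'[OF joint] by simp
  also have "\<dots> = (\<integral>\<^sup>+\<tau>. (\<integral>\<^sup>+x. ennreal (q x) \<partial>lborel) * indicator {0..1::real} \<tau> \<partial>lborel)"
  proof (rule nn_integral_cong)
    fix \<tau> :: real
    have "(\<integral>\<^sup>+x. ennreal (q (x + (- \<tau> * \<sigma>) *\<^sub>R e)) \<partial>lborel) = (\<integral>\<^sup>+x. ennreal (q ((- \<tau> * \<sigma>) *\<^sub>R e + x)) \<partial>lborel)"
      by (simp add: add.commute)
    also have "\<dots> = (\<integral>\<^sup>+x. ennreal (q x) \<partial>distr lborel borel ((+) ((- \<tau> * \<sigma>) *\<^sub>R e)))"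
      by (subst nn_integral_distr) auto
    finally have "(\<integral>\<^sup>+x. ennreal (q (x + (- \<tau> * \<sigma>) *\<^sub>R e)) \<partial>lborel) = (\<integral>\<^sup>+x. ennreal (q x) \<partial>lborel)"
      by (simp add: lborel_distr_plus)
    then show "(\<integral>\<^sup>+x. ennreal (q (x + (- \<tau> * \<sigma>) *\<^sub>R e)) * indicator {0..1} \<tau> \<partial>lborel)
       = (\<integral>\<^sup>+x. ennreal (q x) \<partial>lborel) * indicator {0..1::real} \<tau>"
      by (auto simp: indicator_def)
  qed
  also have "\<dots> = (\<integral>\<^sup>+x. ennreal (q x) \<partial>lborel)"
    by (subst nn_integral_cmult_indicator) auto
  finally show ?thesis by (simp add: q_def)
qed

text \<open>For \<open>h\<close> in \<open>H\<^sup>1\<^sub>0(\<Omega>)\<close>, the part of \<open>{|h| \<ge> \<delta>}\<close> from which a translation by \<open>- \<sigma> e\<close> leaves \<open>\<Omega>\<close> has measure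
\<open>O(\<sigma>\<^sup>2)\<close>. The translation estimate is applied to the approximating test functions, which vanish outside \<open>\<Omega>\<close>.\<close>

lemma H10_strip_estimate:
  fixes \<Omega> :: "'a::euclidean_space set"
  assumes op: "open \<Omega>" and h: "H10 \<Omega> h"
  obtains C where "0 \<le> C"
    "\<And>S \<sigma> \<delta> e. S \<in> lmeasurable \<Longrightarrow> S \<subseteq> \<Omega> \<Longrightarrow> 0 \<le> \<delta> \<Longrightarrow> norm e = 1 \<Longrightarrow>
      (\<And>x. x \<in> S \<Longrightarrow> \<delta> \<le> \<bar>h x\<bar>) \<Longrightarrow> (\<And>x. x \<in> S \<Longrightarrow> x - \<sigma> *\<^sub>R e \<notin> \<Omega>) \<Longrightarrow>
      \<delta>\<^sup>2 * measure lebesgue S \<le> C * \<sigma>\<^sup>2"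
proof -
  have mO: "\<Omega> \<in> sets lebesgue" using op by simp
  obtain g \<phi> where hL: "L2_on \<Omega> h" and g: "\<And>b. b \<in> Basis \<Longrightarrow> L2_on \<Omega> (g b)"
    and t: "\<And>n::nat. test_function \<Omega> (\<phi> n)"
    and l0: "(\<lambda>n. L2norm \<Omega> (\<lambda>x. \<phi> n x - h x)) \<longlonglongrightarrow> 0"
    and l1: "\<And>b. b \<in> Basis \<Longrightarrow> (\<lambda>n. L2norm \<Omega> (\<lambda>x. pd b (\<phi> n) x - g b x)) \<longlonglongrightarrow> 0"
    using h unfolding H10_def by blast
  have s0: "(\<lambda>n. sqint \<Omega> (\<lambda>x. \<phi> n x - h x)) \<longlonglongrightarrow> 0"
    using tendsto_power[OF l0, of 2] by (simp add: L2norm_sq)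
  have s1: "(\<lambda>n. sqint \<Omega> (\<lambda>x. pd b (\<phi> n) x - g b x)) \<longlonglongrightarrow> 0" if "b \<in> Basis" for b
    using tendsto_power[OF l1[OF that], of 2] by (simp add: L2norm_sq)
  have tb: "test_function \<Omega> (pd b (\<phi> n))" if "b \<in> Basis" for b n using t that by (rule test_function_pd)
  have \<phi>L: "L2_on \<Omega> (\<phi> n)" for n by (rule test_function_L2_on[OF t mO])
  have pL: "L2_on \<Omega> (pd b (\<phi> n))" if "b \<in> Basis" for b n by (rule test_function_L2_on[OF tb[OF that] mO])
  define C0 where "C0 = (\<lambda>n. \<Sum>b\<in>Basis. 2 * sqint \<Omega> (\<lambda>x. pd b (\<phi> n) x - g b x) + 2 * sqint \<Omega> (g b))"
  define C1 where "C1 = (\<Sum>b\<in>Basis. 2 * sqint \<Omega> (g b))"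
  have C01: "C0 \<longlonglongrightarrow> (\<Sum>b\<in>Basis. 2 * 0 + 2 * sqint \<Omega> (g b))"
    unfolding C0_def by (intro tendsto_intros s1) auto
  have grad: "(\<integral>\<^sup>+x. ennreal (\<Sum>b\<in>Basis. (pd b (\<phi> n) x)\<^sup>2) \<partial>lborel) \<le> ennreal (C0 n)" for n
  proof -
    have z: "pd b (\<phi> n) x = 0" if "b \<in> Basis" "x \<notin> \<Omega>" for b x
      using tb[OF that(1), of n] that(2) by (auto simp: test_function_def)
    have bi: "(\<integral>\<^sup>+x. ennreal ((pd b (\<phi> n) x)\<^sup>2) \<partial>lborel) = ennreal (sqint \<Omega> (pd b (\<phi> n)))" if b: "b \<in> Basis" for b
    proof -
      have "(\<integral>\<^sup>+x. ennreal ((pd b (\<phi> n) x)\<^sup>2) \<partial>lborel) = (\<integral>\<^sup>+x. ennreal ((pd b (\<phi> n) x)\<^sup>2) * indicator \<Omega> x \<partial>lborel)"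
        using z[OF b] by (intro nn_integral_cong) (auto simp: indicator_def)
      also have "\<dots> = (\<integral>\<^sup>+x. ennreal ((pd b (\<phi> n) x)\<^sup>2) * indicator \<Omega> x \<partial>lebesgue)"
        by (rule nn_integral_completion[symmetric])
      also have "\<dots> = (\<integral>\<^sup>+x. ennreal ((pd b (\<phi> n) x)\<^sup>2) \<partial>lebesgue_on \<Omega>)"
        using mO by (subst nn_integral_restrict_space) auto
      also have "\<dots> = ennreal (sqint \<Omega> (pd b (\<phi> n)))"
        using pL[OF b, of n] by (subst nn_integral_eq_integral) (auto simp: L2_on_def)
      finally show ?thesis .
    qed
    have "(\<integral>\<^sup>+x. ennreal (\<Sum>b\<in>Basis. (pd b (\<phi> n) x)\<^sup>2) \<partial>lborel) = (\<integral>\<^sup>+x. (\<Sum>b\<in>Basis. ennreal ((pd b (\<phi> n) x)\<^sup>2)) \<partial>lborel)"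
      by (intro nn_integral_cong) (simp add: sum_ennreal)
    also have "\<dots> = (\<Sum>b\<in>Basis. \<integral>\<^sup>+x. ennreal ((pd b (\<phi> n) x)\<^sup>2) \<partial>lborel)"
      using test_function_C1(3)[OF t, of _ UNIV n]
      by (intro nn_integral_sum) (auto intro!: borel_measurable_continuous_onI continuous_intros)
    also have "\<dots> = (\<Sum>b\<in>Basis. ennreal (sqint \<Omega> (pd b (\<phi> n))))" using bi by simp
    also have "\<dots> = ennreal (\<Sum>b\<in>Basis. sqint \<Omega> (pd b (\<phi> n)))" by (simp add: sum_ennreal sqint_nonneg)
    also have "\<dots> \<le> ennreal (C0 n)"
      unfolding C0_def
    proof (intro ennreal_leI sum_mono)
      fix b :: 'a assume b: "b \<in> Basis"
      show "sqint \<Omega> (pd b (\<phi> n)) \<le> 2 * sqint \<Omega> (\<lambda>x. pd b (\<phi> n) x - g b x) + 2 * sqint \<Omega> (g b)"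
        using sqint_triangle[OF pL[OF b, of n] g[OF b], of "\<lambda>x. 0"] by (simp add: L2_on_def)
    qed
    finally show ?thesis .
  qed
  have C1: "0 \<le> 2 * C1" unfolding C1_def by (intro mult_nonneg_nonneg sum_nonneg) (auto simp: sqint_nonneg)
  have main: "\<delta>\<^sup>2 * measure lebesgue S \<le> 2 * C1 * \<sigma>\<^sup>2"
    if S: "S \<in> lmeasurable" "S \<subseteq> \<Omega>" and \<delta>: "0 \<le> \<delta>" and e: "norm e = 1"
      and hb: "\<And>x. x \<in> S \<Longrightarrow> \<delta> \<le> \<bar>h x\<bar>" and out: "\<And>x. x \<in> S \<Longrightarrow> x - \<sigma> *\<^sub>R e \<notin> \<Omega>" for S \<sigma> \<delta> e
  proof -
    have mS: "S \<in> sets lebesgue" using S by (simp add: fmeasurableD)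
    have step: "\<delta>\<^sup>2 * measure lebesgue S \<le> 2 * sqint \<Omega> (\<lambda>x. \<phi> n x - h x) + 2 * (\<sigma>\<^sup>2 * C0 n)" for n
    proof -
      have z: "\<phi> n (x - \<sigma> *\<^sub>R e) = 0" if "x \<in> S" for x
        using out[OF that] t[of n] by (auto simp: test_function_def)
      have [measurable]: "S \<in> sets (lebesgue_on \<Omega>)" using S mS mO by (simp add: sets_restrict_space_iff)
      have [measurable]: "\<phi> n \<in> borel_measurable (lebesgue_on \<Omega>)" "h \<in> borel_measurable (lebesgue_on \<Omega>)"
        using \<phi>L hL by (auto simp: L2_on_def)
      have "ennreal (\<delta>\<^sup>2 * measure lebesgue S) = ennreal (\<delta>\<^sup>2) * emeasure (lebesgue_on \<Omega>) S"
        using S mO by (simp add: ennreal_mult emeasure_restrict_space emeasure_eq_measure2)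
      also have "\<dots> = (\<integral>\<^sup>+x. ennreal (\<delta>\<^sup>2) * indicator S x \<partial>lebesgue_on \<Omega>)"
        by (subst nn_integral_cmult_indicator) measurable
      also have "\<dots> \<le> (\<integral>\<^sup>+x. ennreal (2 * (norm (\<phi> n x - h x))\<^sup>2) + 2 * (ennreal ((\<phi> n x)\<^sup>2) * indicator S x) \<partial>lebesgue_on \<Omega>)"
      proof (rule nn_integral_mono)
        fix x
        show "ennreal (\<delta>\<^sup>2) * indicator S x \<le> ennreal (2 * (norm (\<phi> n x - h x))\<^sup>2) + 2 * (ennreal ((\<phi> n x)\<^sup>2) * indicator S x)"
        proof (cases "x \<in> S")
          case True
          have "\<delta>\<^sup>2 \<le> (norm (h x))\<^sup>2" using hb[OF True] \<delta> by (intro power_mono) auto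
          also have "\<dots> \<le> 2 * (norm (h x - \<phi> n x))\<^sup>2 + 2 * (norm (\<phi> n x))\<^sup>2"
            using norm_add_sq_le[of "h x - \<phi> n x" "\<phi> n x"] by simp
          finally have "\<delta>\<^sup>2 \<le> 2 * (norm (\<phi> n x - h x))\<^sup>2 + 2 * (\<phi> n x)\<^sup>2"
            by (simp add: power2_commute)
          then have "ennreal (\<delta>\<^sup>2) \<le> ennreal (2 * (norm (\<phi> n x - h x))\<^sup>2 + 2 * (\<phi> n x)\<^sup>2)" by (rule ennreal_leI)
          also have "\<dots> = ennreal (2 * (norm (\<phi> n x - h x))\<^sup>2) + 2 * ennreal ((\<phi> n x)\<^sup>2)"
            by (subst ennreal_plus) (auto simp: ennreal_mult)
          finally show ?thesis using True by simp
        qed simp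
      qed
      also have "\<dots> = (\<integral>\<^sup>+x. ennreal (2 * (norm (\<phi> n x - h x))\<^sup>2) \<partial>lebesgue_on \<Omega>)
          + 2 * (\<integral>\<^sup>+x. ennreal ((\<phi> n x)\<^sup>2) * indicator S x \<partial>lebesgue_on \<Omega>)"
        by (subst nn_integral_add, measurable, subst nn_integral_cmult) measurable
      also have "(\<integral>\<^sup>+x. ennreal (2 * (norm (\<phi> n x - h x))\<^sup>2) \<partial>lebesgue_on \<Omega>) = ennreal (2 * sqint \<Omega> (\<lambda>x. \<phi> n x - h x))"
        using L2_on_diff[OF \<phi>L hL, of n] by (subst nn_integral_eq_integral) (auto simp: L2_on_def)
      also have "(\<integral>\<^sup>+x. ennreal ((\<phi> n x)\<^sup>2) * indicator S x \<partial>lebesgue_on \<Omega>) \<le> ennreal (\<sigma>\<^sup>2 * C0 n)"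
      proof -
        have "(\<integral>\<^sup>+x. ennreal ((\<phi> n x)\<^sup>2) * indicator S x \<partial>lebesgue_on \<Omega>)
          = (\<integral>\<^sup>+x. ennreal ((\<phi> n x)\<^sup>2) * indicator S x * indicator \<Omega> x \<partial>lebesgue)"
          using mO by (subst nn_integral_restrict_space) auto
        also have "\<dots> \<le> (\<integral>\<^sup>+x. ennreal ((\<phi> n x)\<^sup>2) * indicator S x \<partial>lebesgue)"
          by (intro nn_integral_mono) (auto simp: indicator_def)
        also have "\<dots> \<le> ennreal (\<sigma>\<^sup>2) * (\<integral>\<^sup>+x. ennreal (\<Sum>b\<in>Basis. (pd b (\<phi> n) x)\<^sup>2) \<partial>lborel)"
          by (rule translation_estimate[OF t e z])
        also have "\<dots> \<le> ennreal (\<sigma>\<^sup>2) * ennreal (C0 n)" by (intro mult_left_mono grad) auto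
        also have "\<dots> = ennreal (\<sigma>\<^sup>2 * C0 n)"
          unfolding C0_def by (subst ennreal_mult) (auto intro!: sum_nonneg add_nonneg_nonneg sqint_nonneg)
        finally show ?thesis .
      qed
      also have "ennreal (2 * sqint \<Omega> (\<lambda>x. \<phi> n x - h x)) + 2 * ennreal (\<sigma>\<^sup>2 * C0 n)
          = ennreal (2 * sqint \<Omega> (\<lambda>x. \<phi> n x - h x) + 2 * (\<sigma>\<^sup>2 * C0 n))"
      proof -
        have "0 \<le> C0 n" unfolding C0_def by (intro sum_nonneg add_nonneg_nonneg mult_nonneg_nonneg sqint_nonneg) auto
        then have "2 * ennreal (\<sigma>\<^sup>2 * C0 n) = ennreal (2 * (\<sigma>\<^sup>2 * C0 n))" by (simp add: ennreal_mult)
        moreover have "0 \<le> 2 * sqint \<Omega> (\<lambda>x. \<phi> n x - h x)" by (intro mult_nonneg_nonneg sqint_nonneg) auto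
        ultimately show ?thesis using \<open>0 \<le> C0 n\<close> by (simp only: ennreal_plus mult_nonneg_nonneg zero_le_numeral zero_le_power2)
      qed
      finally have le: "ennreal (\<delta>\<^sup>2 * measure lebesgue S) \<le> ennreal (2 * sqint \<Omega> (\<lambda>x. \<phi> n x - h x) + 2 * (\<sigma>\<^sup>2 * C0 n))"
        by (simp add: add_mono mult_left_mono)
      have nn: "0 \<le> 2 * sqint \<Omega> (\<lambda>x. \<phi> n x - h x) + 2 * (\<sigma>\<^sup>2 * C0 n)"
        unfolding C0_def by (auto intro!: mult_nonneg_nonneg sum_nonneg add_nonneg_nonneg sqint_nonneg)
      show ?thesis using le nn by (simp add: ennreal_le_iff)
    qed
    have "(\<lambda>n. 2 * sqint \<Omega> (\<lambda>x. \<phi> n x - h x) + 2 * (\<sigma>\<^sup>2 * C0 n)) \<longlonglongrightarrow> 2 * 0 + 2 * (\<sigma>\<^sup>2 * (\<Sum>b\<in>Basis. 2 * 0 + 2 * sqint \<Omega> (g b)))"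
      by (intro tendsto_intros s0 C01)
    then have "\<delta>\<^sup>2 * measure lebesgue S \<le> 2 * 0 + 2 * (\<sigma>\<^sup>2 * (\<Sum>b\<in>Basis. 2 * 0 + 2 * sqint \<Omega> (g b)))"
      by (rule LIMSEQ_le_const) (use step in auto)
    then show ?thesis by (simp add: C1_def mult.commute mult.left_commute)
  qed
  show ?thesis by (rule that[OF C1 main])
qed

text \<open>The chart at a boundary point, with the preimages \<open>e1\<close>, \<open>e2\<close> of the coordinate vectors. The boundary point itself lies on the graph.\<close>

lemma C2_chart:
  assumes op: "open \<Omega>" and C2: "C2_boundary \<Omega>" and p: "p \<in> frontier \<Omega>"
  obtains r and A :: "real^2 \<Rightarrow> real^2" and g g' :: "real \<Rightarrow> real" and e1 e2
  where "r > 0" "linear A" "\<And>x. norm (A x) = norm x"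
    "A e1 = axis 1 1" "A e2 = axis 2 1" "norm e2 = 1"
    "\<And>x. (g has_real_derivative g' x) (at x)"
    "\<And>x. x \<in> \<Omega> \<Longrightarrow> x \<in> ball p r \<Longrightarrow> g (A x $ 1) < A x $ 2"
    "\<And>x. x \<in> ball p r \<Longrightarrow> g (A x $ 1) < A x $ 2 \<Longrightarrow> x \<in> \<Omega>"
    "A p $ 2 = g (A p $ 1)"
proof -
  obtain r and A :: "real^2 \<Rightarrow> real^2" and g :: "real \<Rightarrow> real"
    where r: "r > 0" and A: "orthogonal_transformation A" and g: "Ck 2 UNIV g"
    and chart: "\<Omega> \<inter> ball p r = {x \<in> ball p r. A x $ 2 > g (A x $ 1)}"
    using C2[unfolded C2_boundary_def, rule_format, OF p] by blast
  have chartD: "A x $ 2 > g (A x $ 1)" if "x \<in> \<Omega>" "x \<in> ball p r" for x using that chart by blast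
  have chartI: "x \<in> \<Omega>" if "x \<in> ball p r" "A x $ 2 > g (A x $ 1)" for x using that chart by blast
  obtain g' where g': "\<And>x. (g has_real_derivative g' x) (at x)" "continuous_on UNIV g'"
    using Ck2_real_C1[OF g] by blast
  have linA: "linear A" using A by (rule orthogonal_transformation_linear)
  have nA: "norm (A x) = norm x" for x using A by (rule orthogonal_transformation_norm)
  obtain e1 e2 where e: "A e1 = axis 1 1" "A e2 = axis 2 1"
    using orthogonal_transformation_surj[OF A] by (metis surjD)
  have ne: "norm e2 = 1" using nA[of e2] e by simp
  have pO: "p \<notin> \<Omega>" "p \<in> closure \<Omega>" using p op by (auto simp: frontier_def interior_open)
  have contg: "continuous_on UNIV g" using g'(1) by (meson DERIV_isCont continuous_at_imp_continuous_on)
  have contA: "continuous_on UNIV A" using linA by (simp add: linear_continuous_on linear_conv_bounded_linear)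
  have "A p $ 2 \<le> g (A p $ 1)" using pO chartI[of p] r by force
  moreover have "\<not> A p $ 2 < g (A p $ 1)"
  proof
    assume lt: "A p $ 2 < g (A p $ 1)"
    define U where "U = {x. A x $ 2 < g (A x $ 1)} \<inter> ball p r"
    have "open {x. A x $ 2 < g (A x $ 1)}"
      by (intro open_Collect_less continuous_intros contA continuous_on_compose2[OF contg]) auto
    then have "open U" unfolding U_def by auto
    moreover have "p \<in> U" using lt r by (simp add: U_def)
    ultimately have "U \<inter> \<Omega> \<noteq> {}" using pO(2) open_Int_closure_eq_empty[of U \<Omega>] by blast
    then obtain z where "z \<in> U" "z \<in> \<Omega>" by blast
    then show False using chartD[of z] unfolding U_def by simp
  qed
  ultimately have "A p $ 2 = g (A p $ 1)" by simp
  then show ?thesis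
    using that[where r=r and A=A and ?e1.0=e1 and ?e2.0=e2 and g=g and g'=g', OF r linA nA e ne g'(1) chartD chartI] by simp
qed

text \<open>Suppose \<open>|h| \<ge> \<delta> > 0\<close> in \<open>\<Omega>\<close> near \<open>p\<close>. Every point of \<open>\<Omega>\<close> near \<open>p\<close> leaves \<open>\<Omega>\<close> within a fixed distance
\<open>\<rho>\<close> when moved down in the chart. Moving in \<open>J\<close> steps of length \<open>\<sigma> = \<rho> / J\<close>, the last position in \<open>\<Omega>\<close>
lies in the set \<open>S\<close> of points that leave \<open>\<Omega>\<close> in one step. So \<open>J\<close> translates of \<open>S\<close>, each of measure \<open>O(\<sigma>\<^sup>2)\<close>,
cover a neighbourhood \<open>G\<close> of \<open>p\<close> in \<open>\<Omega>\<close>, whose measure is thus \<open>O(1 / J)\<close>: a contradiction.\<close>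

lemma H10_trace_zero:
  fixes \<Omega> :: "(real^2) set"
  assumes op: "open \<Omega>" and C2: "C2_boundary \<Omega>"
    and cont: "continuous_on (closure \<Omega>) h" and H: "H10 \<Omega> h" and p: "p \<in> frontier \<Omega>"
  shows "h p = 0"
proof (rule ccontr)
  assume nz: "h p \<noteq> 0"
  obtain r and A :: "real^2 \<Rightarrow> real^2" and g g' :: "real \<Rightarrow> real" and e1 e2
  where r: "r > 0" and linA: "linear A" and nA: "\<And>x. norm (A x) = norm x"
    and e: "A e1 = axis 1 1" "A e2 = axis 2 1" "norm e2 = 1"
    and g': "\<And>x. (g has_real_derivative g' x) (at x)"
    and chartD: "\<And>x. x \<in> \<Omega> \<Longrightarrow> x \<in> ball p r \<Longrightarrow> g (A x $ 1) < A x $ 2"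
    and chartI: "\<And>x. x \<in> ball p r \<Longrightarrow> g (A x $ 1) < A x $ 2 \<Longrightarrow> x \<in> \<Omega>"
    and gp: "A p $ 2 = g (A p $ 1)"
    by (rule C2_chart[OF op C2 p]) (rule that, assumption+)
  have Ae: "A (x - k *\<^sub>R e2) $ 1 = A x $ 1" "A (x - k *\<^sub>R e2) $ 2 = A x $ 2 - k" for x k
    by (simp_all add: linear_diff[OF linA] linear_scale[OF linA] e axis_def)
  have pcl: "p \<in> closure \<Omega>" using p by (simp add: frontier_def)
  define \<delta> where "\<delta> = \<bar>h p\<bar> / 2"
  have \<delta>: "\<delta> > 0" using nz by (simp add: \<delta>_def)
  obtain r0 where r0: "r0 > 0" "\<And>x. x \<in> closure \<Omega> \<Longrightarrow> dist x p < r0 \<Longrightarrow> dist (h x) (h p) < \<delta>"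
    using cont[unfolded continuous_on_iff] pcl \<delta> by blast
  define r1 where "r1 = min r0 r"
  have r1: "r1 > 0" "r1 \<le> r" using r r0 by (auto simp: r1_def)
  have h\<delta>: "\<delta> \<le> \<bar>h x\<bar>" if "x \<in> \<Omega>" "x \<in> ball p r1" for x
  proof -
    have "\<bar>h x - h p\<bar> < \<delta>"
      using r0(2)[of x] that closure_subset[of \<Omega>] by (auto simp: r1_def dist_real_def dist_commute)
    then show ?thesis unfolding \<delta>_def by linarith
  qed
  define \<rho> where "\<rho> = r1 / 2"
  have \<rho>: "\<rho> > 0" using r1 by (simp add: \<rho>_def)
  define c where "c = A p $ 1"
  have "isCont g c" using g' by (rule DERIV_isCont)
  then obtain \<eta> where \<eta>: "\<eta> > 0" "\<And>s. \<bar>s - c\<bar> < \<eta> \<Longrightarrow> \<bar>g s - g c\<bar> < \<rho> / 4"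
    unfolding continuous_at_eps_delta dist_real_def using \<rho> by (metis zero_less_divide_iff zero_less_numeral)
  \<comment> \<open>In \<open>ball p r2\<close> the graph has height within \<open>\<rho>/4\<close> of that of \<open>p\<close>, so a descent by \<open>\<rho>\<close> ends below it.\<close>
  define r2 where "r2 = min \<eta> (\<rho> / 4)"
  have r2: "r2 > 0" using \<eta> \<rho> by (simp add: r2_def)
  define G where "G = \<Omega> \<inter> ball p r2"
  have exitG: "x - \<rho> *\<^sub>R e2 \<notin> \<Omega>" if x: "x \<in> G" for x
  proof
    assume xO: "x - \<rho> *\<^sub>R e2 \<in> \<Omega>"
    have xp: "norm (x - p) < \<eta>" "norm (x - p) < \<rho> / 4"
      using x by (auto simp: G_def r2_def dist_norm norm_minus_commute)
    have "norm (x - \<rho> *\<^sub>R e2 - p) \<le> norm (x - p) + norm (\<rho> *\<^sub>R e2)"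
      using norm_triangle_ineq4[of "x - p" "\<rho> *\<^sub>R e2"] by (simp add: algebra_simps)
    also have "\<dots> < r1" using xp \<rho> e by (simp add: \<rho>_def)
    finally have "x - \<rho> *\<^sub>R e2 \<in> ball p r" using r1 by (simp add: dist_norm norm_minus_commute)
    then have "g (A x $ 1) < A x $ 2 - \<rho>" using chartD[OF xO] Ae by simp
    moreover have cmp: "\<bar>A x $ i - A p $ i\<bar> \<le> norm (x - p)" for i
      using component_le_norm_cart[of "A x - A p" i] nA[of "x - p"] by (simp add: linear_diff[OF linA])
    have "\<bar>g (A x $ 1) - g c\<bar> < \<rho> / 4" using cmp[of 1] xp by (intro \<eta>) (simp add: c_def)
    moreover have "A x $ 2 < g c + \<rho> / 4" using cmp[of 2] xp gp by (simp add: c_def)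
    ultimately show False using \<rho> by (simp add: abs_if split: if_splits)
  qed
  have "G \<noteq> {}"
    using pcl r2 closure_iff_nhds_not_empty[of p \<Omega>] unfolding G_def
    by (metis Int_commute centre_in_ball open_ball subset_refl)
  have "open G" using op by (simp add: G_def open_Int)
  have Gm: "G \<in> lmeasurable" using \<open>open G\<close> by (intro bounded_set_imp_lmeasurable) (auto simp: G_def)
  have mG: "measure lebesgue G > 0"
    using open_not_negligible[OF \<open>open G\<close> \<open>G \<noteq> {}\<close>] negligible_iff_measure0[OF Gm]
    by (simp add: zero_less_measure_iff)
  obtain C where C: "0 \<le> C"
    "\<And>S \<sigma> \<delta> e. S \<in> lmeasurable \<Longrightarrow> S \<subseteq> \<Omega> \<Longrightarrow> 0 \<le> \<delta> \<Longrightarrow> norm e = 1 \<Longrightarrow>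
      (\<And>x. x \<in> S \<Longrightarrow> \<delta> \<le> \<bar>h x\<bar>) \<Longrightarrow> (\<And>x. x \<in> S \<Longrightarrow> x - \<sigma> *\<^sub>R e \<notin> \<Omega>) \<Longrightarrow>
      \<delta>\<^sup>2 * measure lebesgue S \<le> C * \<sigma>\<^sup>2"
    by (rule H10_strip_estimate[OF op H]) blast
  have bound: "\<delta>\<^sup>2 * measure lebesgue G \<le> C * \<rho>\<^sup>2 / real J" if J: "J > 0" for J :: nat
  proof -
    define \<sigma> where "\<sigma> = \<rho> / real J"
    have \<sigma>: "\<sigma> > 0" "real J * \<sigma> = \<rho>" using \<rho> J by (auto simp: \<sigma>_def)
    define S where "S = {x \<in> \<Omega> \<inter> ball p r1. x - \<sigma> *\<^sub>R e2 \<notin> \<Omega>}"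
    have Seq: "S = \<Omega> \<inter> ball p r1 \<inter> (\<lambda>x. x - \<sigma> *\<^sub>R e2) -` (- \<Omega>)" by (auto simp: S_def)
    have "closed ((\<lambda>x. x - \<sigma> *\<^sub>R e2) -` (- \<Omega>))"
      using op by (intro continuous_closed_vimage) auto
    then have "S \<in> sets borel" unfolding Seq using op by auto
    then have Sm: "S \<in> lmeasurable"
      by (intro bounded_set_imp_lmeasurable) (auto intro: bounded_subset[of "ball p r1"] simp: S_def)
    have est: "\<delta>\<^sup>2 * measure lebesgue S \<le> C * \<sigma>\<^sup>2"
      using \<delta> e h\<delta> by (intro C(2)[OF Sm, of \<delta> e2]) (auto simp: S_def)
    have "G \<subseteq> (\<Union>i\<in>{..<J}. (+) ((real i * \<sigma>) *\<^sub>R e2) ` S)"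
    proof
      fix x assume x: "x \<in> G"
      define P where "P = (\<lambda>j::nat. x - (real j * \<sigma>) *\<^sub>R e2 \<notin> \<Omega>)"
      have PJ: "P J" using exitG[OF x] \<sigma> by (simp add: P_def)
      define j where "j = (LEAST j. P j)"
      have Pj: "P j" unfolding j_def using PJ by (rule LeastI)
      have jJ: "j \<le> J" unfolding j_def using PJ by (rule Least_le)
      have "\<not> P 0" using x by (simp add: P_def G_def)
      then obtain i where i: "j = Suc i" using Pj by (cases j) auto
      then have "\<not> P i" using not_less_Least[of i P] by (simp add: j_def)
      define y where "y = x - (real i * \<sigma>) *\<^sub>R e2"
      have yO: "y \<in> \<Omega>" using \<open>\<not> P i\<close> by (simp add: P_def y_def)
      have "y - \<sigma> *\<^sub>R e2 = x - (real j * \<sigma>) *\<^sub>R e2" by (simp add: y_def i algebra_simps)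
      then have y2: "y - \<sigma> *\<^sub>R e2 \<notin> \<Omega>" using Pj by (simp add: P_def)
      have "norm (y - p) \<le> norm (x - p) + norm ((real i * \<sigma>) *\<^sub>R e2)"
        using norm_triangle_ineq4[of "x - p" "(real i * \<sigma>) *\<^sub>R e2"] by (simp add: y_def algebra_simps)
      also have "norm ((real i * \<sigma>) *\<^sub>R e2) \<le> \<rho>"
      proof -
        have "real i * \<sigma> \<le> real J * \<sigma>" using i jJ \<sigma> by (intro mult_right_mono) auto
        then show ?thesis using \<sigma> e by simp
      qed
      also have "norm (x - p) < \<rho>" using x \<rho> by (auto simp: G_def r2_def dist_norm norm_minus_commute)
      finally have "y \<in> ball p r1" by (simp add: \<rho>_def dist_norm norm_minus_commute)
      then have "y \<in> S" using yO y2 by (simp add: S_def)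
      then show "x \<in> (\<Union>i\<in>{..<J}. (+) ((real i * \<sigma>) *\<^sub>R e2) ` S)"
        using i jJ by (intro UN_I[of i]) (auto simp: y_def image_iff intro!: bexI[of _ y])
    qed
    then have "measure lebesgue G \<le> measure lebesgue (\<Union>i\<in>{..<J}. (+) ((real i * \<sigma>) *\<^sub>R e2) ` S)"
      using Gm Sm by (intro measure_mono_fmeasurable) (auto simp: fmeasurableD intro!: fmeasurableD fmeasurable.finite_UN measurable_translation)
    also have "\<dots> \<le> (\<Sum>i<J. measure lebesgue ((+) ((real i * \<sigma>) *\<^sub>R e2) ` S))"
      using Sm by (intro measure_UNION_le) (auto intro: fmeasurableD measurable_translation)
    also have "\<dots> = real J * measure lebesgue S" by (simp add: measure_translation)
    finally have "\<delta>\<^sup>2 * measure lebesgue G \<le> \<delta>\<^sup>2 * (real J * measure lebesgue S)" by (intro mult_left_mono) auto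
    also have "\<dots> = real J * (\<delta>\<^sup>2 * measure lebesgue S)" by simp
    also have "\<dots> \<le> real J * (C * \<sigma>\<^sup>2)" by (intro mult_left_mono est) auto
    also have "\<dots> = C * \<rho>\<^sup>2 / real J" using J by (simp add: \<sigma>_def power2_eq_square)
    finally show ?thesis .
  qed
  have "(\<lambda>J. C * \<rho>\<^sup>2 / real J) \<longlonglongrightarrow> 0" by (rule lim_const_over_n)
  then have "\<delta>\<^sup>2 * measure lebesgue G \<le> 0"
    by (rule LIMSEQ_le_const) (use bound in \<open>auto intro!: exI[of _ 1]\<close>)
  moreover have "\<delta>\<^sup>2 * measure lebesgue G > 0" using \<delta> mG by simp
  ultimately show False by simp
qed

section \<open>Tangential velocity at the boundary\<close>

lemma Jmat_mult: "(Jmat *v x) $ 1 = - x $ 2" "(Jmat *v x) $ 2 = x $ 1"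
  by (simp_all add: Jmat_def matrix_vector_mult_def sum_2 vector_2)

text \<open>The gradient \<open>G\<close> of a function with zero boundary values is normal to the boundary, and so is each
proximal normal \<open>n\<close> of the closure, that is, each \<open>n\<close> such that \<open>y\<close> is a nearest point of the closure to
\<open>y + n\<close>. In the plane, \<open>n\<close> is therefore orthogonal to the gradient rotated by a right angle.
The gradient is only known to be continuous up to the boundary; that it
annihilates the tangent is a difference quotient estimate for \<open>h\<close> along the boundary.\<close>

lemma perp_grad_tangential:
  fixes \<Omega> :: "(real^2) set" and h :: "real^2 \<Rightarrow> real" and G :: "real^2 \<Rightarrow> real^2"
  assumes op: "open \<Omega>" and C2: "C2_boundary \<Omega>"
    and conth: "continuous_on (closure \<Omega>) h" and contG: "continuous_on (closure \<Omega>) G"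
    and dh: "\<And>x. x \<in> \<Omega> \<Longrightarrow> (h has_derivative (\<lambda>v. G x \<bullet> v)) (at x)"
    and h0: "\<And>x. x \<in> frontier \<Omega> \<Longrightarrow> h x = 0"
    and y: "y \<in> frontier \<Omega>" and n: "\<And>z. z \<in> closure \<Omega> \<Longrightarrow> 2 * (n \<bullet> (z - y)) \<le> (norm (z - y))\<^sup>2"
  shows "n \<bullet> (Jmat *v G y) = 0"
proof -
  obtain r and A :: "real^2 \<Rightarrow> real^2" and g g' :: "real \<Rightarrow> real" and e1 e2
  where r: "r > 0" and linA: "linear A" and nA: "\<And>x. norm (A x) = norm x"
    and e: "A e1 = axis 1 1" "A e2 = axis 2 1" "norm e2 = 1"
    and g': "\<And>x. (g has_real_derivative g' x) (at x)"
    and chartD: "\<And>x. x \<in> \<Omega> \<Longrightarrow> x \<in> ball y r \<Longrightarrow> g (A x $ 1) < A x $ 2"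
    and chartI: "\<And>x. x \<in> ball y r \<Longrightarrow> g (A x $ 1) < A x $ 2 \<Longrightarrow> x \<in> \<Omega>"
    and gy: "A y $ 2 = g (A y $ 1)"
    by (rule C2_chart[OF op C2 y]) (rule that, assumption+)
  have ycl: "y \<in> closure \<Omega>" using y by (simp add: frontier_def)
  define c where "c = A y $ 1"
  \<comment> \<open>The boundary near \<open>y\<close> as a curve \<open>q\<close> with tangent vector \<open>\<tau>\<close> at \<open>q 0 = y\<close>.\<close>
  define q where "q = (\<lambda>s. y + s *\<^sub>R e1 + (g (c + s) - g c) *\<^sub>R e2)"
  define \<tau> where "\<tau> = e1 + g' c *\<^sub>R e2"
  have Aq: "A (q s + k *\<^sub>R e2) $ 1 = c + s" "A (q s + k *\<^sub>R e2) $ 2 = g (c + s) + k" for s k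
    by (simp_all add: q_def linear_add[OF linA] linear_scale[OF linA] e axis_def c_def gy)
  have q0: "q 0 = y" by (simp add: q_def)
  have dq: "(q has_vector_derivative \<tau>) (at 0)"
  proof -
    have "((\<lambda>s. g (c + s)) has_real_derivative g' c) (at 0)"
    proof -
      have "((\<lambda>s. c + s) has_real_derivative 1) (at 0)" by (auto intro!: derivative_eq_intros)
      then show ?thesis using DERIV_chain2[of g "g' c" "\<lambda>s. c + s" 0 1 UNIV] g'[of c] by simp
    qed
    then have "((\<lambda>s. g (c + s)) has_derivative (\<lambda>v. g' c * v)) (at 0)"
      by (simp add: has_field_derivative_def)
    then have "((\<lambda>s. g (c + s) - g c) has_derivative (\<lambda>v. g' c * v - 0)) (at 0)"
      by (intro has_derivative_diff has_derivative_const)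
    then have "(q has_derivative (\<lambda>v. 0 + v *\<^sub>R e1 + (g' c * v - 0) *\<^sub>R e2)) (at 0)"
      unfolding q_def by (intro has_derivative_add has_derivative_const has_derivative_scaleR_left has_derivative_ident)
    then show ?thesis
      unfolding has_vector_derivative_def \<tau>_def by (simp add: algebra_simps)
  qed
  define w where "w = (\<lambda>s. (1 / s) *\<^sub>R (q s - y))"
  have wlim: "(w \<longlongrightarrow> \<tau>) (at 0)"
  proof -
    have "((\<lambda>s. norm (q (0 + s) - q 0 - s *\<^sub>R \<tau>) / norm s) \<longlongrightarrow> 0) (at 0)"
      using dq unfolding has_vector_derivative_def has_derivative_at by blast
    moreover have "norm (q (0 + s) - q 0 - s *\<^sub>R \<tau>) / norm s = norm (w s - \<tau>)" if "s \<noteq> 0" for s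
    proof -
      have "w s - \<tau> = (1 / s) *\<^sub>R (q s - y - s *\<^sub>R \<tau>)"
        using that by (simp add: w_def scaleR_diff_right)
      then show ?thesis using that by (simp add: q0 divide_inverse mult.commute)
    qed
    then have "\<forall>\<^sub>F s in at 0. norm (q (0 + s) - q 0 - s *\<^sub>R \<tau>) / norm s = norm (w s - \<tau>)"
      by (simp add: eventually_at_filter)
    ultimately have "((\<lambda>s. norm (w s - \<tau>)) \<longlongrightarrow> 0) (at 0)"
      by (rule Lim_transform_eventually)
    then show ?thesis using Lim_null tendsto_norm_zero_iff by blast
  qed
  have qcont: "(q \<longlongrightarrow> y) (at 0)"
    using has_vector_derivative_continuous[OF dq] by (simp add: isCont_def q0)
  have qfront: "q s \<in> frontier \<Omega>" if "q s \<in> ball y r" for s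
  proof -
    have "q s \<notin> \<Omega>" using chartD[of "q s"] that Aq[of s 0] by auto
    moreover have "q s \<in> closure \<Omega>"
      unfolding closure_approachable
    proof (intro allI impI)
      fix d :: real assume d: "d > 0"
      define k where "k = min (d / 2) ((r - norm (q s - y)) / 2)"
      have k: "k > 0" "k < d" "k < r - norm (q s - y)"
        using that d by (auto simp: k_def dist_norm norm_minus_commute min_def field_simps)
      have "norm (q s + k *\<^sub>R e2 - y) \<le> norm (q s - y) + norm (k *\<^sub>R e2)"
        using norm_triangle_ineq[of "q s - y" "k *\<^sub>R e2"] by (simp add: algebra_simps)
      then have "q s + k *\<^sub>R e2 \<in> ball y r" using k e by (simp add: dist_norm norm_minus_commute)
      then have "q s + k *\<^sub>R e2 \<in> \<Omega>" using k Aq[of s k] by (intro chartI) auto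
      then show "\<exists>x\<in>\<Omega>. dist x (q s) < d" using k e by (intro bexI[of _ "q s + k *\<^sub>R e2"]) (auto simp: dist_norm)
    qed
    ultimately show ?thesis using op by (simp add: frontier_def interior_open)
  qed
  have ev: "\<forall>\<^sub>F s in at 0. q s \<in> ball y r' \<and> q s \<in> frontier \<Omega>" if "r' > 0" for r'
  proof -
    have "\<forall>\<^sub>F s in at 0. dist (q s) y < min r r'"
      using qcont r that unfolding tendsto_iff by (metis min_less_iff_conj min_def)
    then show ?thesis by eventually_elim (auto simp: dist_commute intro!: qfront)
  qed
  obtain \<rho> M where \<rho>: "\<rho> > 0" and M: "M > 0" and
     ql: "\<And>R (F::real^2 \<Rightarrow> real) B x x'. R > 0 \<Longrightarrow> \<forall>x\<in>\<Omega>. F differentiable (at x) \<Longrightarrow>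
     \<forall>x\<in>\<Omega> \<inter> ball y R. onorm (frechet_derivative F (at x)) \<le> B \<Longrightarrow>
     x \<in> \<Omega> \<inter> ball y (min \<rho> (R / M)) \<Longrightarrow> x' \<in> \<Omega> \<inter> ball y (min \<rho> (R / M)) \<Longrightarrow>
     \<bar>F x - F x'\<bar> \<le> M * B * norm (x - x')"
    by (rule quasi_lipschitz[OF op C2 ycl]) blast
  \<comment> \<open>Near \<open>y\<close> the function \<open>F = h - G y \<bullet> id\<close> has a small derivative, hence a small Lipschitz constant up to
    the boundary; on the boundary itself its increments are those of \<open>- G y \<bullet> id\<close>.\<close>
  have small: "\<bar>G y \<bullet> \<tau>\<bar> \<le> M * \<epsilon> * norm \<tau>" if \<epsilon>: "\<epsilon> > 0" for \<epsilon>
  proof -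
    obtain R where R: "R > 0" "\<And>x. x \<in> closure \<Omega> \<Longrightarrow> dist x y < R \<Longrightarrow> dist (G x) (G y) < \<epsilon>"
      using contG[unfolded continuous_on_iff] ycl \<epsilon> by blast
    define F where "F = (\<lambda>x. h x - G y \<bullet> x)"
    have dF: "(F has_derivative (\<lambda>v. (G x - G y) \<bullet> v)) (at x)" if "x \<in> \<Omega>" for x
      unfolding F_def by (auto intro!: derivative_eq_intros dh[OF that] simp: inner_diff_left)
    have oF: "onorm (frechet_derivative F (at x)) \<le> \<epsilon>" if "x \<in> \<Omega> \<inter> ball y R" for x
    proof -
      have "frechet_derivative F (at x) = (\<lambda>v. (G x - G y) \<bullet> v)"
        using frechet_derivative_at[OF dF, of x] that by simp
      moreover have "norm (G x - G y) \<le> \<epsilon>"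
        using R(2)[of x] that closure_subset[of \<Omega>] by (auto simp: dist_norm norm_minus_commute)
      then have "norm ((G x - G y) \<bullet> v) \<le> \<epsilon> * norm v" for v
        using Cauchy_Schwarz_ineq2[of "G x - G y" v] mult_right_mono[of "norm (G x - G y)" \<epsilon> "norm v"] by simp
      then have "onorm (\<lambda>v. (G x - G y) \<bullet> v) \<le> \<epsilon>" by (rule onorm_le)
      ultimately show ?thesis by simp
    qed
    define r' where "r' = min \<rho> (R / M)"
    have r': "r' > 0" using \<rho> R M by (simp add: r'_def)
    have "(M * \<epsilon>)-lipschitz_on (\<Omega> \<inter> ball y r') F"
    proof (rule lipschitz_onI)
      fix x x' assume "x \<in> \<Omega> \<inter> ball y r'" "x' \<in> \<Omega> \<inter> ball y r'"
      then have "\<bar>F x - F x'\<bar> \<le> M * \<epsilon> * norm (x - x')"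
        using oF dF R(1) unfolding r'_def by (intro ql[of R F \<epsilon>]) (auto simp: differentiable_def)
      then show "dist (F x) (F x') \<le> M * \<epsilon> * dist x x'" by (simp add: dist_norm)
    qed (use M \<epsilon> in simp)
    then have l1: "(M * \<epsilon>)-lipschitz_on (closure (\<Omega> \<inter> ball y r')) F"
    proof (rule lipschitz_on_closure)
      have "continuous_on (closure \<Omega>) F" unfolding F_def by (intro continuous_intros conth)
      then show "continuous_on (closure (\<Omega> \<inter> ball y r')) F"
        by (rule continuous_on_subset) (rule closure_mono, auto)
    qed
    have sub: "ball y r' \<inter> closure \<Omega> \<subseteq> closure (ball y r' \<inter> \<Omega>)"
      by (rule open_Int_closure_subset) simp
    have est: "\<bar>G y \<bullet> (x - y)\<bar> \<le> M * \<epsilon> * norm (x - y)" if "x \<in> ball y r'" "x \<in> frontier \<Omega>" for x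
    proof -
      have "x \<in> closure (\<Omega> \<inter> ball y r')" "y \<in> closure (\<Omega> \<inter> ball y r')"
        using sub that r' ycl by (auto simp: Int_commute frontier_def)
      then have "dist (F x) (F y) \<le> M * \<epsilon> * dist x y" by (rule lipschitz_onD[OF l1])
      moreover have "F x - F y = - (G y \<bullet> (x - y))"
        using h0[OF that(2)] h0[OF y] by (simp add: F_def inner_diff_right)
      ultimately show ?thesis by (simp add: dist_norm)
    qed
    have "\<forall>\<^sub>F s in at 0. \<bar>G y \<bullet> w s\<bar> \<le> M * \<epsilon> * norm (w s)"
      using ev[OF r']
    proof eventually_elim
      case (elim s)
      then have "\<bar>G y \<bullet> (q s - y)\<bar> \<le> M * \<epsilon> * norm (q s - y)" using est[of "q s"] by auto
      then have "\<bar>1 / s\<bar> * \<bar>G y \<bullet> (q s - y)\<bar> \<le> \<bar>1 / s\<bar> * (M * \<epsilon> * norm (q s - y))"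
        by (intro mult_left_mono) auto
      then show ?case by (simp add: w_def abs_mult[symmetric] mult.left_commute mult.assoc)
    qed
    then show ?thesis
      by (intro tendsto_le[OF _ _ _ \<open>\<forall>\<^sub>F s in at 0. \<bar>G y \<bullet> w s\<bar> \<le> M * \<epsilon> * norm (w s)\<close>]) (auto intro!: tendsto_intros wlim)
  qed
  have G\<tau>: "G y \<bullet> \<tau> = 0"
  proof -
    have "(\<lambda>J. (M * norm \<tau>) / real J) \<longlonglongrightarrow> 0" by (rule lim_const_over_n)
    moreover have "\<bar>G y \<bullet> \<tau>\<bar> \<le> (M * norm \<tau>) / real J" if "J \<ge> 1" for J
      using small[of "1 / real J"] that by simp
    ultimately have "\<bar>G y \<bullet> \<tau>\<bar> \<le> 0" by (intro LIMSEQ_le_const) blast+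
    then show ?thesis by simp
  qed
  \<comment> \<open>The boundary curve leaves \<open>y\<close> in both directions, so the one-sided condition on \<open>n\<close> gives equality.\<close>
  have nq: "\<forall>\<^sub>F s in at 0. 2 * (n \<bullet> (q s - y)) \<le> (norm (q s - y))\<^sup>2"
    using ev[OF r] by eventually_elim (intro n, simp add: frontier_def)
  have nw: "s * (2 * (n \<bullet> w s)) \<le> s * (s * (norm (w s))\<^sup>2)" if "s \<noteq> 0" "2 * (n \<bullet> (q s - y)) \<le> (norm (q s - y))\<^sup>2" for s
  proof -
    have "q s - y = s *\<^sub>R w s" using that by (simp add: w_def)
    then show ?thesis using that(2) by (simp add: power2_eq_square power_mult_distrib algebra_simps)
  qed
  have "2 * (n \<bullet> \<tau>) \<le> 0 * (norm \<tau>)\<^sup>2"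
  proof (rule tendsto_le[of "at_right (0::real)"])
    show "((\<lambda>s. s * (norm (w s))\<^sup>2) \<longlongrightarrow> 0 * (norm \<tau>)\<^sup>2) (at_right 0)" "((\<lambda>s. 2 * (n \<bullet> w s)) \<longlongrightarrow> 2 * (n \<bullet> \<tau>)) (at_right 0)"
      by (intro tendsto_intros tendsto_within_subset[OF wlim]; simp)+
    have "\<forall>\<^sub>F s in at_right 0. 2 * (n \<bullet> (q s - y)) \<le> (norm (q s - y))\<^sup>2"
      using nq by (rule filter_leD[OF at_le, rotated]) auto
    then show "\<forall>\<^sub>F s in at_right 0. 2 * (n \<bullet> w s) \<le> s * (norm (w s))\<^sup>2"
      using eventually_at_right_less[of 0]
    proof eventually_elim
      case (elim s)
      then show ?case using nw[of s] by (simp add: mult_le_cancel_left)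
    qed
  qed auto
  moreover have "0 * (norm \<tau>)\<^sup>2 \<le> 2 * (n \<bullet> \<tau>)"
  proof (rule tendsto_le[of "at_left (0::real)"])
    show "((\<lambda>s. s * (norm (w s))\<^sup>2) \<longlongrightarrow> 0 * (norm \<tau>)\<^sup>2) (at_left 0)" "((\<lambda>s. 2 * (n \<bullet> w s)) \<longlongrightarrow> 2 * (n \<bullet> \<tau>)) (at_left 0)"
      by (intro tendsto_intros tendsto_within_subset[OF wlim]; simp)+
    have "\<forall>\<^sub>F s in at_left 0. 2 * (n \<bullet> (q s - y)) \<le> (norm (q s - y))\<^sup>2"
      using nq by (rule filter_leD[OF at_le, rotated]) auto
    moreover have "\<forall>\<^sub>F s in at_left (0::real). s < 0" by (simp add: eventually_at_filter)
    ultimately show "\<forall>\<^sub>F s in at_left 0. s * (norm (w s))\<^sup>2 \<le> 2 * (n \<bullet> w s)"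
    proof eventually_elim
      case (elim s)
      then show ?case using nw[of s] by (simp add: mult_le_cancel_left)
    qed
  qed auto
  ultimately have n\<tau>: "n \<bullet> \<tau> = 0" by simp
  have \<tau>0: "\<tau> \<noteq> 0"
  proof
    assume "\<tau> = 0"
    moreover have "A \<tau> $ 1 = 1" by (simp add: \<tau>_def linear_add[OF linA] linear_scale[OF linA] e axis_def)
    ultimately show False using linear_0[OF linA] by simp
  qed
  have n1: "n $ 1 * \<tau> $ 1 + n $ 2 * \<tau> $ 2 = 0" and g1: "G y $ 1 * \<tau> $ 1 + G y $ 2 * \<tau> $ 2 = 0"
    using n\<tau> G\<tau> by (simp_all add: inner_vec_def sum_2)
  \<comment> \<open>Both \<open>n\<close> and \<open>G y\<close> are orthogonal to \<open>\<tau> \<noteq> 0\<close>, hence parallel; \<open>D\<close> is their determinant.\<close>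
  define D where "D = n $ 2 * G y $ 1 - n $ 1 * G y $ 2"
  have "D * \<tau> $ 1 = 0" "D * \<tau> $ 2 = 0" unfolding D_def using n1 g1 by algebra+
  moreover have "\<tau> $ 1 \<noteq> 0 \<or> \<tau> $ 2 \<noteq> 0" using \<tau>0 by (auto simp: vec_eq_iff forall_2)
  ultimately have "D = 0" by auto
  then show ?thesis by (simp add: inner_vec_def sum_2 Jmat_mult D_def)
qed

section \<open>The derivative of a curve with bounded second derivative\<close>

lemma norm_integral_le_const:
  fixes f :: "real \<Rightarrow> 'b::euclidean_space"
  assumes "f integrable_on {s..t}" "s \<le> t" "\<And>x. x \<in> {s..t} \<Longrightarrow> norm (f x) \<le> K"
  shows "norm (integral {s..t} f) \<le> K * (t - s)"
proof -
  have "norm (integral {s..t} f) \<le> integral {s..t} (\<lambda>x. K)"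
    using assms by (intro Henstock_Kurzweil_Integration.integral_norm_bound_integral) auto
  then show ?thesis using assms(2) by (simp add: mult.commute)
qed

text \<open>Integration by parts for the primitive of a bounded measurable function, for which no derivative
is available at every point.\<close>

lemma indefinite_integral_by_parts:
  fixes g :: "real \<Rightarrow> 'b::euclidean_space"
  assumes g: "g absolutely_integrable_on {0..1}" "\<And>x. norm (g x) \<le> C"
    and \<phi>: "\<And>x. (\<phi> has_real_derivative \<phi>' x) (at x)" "continuous_on UNIV \<phi>'"
  defines "P \<equiv> \<lambda>t. integral {0..t} g"
  shows "integral {0..1} (\<lambda>\<tau>. \<phi>' \<tau> *\<^sub>R P \<tau>) + integral {0..1} (\<lambda>\<tau>. \<phi> \<tau> *\<^sub>R g \<tau>) = \<phi> 1 *\<^sub>R P 1"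
proof -
  have contP: "continuous_on {0..1} P"
    unfolding P_def by (intro indefinite_integral_continuous_1 absint_integrable g)
  have cont\<phi>: "continuous_on A \<phi>" for A
    using \<phi>(1) by (meson DERIV_isCont continuous_at_imp_continuous_on)
  have cont\<phi>': "continuous_on A \<phi>'" for A using \<phi>(2) by (rule continuous_on_subset) auto
  have C0: "0 \<le> C" using g(2)[of 0] norm_ge_zero order_trans by blast
  obtain B where B: "\<And>x. x \<in> {0..1} \<Longrightarrow> \<bar>\<phi>' x\<bar> \<le> B"
    using compact_imp_bounded[OF compact_continuous_image[OF cont\<phi>'[of "{0..1}"]]] unfolding bounded_iff real_norm_def by blast
  have B0: "0 \<le> B" using B[of 0] by auto
  have i1: "(\<lambda>\<tau>. \<phi>' \<tau> *\<^sub>R P \<tau>) absolutely_integrable_on {0..1}"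
    by (intro absint_continuous_compact continuous_intros contP cont\<phi>') auto
  have i2: "(\<lambda>\<tau>. \<phi> \<tau> *\<^sub>R g \<tau>) absolutely_integrable_on {0..1}"
  proof -
    have "bilinear (\<lambda>(x::real) (y::'b). x *\<^sub>R y)"
      by (auto simp: bilinear_def linear_iff algebra_simps)
    moreover have "\<phi> \<in> borel_measurable (lebesgue_on {0..1})"
      by (intro continuous_imp_measurable_on_sets_lebesgue cont\<phi>) auto
    moreover have "bounded (\<phi> ` {0..1})"
      by (intro compact_imp_bounded compact_continuous_image cont\<phi>) auto
    ultimately show ?thesis
      using absolutely_integrable_bounded_measurable_product[of "\<lambda>x y. x *\<^sub>R y" \<phi> "{0..1}" g] g(1) by auto
  qed
  \<comment> \<open>\<open>E\<close> vanishes at \<open>0\<close>, and its increments are quadratic.\<close>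
  define E where "E = (\<lambda>t. \<phi> t *\<^sub>R P t - integral {0..t} (\<lambda>\<tau>. \<phi>' \<tau> *\<^sub>R P \<tau>) - integral {0..t} (\<lambda>\<tau>. \<phi> \<tau> *\<^sub>R g \<tau>))"
  have dP: "P t - P s = integral {s..t} g" if "0 \<le> s" "s \<le> t" "t \<le> 1" for s t
    unfolding P_def using integral_split[OF g(1) that] by simp
  have Plip: "norm (P t - P s) \<le> C * (t - s)" if "0 \<le> s" "s \<le> t" "t \<le> 1" for s t
    unfolding dP[OF that] using that g by (intro norm_integral_le_const absint_integrable) (auto intro: absint_sub)
  have \<phi>lip: "\<bar>\<phi> s - \<phi> t\<bar> \<le> B * (t - s)" if "0 \<le> s" "s \<le> t" "t \<le> 1" for s t
  proof -
    have "norm (\<phi> t - \<phi> s) \<le> B * norm (t - s)"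
      by (rule field_differentiable_bound[of "{0..1}" \<phi> \<phi>'])
        (use that B \<phi>(1) in \<open>auto intro: has_field_derivative_at_within\<close>)
    then show ?thesis using that by (simp add: abs_minus_commute)
  qed
  have "norm (E 1) \<le> norm (E 0)"
  proof (rule increments_quadratic[of 0 1 "\<lambda>t. t" "\<lambda>t. norm (E t)" "2 * B * C"])
    fix s t :: real assume st: "0 \<le> s" "s \<le> t" "t \<le> 1"
    have sub: "f integrable_on {s..t}" if "f absolutely_integrable_on {0..1}" for f :: "real \<Rightarrow> 'b"
      using that st by (intro absint_integrable) (auto intro: absint_sub)
    have i\<phi>': "(\<phi>' has_integral (\<phi> t - \<phi> s)) {s..t}"
      using st \<phi>(1) by (intro fundamental_theorem_of_calculus)
        (auto simp: has_real_derivative_iff_has_vector_derivative[symmetric] intro: has_field_derivative_at_within)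
    have j1: "integral {s..t} (\<lambda>\<tau>. \<phi>' \<tau> *\<^sub>R P t) = (\<phi> t - \<phi> s) *\<^sub>R P t"
      using has_integral_linear[OF i\<phi>' bounded_linear_scaleR_left[of "P t"]] by (auto simp: o_def intro: integral_unique)
    have j1': "(\<lambda>\<tau>. \<phi>' \<tau> *\<^sub>R P t) integrable_on {s..t}"
      by (intro integrable_continuous_real continuous_intros cont\<phi>')
    have j2: "integral {s..t} (\<lambda>\<tau>. \<phi> s *\<^sub>R g \<tau>) = \<phi> s *\<^sub>R (P t - P s)"
      using dP[OF st] by simp
    have j2': "(\<lambda>\<tau>. \<phi> s *\<^sub>R g \<tau>) integrable_on {s..t}" using sub[OF g(1)] by (rule integrable_cmul)
    have "E t - E s = (\<phi> t *\<^sub>R P t - \<phi> s *\<^sub>R P s) - integral {s..t} (\<lambda>\<tau>. \<phi>' \<tau> *\<^sub>R P \<tau>) - integral {s..t} (\<lambda>\<tau>. \<phi> \<tau> *\<^sub>R g \<tau>)"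
      unfolding E_def using integral_split[OF i1 st] integral_split[OF i2 st] by (simp add: algebra_simps)
    also have "\<dots> = integral {s..t} (\<lambda>\<tau>. \<phi>' \<tau> *\<^sub>R P t - \<phi>' \<tau> *\<^sub>R P \<tau>) + integral {s..t} (\<lambda>\<tau>. \<phi> s *\<^sub>R g \<tau> - \<phi> \<tau> *\<^sub>R g \<tau>)"
      unfolding Henstock_Kurzweil_Integration.integral_diff[OF j1' sub[OF i1]]
        Henstock_Kurzweil_Integration.integral_diff[OF j2' sub[OF i2]] j1 j2 by (simp add: algebra_simps)
    finally have "norm (E t - E s) \<le> norm (integral {s..t} (\<lambda>\<tau>. \<phi>' \<tau> *\<^sub>R P t - \<phi>' \<tau> *\<^sub>R P \<tau>)) + norm (integral {s..t} (\<lambda>\<tau>. \<phi> s *\<^sub>R g \<tau> - \<phi> \<tau> *\<^sub>R g \<tau>))"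
      by (simp add: norm_triangle_ineq)
    also have "norm (integral {s..t} (\<lambda>\<tau>. \<phi>' \<tau> *\<^sub>R P t - \<phi>' \<tau> *\<^sub>R P \<tau>)) \<le> (B * (C * (t - s))) * (t - s)"
    proof (rule norm_integral_le_const)
      fix x assume x: "x \<in> {s..t}"
      have "norm (\<phi>' x *\<^sub>R P t - \<phi>' x *\<^sub>R P x) = \<bar>\<phi>' x\<bar> * norm (P t - P x)" by (simp flip: scaleR_diff_right)
      also have "\<dots> \<le> B * (C * (t - s))"
        using x st B[of x] B0 Plip[of x t] C0 mult_left_mono[of "t - x" "t - s" C]
        by (intro mult_mono) auto
      finally show "norm (\<phi>' x *\<^sub>R P t - \<phi>' x *\<^sub>R P x) \<le> B * (C * (t - s))" .
    qed (use st j1' sub[OF i1] in \<open>auto intro: Henstock_Kurzweil_Integration.integrable_diff\<close>)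
    also have "norm (integral {s..t} (\<lambda>\<tau>. \<phi> s *\<^sub>R g \<tau> - \<phi> \<tau> *\<^sub>R g \<tau>)) \<le> (B * (t - s) * C) * (t - s)"
    proof (rule norm_integral_le_const)
      fix x assume x: "x \<in> {s..t}"
      have "norm (\<phi> s *\<^sub>R g x - \<phi> x *\<^sub>R g x) = \<bar>\<phi> s - \<phi> x\<bar> * norm (g x)" by (simp flip: scaleR_diff_left)
      also have "\<dots> \<le> B * (t - s) * C"
        using x st \<phi>lip[of s x] B0 g(2)[of x] mult_left_mono[of "x - s" "t - s" B] by (intro mult_mono) auto
      finally show "norm (\<phi> s *\<^sub>R g x - \<phi> x *\<^sub>R g x) \<le> B * (t - s) * C" .
    qed (use st j2' sub[OF i2] in \<open>auto intro: Henstock_Kurzweil_Integration.integrable_diff\<close>)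
    finally have "norm (E t - E s) \<le> 2 * B * C * (t - s)\<^sup>2" by (simp add: power2_eq_square algebra_simps)
    then show "norm (E t) \<le> norm (E s) + 2 * B * C * (t - s)\<^sup>2"
      using norm_triangle_ineq2[of "E t" "E s"] by linarith
  qed auto
  moreover have "E 0 = 0" by (simp add: E_def P_def)
  ultimately have "E 1 = 0" by simp
  then show ?thesis by (simp add: E_def algebra_simps)
qed

lemma real_test_function_deriv:
  fixes \<phi> :: "real \<Rightarrow> real"
  assumes "test_function S \<phi>"
  shows "(\<phi> has_real_derivative pd 1 \<phi> x) (at x)"
  using has_derivative_line[of \<phi> 0 x 1] test_function_C1(1)[OF assms] by (simp add: pd_def)

text \<open>The test functions of mean zero are the derivatives of test functions.\<close>

lemma test_function_primitive:
  fixes \<phi> :: "real \<Rightarrow> real"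
  assumes t: "test_function {0<..<1} \<phi>" and z: "integral {0<..<1} \<phi> = 0"
  shows "\<exists>\<theta>. test_function {0<..<1} \<theta> \<and> pd 1 \<theta> = \<phi>"
proof -
  obtain K where K: "compact K" "K \<subseteq> {0<..<1}" "\<And>x. x \<notin> K \<Longrightarrow> \<phi> x = 0"
    using t by (auto simp: test_function_def)
  have "\<exists>a b. 0 < a \<and> a < b \<and> b < 1 \<and> K \<subseteq> {a..b}"
  proof (cases "K = {}")
    case False
    obtain m where m: "m \<in> K" "\<And>x. x \<in> K \<Longrightarrow> m \<le> x" using compact_attains_inf[OF K(1) False] by blast
    obtain M where M: "M \<in> K" "\<And>x. x \<in> K \<Longrightarrow> x \<le> M" using compact_attains_sup[OF K(1) False] by blast
    have "0 < m" "M < 1" "m \<le> M" using m M K(2) by auto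
    then show ?thesis using m M by (intro exI[of _ "m / 2"] exI[of _ "(M + 1) / 2"]) (force simp: field_simps)
  qed (intro exI[of _ "1/3"] exI[of _ "1/2"], auto)
  then obtain a b where ab: "0 < a" "a < b" "b < 1" "K \<subseteq> {a..b}" by blast
  have \<phi>0: "\<phi> x = 0" if "x < a \<or> x > b" for x
  proof -
    have "x \<notin> K" using ab(4) that by force
    then show ?thesis by (rule K(3))
  qed
  have cont: "continuous_on A \<phi>" for A by (rule test_function_C1(2)[OF t])
  define \<theta> where "\<theta> = (\<lambda>x. integral {0..x} \<phi>)"
  have int_eq: "integral S \<phi> = integral UNIV \<phi>" if "{a..b} \<subseteq> S" for S
  proof -
    have "(\<lambda>x. if x \<in> S then \<phi> x else 0) = \<phi>"
    proof
      fix x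
      have "\<phi> x = 0" if "x \<notin> S" using that \<open>{a..b} \<subseteq> S\<close> \<phi>0[of x] by (meson atLeastAtMost_iff not_le subsetD)
      then show "(if x \<in> S then \<phi> x else 0) = \<phi> x" by simp
    qed
    then show ?thesis using integral_restrict_UNIV[of S \<phi>] by simp
  qed
  have \<theta>low: "\<theta> x = 0" if "x < a" for x
  proof -
    have "integral {0..x} \<phi> = integral {0..x} (\<lambda>x. 0)" using \<phi>0 that by (intro integral_cong) auto
    then show ?thesis by (simp add: \<theta>_def)
  qed
  have \<theta>high: "\<theta> x = 0" if "x \<ge> b" for x
  proof -
    have "{a..b} \<subseteq> {0<..<1}" "{a..b} \<subseteq> {0..x}" using that ab by auto
    then show ?thesis using int_eq[of "{0..x}"] int_eq[of "{0<..<1}"] z by (simp add: \<theta>_def)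
  qed
  have d: "(\<theta> has_real_derivative \<phi> x) (at x)" for x
  proof (cases "x < a")
    case True
    have "((\<lambda>x. 0) has_real_derivative 0) (at x)" by simp
    then have "(\<theta> has_real_derivative 0) (at x)"
      by (rule DERIV_cong_ev[THEN iffD1, rotated -1, OF _ refl _ refl])
        (use True \<theta>low in \<open>auto simp: eventually_nhds intro!: exI[of _ "{..<a}"]\<close>)
    then show ?thesis using \<phi>0 True by simp
  next
    case False
    then have x: "0 < x" using ab by simp
    have "((\<lambda>x. integral {0..x} \<phi>) has_real_derivative \<phi> x) (at x within {0..x+1})"
      using x by (intro integral_has_real_derivative cont) auto
    then show ?thesis unfolding \<theta>_def using x by (simp add: at_within_interior[of x "{0..x+1}"] interior_atLeastAtMost_real)
  qed
  have pd\<theta>: "pd 1 \<theta> = \<phi>"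
  proof
    show "pd 1 \<theta> x = \<phi> x" for x
      using pd_eq[OF d[unfolded has_field_derivative_def], of 1] by simp
  qed
  have "Cinf UNIV \<theta>"
    unfolding Cinf_iff
  proof (intro allI impI)
    fix \<alpha> :: "real list" assume \<alpha>: "set \<alpha> \<subseteq> Basis"
    show "ipd \<alpha> \<theta> differentiable_on UNIV"
    proof (cases \<alpha> rule: rev_cases)
      case Nil
      have "\<theta> differentiable (at x)" for x using d real_differentiable_def by blast
      then show ?thesis using Nil by (simp add: differentiable_on_def)
    next
      case (snoc bs b)
      then have "b = 1" "set bs \<subseteq> Basis" using \<alpha> by auto
      moreover have "Cinf UNIV \<phi>" using t by (simp add: test_function_def)
      ultimately show ?thesis using snoc pd\<theta> by (simp add: ipd_append Cinf_iff)
    qed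
  qed
  moreover have "\<theta> x = 0" if "x \<notin> {a..b}" for x using \<theta>low \<theta>high that by (cases "x < a") auto
  ultimately have "test_function {0<..<1} \<theta>"
    unfolding test_function_def using ab by (intro conjI exI[of _ "{a..b}"]) auto
  with pd\<theta> show ?thesis by blast
qed

lemma test_function_diff_scale:
  fixes \<phi> \<eta> :: "'a::euclidean_space \<Rightarrow> real"
  assumes "test_function S \<phi>" "test_function S \<eta>"
  shows "test_function S (\<lambda>x. \<phi> x - a * \<eta> x)"
    "b \<in> Basis \<Longrightarrow> pd b (\<lambda>x. \<phi> x - a * \<eta> x) = (\<lambda>x. pd b \<phi> x - a * pd b \<eta> x)"
proof -
  have pdl: "pd b (\<lambda>x. f x - a * g x) = (\<lambda>x. pd b f x - a * pd b g x)"
    if "\<And>x. f differentiable (at x)" "\<And>x. g differentiable (at x)" for f g :: "'a \<Rightarrow> real" and b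
  proof
    fix x
    have "((\<lambda>x. f x - a * g x) has_derivative (\<lambda>v. frechet_derivative f (at x) v - a * frechet_derivative g (at x) v)) (at x)"
      using that frechet_derivative_works by (intro has_derivative_diff has_derivative_mult_right) blast+
    then show "pd b (\<lambda>x. f x - a * g x) x = pd b f x - a * pd b g x" using pd_eq by (fastforce simp: pd_def)
  qed
  then show "b \<in> Basis \<Longrightarrow> pd b (\<lambda>x. \<phi> x - a * \<eta> x) = (\<lambda>x. pd b \<phi> x - a * pd b \<eta> x)"
    using test_function_C1(1)[OF assms(1)] test_function_C1(1)[OF assms(2)] by blast
  have C: "Cinf UNIV \<phi>" "Cinf UNIV \<eta>" using assms by (auto simp: test_function_def)
  have ipdl: "ipd \<alpha> (\<lambda>x. \<phi> x - a * \<eta> x) = (\<lambda>x. ipd \<alpha> \<phi> x - a * ipd \<alpha> \<eta> x)" if "set \<alpha> \<subseteq> Basis" for \<alpha>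
    using that
  proof (induction \<alpha>)
    case (Cons b bs)
    have "ipd bs \<phi> differentiable (at x)" "ipd bs \<eta> differentiable (at x)" for x
      using Cons.prems C by (auto intro!: Cinf_differentiable[of UNIV] Cinf_ipd)
    then show ?case using Cons by (simp add: pdl)
  qed simp
  have "Cinf UNIV (\<lambda>x. \<phi> x - a * \<eta> x)"
    unfolding Cinf_iff
  proof (intro allI impI)
    fix \<alpha> :: "'a list" assume \<alpha>: "set \<alpha> \<subseteq> Basis"
    then have "ipd \<alpha> \<phi> differentiable_on UNIV" "ipd \<alpha> \<eta> differentiable_on UNIV" using C by (auto simp: Cinf_iff)
    then show "ipd \<alpha> (\<lambda>x. \<phi> x - a * \<eta> x) differentiable_on UNIV"
      unfolding ipdl[OF \<alpha>] by (intro differentiable_on_diff differentiable_on_mult) auto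
  qed
  moreover obtain K K' where "compact K" "K \<subseteq> S" "\<And>x. x \<notin> K \<Longrightarrow> \<phi> x = 0"
    "compact K'" "K' \<subseteq> S" "\<And>x. x \<notin> K' \<Longrightarrow> \<eta> x = 0"
    using assms unfolding test_function_def by blast
  ultimately show "test_function S (\<lambda>x. \<phi> x - a * \<eta> x)"
    unfolding test_function_def by (intro conjI exI[of _ "K \<union> K'"]) auto
qed

text \<open>Let \<open>Q\<close> be a second primitive of the bounded weak second derivative of \<open>\<gamma>\<close>. Then \<open>w = \<gamma> - Q\<close> has weak
second derivative zero, hence a constant weak first derivative \<open>c\<close>, and \<open>Q' + c\<close> is a continuous weak
derivative of \<open>\<gamma>\<close>.\<close>

lemma weak_deriv_W2inf_continuous:
  fixes \<gamma> :: "real \<Rightarrow> 'b::euclidean_space"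
  assumes W: "W_inf 2 {0<..<1} \<gamma>" and cont: "continuous_on {0..1} \<gamma>"
  shows "\<exists>g. continuous_on {0..1} g \<and> has_weak_deriv {0<..<1} [1] \<gamma> g"
proof -
  let ?S = "{0<..<1::real}"
  have "(INF g\<in>{g. has_weak_deriv ?S [1,1] \<gamma> g}. esssup (lebesgue_on ?S) (\<lambda>x. ennreal (norm (g x)))) \<le> Wnorm 2 ?S \<gamma>"
    unfolding Wnorm_def by (rule SUP_upper) auto
  also have "\<dots> < \<infinity>" using W by (simp add: W_inf_def)
  finally obtain g2 where g2: "has_weak_deriv ?S [1,1] \<gamma> g2"
    and es: "esssup (lebesgue_on ?S) (\<lambda>x. ennreal (norm (g2 x))) < \<infinity>"
    by (auto simp: INF_less_iff)
  obtain C where C: "0 \<le> C" "esssup (lebesgue_on ?S) (\<lambda>x. ennreal (norm (g2 x))) = ennreal C"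
    using es by (cases "esssup (lebesgue_on ?S) (\<lambda>x. ennreal (norm (g2 x)))") auto
  have AE: "AE x in lebesgue_on ?S. norm (g2 x) \<le> C"
    using esssup_AE[of "\<lambda>x. ennreal (norm (g2 x))" "lebesgue_on ?S"] unfolding C(2) using C(1) by simp
  define N where "N = {x \<in> ?S. \<not> norm (g2 x) \<le> C}"
  have "AE x in lebesgue. x \<in> ?S \<longrightarrow> norm (g2 x) \<le> C"
    using AE by (subst (asm) AE_restrict_space_iff) auto
  then obtain N' where "N' \<in> null_sets lebesgue" "{x. \<not> (x \<in> ?S \<longrightarrow> norm (g2 x) \<le> C)} \<subseteq> N'"
    by (auto simp: eventually_ae_filter)
  then have negN: "negligible N"
    unfolding N_def using negligible_iff_null_sets negligible_subset by (metis (mono_tags, lifting) Collect_mono_iff)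
  \<comment> \<open>A representative of the weak second derivative that is bounded everywhere.\<close>
  define g where "g = (\<lambda>x. if x \<in> ?S - N then g2 x else 0)"
  have gC: "norm (g x) \<le> C" for x using C by (auto simp: g_def N_def)
  have li2: "locally_integrable ?S g2" using g2 by (simp add: has_weak_deriv_def)
  have gi: "g absolutely_integrable_on {0..1}"
  proof -
    define k where "k = (\<lambda>n x. if x \<in> {1 / real (n + 2)..1 - 1 / real (n + 2)} then g x else 0)"
    show ?thesis
    proof (rule dominated_convergence_absolutely_integrable[where f=k and h="\<lambda>x. C"])
      fix n :: nat
      have sub: "{1 / real (n + 2)..1 - 1 / real (n + 2)} \<subseteq> ?S"
      proof
        fix x assume x: "x \<in> {1 / real (n + 2)..1 - 1 / real (n + 2)}"
        have "1 / real (n + 2) > 0" by simp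
        then show "x \<in> ?S" using x unfolding atLeastAtMost_iff greaterThanLessThan_iff by linarith
      qed
      then have "g2 absolutely_integrable_on {1 / real (n + 2)..1 - 1 / real (n + 2)}"
        using li2 unfolding locally_integrable_def by blast
      then have "g absolutely_integrable_on {1 / real (n + 2)..1 - 1 / real (n + 2)}"
      proof (rule absolutely_integrable_spike[OF _ negN])
        fix x assume "x \<in> {1 / real (n + 2)..1 - 1 / real (n + 2)} - N"
        then have "x \<in> ?S - N" using sub by blast
        then show "g x = g2 x" by (simp add: g_def)
      qed
      then have "k n absolutely_integrable_on UNIV"
        unfolding k_def by (simp only: absolutely_integrable_restrict_UNIV)
      then show "k n absolutely_integrable_on {0..1}" by (rule set_integrable_subset) auto
    next
      fix x :: real
      have "\<forall>\<^sub>F n in sequentially. k n x = g x"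
      proof (cases "x \<in> ?S")
        case True
        have "(\<lambda>n. 1 / real (n + 2)) \<longlonglongrightarrow> 0"
          using LIMSEQ_ignore_initial_segment[OF lim_const_over_n[of 1], of 2] by simp
        then have "\<forall>\<^sub>F n in sequentially. 1 / real (n + 2) < min x (1 - x)"
          using True by (intro order_tendstoD) auto
        then show ?thesis by eventually_elim (auto simp: k_def)
      qed (auto simp: k_def g_def)
      then show "(\<lambda>n. k n x) \<longlonglongrightarrow> g x" by (rule tendsto_eventually)
    qed (use gC in auto)
  qed
  define P where "P = (\<lambda>t. integral {0..t} g)"
  have contP: "continuous_on {0..1} P"
    unfolding P_def by (intro indefinite_integral_continuous_1 absint_integrable gi)
  obtain C' where C': "\<And>x. x \<in> {0..1} \<Longrightarrow> norm (P x) \<le> C'"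
    using compact_imp_bounded[OF compact_continuous_image[OF contP]] unfolding bounded_iff by blast
  \<comment> \<open>\<open>P\<close> is only controlled on \<open>[0,1]\<close>; it is cut off, since a global bound is required below.\<close>
  define P' where "P' = (\<lambda>t. if t \<in> {0..1} then P t else 0)"
  have contP': "continuous_on {0..1} P'"
    by (rule iffD2[OF continuous_on_cong[OF refl] contP]) (simp add: P'_def)
  define Q where "Q = (\<lambda>t. integral {0..t} P')"
  have contQ: "continuous_on {0..1} Q"
    unfolding Q_def by (intro indefinite_integral_continuous_1 integrable_continuous_real contP')
  have open_closed: "integral ?S f = integral {0..1} f" for f :: "real \<Rightarrow> 'c::banach"
    using integral_open_interval[of "0::real" 1 f] by simp
  have end0: "\<phi> 1 = 0" if "test_function ?S \<phi>" for \<phi> using that by (auto simp: test_function_def)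
  have ibp: "integral ?S (\<lambda>x. pd 1 \<phi> x *\<^sub>R P x) = - integral ?S (\<lambda>x. \<phi> x *\<^sub>R g x)"
      "integral ?S (\<lambda>x. pd 1 \<phi> x *\<^sub>R Q x) = - integral ?S (\<lambda>x. \<phi> x *\<^sub>R P x)" if t: "test_function ?S \<phi>" for \<phi>
  proof -
    show "integral ?S (\<lambda>x. pd 1 \<phi> x *\<^sub>R P x) = - integral ?S (\<lambda>x. \<phi> x *\<^sub>R g x)"
      using indefinite_integral_by_parts[OF gi gC real_test_function_deriv[OF t] test_function_C1(3)[OF t]] end0[OF t]
      unfolding open_closed P_def by (simp add: eq_neg_iff_add_eq_0)
    have "norm (P' x) \<le> \<bar>C'\<bar>" for x using C'[of x] by (auto simp: P'_def)
    moreover have "P' absolutely_integrable_on {0..1}" by (intro absint_continuous_compact contP') auto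
    moreover have "integral {0..1} (\<lambda>x. \<phi> x *\<^sub>R P' x) = integral {0..1} (\<lambda>x. \<phi> x *\<^sub>R P x)"
      by (rule integral_cong) (simp add: P'_def)
    ultimately show "integral ?S (\<lambda>x. pd 1 \<phi> x *\<^sub>R Q x) = - integral ?S (\<lambda>x. \<phi> x *\<^sub>R P x)"
      using indefinite_integral_by_parts[OF _ _ real_test_function_deriv[OF t] test_function_C1(3)[OF t], of P' "\<bar>C'\<bar>"] end0[OF t]
      unfolding open_closed Q_def by (simp add: eq_neg_iff_add_eq_0)
  qed
  define w where "w = (\<lambda>x. \<gamma> x - Q x)"
  have li: "locally_integrable ?S f" if "continuous_on {0..1} f" for f :: "real \<Rightarrow> 'b"
    using that by (intro locally_integrable_continuous) (auto intro: continuous_on_subset)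
  have tpd: "test_function ?S (pd 1 \<phi>)" if "test_function ?S \<phi>" for \<phi>
    using test_function_pd[OF that, of 1] by simp
  have int: "(\<lambda>x. \<phi> x *\<^sub>R f x) integrable_on ?S" if "test_function ?S \<phi>" "continuous_on {0..1} f" for \<phi> and f :: "real \<Rightarrow> 'b"
    by (rule weak_product_integrable[OF li[OF that(2)] that(1)])
  have contw: "continuous_on {0..1} w" unfolding w_def by (intro continuous_intros cont contQ)
  have w2: "integral ?S (\<lambda>x. pd 1 (pd 1 \<phi>) x *\<^sub>R w x) = 0" if t: "test_function ?S \<phi>" for \<phi>
  proof -
    have "integral ?S (\<lambda>x. pd 1 (pd 1 \<phi>) x *\<^sub>R w x)
        = integral ?S (\<lambda>x. pd 1 (pd 1 \<phi>) x *\<^sub>R \<gamma> x) - integral ?S (\<lambda>x. pd 1 (pd 1 \<phi>) x *\<^sub>R Q x)"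
      unfolding w_def scaleR_diff_right
      by (intro Henstock_Kurzweil_Integration.integral_diff int tpd t cont contQ)
    also have "integral ?S (\<lambda>x. pd 1 (pd 1 \<phi>) x *\<^sub>R Q x) = integral ?S (\<lambda>x. \<phi> x *\<^sub>R g x)"
      using ibp(2)[OF tpd[OF t]] ibp(1)[OF t] by simp
    also have "integral ?S (\<lambda>x. pd 1 (pd 1 \<phi>) x *\<^sub>R \<gamma> x) = integral ?S (\<lambda>x. \<phi> x *\<^sub>R g2 x)"
      using g2 t unfolding has_weak_deriv_def by auto
    also have "integral ?S (\<lambda>x. \<phi> x *\<^sub>R g2 x) = integral ?S (\<lambda>x. \<phi> x *\<^sub>R g x)"
      by (rule integral_spike[OF negN]) (simp add: g_def)
    finally show ?thesis by simp
  qed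
  have "\<exists>c. \<forall>\<phi>. test_function ?S \<phi> \<longrightarrow> integral ?S (\<lambda>x. pd 1 \<phi> x *\<^sub>R w x) = - integral ?S \<phi> *\<^sub>R c"
  \<comment> \<open>A fixed test function \<open>\<eta>\<close> with nonzero integral serves to subtract the mean of any other one. If
    there were none, every test function would itself be a derivative, and \<open>c = 0\<close> would do.\<close>
  proof (cases "\<exists>\<eta>. test_function ?S \<eta> \<and> integral ?S \<eta> \<noteq> 0")
    case True
    then obtain \<eta> where \<eta>: "test_function ?S \<eta>" "integral ?S \<eta> \<noteq> 0" by blast
    define c where "c = - (1 / integral ?S \<eta>) *\<^sub>R integral ?S (\<lambda>x. pd 1 \<eta> x *\<^sub>R w x)"
    have "integral ?S (\<lambda>x. pd 1 \<phi> x *\<^sub>R w x) = - integral ?S \<phi> *\<^sub>R c" if t: "test_function ?S \<phi>" for \<phi>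
    proof -
      define a where "a = integral ?S \<phi> / integral ?S \<eta>"
      have i1: "\<phi> integrable_on ?S" "\<eta> integrable_on ?S"
        using weak_product_integrable[of ?S "\<lambda>x. 1::real", OF locally_integrable_continuous] t \<eta>(1) by force+
      have "integral ?S (\<lambda>x. \<phi> x - a * \<eta> x) = integral ?S \<phi> - a * integral ?S \<eta>"
        using i1 by (subst Henstock_Kurzweil_Integration.integral_diff) (auto intro: integrable_on_mult_right)
      also have "\<dots> = 0" using \<eta>(2) by (simp add: a_def)
      finally obtain \<theta> where \<theta>: "test_function ?S \<theta>" "pd 1 \<theta> = (\<lambda>x. \<phi> x - a * \<eta> x)"
        using test_function_primitive[OF test_function_diff_scale(1)[OF t \<eta>(1), of a]] by blast
      have "0 = integral ?S (\<lambda>x. pd 1 \<phi> x *\<^sub>R w x - a *\<^sub>R (pd 1 \<eta> x *\<^sub>R w x))"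
        using w2[OF \<theta>(1)] unfolding \<theta>(2) by (simp add: test_function_diff_scale(2)[OF t \<eta>(1)] scaleR_left_diff_distrib)
      also have "\<dots> = integral ?S (\<lambda>x. pd 1 \<phi> x *\<^sub>R w x) - a *\<^sub>R integral ?S (\<lambda>x. pd 1 \<eta> x *\<^sub>R w x)"
        unfolding Henstock_Kurzweil_Integration.integral_diff[OF int[OF tpd[OF t] contw]
            integrable_cmul[OF int[OF tpd[OF \<eta>(1)] contw], of a]] by (simp only: integral_cmul)
      finally show ?thesis by (simp add: c_def a_def)
    qed
    then show ?thesis by blast
  next
    case False
    have "integral ?S (\<lambda>x. pd 1 \<phi> x *\<^sub>R w x) = 0" if t: "test_function ?S \<phi>" for \<phi>
    proof -
      obtain \<theta> where \<theta>: "test_function ?S \<theta>" "pd 1 \<theta> = \<phi>"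
        using test_function_primitive[OF t] False t by blast
      then show ?thesis using w2[OF \<theta>(1)] by simp
    qed
    then show ?thesis by (intro exI[of _ 0]) simp
  qed
  then obtain c where c: "\<And>\<phi>. test_function ?S \<phi> \<Longrightarrow> integral ?S (\<lambda>x. pd 1 \<phi> x *\<^sub>R w x) = - integral ?S \<phi> *\<^sub>R c" by blast
  have contPc: "continuous_on {0..1} (\<lambda>x. P x + c)" by (intro continuous_intros contP)
  have "integral ?S (\<lambda>x. pd 1 \<phi> x *\<^sub>R \<gamma> x) = - integral ?S (\<lambda>x. \<phi> x *\<^sub>R (P x + c))" if t: "test_function ?S \<phi>" for \<phi>
  proof -
    have "integral ?S (\<lambda>x. pd 1 \<phi> x *\<^sub>R \<gamma> x) = integral ?S (\<lambda>x. pd 1 \<phi> x *\<^sub>R w x + pd 1 \<phi> x *\<^sub>R Q x)"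
      by (simp add: w_def scaleR_diff_right)
    also have "\<dots> = integral ?S (\<lambda>x. pd 1 \<phi> x *\<^sub>R w x) + integral ?S (\<lambda>x. pd 1 \<phi> x *\<^sub>R Q x)"
      by (intro Henstock_Kurzweil_Integration.integral_add int tpd t contw contQ)
    also have "\<dots> = - (integral ?S \<phi> *\<^sub>R c + integral ?S (\<lambda>x. \<phi> x *\<^sub>R P x))"
      using c[OF t] ibp(2)[OF t] by simp
    also have "integral ?S \<phi> *\<^sub>R c = integral ?S (\<lambda>x. \<phi> x *\<^sub>R c)"
    proof -
      have "\<phi> integrable_on ?S"
        using weak_product_integrable[of ?S "\<lambda>x. 1::real", OF locally_integrable_continuous t] by force
      from has_integral_linear[OF integrable_integral[OF this] bounded_linear_scaleR_left[of c]]
      show ?thesis by (auto simp: o_def intro: integral_unique[symmetric])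
    qed
    also have "integral ?S (\<lambda>x. \<phi> x *\<^sub>R c) + integral ?S (\<lambda>x. \<phi> x *\<^sub>R P x) = integral ?S (\<lambda>x. \<phi> x *\<^sub>R (P x + c))"
      unfolding scaleR_add_right using int[OF t contP] int[OF t continuous_on_const[of _ c]]
      by (subst Henstock_Kurzweil_Integration.integral_add) auto
    finally show ?thesis .
  qed
  then have "has_weak_deriv ?S [1] \<gamma> (\<lambda>x. P x + c)"
    unfolding has_weak_deriv_def using li[OF cont] li[OF contPc] by simp
  with contPc show ?thesis by blast
qed

lemma continuous_on_curve_deriv:
  assumes "W_inf 2 {0<..<1} \<gamma>" "continuous_on {0..1} \<gamma>"
  shows "continuous_on {0..1} (curve_deriv \<gamma>)"
  using someI_ex[OF weak_deriv_W2inf_continuous[OF assms]] unfolding curve_deriv_def by blast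

section \<open>Integral equations driven by a control\<close>

text \<open>The integral of \<open>\<Sum>\<^sub>k u\<^sub>k \<phi>\<^sub>k\<close> up to time \<open>t\<close>. Fields of the form \<open>\<Sum>\<^sub>k u\<^sub>k(t) V\<^sub>k(x)\<close> enter the
integral equations with \<open>\<phi>\<^sub>k = V\<^sub>k \<circ> X\<close>.\<close>

definition control_integral :: "(real \<Rightarrow> real^'n::finite) \<Rightarrow> ('n \<Rightarrow> real \<Rightarrow> 'a::euclidean_space) \<Rightarrow> real \<Rightarrow> 'a" where
  "control_integral u \<phi> t = integral {0..t} (\<lambda>\<tau>. \<Sum>k\<in>UNIV. u \<tau> $ k *\<^sub>R \<phi> k \<tau>)"

text \<open>The \<open>L\<^sup>1\<close> norm of the control on \<open>[0,T]\<close>, with the sum norm of its values. It takes the place of time in Gronwall estimates.\<close>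

definition control_mass :: "real \<Rightarrow> (real \<Rightarrow> real^'n::finite) \<Rightarrow> real" where
  "control_mass T u = integral {0..T} (\<lambda>\<tau>. \<Sum>k\<in>UNIV. \<bar>u \<tau> $ k\<bar>)"

context
  fixes T :: real and u :: "real \<Rightarrow> real^'n::finite"
  assumes u: "u absolutely_integrable_on {0..T}"
begin

lemma component_absint: "(\<lambda>\<tau>. u \<tau> $ k) absolutely_integrable_on {0..T}"
  using absolutely_integrable_linear[OF u bounded_linear_vec_nth[of k]] by (simp add: o_def)

lemma control_integrand_absint:
  assumes "\<And>k. continuous_on {0..T} (\<phi> k)"
  shows "(\<lambda>\<tau>. \<Sum>k\<in>UNIV. u \<tau> $ k *\<^sub>R (\<phi> k \<tau> :: 'a::euclidean_space)) absolutely_integrable_on {0..T}"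
  by (intro absolutely_integrable_sum absint_mult_cont component_absint assms) auto

lemma mass_absint: "(\<lambda>\<tau>. \<Sum>k\<in>UNIV. \<bar>u \<tau> $ k\<bar>) absolutely_integrable_on {0..T}"
  using absolutely_integrable_norm[OF component_absint]
  by (intro absolutely_integrable_sum) (auto simp: o_def)

lemma mass_le: "t \<in> {0..T} \<Longrightarrow> integral {0..t} (\<lambda>\<tau>. \<Sum>k\<in>UNIV. \<bar>u \<tau> $ k\<bar>) \<le> control_mass T u"
  unfolding control_mass_def by (rule integral_mono_ivl[OF mass_absint]) (auto intro: sum_nonneg)

lemma mass_nonneg: "0 \<le> T \<Longrightarrow> 0 \<le> control_mass T u"
  using mass_le[of 0] by simp

text \<open>The increments of control integrals are dominated by the mass of the control.\<close>

lemma control_integral_sub_bound: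
  fixes \<phi> :: "'n \<Rightarrow> real \<Rightarrow> 'a::euclidean_space"
  assumes c: "\<And>k. continuous_on {0..T} (\<phi> k)" and st: "0 \<le> s" "s \<le> t" "t \<le> T"
    and b: "\<And>k \<tau>. \<tau> \<in> {s..t} \<Longrightarrow> norm (\<phi> k \<tau>) \<le> f \<tau>"
    and f: "continuous_on {0..T} f"
  shows "norm (control_integral u \<phi> t - control_integral u \<phi> s) \<le> integral {s..t} (\<lambda>\<tau>. (\<Sum>k\<in>UNIV. \<bar>u \<tau> $ k\<bar>) * f \<tau>)"
proof -
  have "control_integral u \<phi> t - control_integral u \<phi> s = integral {s..t} (\<lambda>\<tau>. \<Sum>k\<in>UNIV. u \<tau> $ k *\<^sub>R \<phi> k \<tau>)"
    unfolding control_integral_def using integral_split[OF control_integrand_absint[of \<phi>, OF c] st] by simp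
  also have "norm \<dots> \<le> integral {s..t} (\<lambda>\<tau>. (\<Sum>k\<in>UNIV. \<bar>u \<tau> $ k\<bar>) * f \<tau>)"
  proof (rule Henstock_Kurzweil_Integration.integral_norm_bound_integral)
    show "(\<lambda>\<tau>. \<Sum>k\<in>UNIV. u \<tau> $ k *\<^sub>R \<phi> k \<tau>) integrable_on {s..t}"
      using st by (intro absint_integrable absint_sub[OF control_integrand_absint[of \<phi>, OF c]]) auto
    show "(\<lambda>\<tau>. (\<Sum>k\<in>UNIV. \<bar>u \<tau> $ k\<bar>) * f \<tau>) integrable_on {s..t}"
      using st by (intro absint_integrable absint_sub[OF absint_mult_cont_real[OF mass_absint f]]) auto
    fix \<tau> assume \<tau>: "\<tau> \<in> {s..t}"
    have "norm (\<Sum>k\<in>UNIV. u \<tau> $ k *\<^sub>R \<phi> k \<tau>) \<le> (\<Sum>k\<in>UNIV. \<bar>u \<tau> $ k\<bar> * f \<tau>)"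
      using b[OF \<tau>] by (intro sum_norm_le) (auto intro: mult_left_mono)
    then show "norm (\<Sum>k\<in>UNIV. u \<tau> $ k *\<^sub>R \<phi> k \<tau>) \<le> (\<Sum>k\<in>UNIV. \<bar>u \<tau> $ k\<bar>) * f \<tau>"
      by (simp add: sum_distrib_right)
  qed
  finally show ?thesis .
qed

lemma control_integral_bound:
  fixes \<phi> :: "'n \<Rightarrow> real \<Rightarrow> 'a::euclidean_space"
  assumes c: "\<And>k. continuous_on {0..T} (\<phi> k)" and t: "t \<in> {0..T}"
    and b: "\<And>k \<tau>. \<tau> \<in> {0..T} \<Longrightarrow> norm (\<phi> k \<tau>) \<le> P" and P: "0 \<le> P"
  shows "norm (control_integral u \<phi> t) \<le> control_mass T u * P"
proof -
  have "norm (control_integral u \<phi> t - control_integral u \<phi> 0) \<le> integral {0..t} (\<lambda>\<tau>. (\<Sum>k\<in>UNIV. \<bar>u \<tau> $ k\<bar>) * P)"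
    using t by (intro control_integral_sub_bound c b) auto
  also have "\<dots> = integral {0..t} (\<lambda>\<tau>. \<Sum>k\<in>UNIV. \<bar>u \<tau> $ k\<bar>) * P" by simp
  also have "\<dots> \<le> control_mass T u * P" by (intro mult_right_mono mass_le t P)
  finally show ?thesis by (simp add: control_integral_def)
qed

lemma control_integral_diff:
  fixes \<phi> \<psi> :: "'n \<Rightarrow> real \<Rightarrow> 'a::euclidean_space"
  assumes c: "\<And>k. continuous_on {0..T} (\<phi> k)" "\<And>k. continuous_on {0..T} (\<psi> k)" and t: "t \<in> {0..T}"
  shows "control_integral u (\<lambda>k \<tau>. \<phi> k \<tau> - \<psi> k \<tau>) t = control_integral u \<phi> t - control_integral u \<psi> t"
proof -
  have i: "(\<lambda>\<tau>. \<Sum>k\<in>UNIV. u \<tau> $ k *\<^sub>R \<phi> k \<tau>) integrable_on {0..t}" if "\<And>k. continuous_on {0..T} (\<phi> k)" for \<phi> :: "'n \<Rightarrow> real \<Rightarrow> 'a"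
    using t by (intro absint_integrable absint_sub[OF control_integrand_absint[of \<phi>, OF that]]) auto
  show ?thesis unfolding control_integral_def
    by (subst Henstock_Kurzweil_Integration.integral_diff[OF i[OF c(1)] i[OF c(2)], symmetric])
      (simp add: scaleR_diff_right sum_subtractf)
qed

text \<open>Two curves that solve an integral equation with Lipschitz integrand up to an error \<open>D\<close> stay close. The
error is measured after integration, so an oscillating perturbation of the control may count as small.\<close>

lemma control_gronwall:
  fixes X Y :: "real \<Rightarrow> 'a::euclidean_space"
  assumes T: "0 \<le> T" and XY: "continuous_on {0..T} X" "continuous_on {0..T} Y"
    and p: "\<And>k. continuous_on {0..T} (p k)" "\<And>k \<tau>. \<tau> \<in> {0..T} \<Longrightarrow> norm (p k \<tau>) \<le> L * norm (X \<tau> - Y \<tau>)"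
    and L: "0 \<le> L" and D: "0 \<le> D"
    and eq: "\<And>t. t \<in> {0..T} \<Longrightarrow> norm (X t - Y t - control_integral u p t) \<le> D"
    and t: "t \<in> {0..T}"
  shows "norm (X t - Y t) \<le> D * exp (L * control_mass T u)"
proof -
  let ?m = "\<lambda>\<tau>. \<Sum>k\<in>UNIV. \<bar>u \<tau> $ k\<bar>"
  have "norm (X t - Y t) \<le> D * exp (integral {0..t} (\<lambda>\<tau>. ?m \<tau> * L))"
  proof (rule gronwall_L1[where f="\<lambda>t. norm (X t - Y t)" and T=T])
    show "(\<lambda>\<tau>. ?m \<tau> * L) absolutely_integrable_on {0..T}"
      by (intro absint_mult_cont_real mass_absint continuous_intros)
    show "0 \<le> ?m \<tau> * L" for \<tau> using L by (intro mult_nonneg_nonneg sum_nonneg) auto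
    show "norm (X t - Y t) \<le> D + integral {0..t} (\<lambda>\<tau>. (?m \<tau> * L) * norm (X \<tau> - Y \<tau>))" if t: "t \<in> {0..T}" for t
    proof -
      have "norm (control_integral u p t - control_integral u p 0) \<le> integral {0..t} (\<lambda>\<tau>. ?m \<tau> * (L * norm (X \<tau> - Y \<tau>)))"
        using t by (intro control_integral_sub_bound p continuous_intros XY) auto
      moreover have "norm (X t - Y t) \<le> norm (X t - Y t - control_integral u p t) + norm (control_integral u p t)"
        using norm_triangle_ineq[of "X t - Y t - control_integral u p t" "control_integral u p t"] by simp
      ultimately show ?thesis using eq[OF t] by (simp add: control_integral_def mult.assoc)
    qed
  qed (use XY D t in \<open>auto intro!: continuous_intros\<close>)
  also have "integral {0..t} (\<lambda>\<tau>. ?m \<tau> * L) \<le> L * control_mass T u"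
    using mass_le[OF t] L by (simp add: mult.commute mult_left_mono)
  finally show ?thesis using D by (simp add: mult_left_mono)
qed

lemma control_system_exists:
  fixes W :: "'n \<Rightarrow> real \<Rightarrow> 'a::euclidean_space \<Rightarrow> 'a"
  assumes T: "0 \<le> T" and L: "0 \<le> L"
    and c: "\<And>k Y. continuous_on {0..T} Y \<Longrightarrow> continuous_on {0..T} (\<lambda>\<tau>. W k \<tau> (Y \<tau>))"
    and lip: "\<And>k t x y. t \<in> {0..T} \<Longrightarrow> norm (W k t x - W k t y) \<le> L * norm (x - y)"
  shows "\<exists>X. continuous_on {0..T} X \<and> (\<forall>t\<in>{0..T}. X t = x0 + control_integral u (\<lambda>k \<tau>. W k \<tau> (X \<tau>)) t)"
  unfolding control_integral_def
proof (rule caratheodory_exists[where m="\<lambda>\<tau>. (\<Sum>k\<in>UNIV. \<bar>u \<tau> $ k\<bar>) * L" and F="\<lambda>\<tau> y. \<Sum>k\<in>UNIV. u \<tau> $ k *\<^sub>R W k \<tau> y"])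
  show "(\<lambda>\<tau>. (\<Sum>k\<in>UNIV. \<bar>u \<tau> $ k\<bar>) * L) absolutely_integrable_on {0..T}"
    by (intro absint_mult_cont_real mass_absint continuous_intros)
  show "0 \<le> (\<Sum>k\<in>UNIV. \<bar>u \<tau> $ k\<bar>) * L" for \<tau> using L by (intro mult_nonneg_nonneg sum_nonneg) auto
  show "(\<lambda>\<tau>. \<Sum>k\<in>UNIV. u \<tau> $ k *\<^sub>R W k \<tau> (Y \<tau>)) absolutely_integrable_on {0..T}" if "continuous_on {0..T} Y" for Y
    by (intro control_integrand_absint c that)
  show "norm ((\<Sum>k\<in>UNIV. u t $ k *\<^sub>R W k t x) - (\<Sum>k\<in>UNIV. u t $ k *\<^sub>R W k t y)) \<le> (\<Sum>k\<in>UNIV. \<bar>u t $ k\<bar>) * L * norm (x - y)"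
    if t: "t \<in> {0..T}" for t x y
  proof -
    have "norm (\<Sum>k\<in>UNIV. u t $ k *\<^sub>R (W k t x - W k t y)) \<le> (\<Sum>k\<in>UNIV. \<bar>u t $ k\<bar> * (L * norm (x - y)))"
      using lip[OF t] by (intro sum_norm_le) (auto intro: mult_left_mono)
    then show ?thesis by (simp add: sum_distrib_right scaleR_diff_right sum_subtractf mult.assoc)
  qed
qed (rule T)

text \<open>If the fields \<open>V\<^sub>k\<close> are orthogonal to all proximal normals of a compact set \<open>K\<close>, then solutions starting in
\<open>K\<close> remain there. With \<open>y\<close> a nearest point of \<open>K\<close> to \<open>X s\<close>, the vector \<open>n = X s - y\<close> is a proximal normal, and
\<open>n \<bullet> V\<^sub>k (X) = n \<bullet> (V\<^sub>k (X) - V\<^sub>k (y))\<close> is bounded by \<open>L\<close> times the squared distance, up to terms of higher order.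
So the squared distance of \<open>X\<close> to \<open>K\<close> satisfies a Gronwall inequality; it does not have to be
differentiable.\<close>

lemma closed_set_invariant:
  fixes V :: "'n \<Rightarrow> 'a::euclidean_space \<Rightarrow> 'a"
  assumes T: "0 \<le> T" and K: "compact K" and L: "\<And>k. L-lipschitz_on UNIV (V k)"
    and tang: "\<And>k y n. y \<in> K \<Longrightarrow> (\<And>z. z \<in> K \<Longrightarrow> 2 * (n \<bullet> (z - y)) \<le> (norm (z - y))\<^sup>2) \<Longrightarrow> n \<bullet> V k y = 0"
    and X: "continuous_on {0..T} X" "\<And>t. t \<in> {0..T} \<Longrightarrow> X t = x0 + control_integral u (\<lambda>k \<tau>. V k (X \<tau>)) t"
    and x0: "x0 \<in> K" and t: "t \<in> {0..T}"
  shows "X t \<in> K"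
proof -
  let ?m = "\<lambda>\<tau>. \<Sum>k\<in>UNIV. \<bar>u \<tau> $ k\<bar>"
  define A where "A = (\<lambda>t. integral {0..t} ?m)"
  have L0: "0 \<le> L" using lipschitz_on_nonneg[OF L] .
  have clK: "closed K" "K \<noteq> {}" using K x0 by (auto intro: compact_imp_closed)
  have cV: "continuous_on {0..T} (\<lambda>\<tau>. V k (X \<tau>))" for k
    by (rule continuous_on_compose2[OF lipschitz_on_continuous_on[OF L] X(1)]) auto
  have "bounded (\<Union>k. (\<lambda>\<tau>. V k (X \<tau>)) ` {0..T})"
    by (intro bounded_UN compact_imp_bounded compact_continuous_image cV ballI) auto
  then obtain B where B': "\<forall>v\<in>(\<Union>k. (\<lambda>\<tau>. V k (X \<tau>)) ` {0..T}). norm v \<le> B" unfolding bounded_iff by blast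
  have B: "norm (V k (X \<tau>)) \<le> B" if "\<tau> \<in> {0..T}" for k \<tau>
    using that by (intro B'[rule_format] UN_I[of k] imageI) auto
  have B0: "0 \<le> B" using order_trans[OF norm_ge_zero B[of 0]] T by simp
  define d where "d = (\<lambda>t. infdist (X t) K)"
  have d0: "0 \<le> d t" for t by (simp add: d_def infdist_nonneg)
  have cd: "continuous_on {0..T} d" unfolding d_def by (intro continuous_intros X)
  obtain dm where dm: "\<And>t. t \<in> {0..T} \<Longrightarrow> d t \<le> dm"
    using compact_imp_bounded[OF compact_continuous_image[OF cd compact_Icc]] unfolding bounded_iff real_norm_def
    by (meson abs_le_D1 imageI)
  have dm0: "0 \<le> dm" using dm[of 0] d0[of 0] T by auto
  have A_diff: "integral {s..t} ?m = A t - A s" if "0 \<le> s" "s \<le> t" "t \<le> T" for s t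
    unfolding A_def using integral_split[OF mass_absint that] by simp
  have monoA: "A s \<le> A t" if "0 \<le> s" "s \<le> t" "t \<le> T" for s t
    unfolding A_def using that by (intro integral_mono_ivl[OF mass_absint]) (auto intro: sum_nonneg)
  have contA: "continuous_on {0..T} A"
    unfolding A_def by (intro indefinite_integral_continuous_1 absint_integrable mass_absint)
  define Cc where "Cc = 2 * (dm * (L * B)) + B\<^sup>2"
  have Cc0: "0 \<le> Cc" unfolding Cc_def using dm0 L0 B0 by simp
  \<comment> \<open>\<open>Cc\<close> collects the terms of second order.\<close>
  have step: "(d t)\<^sup>2 \<le> (d s)\<^sup>2 * (1 + 2 * L * (A t - A s)) + Cc * (A t - A s)\<^sup>2"
    if st: "0 \<le> s" "s \<le> t" "t \<le> T" for s t
  proof -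
    define DA where "DA = A t - A s"
    have DA0: "0 \<le> DA" using monoA[OF st] by (simp add: DA_def)
    obtain y where y: "y \<in> K" "d s = dist (X s) y" using infdist_attains_inf[OF clK, of "X s"] unfolding d_def by blast
    define n where "n = X s - y"
    have nd: "norm n = d s" by (simp add: n_def y dist_norm)
    have prox: "2 * (n \<bullet> (z - y)) \<le> (norm (z - y))\<^sup>2" if z: "z \<in> K" for z
    proof -
      have "dist (X s) y \<le> dist (X s) z" using infdist_le[OF z, of "X s"] y by (simp add: d_def)
      then have "(norm n)\<^sup>2 \<le> (norm (n - (z - y)))\<^sup>2" by (intro power_mono) (auto simp: n_def dist_norm)
      then show ?thesis by (simp add: power2_norm_eq_inner inner_diff_left inner_diff_right inner_commute)
    qed
    have nV: "n \<bullet> V k y = 0" for k using tang[OF y(1) prox] .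
    define I where "I = control_integral u (\<lambda>k \<tau>. V k (X \<tau>)) t - control_integral u (\<lambda>k \<tau>. V k (X \<tau>)) s"
    have XI: "X t = X s + I" using X(2)[of t] X(2)[of s] st by (simp add: I_def)
    have Ibd: "norm (control_integral u (\<lambda>k \<tau>. V k (X \<tau>)) \<tau> - control_integral u (\<lambda>k \<tau>. V k (X \<tau>)) s) \<le> B * DA"
      if \<tau>: "s \<le> \<tau>" "\<tau> \<le> t" for \<tau>
    proof -
      have "norm (control_integral u (\<lambda>k \<tau>. V k (X \<tau>)) \<tau> - control_integral u (\<lambda>k \<tau>. V k (X \<tau>)) s)
         \<le> integral {s..\<tau>} (\<lambda>\<tau>. ?m \<tau> * B)"
        using st \<tau> by (intro control_integral_sub_bound cV B) auto
      also have "\<dots> = (A \<tau> - A s) * B" using A_diff[of s \<tau>] st \<tau> by simp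
      also have "\<dots> \<le> DA * B" unfolding DA_def using monoA[of \<tau> t] st \<tau> B0 by (intro mult_right_mono) auto
      finally show ?thesis by (simp add: mult.commute)
    qed
    have Xy: "norm (X \<tau> - y) \<le> d s + B * DA" if \<tau>: "s \<le> \<tau>" "\<tau> \<le> t" for \<tau>
    proof -
      have "X \<tau> - y = n + (control_integral u (\<lambda>k \<tau>. V k (X \<tau>)) \<tau> - control_integral u (\<lambda>k \<tau>. V k (X \<tau>)) s)"
        using X(2)[of \<tau>] X(2)[of s] st \<tau> by (simp add: n_def)
      then have "norm (X \<tau> - y) \<le> norm n + norm (control_integral u (\<lambda>k \<tau>. V k (X \<tau>)) \<tau> - control_integral u (\<lambda>k \<tau>. V k (X \<tau>)) s)"
        by (simp only: norm_triangle_ineq)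
      then show ?thesis using Ibd[OF \<tau>] nd by simp
    qed
    have nI: "n \<bullet> I \<le> d s * (L * (d s + B * DA)) * DA"
    proof -
      have Ieq: "I = integral {s..t} (\<lambda>\<tau>. \<Sum>k\<in>UNIV. u \<tau> $ k *\<^sub>R V k (X \<tau>))"
        unfolding I_def control_integral_def
        using integral_split[OF control_integrand_absint[of "\<lambda>k \<tau>. V k (X \<tau>)", OF cV] st] by simp
      have ii: "(\<lambda>\<tau>. \<Sum>k\<in>UNIV. u \<tau> $ k *\<^sub>R V k (X \<tau>)) integrable_on {s..t}"
        using st by (intro absint_integrable absint_sub[OF control_integrand_absint[of "\<lambda>k \<tau>. V k (X \<tau>)", OF cV]]) auto
      have "((\<lambda>\<tau>. n \<bullet> (\<Sum>k\<in>UNIV. u \<tau> $ k *\<^sub>R V k (X \<tau>))) has_integral n \<bullet> I) {s..t}"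
        using has_integral_linear[OF integrable_integral[OF ii] bounded_linear_inner_right[of n]] by (simp add: o_def Ieq)
      moreover have "((\<lambda>\<tau>. ?m \<tau> * (d s * (L * (d s + B * DA)))) has_integral (A t - A s) * (d s * (L * (d s + B * DA)))) {s..t}"
        using has_integral_mult_left[OF integrable_integral, of ?m "{s..t}"] A_diff[OF st] st
          absint_integrable[OF absint_sub[OF mass_absint, of s t]] by simp
      ultimately have "n \<bullet> I \<le> (A t - A s) * (d s * (L * (d s + B * DA)))"
      proof (rule has_integral_le)
        fix \<tau> assume \<tau>: "\<tau> \<in> {s..t}"
        have "n \<bullet> (\<Sum>k\<in>UNIV. u \<tau> $ k *\<^sub>R V k (X \<tau>)) = (\<Sum>k\<in>UNIV. u \<tau> $ k * (n \<bullet> (V k (X \<tau>) - V k y)))"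
          using nV by (simp add: inner_sum_right inner_diff_right)
        also have "\<dots> \<le> (\<Sum>k\<in>UNIV. \<bar>u \<tau> $ k\<bar> * (d s * (L * (d s + B * DA))))"
        proof (rule sum_mono)
          fix k
          have "norm (V k (X \<tau>) - V k y) \<le> L * norm (X \<tau> - y)"
            using lipschitz_onD[OF L, of "X \<tau>" y k] by (simp add: dist_norm)
          also have "\<dots> \<le> L * (d s + B * DA)" using Xy[of \<tau>] \<tau> L0 by (intro mult_left_mono) auto
          finally have 1: "norm (V k (X \<tau>) - V k y) \<le> L * (d s + B * DA)" .
          have "\<bar>n \<bullet> (V k (X \<tau>) - V k y)\<bar> \<le> d s * norm (V k (X \<tau>) - V k y)"
            using Cauchy_Schwarz_ineq2[of n] nd by simp
          also have "\<dots> \<le> d s * (L * (d s + B * DA))" using 1 d0 by (intro mult_left_mono) auto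
          finally have "\<bar>u \<tau> $ k\<bar> * \<bar>n \<bullet> (V k (X \<tau>) - V k y)\<bar> \<le> \<bar>u \<tau> $ k\<bar> * (d s * (L * (d s + B * DA)))"
            by (intro mult_left_mono) auto
          then show "u \<tau> $ k * (n \<bullet> (V k (X \<tau>) - V k y)) \<le> \<bar>u \<tau> $ k\<bar> * (d s * (L * (d s + B * DA)))"
            unfolding abs_mult[symmetric] by (rule order_trans[OF abs_ge_self])
        qed
        finally show "n \<bullet> (\<Sum>k\<in>UNIV. u \<tau> $ k *\<^sub>R V k (X \<tau>)) \<le> ?m \<tau> * (d s * (L * (d s + B * DA)))"
          by (simp add: sum_distrib_right)
      qed
      then show ?thesis by (simp add: DA_def mult.commute)
    qed
    have "d t \<le> norm (X t - y)" unfolding d_def using infdist_le[OF y(1), of "X t"] by (simp add: dist_norm)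
    then have "(d t)\<^sup>2 \<le> (norm (X t - y))\<^sup>2" using d0 by (intro power_mono) auto
    also have "X t - y = n + I" using XI by (simp add: n_def)
    also have "(norm (n + I))\<^sup>2 = (d s)\<^sup>2 + 2 * (n \<bullet> I) + (norm I)\<^sup>2"
      unfolding nd[symmetric] by (simp add: power2_norm_eq_inner inner_add_left inner_add_right inner_commute)
    also have "(norm I)\<^sup>2 \<le> (B * DA)\<^sup>2" using Ibd[of t] st by (intro power_mono) (auto simp: I_def)
    also have "(d s)\<^sup>2 + 2 * (n \<bullet> I) + (B * DA)\<^sup>2 \<le> (d s)\<^sup>2 + 2 * (d s * (L * (d s + B * DA)) * DA) + (B * DA)\<^sup>2"
      using nI by simp
    also have "\<dots> = (d s)\<^sup>2 * (1 + 2 * L * DA) + (2 * (d s * (L * B)) + B\<^sup>2) * DA\<^sup>2"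
      by (simp add: power2_eq_square algebra_simps)
    also have "\<dots> \<le> (d s)\<^sup>2 * (1 + 2 * L * DA) + Cc * DA\<^sup>2"
    proof -
      have "d s * (L * B) \<le> dm * (L * B)" using dm[of s] st L0 B0 by (intro mult_right_mono) auto
      then show ?thesis unfolding Cc_def by (intro add_left_mono mult_right_mono) auto
    qed
    finally show ?thesis by (simp add: DA_def)
  qed
  have A0: "0 \<le> A s" if "0 \<le> s" "s \<le> T" for s using monoA[of 0 s] that by (simp add: A_def)
  have "(d t)\<^sup>2 * exp (- (2 * L * A t)) \<le> (d 0)\<^sup>2 * exp (- (2 * L * A 0))"
  proof (rule increments_quadratic[of 0 t A _ Cc])
    show "continuous_on {0..t} A" using contA by (rule continuous_on_subset) (use t in auto)
    fix s r assume sr: "0 \<le> s" "s \<le> r" "r \<le> t"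
    have rT: "r \<le> T" using sr t by simp
    have "(d r)\<^sup>2 \<le> (d s)\<^sup>2 * (1 + 2 * L * (A r - A s)) + Cc * (A r - A s)\<^sup>2" using step[OF sr(1,2) rT] .
    also have "(d s)\<^sup>2 * (1 + 2 * L * (A r - A s)) \<le> (d s)\<^sup>2 * exp (2 * L * (A r - A s))"
      by (intro mult_left_mono exp_ge_add_one_self) auto
    finally have "(d r)\<^sup>2 * exp (- (2 * L * A r)) \<le> ((d s)\<^sup>2 * exp (2 * L * (A r - A s)) + Cc * (A r - A s)\<^sup>2) * exp (- (2 * L * A r))"
      by (intro mult_right_mono) auto
    also have "\<dots> = (d s)\<^sup>2 * (exp (2 * L * (A r - A s)) * exp (- (2 * L * A r))) + Cc * (A r - A s)\<^sup>2 * exp (- (2 * L * A r))"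
      by (simp only: distrib_right mult.assoc)
    also have "exp (2 * L * (A r - A s)) * exp (- (2 * L * A r)) = exp (- (2 * L * A s))"
      by (simp only: exp_add[symmetric]) (simp add: algebra_simps)
    also have "Cc * (A r - A s)\<^sup>2 * exp (- (2 * L * A r)) \<le> Cc * (A r - A s)\<^sup>2 * 1"
      using Cc0 L0 A0[of r] sr rT by (intro mult_left_mono) auto
    finally show "(d r)\<^sup>2 * exp (- (2 * L * A r)) \<le> (d s)\<^sup>2 * exp (- (2 * L * A s)) + Cc * (A r - A s)\<^sup>2" by simp
  qed (use t monoA in auto)
  moreover have "d 0 = 0" using X(2)[of 0] T x0 by (simp add: d_def control_integral_def)
  ultimately have "(d t)\<^sup>2 * exp (- (2 * L * A t)) \<le> 0" by simp
  then have "d t = 0" by (simp add: mult_le_0_iff)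
  then show ?thesis using clK by (simp add: d_def in_closed_iff_infdist_zero)
qed

end

section \<open>Extension of Lipschitz functions\<close>

text \<open>The extension is the largest one: the infimum of the cones above the graph of \<open>f\<close>.\<close>

lemma mcshane_extension:
  fixes f :: "'a::metric_space \<Rightarrow> real"
  assumes f: "L-lipschitz_on K f" and K: "K \<noteq> {}"
  shows "\<exists>F. L-lipschitz_on UNIV F \<and> (\<forall>x\<in>K. F x = f x)"
proof -
  define F where "F = (\<lambda>x. INF y\<in>K. f y + L * dist x y)"
  have L0: "0 \<le> L" using lipschitz_on_nonneg[OF f] .
  obtain y0 where y0: "y0 \<in> K" using K by blast
  have bd: "bdd_below ((\<lambda>y. f y + L * dist x y) ` K)" for x
  proof (rule bdd_belowI2)
    fix y assume y: "y \<in> K"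
    have "\<bar>f y0 - f y\<bar> \<le> L * dist y0 y" using lipschitz_onD[OF f y0 y] by (simp add: dist_real_def)
    also have "\<dots> \<le> L * (dist x y0 + dist x y)" using L0 dist_triangle3[of y0 y x] by (intro mult_left_mono) auto
    finally show "f y0 - L * dist x y0 \<le> f y + L * dist x y" by (simp add: distrib_left abs_le_iff)
  qed
  have le: "F x \<le> F z + L * dist x z" for x z
  proof -
    have "F x - L * dist x z \<le> F z"
      unfolding F_def[of, THEN fun_cong, of z] F_def
    proof (rule cINF_greatest[OF K])
      fix y assume y: "y \<in> K"
      have "(INF y\<in>K. f y + L * dist x y) \<le> f y + L * dist x y" by (rule cINF_lower[OF bd y])
      also have "\<dots> \<le> f y + L * (dist x z + dist z y)"
        using L0 dist_triangle[of x y z] by (intro add_left_mono mult_left_mono) auto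
      finally show "(INF y\<in>K. f y + L * dist x y) - L * dist x z \<le> f y + L * dist z y" by (simp add: distrib_left)
    qed
    then show ?thesis by simp
  qed
  have "L-lipschitz_on UNIV F"
  proof (rule lipschitz_onI)
    fix x z show "dist (F x) (F z) \<le> L * dist x z"
      using le[of x z] le[of z x] by (simp add: dist_real_def dist_commute abs_le_iff)
  qed (rule L0)
  moreover have "F x = f x" if x: "x \<in> K" for x
  proof (rule antisym)
    show "F x \<le> f x" unfolding F_def using cINF_lower[OF bd x, of x] by simp
    show "f x \<le> F x" unfolding F_def
    proof (rule cINF_greatest[OF K])
      fix y assume y: "y \<in> K"
      show "f x \<le> f y + L * dist x y" using lipschitz_onD[OF f x y] by (simp add: dist_real_def abs_le_iff)
    qed
  qed
  ultimately show ?thesis by blast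
qed

text \<open>McShane's extension of each coordinate. The constant grows with the dimension, which is harmless here
and avoids Kirszbraun's theorem.\<close>

lemma lipschitz_extension_euclidean:
  fixes f :: "'a::metric_space \<Rightarrow> 'b::euclidean_space"
  assumes f: "L-lipschitz_on K f" and K: "K \<noteq> {}"
  shows "\<exists>F. (real DIM('b) * L)-lipschitz_on UNIV F \<and> (\<forall>x\<in>K. F x = f x)"
proof -
  have L0: "0 \<le> L" using lipschitz_on_nonneg[OF f] .
  have "\<exists>F. L-lipschitz_on UNIV F \<and> (\<forall>x\<in>K. F x = f x \<bullet> b)" if b: "b \<in> Basis" for b
  proof (rule mcshane_extension[OF _ K])
    show "L-lipschitz_on K (\<lambda>x. f x \<bullet> b)"
    proof (rule lipschitz_onI)
      fix x y assume "x \<in> K" "y \<in> K"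
      have "dist (f x \<bullet> b) (f y \<bullet> b) = \<bar>(f x - f y) \<bullet> b\<bar>" by (simp add: dist_real_def inner_diff_left)
      also have "\<dots> \<le> dist (f x) (f y)" using Basis_le_norm[OF b, of "f x - f y"] by (simp add: dist_norm)
      also have "\<dots> \<le> L * dist x y" by (rule lipschitz_onD[OF f]) fact+
      finally show "dist (f x \<bullet> b) (f y \<bullet> b) \<le> L * dist x y" .
    qed (rule L0)
  qed
  then obtain F where F: "\<And>b. b \<in> Basis \<Longrightarrow> L-lipschitz_on UNIV (F b)" "\<And>b x. b \<in> Basis \<Longrightarrow> x \<in> K \<Longrightarrow> F b x = f x \<bullet> b"
    by metis
  define G where "G = (\<lambda>x. \<Sum>b\<in>Basis. F b x *\<^sub>R b)"
  have "(real DIM('b) * L)-lipschitz_on UNIV G"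
  proof (rule lipschitz_onI)
    fix x y
    have "dist (G x) (G y) = norm (\<Sum>b\<in>Basis. (F b x - F b y) *\<^sub>R b)"
      by (simp add: G_def dist_norm sum_subtractf scaleR_diff_left)
    also have "\<dots> \<le> (\<Sum>b\<in>(Basis::'b set). L * dist x y)"
      using lipschitz_onD[OF F(1), of _ x y] by (intro sum_norm_le) (auto simp: dist_real_def)
    finally show "dist (G x) (G y) \<le> real DIM('b) * L * dist x y" by simp
  qed (use L0 in simp)
  moreover have "G x = f x" if "x \<in> K" for x
    using that by (simp add: G_def F(2) euclidean_representation)
  ultimately show ?thesis by blast
qed

section \<open>Controls with small primitives\<close>

lemma control_integral_diff_control:
  fixes u w :: "real \<Rightarrow> real^'n::finite" and \<phi> :: "'n \<Rightarrow> real \<Rightarrow> 'a::euclidean_space"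
  assumes u: "u absolutely_integrable_on {0..T}" and w: "w absolutely_integrable_on {0..T}"
    and c: "\<And>k. continuous_on {0..T} (\<phi> k)" and t: "t \<in> {0..T}"
  shows "control_integral (\<lambda>\<tau>. u \<tau> - w \<tau>) \<phi> t = control_integral u \<phi> t - control_integral w \<phi> t"
proof -
  have i: "(\<lambda>\<tau>. \<Sum>k\<in>UNIV. v \<tau> $ k *\<^sub>R \<phi> k \<tau>) integrable_on {0..t}" if "v absolutely_integrable_on {0..T}" for v :: "real \<Rightarrow> real^'n"
    using t by (intro absint_integrable absint_sub[OF control_integrand_absint[where \<phi>=\<phi>, OF that c]]) auto
  show ?thesis unfolding control_integral_def
    by (subst Henstock_Kurzweil_Integration.integral_diff[OF i[OF u] i[OF w], symmetric])
      (simp add: scaleR_diff_left sum_subtractf)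
qed

text \<open>If \<open>p\<close> has bounded mass and uniformly small primitives, its integrals against a fixed continuous
\<open>\<phi>\<close> are uniformly small. On a fine partition \<open>\<phi>\<close> is nearly constant: the oscillation costs \<open>\<epsilon>\<close> times the mass, and
each constant piece costs an increment of the primitive of \<open>p\<close>.\<close>

lemma control_integral_small:
  fixes \<phi> :: "'n::finite \<Rightarrow> real \<Rightarrow> 'a::euclidean_space"
  assumes T: "0 < T" and c: "\<And>k. continuous_on {0..T} (\<phi> k)" and M: "0 \<le> M" and e: "0 < e"
  shows "\<exists>\<eta>>0. \<forall>p :: real \<Rightarrow> real^'n. p absolutely_integrable_on {0..T} \<longrightarrow> control_mass T p \<le> M \<longrightarrow>
    (\<forall>t\<in>{0..T}. \<forall>k. \<bar>integral {0..t} (\<lambda>\<tau>. p \<tau> $ k)\<bar> \<le> \<eta>) \<longrightarrow>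
    (\<forall>t\<in>{0..T}. norm (control_integral p \<phi> t) \<le> e)"
proof -
  have "\<exists>W. \<forall>t\<in>{0..T}. norm (\<phi> k t) \<le> W" for k
    using compact_imp_bounded[OF compact_continuous_image[OF c compact_Icc]] unfolding bounded_iff by auto
  then obtain W where W: "\<And>k t. t \<in> {0..T} \<Longrightarrow> norm (\<phi> k t) \<le> W k" by metis
  define Ws where "Ws = (\<Sum>k\<in>UNIV. \<bar>W k\<bar>)"
  have Ws0: "0 \<le> Ws" unfolding Ws_def by (intro sum_nonneg) auto
  define \<epsilon> where "\<epsilon> = e / (2 * (M + 1))"
  have \<epsilon>: "\<epsilon> > 0" "\<epsilon> * M \<le> e / 2" using e M by (auto simp: \<epsilon>_def field_simps)
  have "\<exists>d>0. \<forall>s\<in>{0..T}. \<forall>t\<in>{0..T}. dist s t < d \<longrightarrow> dist (\<phi> k s) (\<phi> k t) < \<epsilon>" for k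
    using compact_uniformly_continuous[OF c compact_Icc, of k] \<epsilon> unfolding uniformly_continuous_on_def by metis
  then obtain d where d: "\<And>k. d k > 0" "\<And>k s t. s \<in> {0..T} \<Longrightarrow> t \<in> {0..T} \<Longrightarrow> dist s t < d k \<Longrightarrow> dist (\<phi> k s) (\<phi> k t) < \<epsilon>"
    by metis
  define dm where "dm = Min (range d)"
  have dm: "dm > 0" "\<And>k. dm \<le> d k" using d(1) by (auto simp: dm_def)
  obtain N0 :: nat where N0: "real N0 > T / dm" using reals_Archimedean2 by blast
  define N where "N = Suc N0"
  have N: "N > 0" "T / real N < dm"
  proof -
    have "T / dm < real N" using N0 by (simp add: N_def)
    then show "T / real N < dm" using dm T by (simp add: N_def field_simps)
  qed (simp add: N_def)
  define \<eta> where "\<eta> = e / (4 * real N * (Ws + 1))"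
  have \<eta>: "\<eta> > 0" using e N Ws0 by (simp add: \<eta>_def)
  have \<eta>2: "real N * (2 * \<eta> * Ws) \<le> e / 2"
  proof -
    have "real N * \<eta> = e / (4 * (Ws + 1))" using N by (simp add: \<eta>_def)
    then have "real N * (2 * \<eta> * Ws) = 2 * Ws * (e / (4 * (Ws + 1)))" by (metis mult.assoc mult.commute)
    also have "\<dots> = (e / 2) * (Ws / (Ws + 1))" using Ws0 by (simp add: field_simps)
    also have "\<dots> \<le> (e / 2) * 1" using e Ws0 by (intro mult_left_mono) (auto simp: divide_le_eq)
    finally show ?thesis by simp
  qed
  have "norm (control_integral p \<phi> t) \<le> e"
    if p: "p absolutely_integrable_on {0..T}" and mass: "control_mass T p \<le> M"
      and small: "\<forall>t\<in>{0..T}. \<forall>k. \<bar>integral {0..t} (\<lambda>\<tau>. p \<tau> $ k)\<bar> \<le> \<eta>" and t: "t \<in> {0..T}" for p :: "real \<Rightarrow> real^'n" and t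
  proof -
    define A where "A = (\<lambda>t. integral {0..t} (\<lambda>\<tau>. \<Sum>k\<in>UNIV. \<bar>p \<tau> $ k\<bar>))"
    have step: "norm (control_integral p \<phi> t - control_integral p \<phi> a) \<le> \<epsilon> * (A t - A a) + 2 * \<eta> * Ws"
      if at: "0 \<le> a" "a \<le> t" "t \<le> T" "t - a \<le> T / real N" for a t
    proof -
      define \<psi> where "\<psi> = (\<lambda>k \<tau>. \<phi> k \<tau> - \<phi> k a)"
      have c\<psi>: "continuous_on {0..T} (\<psi> k)" for k unfolding \<psi>_def by (intro continuous_intros c)
      have cc: "continuous_on {0..T} (\<lambda>\<tau>. \<phi> k a)" for k by (rule continuous_on_const)
      have split: "control_integral p \<phi> r = control_integral p \<psi> r + control_integral p (\<lambda>k \<tau>. \<phi> k a) r" if "r \<in> {0..T}" for r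
        using control_integral_diff[OF p, of \<phi> "\<lambda>k \<tau>. \<phi> k a" r] c cc that by (simp add: \<psi>_def)
      have 1: "norm (control_integral p \<psi> t - control_integral p \<psi> a) \<le> \<epsilon> * (A t - A a)"
      proof -
        have "norm (control_integral p \<psi> t - control_integral p \<psi> a) \<le> integral {a..t} (\<lambda>\<tau>. (\<Sum>k\<in>UNIV. \<bar>p \<tau> $ k\<bar>) * \<epsilon>)"
        proof (rule control_integral_sub_bound[OF p c\<psi> at(1-3)])
          fix k \<tau> assume \<tau>: "\<tau> \<in> {a..t}"
          have "dist \<tau> a < d k" using \<tau> at N dm(2)[of k] by (auto simp: dist_real_def)
          then have "dist (\<phi> k \<tau>) (\<phi> k a) < \<epsilon>" using \<tau> at by (intro d) auto
          then show "norm (\<psi> k \<tau>) \<le> \<epsilon>" by (simp add: \<psi>_def dist_norm)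
        qed (rule continuous_on_const)
        also have "\<dots> = (A t - A a) * \<epsilon>"
          using integral_split[OF mass_absint[OF p] at(1-3)] by (simp add: A_def)
        finally show ?thesis by (simp add: mult.commute)
      qed
      have const: "control_integral p (\<lambda>k \<tau>. \<phi> k a) r = (\<Sum>k\<in>UNIV. integral {0..r} (\<lambda>\<tau>. p \<tau> $ k) *\<^sub>R \<phi> k a)" if r: "r \<in> {0..T}" for r
      proof -
        have ik: "(\<lambda>\<tau>. p \<tau> $ k) integrable_on {0..r}" for k
          using r by (intro absint_integrable absint_sub[OF component_absint[OF p]]) auto
        have "((\<lambda>\<tau>. p \<tau> $ k *\<^sub>R \<phi> k a) has_integral integral {0..r} (\<lambda>\<tau>. p \<tau> $ k) *\<^sub>R \<phi> k a) {0..r}" for k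
          using has_integral_linear[OF integrable_integral[OF ik] bounded_linear_scaleR_left[of "\<phi> k a"], of k] by (simp add: o_def)
        then show ?thesis unfolding control_integral_def
          by (intro integral_unique has_integral_sum) auto
      qed
      have 2: "norm (control_integral p (\<lambda>k \<tau>. \<phi> k a) t - control_integral p (\<lambda>k \<tau>. \<phi> k a) a) \<le> 2 * \<eta> * Ws"
      proof -
        have "norm (\<Sum>k\<in>UNIV. (integral {0..t} (\<lambda>\<tau>. p \<tau> $ k) - integral {0..a} (\<lambda>\<tau>. p \<tau> $ k)) *\<^sub>R \<phi> k a)
           \<le> (\<Sum>k\<in>UNIV. (2 * \<eta>) * \<bar>W k\<bar>)"
        proof (rule sum_norm_le)
          fix k
          have "\<bar>integral {0..t} (\<lambda>\<tau>. p \<tau> $ k)\<bar> \<le> \<eta>" "\<bar>integral {0..a} (\<lambda>\<tau>. p \<tau> $ k)\<bar> \<le> \<eta>"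
            using small at by auto
          then have "\<bar>integral {0..t} (\<lambda>\<tau>. p \<tau> $ k) - integral {0..a} (\<lambda>\<tau>. p \<tau> $ k)\<bar> \<le> 2 * \<eta>" by linarith
          moreover have "norm (\<phi> k a) \<le> \<bar>W k\<bar>" using W[of a k] at by auto
          ultimately show "norm ((integral {0..t} (\<lambda>\<tau>. p \<tau> $ k) - integral {0..a} (\<lambda>\<tau>. p \<tau> $ k)) *\<^sub>R \<phi> k a) \<le> (2 * \<eta>) * \<bar>W k\<bar>"
            unfolding norm_scaleR using \<eta> by (intro mult_mono) auto
        qed
        then show ?thesis using at by (simp add: const scaleR_diff_left sum_subtractf Ws_def sum_distrib_left)
      qed
      have "control_integral p \<phi> t - control_integral p \<phi> a = (control_integral p \<psi> t - control_integral p \<psi> a)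
          + (control_integral p (\<lambda>k \<tau>. \<phi> k a) t - control_integral p (\<lambda>k \<tau>. \<phi> k a) a)"
        using split[of t] split[of a] at by simp
      then show ?thesis using norm_triangle_mono[OF 1 2] by simp
    qed
    have ind: "norm (control_integral p \<phi> t) \<le> \<epsilon> * A t + real i * (2 * \<eta> * Ws)"
      if "0 \<le> t" "t \<le> real i * T / real N" "i \<le> N" for i t
      using that
    proof (induction i arbitrary: t)
      case 0
      then have "t = 0" by simp
      then show ?case by (simp add: control_integral_def A_def)
    next
      case (Suc i)
      have iN: "real (Suc i) * T / real N \<le> T"
      proof -
        have "real (Suc i) * T \<le> real N * T" using Suc.prems T by (intro mult_right_mono) auto
        then show ?thesis using N by (simp add: divide_le_eq mult.commute)
      qed
      define a where "a = min t (real i * T / real N)"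
      have a0: "0 \<le> a" using Suc.prems T by (simp add: a_def)
      have at: "a \<le> t" by (simp add: a_def)
      have "t - a \<le> T / real N"
      proof (cases "t \<le> real i * T / real N")
        case False
        have "real (Suc i) * T / real N = real i * T / real N + T / real N" by (simp add: distrib_right add_divide_distrib)
        then show ?thesis using False Suc.prems(2) by (simp add: a_def)
      qed (use T in \<open>simp add: a_def\<close>)
      then have "norm (control_integral p \<phi> t - control_integral p \<phi> a) \<le> \<epsilon> * (A t - A a) + 2 * \<eta> * Ws"
        using a0 at Suc.prems iN by (intro step) auto
      moreover have "norm (control_integral p \<phi> a) \<le> \<epsilon> * A a + real i * (2 * \<eta> * Ws)"
        using a0 Suc.prems by (intro Suc.IH) (auto simp: a_def)
      moreover have "norm (control_integral p \<phi> t) \<le> norm (control_integral p \<phi> t - control_integral p \<phi> a) + norm (control_integral p \<phi> a)"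
        using norm_triangle_ineq[of "control_integral p \<phi> t - control_integral p \<phi> a" "control_integral p \<phi> a"] by simp
      ultimately show ?case by (simp add: algebra_simps)
    qed
    have "norm (control_integral p \<phi> t) \<le> \<epsilon> * A t + real N * (2 * \<eta> * Ws)"
      using t N by (intro ind) auto
    also have "\<epsilon> * A t \<le> \<epsilon> * M" unfolding A_def using mass_le[OF p t] mass \<epsilon> by (intro mult_left_mono) auto
    finally show ?thesis using \<epsilon>(2) \<eta>2 by simp
  qed
  with \<eta> show ?thesis by blast
qed

section \<open>Solutions of Caratheodory equations\<close>

lemma caratheodory_solution_cong:
  assumes "\<And>t. t \<in> {0..T} \<Longrightarrow> X t \<in> D \<Longrightarrow> F t (X t) = G t (X t)"
  shows "caratheodory_solution D T F x X \<longleftrightarrow> caratheodory_solution D T G x X"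
proof -
  have *: "caratheodory_solution D T G x X" if F: "caratheodory_solution D T F x X"
    and eq: "\<And>t. t \<in> {0..T} \<Longrightarrow> X t \<in> D \<Longrightarrow> F t (X t) = G t (X t)" for F G
    unfolding caratheodory_solution_def
  proof (intro ballI conjI)
    fix t assume t: "t \<in> {0..T}"
    have e: "F \<tau> (X \<tau>) = G \<tau> (X \<tau>)" if "\<tau> \<in> {0..t}" for \<tau>
    proof -
      have "\<tau> \<in> {0..T}" using that t by auto
      moreover from this have "X \<tau> \<in> D" using F unfolding caratheodory_solution_def by blast
      ultimately show ?thesis by (rule eq)
    qed
    have "integral {0..t} (\<lambda>\<tau>. F \<tau> (X \<tau>)) = integral {0..t} (\<lambda>\<tau>. G \<tau> (X \<tau>))" by (rule integral_cong) (rule e)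
    moreover have Ft: "X t \<in> D" "X t = x + integral {0..t} (\<lambda>\<tau>. F \<tau> (X \<tau>))"
      using F t unfolding caratheodory_solution_def by blast+
    ultimately show "X t = x + integral {0..t} (\<lambda>\<tau>. G \<tau> (X \<tau>))" by (simp only: )
    show "X t \<in> D" by (rule Ft)
    have "(\<lambda>\<tau>. F \<tau> (X \<tau>)) absolutely_integrable_on {0..t}" using F t unfolding caratheodory_solution_def by auto
    then show "(\<lambda>\<tau>. G \<tau> (X \<tau>)) absolutely_integrable_on {0..t}"
      by (rule set_integrable_cong[THEN iffD1, rotated -1]) (use e in auto)
  qed
  show ?thesis using *[of F G] *[of G F] assms by metis
qed

lemma caratheodory_solution_continuous:
  assumes "caratheodory_solution D T F x X" "0 \<le> T"
  shows "continuous_on {0..T} X"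
proof -
  have "(\<lambda>\<tau>. F \<tau> (X \<tau>)) absolutely_integrable_on {0..T}"
    and eq: "\<And>t. t \<in> {0..T} \<Longrightarrow> X t = x + integral {0..t} (\<lambda>\<tau>. F \<tau> (X \<tau>))"
    using assms unfolding caratheodory_solution_def by auto
  then have "continuous_on {0..T} (\<lambda>t. x + integral {0..t} (\<lambda>\<tau>. F \<tau> (X \<tau>)))"
    by (intro continuous_intros indefinite_integral_continuous_1 absint_integrable)
  then show ?thesis by (rule continuous_on_eq) (rule eq[symmetric])
qed

text \<open>Joint continuity from continuity in \<open>t\<close> and continuity in \<open>s\<close> uniformly in \<open>t\<close>.\<close>

lemma continuous_on_Times_uniform:
  fixes f :: "'a::metric_space \<Rightarrow> 'b::metric_space \<Rightarrow> 'c::metric_space"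
  assumes 1: "\<And>s. s \<in> S \<Longrightarrow> continuous_on A (\<lambda>t. f t s)"
    and 2: "\<And>s0 e. s0 \<in> S \<Longrightarrow> e > 0 \<Longrightarrow> \<exists>d>0. \<forall>s\<in>S. dist s s0 < d \<longrightarrow> (\<forall>t\<in>A. dist (f t s) (f t s0) < e)"
  shows "continuous_on (A \<times> S) (\<lambda>(t, s). f t s)"
  unfolding continuous_on_iff
proof (intro ballI allI impI)
  fix p e assume p: "p \<in> A \<times> S" and e: "(0::real) < e"
  obtain t0 s0 where ts: "p = (t0, s0)" "t0 \<in> A" "s0 \<in> S" using p by auto
  obtain d1 where d1: "d1 > 0" "\<And>t. t \<in> A \<Longrightarrow> dist t t0 < d1 \<Longrightarrow> dist (f t s0) (f t0 s0) < e / 2"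
    using 1[OF ts(3), unfolded continuous_on_iff] ts(2) e by (metis half_gt_zero)
  obtain d2 where d2: "d2 > 0" "\<And>s t. s \<in> S \<Longrightarrow> dist s s0 < d2 \<Longrightarrow> t \<in> A \<Longrightarrow> dist (f t s) (f t s0) < e / 2"
    using 2[OF ts(3), of "e / 2"] e by (metis half_gt_zero)
  show "\<exists>d>0. \<forall>x'\<in>A \<times> S. dist x' p < d \<longrightarrow> dist (case x' of (t, s) \<Rightarrow> f t s) (case p of (t, s) \<Rightarrow> f t s) < e"
  proof (intro exI[of _ "min d1 d2"] conjI ballI impI)
    fix q assume q: "q \<in> A \<times> S" and dq: "dist q p < min d1 d2"
    obtain t s where q': "q = (t, s)" "t \<in> A" "s \<in> S" using q by auto
    have "dist t t0 < d1" "dist s s0 < d2"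
      using dq dist_fst_le[of q p] dist_snd_le[of q p] by (auto simp: q' ts)
    then have "dist (f t s) (f t s0) < e / 2" "dist (f t s0) (f t0 s0) < e / 2" using d1 d2 q' by auto
    then have "dist (f t s) (f t0 s0) < e" using dist_triangle[of "f t s" "f t0 s0" "f t s0"] by simp
    then show "dist (case q of (t, s) \<Rightarrow> f t s) (case p of (t, s) \<Rightarrow> f t s) < e" by (simp add: q' ts)
  qed (use d1 d2 in auto)
qed

section \<open>Transport and linearised transport in a compact set\<close>

text \<open>Control fields \<open>V\<^sub>k\<close> on a compact set \<open>K\<close>, tangential in the sense of proximal normals, together with linear maps
\<open>B\<^sub>k(x)\<close> that stand for the derivatives of \<open>V\<^sub>k\<close> at \<open>x\<close>. That \<open>B\<^sub>k\<close> is this derivative is never used: only bounds and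
Lipschitz dependence on \<open>x\<close> matter.\<close>

locale transport_system =
  fixes T :: real and K :: "'a::euclidean_space set" and V :: "'n::finite \<Rightarrow> 'a \<Rightarrow> 'a"
    and B :: "'n \<Rightarrow> 'a \<Rightarrow> 'a \<Rightarrow> 'a" and L \<beta> :: real
  assumes T: "0 < T" and K: "compact K" and \<beta>: "0 \<le> \<beta>"
    and V_lip: "\<And>k. L-lipschitz_on K (V k)"
    and tangential: "\<And>k y n. y \<in> K \<Longrightarrow> (\<And>z. z \<in> K \<Longrightarrow> 2 * (n \<bullet> (z - y)) \<le> (norm (z - y))\<^sup>2) \<Longrightarrow> n \<bullet> V k y = 0"
    and B_linear: "\<And>k x. linear (B k x)"
    and B_bound: "\<And>k x b. x \<in> K \<Longrightarrow> norm (B k x b) \<le> \<beta> * norm b"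
    and B_lip: "\<And>k x y b. x \<in> K \<Longrightarrow> y \<in> K \<Longrightarrow> norm (B k x b - B k y b) \<le> L * norm (x - y) * norm b"
begin

text \<open>Solutions in \<open>K\<close> of \<open>X' = \<Sum>\<^sub>k u\<^sub>k(t) V\<^sub>k(X)\<close>, \<open>X(0) = x\<close>.\<close>

definition trajectory :: "(real \<Rightarrow> real^'n) \<Rightarrow> 'a \<Rightarrow> (real \<Rightarrow> 'a) \<Rightarrow> bool" where
  "trajectory u x X \<longleftrightarrow> caratheodory_solution K T (\<lambda>t y. \<Sum>k\<in>UNIV. u t $ k *\<^sub>R V k y) x X"

text \<open>Solutions of \<open>a' = \<Sum>\<^sub>k u\<^sub>k(t) B\<^sub>k(X(t)) a\<close>, \<open>a(0) = a0\<close>, along a curve \<open>X\<close>.\<close>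

definition linearised :: "(real \<Rightarrow> real^'n) \<Rightarrow> (real \<Rightarrow> 'a) \<Rightarrow> 'a \<Rightarrow> (real \<Rightarrow> 'a) \<Rightarrow> bool" where
  "linearised u X a0 a \<longleftrightarrow> caratheodory_solution UNIV T (\<lambda>t b. \<Sum>k\<in>UNIV. u t $ k *\<^sub>R B k (X t) b) a0 a"

lemma L_nonneg: "0 \<le> L" using lipschitz_on_nonneg[OF V_lip] .

lemma T_nonneg: "0 \<le> T" using T by simp

lemma V_comp_continuous:
  assumes "continuous_on {0..T} X" "\<And>t. t \<in> {0..T} \<Longrightarrow> X t \<in> K"
  shows "continuous_on {0..T} (\<lambda>\<tau>. V k (X \<tau>))"
  by (rule continuous_on_compose2[OF lipschitz_on_continuous_on[OF V_lip] assms(1)]) (use assms(2) in auto)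

lemma B_diff_le:
  assumes "x \<in> K" "y \<in> K"
  shows "norm (B k x a - B k y b) \<le> \<beta> * norm (a - b) + L * norm (x - y) * norm b"
proof -
  have eq: "B k x a - B k y b = B k x (a - b) + (B k x b - B k y b)"
    by (simp add: linear_diff[OF B_linear])
  show ?thesis
    unfolding eq by (rule norm_triangle_mono[OF B_bound[OF assms(1), of k "a - b"] B_lip[OF assms, of k b]])
qed

lemma B_comp_continuous:
  assumes X: "continuous_on {0..T} X" "\<And>t. t \<in> {0..T} \<Longrightarrow> X t \<in> K" and a: "continuous_on {0..T} a"
  shows "continuous_on {0..T} (\<lambda>\<tau>. B k (X \<tau>) (a \<tau>))"
  unfolding continuous_on_def
proof
  fix t assume t: "t \<in> {0..T}"
  have "((\<lambda>\<tau>. \<beta> * norm (a \<tau> - a t) + L * norm (X \<tau> - X t) * norm (a t)) \<longlongrightarrow>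
      \<beta> * norm (a t - a t) + L * norm (X t - X t) * norm (a t)) (at t within {0..T})"
    using X(1) a t unfolding continuous_on_def by (intro tendsto_intros) auto
  then have lim: "((\<lambda>\<tau>. \<beta> * norm (a \<tau> - a t) + L * norm (X \<tau> - X t) * norm (a t)) \<longlongrightarrow> 0) (at t within {0..T})"
    by simp
  have "\<forall>\<^sub>F \<tau> in at t within {0..T}. norm (B k (X \<tau>) (a \<tau>) - B k (X t) (a t)) \<le> \<beta> * norm (a \<tau> - a t) + L * norm (X \<tau> - X t) * norm (a t)"
    unfolding eventually_at_filter using X(2) t by (auto intro!: always_eventually B_diff_le)
  from Lim_null_comparison[OF this lim]
  show "((\<lambda>\<tau>. B k (X \<tau>) (a \<tau>)) \<longlongrightarrow> B k (X t) (a t)) (at t within {0..T})"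
    by (rule LIM_zero_cancel)
qed

lemma trajectory_iff:
  assumes u: "u absolutely_integrable_on {0..T}"
  shows "trajectory u x X \<longleftrightarrow> continuous_on {0..T} X \<and>
    (\<forall>t\<in>{0..T}. X t \<in> K \<and> X t = x + control_integral u (\<lambda>k \<tau>. V k (X \<tau>)) t)"
proof
  assume X: "trajectory u x X"
  then have "continuous_on {0..T} X"
    using caratheodory_solution_continuous[OF _ T_nonneg] unfolding trajectory_def by blast
  with X show "continuous_on {0..T} X \<and> (\<forall>t\<in>{0..T}. X t \<in> K \<and> X t = x + control_integral u (\<lambda>k \<tau>. V k (X \<tau>)) t)"
    unfolding trajectory_def caratheodory_solution_def control_integral_def by blast
next
  assume X: "continuous_on {0..T} X \<and> (\<forall>t\<in>{0..T}. X t \<in> K \<and> X t = x + control_integral u (\<lambda>k \<tau>. V k (X \<tau>)) t)"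
  have "(\<lambda>\<tau>. \<Sum>k\<in>UNIV. u \<tau> $ k *\<^sub>R V k (X \<tau>)) absolutely_integrable_on {0..T}"
    using X by (intro control_integrand_absint u V_comp_continuous) blast+
  note i = this
  show "trajectory u x X"
    unfolding trajectory_def caratheodory_solution_def
  proof (intro ballI conjI)
    fix t assume t: "t \<in> {0..T}"
    show "X t \<in> K" using X t by blast
    show "(\<lambda>\<tau>. \<Sum>k\<in>UNIV. u \<tau> $ k *\<^sub>R V k (X \<tau>)) absolutely_integrable_on {0..t}"
      by (rule absint_sub[OF i]) (use t in auto)
    show "X t = x + integral {0..t} (\<lambda>\<tau>. \<Sum>k\<in>UNIV. u \<tau> $ k *\<^sub>R V k (X \<tau>))"
      using X t unfolding control_integral_def by blast
  qed
qed

lemma linearised_iff: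
  assumes u: "u absolutely_integrable_on {0..T}" and X: "continuous_on {0..T} X" "\<And>t. t \<in> {0..T} \<Longrightarrow> X t \<in> K"
  shows "linearised u X a0 a \<longleftrightarrow> continuous_on {0..T} a \<and>
    (\<forall>t\<in>{0..T}. a t = a0 + control_integral u (\<lambda>k \<tau>. B k (X \<tau>) (a \<tau>)) t)"
proof
  assume a: "linearised u X a0 a"
  then have "continuous_on {0..T} a"
    using caratheodory_solution_continuous[OF _ T_nonneg] unfolding linearised_def by blast
  with a show "continuous_on {0..T} a \<and> (\<forall>t\<in>{0..T}. a t = a0 + control_integral u (\<lambda>k \<tau>. B k (X \<tau>) (a \<tau>)) t)"
    unfolding linearised_def caratheodory_solution_def control_integral_def by blast
next
  assume a: "continuous_on {0..T} a \<and> (\<forall>t\<in>{0..T}. a t = a0 + control_integral u (\<lambda>k \<tau>. B k (X \<tau>) (a \<tau>)) t)"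
  have "(\<lambda>\<tau>. \<Sum>k\<in>UNIV. u \<tau> $ k *\<^sub>R B k (X \<tau>) (a \<tau>)) absolutely_integrable_on {0..T}"
    using X a by (intro control_integrand_absint u B_comp_continuous) auto
  then show "linearised u X a0 a"
    using a unfolding linearised_def caratheodory_solution_def control_integral_def by (auto intro: absint_sub)
qed

text \<open>The fields are extended to Lipschitz fields on the whole space; the solution for the extended fields does
not leave \<open>K\<close>.\<close>

lemma trajectory_exists:
  assumes u: "u absolutely_integrable_on {0..T}" and x: "x \<in> K"
  shows "\<exists>X. trajectory u x X"
proof -
  have "K \<noteq> {}" using x by blast
  then have "\<forall>k. \<exists>F. (real DIM('a) * L)-lipschitz_on UNIV F \<and> (\<forall>x\<in>K. F x = V k x)"
    using lipschitz_extension_euclidean[OF V_lip] by blast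
  then obtain F where F: "\<And>k. (real DIM('a) * L)-lipschitz_on UNIV (F k)" "\<And>k x. x \<in> K \<Longrightarrow> F k x = V k x"
    by metis
  have "\<exists>X. continuous_on {0..T} X \<and> (\<forall>t\<in>{0..T}. X t = x + control_integral u (\<lambda>k \<tau>. F k (X \<tau>)) t)"
  proof (rule control_system_exists[OF u T_nonneg])
    show "0 \<le> real DIM('a) * L" using L_nonneg by simp
    show "continuous_on {0..T} (\<lambda>\<tau>. F k (Y \<tau>))" if "continuous_on {0..T} Y" for k Y
      by (rule continuous_on_compose2[OF lipschitz_on_continuous_on[OF F(1)] that]) auto
    show "norm (F k x - F k y) \<le> real DIM('a) * L * norm (x - y)" for k x y
      using lipschitz_onD[OF F(1), of x y k] by (simp add: dist_norm)
  qed
  then obtain X where X: "continuous_on {0..T} X" "\<And>t. t \<in> {0..T} \<Longrightarrow> X t = x + control_integral u (\<lambda>k \<tau>. F k (X \<tau>)) t"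
    by blast
  have inK: "X t \<in> K" if "t \<in> {0..T}" for t
  proof (rule closed_set_invariant[OF u T_nonneg K F(1) _ X x that])
    show "n \<bullet> F k y = 0" if "y \<in> K" "\<And>z. z \<in> K \<Longrightarrow> 2 * (n \<bullet> (z - y)) \<le> (norm (z - y))\<^sup>2" for k y n
      using tangential[OF that] F(2)[OF that(1)] by simp
  qed
  have "control_integral u (\<lambda>k \<tau>. F k (X \<tau>)) t = control_integral u (\<lambda>k \<tau>. V k (X \<tau>)) t" if "t \<in> {0..T}" for t
    unfolding control_integral_def using that inK by (intro integral_cong) (simp add: F(2))
  then have "trajectory u x X" unfolding trajectory_iff[OF u] using X inK by metis
  then show ?thesis by blast
qed

text \<open>Both the initial value and the control vary; the change of control only enters through its integral along
the second solution.\<close>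

lemma trajectory_diff_le:
  assumes u: "u absolutely_integrable_on {0..T}" and w: "w absolutely_integrable_on {0..T}"
    and X: "trajectory u x X" and Y: "trajectory w y Y"
    and D: "\<And>t. t \<in> {0..T} \<Longrightarrow> norm (control_integral (\<lambda>\<tau>. u \<tau> - w \<tau>) (\<lambda>k \<tau>. V k (Y \<tau>)) t) \<le> D"
    and t: "t \<in> {0..T}"
  shows "norm (X t - Y t) \<le> (norm (x - y) + D) * exp (L * control_mass T u)"
proof -
  have X': "continuous_on {0..T} X" "\<And>t. t \<in> {0..T} \<Longrightarrow> X t \<in> K"
    "\<And>t. t \<in> {0..T} \<Longrightarrow> X t = x + control_integral u (\<lambda>k \<tau>. V k (X \<tau>)) t" using X unfolding trajectory_iff[OF u] by blast+
  have Y': "continuous_on {0..T} Y" "\<And>t. t \<in> {0..T} \<Longrightarrow> Y t \<in> K"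
    "\<And>t. t \<in> {0..T} \<Longrightarrow> Y t = y + control_integral w (\<lambda>k \<tau>. V k (Y \<tau>)) t" using Y unfolding trajectory_iff[OF w] by blast+
  have cX: "continuous_on {0..T} (\<lambda>\<tau>. V k (X \<tau>))" for k by (rule V_comp_continuous[OF X'(1,2)])
  have cY: "continuous_on {0..T} (\<lambda>\<tau>. V k (Y \<tau>))" for k by (rule V_comp_continuous[OF Y'(1,2)])
  have D0: "0 \<le> D" using order_trans[OF norm_ge_zero D[OF t]] .
  show ?thesis
  proof (rule control_gronwall[OF u T_nonneg X'(1) Y'(1) _ _ L_nonneg _ _ t])
    show "continuous_on {0..T} (\<lambda>\<tau>. V k (X \<tau>) - V k (Y \<tau>))" for k by (intro continuous_intros cX cY)
    show "norm (V k (X \<tau>) - V k (Y \<tau>)) \<le> L * norm (X \<tau> - Y \<tau>)" if "\<tau> \<in> {0..T}" for k \<tau>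
      using lipschitz_onD[OF V_lip X'(2)[OF that] Y'(2)[OF that], of k] by (simp add: dist_norm)
    show "norm (X t - Y t - control_integral u (\<lambda>k \<tau>. V k (X \<tau>) - V k (Y \<tau>)) t) \<le> norm (x - y) + D" if t: "t \<in> {0..T}" for t
    proof -
      have "X t - Y t - control_integral u (\<lambda>k \<tau>. V k (X \<tau>) - V k (Y \<tau>)) t
          = (x - y) + control_integral (\<lambda>\<tau>. u \<tau> - w \<tau>) (\<lambda>k \<tau>. V k (Y \<tau>)) t"
        by (simp add: X'(3)[OF t] Y'(3)[OF t] control_integral_diff[OF u, where \<phi>="\<lambda>k \<tau>. V k (X \<tau>)" and \<psi>="\<lambda>k \<tau>. V k (Y \<tau>)", OF cX cY t]
          control_integral_diff_control[OF u w, where \<phi>="\<lambda>k \<tau>. V k (Y \<tau>)", OF cY t])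
      then show ?thesis using norm_triangle_mono[OF order_refl D[OF t], of "x - y"] by simp
    qed
  qed (use D0 in auto)
qed

lemma trajectory_unique:
  assumes u: "u absolutely_integrable_on {0..T}" and X: "trajectory u x X" "trajectory u x Y" and t: "t \<in> {0..T}"
  shows "X t = Y t"
proof -
  have "norm (X t - Y t) \<le> (norm (x - x) + 0) * exp (L * control_mass T u)"
    by (rule trajectory_diff_le[OF u u X _ t]) (simp add: control_integral_def)
  then show ?thesis by simp
qed

lemma linearised_exists:
  assumes u: "u absolutely_integrable_on {0..T}" and X: "continuous_on {0..T} X" "\<And>t. t \<in> {0..T} \<Longrightarrow> X t \<in> K"
  shows "\<exists>a. linearised u X a0 a"
proof -
  have "\<exists>a. continuous_on {0..T} a \<and> (\<forall>t\<in>{0..T}. a t = a0 + control_integral u (\<lambda>k \<tau>. B k (X \<tau>) (a \<tau>)) t)"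
  proof (rule control_system_exists[OF u T_nonneg \<beta>])
  show "continuous_on {0..T} (\<lambda>\<tau>. B k (X \<tau>) (Y \<tau>))" if "continuous_on {0..T} Y" for k Y
    by (rule B_comp_continuous[OF X that])
  show "norm (B k (X t) x - B k (X t) y) \<le> \<beta> * norm (x - y)" if "t \<in> {0..T}" for k t x y
    using B_bound[OF X(2)[OF that], of k "x - y"] by (simp add: linear_diff[OF B_linear])
  qed
  then show ?thesis using linearised_iff[OF u X] by blast
qed

lemma linearised_bound:
  assumes u: "u absolutely_integrable_on {0..T}" and X: "continuous_on {0..T} X" "\<And>t. t \<in> {0..T} \<Longrightarrow> X t \<in> K"
    and a: "linearised u X a0 a" and t: "t \<in> {0..T}"
  shows "norm (a t) \<le> norm a0 * exp (\<beta> * control_mass T u)"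
proof -
  have a': "continuous_on {0..T} a" "\<And>t. t \<in> {0..T} \<Longrightarrow> a t = a0 + control_integral u (\<lambda>k \<tau>. B k (X \<tau>) (a \<tau>)) t"
    using a linearised_iff[OF u X] by blast+
  have "norm (a t - 0) \<le> norm a0 * exp (\<beta> * control_mass T u)"
  proof (rule control_gronwall[OF u T_nonneg a'(1) continuous_on_const _ _ \<beta> norm_ge_zero _ t])
    show "continuous_on {0..T} (\<lambda>\<tau>. B k (X \<tau>) (a \<tau>))" for k by (rule B_comp_continuous[OF X a'(1)])
    show "norm (B k (X \<tau>) (a \<tau>)) \<le> \<beta> * norm (a \<tau> - 0)" if "\<tau> \<in> {0..T}" for k \<tau> using B_bound[OF X(2)[OF that]] by simp
    show "norm (a t - 0 - control_integral u (\<lambda>k \<tau>. B k (X \<tau>) (a \<tau>)) t) \<le> norm a0" if "t \<in> {0..T}" for t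
      using a'(2)[OF that] by simp
  qed
  then show ?thesis by simp
qed

lemma linearised_diff_le:
  assumes u: "u absolutely_integrable_on {0..T}" and w: "w absolutely_integrable_on {0..T}"
    and X: "continuous_on {0..T} X" "\<And>t. t \<in> {0..T} \<Longrightarrow> X t \<in> K"
    and Y: "continuous_on {0..T} Y" "\<And>t. t \<in> {0..T} \<Longrightarrow> Y t \<in> K"
    and a: "linearised u X a0 a" and b: "linearised w Y b0 b"
    and \<xi>: "\<And>t. t \<in> {0..T} \<Longrightarrow> norm (X t - Y t) \<le> \<xi>" and \<alpha>: "\<And>t. t \<in> {0..T} \<Longrightarrow> norm (b t) \<le> \<alpha>"
    and D: "\<And>t. t \<in> {0..T} \<Longrightarrow> norm (control_integral (\<lambda>\<tau>. u \<tau> - w \<tau>) (\<lambda>k \<tau>. B k (Y \<tau>) (b \<tau>)) t) \<le> D"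
    and t: "t \<in> {0..T}"
  shows "norm (a t - b t) \<le> (norm (a0 - b0) + control_mass T u * (L * \<xi> * \<alpha>) + D) * exp (\<beta> * control_mass T u)"
proof -
  have a': "continuous_on {0..T} a" "\<And>t. t \<in> {0..T} \<Longrightarrow> a t = a0 + control_integral u (\<lambda>k \<tau>. B k (X \<tau>) (a \<tau>)) t"
    using a linearised_iff[OF u X] by blast+
  have b': "continuous_on {0..T} b" "\<And>t. t \<in> {0..T} \<Longrightarrow> b t = b0 + control_integral w (\<lambda>k \<tau>. B k (Y \<tau>) (b \<tau>)) t"
    using b linearised_iff[OF w Y] by blast+
  have cXa: "continuous_on {0..T} (\<lambda>\<tau>. B k (X \<tau>) (a \<tau>))" for k by (rule B_comp_continuous[OF X a'(1)])
  have cXb: "continuous_on {0..T} (\<lambda>\<tau>. B k (X \<tau>) (b \<tau>))" for k by (rule B_comp_continuous[OF X b'(1)])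
  have cYb: "continuous_on {0..T} (\<lambda>\<tau>. B k (Y \<tau>) (b \<tau>))" for k by (rule B_comp_continuous[OF Y b'(1)])
  have D0: "0 \<le> D" using order_trans[OF norm_ge_zero D[OF t]] .
  have \<xi>0: "0 \<le> \<xi>" using order_trans[OF norm_ge_zero \<xi>[OF t]] .
  have \<alpha>0: "0 \<le> \<alpha>" using order_trans[OF norm_ge_zero \<alpha>[OF t]] .
  have P0: "0 \<le> L * \<xi> * \<alpha>" using L_nonneg \<xi>0 \<alpha>0 by simp
  show ?thesis
  proof (rule control_gronwall[OF u T_nonneg a'(1) b'(1) _ _ \<beta> _ _ t])
    show "continuous_on {0..T} (\<lambda>\<tau>. B k (X \<tau>) (a \<tau>) - B k (X \<tau>) (b \<tau>))" for k by (intro continuous_intros cXa cXb)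
    show "norm (B k (X \<tau>) (a \<tau>) - B k (X \<tau>) (b \<tau>)) \<le> \<beta> * norm (a \<tau> - b \<tau>)" if "\<tau> \<in> {0..T}" for k \<tau>
      using B_bound[OF X(2)[OF that], of k "a \<tau> - b \<tau>"] by (simp add: linear_diff[OF B_linear])
    show "0 \<le> norm (a0 - b0) + control_mass T u * (L * \<xi> * \<alpha>) + D"
      using D0 mult_nonneg_nonneg[OF mass_nonneg[OF u T_nonneg] P0] by (intro add_nonneg_nonneg) auto
    show "norm (a t - b t - control_integral u (\<lambda>k \<tau>. B k (X \<tau>) (a \<tau>) - B k (X \<tau>) (b \<tau>)) t)
        \<le> norm (a0 - b0) + control_mass T u * (L * \<xi> * \<alpha>) + D" if t: "t \<in> {0..T}" for t
    proof -
      have eq: "a t - b t - control_integral u (\<lambda>k \<tau>. B k (X \<tau>) (a \<tau>) - B k (X \<tau>) (b \<tau>)) t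
          = (a0 - b0) + control_integral u (\<lambda>k \<tau>. B k (X \<tau>) (b \<tau>) - B k (Y \<tau>) (b \<tau>)) t
            + control_integral (\<lambda>\<tau>. u \<tau> - w \<tau>) (\<lambda>k \<tau>. B k (Y \<tau>) (b \<tau>)) t"
        by (simp add: a'(2)[OF t] b'(2)[OF t] control_integral_diff[OF u, where \<phi>="\<lambda>k \<tau>. B k (X \<tau>) (a \<tau>)" and \<psi>="\<lambda>k \<tau>. B k (X \<tau>) (b \<tau>)", OF cXa cXb t]
          control_integral_diff[OF u, where \<phi>="\<lambda>k \<tau>. B k (X \<tau>) (b \<tau>)" and \<psi>="\<lambda>k \<tau>. B k (Y \<tau>) (b \<tau>)", OF cXb cYb t]
          control_integral_diff_control[OF u w, where \<phi>="\<lambda>k \<tau>. B k (Y \<tau>) (b \<tau>)", OF cYb t])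
      have "norm (control_integral u (\<lambda>k \<tau>. B k (X \<tau>) (b \<tau>) - B k (Y \<tau>) (b \<tau>)) t) \<le> control_mass T u * (L * \<xi> * \<alpha>)"
      proof (rule control_integral_bound[OF u _ t _ P0])
        show "continuous_on {0..T} (\<lambda>\<tau>. B k (X \<tau>) (b \<tau>) - B k (Y \<tau>) (b \<tau>))" for k by (intro continuous_intros cXb cYb)
        fix k \<tau> assume \<tau>: "\<tau> \<in> {0..T}"
        have "norm (B k (X \<tau>) (b \<tau>) - B k (Y \<tau>) (b \<tau>)) \<le> L * norm (X \<tau> - Y \<tau>) * norm (b \<tau>)"
          by (rule B_lip[OF X(2)[OF \<tau>] Y(2)[OF \<tau>]])
        also have "\<dots> \<le> L * \<xi> * \<alpha>"
          using \<xi>[OF \<tau>] \<alpha>[OF \<tau>] L_nonneg \<xi>0 by (intro mult_mono mult_nonneg_nonneg) auto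
        finally show "norm (B k (X \<tau>) (b \<tau>) - B k (Y \<tau>) (b \<tau>)) \<le> L * \<xi> * \<alpha>" .
      qed
      then show ?thesis unfolding eq using norm_triangle_mono[OF norm_triangle_mono[OF order_refl] D[OF t]] by blast
    qed
  qed
qed

lemma linearised_unique:
  assumes u: "u absolutely_integrable_on {0..T}" and X: "continuous_on {0..T} X" "\<And>t. t \<in> {0..T} \<Longrightarrow> X t \<in> K"
    and a: "linearised u X a0 a" "linearised u X a0 b" and t: "t \<in> {0..T}"
  shows "a t = b t"
proof -
  have "norm (a t - b t) \<le> (norm (a0 - a0) + control_mass T u * (L * 0 * (norm a0 * exp (\<beta> * control_mass T u))) + 0) * exp (\<beta> * control_mass T u)"
    by (rule linearised_diff_le[OF u u X X a _ linearised_bound[OF u X a(2)] _ t]) (auto simp: control_integral_def)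
  then show ?thesis by simp
qed

text \<open>Continuity of the linearised state in the control when merely the primitives of the controls converge
uniformly, under a bound on their masses. Weak convergence in \<open>L\<^sup>2\<close> implies both.\<close>

lemma linearised_weakly_continuous:
  fixes v :: "nat \<Rightarrow> real \<Rightarrow> real^'n"
  assumes u: "u absolutely_integrable_on {0..T}" and v: "\<And>n. v n absolutely_integrable_on {0..T}"
    and M: "\<And>n. control_mass T (v n) \<le> M" "\<And>n. control_mass T (\<lambda>\<tau>. v n \<tau> - u \<tau>) \<le> M"
    and prim: "\<And>e. e > 0 \<Longrightarrow> \<exists>N. \<forall>n\<ge>N. \<forall>t\<in>{0..T}. norm (integral {0..t} (\<lambda>\<tau>. v n \<tau> - u \<tau>)) \<le> e"
    and X: "trajectory u x X" "\<And>n. trajectory (v n) x (Y n)"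
    and a: "linearised u X a0 a" "\<And>n. linearised (v n) (Y n) a0 (b n)"
    and t: "t \<in> {0..T}"
  shows "(\<lambda>n. b n t) \<longlonglongrightarrow> a t"
proof -
  have X': "continuous_on {0..T} X" "\<And>t. t \<in> {0..T} \<Longrightarrow> X t \<in> K" using X(1) unfolding trajectory_iff[OF u] by blast+
  have Y': "continuous_on {0..T} (Y n)" "\<And>t. t \<in> {0..T} \<Longrightarrow> Y n t \<in> K" for n
    using X(2) unfolding trajectory_iff[OF v] by blast+
  have a': "continuous_on {0..T} a" using a(1) linearised_iff[OF u X'] by blast+
  have M0: "0 \<le> M" using mass_nonneg[OF v T_nonneg, of 0] M(1)[of 0] by simp
  have vu: "(\<lambda>\<tau>. v n \<tau> - u \<tau>) absolutely_integrable_on {0..T}" for n by (intro set_integral_diff v u)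
  have small: "\<exists>N. \<forall>n\<ge>N. \<forall>t\<in>{0..T}. norm (control_integral (\<lambda>\<tau>. v n \<tau> - u \<tau>) \<phi> t) \<le> e"
    if c: "\<And>k. continuous_on {0..T} (\<phi> k)" and e: "e > 0" for \<phi> :: "'n \<Rightarrow> real \<Rightarrow> 'a" and e
  proof -
    obtain \<eta> where \<eta>: "\<eta> > 0" "\<And>p :: real \<Rightarrow> real^'n. p absolutely_integrable_on {0..T} \<Longrightarrow> control_mass T p \<le> M \<Longrightarrow>
    (\<forall>t\<in>{0..T}. \<forall>k. \<bar>integral {0..t} (\<lambda>\<tau>. p \<tau> $ k)\<bar> \<le> \<eta>) \<Longrightarrow>
    (\<forall>t\<in>{0..T}. norm (control_integral p \<phi> t) \<le> e)"
      using control_integral_small[of T \<phi> M e, OF T c M0 e] by blast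
    obtain N where N: "\<And>n t. n \<ge> N \<Longrightarrow> t \<in> {0..T} \<Longrightarrow> norm (integral {0..t} (\<lambda>\<tau>. v n \<tau> - u \<tau>)) \<le> \<eta>"
      using prim[OF \<eta>(1)] by blast
    have "\<forall>t\<in>{0..T}. norm (control_integral (\<lambda>\<tau>. v n \<tau> - u \<tau>) \<phi> t) \<le> e" if n: "n \<ge> N" for n
    proof (rule \<eta>(2)[OF vu M(2)], intro ballI allI)
      fix t k assume t: "t \<in> {0..T}"
      have i: "(\<lambda>\<tau>. v n \<tau> - u \<tau>) integrable_on {0..t}" using t by (intro absint_integrable absint_sub[OF vu]) auto
      have "integral {0..t} (\<lambda>\<tau>. (v n \<tau> - u \<tau>) $ k) = integral {0..t} (\<lambda>\<tau>. v n \<tau> - u \<tau>) $ k"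
        using integral_linear[OF i bounded_linear_vec_nth[of k]] by (simp add: o_def)
      then show "\<bar>integral {0..t} (\<lambda>\<tau>. (v n \<tau> - u \<tau>) $ k)\<bar> \<le> \<eta>"
        using component_le_norm_cart[of "integral {0..t} (\<lambda>\<tau>. v n \<tau> - u \<tau>)" k] N[OF n t] by simp
    qed
    then show ?thesis by blast
  qed
  define E where "E = exp (max L \<beta> * M)"
  have E: "exp (L * control_mass T (v n)) \<le> E" "exp (\<beta> * control_mass T (v n)) \<le> E" for n
    unfolding E_def using M(1)[of n] M0 L_nonneg \<beta> mass_nonneg[OF v T_nonneg, of n]
    by (auto intro!: mult_mono)
  have E0: "E > 0" by (simp add: E_def)
  define \<alpha> where "\<alpha> = norm a0 * exp (\<beta> * control_mass T u)"
  have \<alpha>0: "0 \<le> \<alpha>" by (simp add: \<alpha>_def)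
  show ?thesis
  proof (rule LIMSEQ_I)
    fix e :: real assume e: "e > 0"
    define c where "c = M * (L * E * \<alpha>) * E + E"
    have c0: "c > 0" unfolding c_def using M0 L_nonneg E0 \<alpha>0 by (intro add_nonneg_pos mult_nonneg_nonneg) auto
    define \<epsilon> where "\<epsilon> = e / (2 * c)"
    have \<epsilon>: "\<epsilon> > 0" "c * \<epsilon> < e" using e c0 by (auto simp: \<epsilon>_def)
    obtain N1 where N1: "\<And>n t. n \<ge> N1 \<Longrightarrow> t \<in> {0..T} \<Longrightarrow> norm (control_integral (\<lambda>\<tau>. v n \<tau> - u \<tau>) (\<lambda>k \<tau>. V k (X \<tau>)) t) \<le> \<epsilon>"
      using small[of "\<lambda>k \<tau>. V k (X \<tau>)", OF V_comp_continuous[OF X'] \<epsilon>(1)] by blast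
    obtain N2 where N2: "\<And>n t. n \<ge> N2 \<Longrightarrow> t \<in> {0..T} \<Longrightarrow> norm (control_integral (\<lambda>\<tau>. v n \<tau> - u \<tau>) (\<lambda>k \<tau>. B k (X \<tau>) (a \<tau>)) t) \<le> \<epsilon>"
      using small[of "\<lambda>k \<tau>. B k (X \<tau>) (a \<tau>)", OF B_comp_continuous[OF X' a'] \<epsilon>(1)] by blast
    have "norm (b n t - a t) < e" if n: "n \<ge> max N1 N2" for n
    proof -
      have \<xi>: "norm (Y n s - X s) \<le> \<epsilon> * E" if s: "s \<in> {0..T}" for s
      proof -
        have "norm (Y n s - X s) \<le> (norm (x - x) + \<epsilon>) * exp (L * control_mass T (v n))"
          using n by (intro trajectory_diff_le[OF v u X(2) X(1) N1 s]) auto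
        also have "\<dots> \<le> \<epsilon> * E" using E(1)[of n] \<epsilon> by (auto intro: mult_left_mono)
        finally show ?thesis .
      qed
      have "norm (b n t - a t) \<le> (norm (a0 - a0) + control_mass T (v n) * (L * (\<epsilon> * E) * \<alpha>) + \<epsilon>) * exp (\<beta> * control_mass T (v n))"
      proof (rule linearised_diff_le[OF v u Y' X' a(2) a(1) \<xi> _ _ t])
        show "norm (a s) \<le> \<alpha>" if "s \<in> {0..T}" for s unfolding \<alpha>_def by (rule linearised_bound[OF u X' a(1) that])
      qed (use N2 n in auto)
      also have "\<dots> \<le> (M * (L * (\<epsilon> * E) * \<alpha>) + \<epsilon>) * E"
      proof -
        have p: "0 \<le> L * (\<epsilon> * E) * \<alpha>" using L_nonneg \<epsilon> E0 \<alpha>0 by simp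
        have "control_mass T (v n) * (L * (\<epsilon> * E) * \<alpha>) \<le> M * (L * (\<epsilon> * E) * \<alpha>)"
          by (rule mult_right_mono[OF M(1) p])
        then have "norm (a0 - a0) + control_mass T (v n) * (L * (\<epsilon> * E) * \<alpha>) + \<epsilon> \<le> M * (L * (\<epsilon> * E) * \<alpha>) + \<epsilon>" by simp
        moreover have "0 \<le> M * (L * (\<epsilon> * E) * \<alpha>) + \<epsilon>" using mult_nonneg_nonneg[OF M0 p] \<epsilon> by simp
        ultimately show ?thesis using E(2)[of n] by (intro mult_mono) auto
      qed
      also have "\<dots> = c * \<epsilon>" by (simp add: c_def algebra_simps)
      also have "\<dots> < e" by (rule \<epsilon>)
      finally show ?thesis .
    qed
    then show "\<exists>N. \<forall>n\<ge>N. norm (b n t - a t) < e" by blast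
  qed
qed

end

section \<open>Families of trajectories\<close>

lemma control_mass_le_L2norm:
  fixes p :: "real \<Rightarrow> real^'n::finite"
  assumes p: "L2_on {0..T} p" and T: "0 \<le> T"
  shows "control_mass T p \<le> real CARD('n) * (sqrt T * L2norm {0..T} p)"
proof -
  have pa: "p absolutely_integrable_on {0..T}" using p by (rule L2_on_absolutely_integrable) auto
  have na: "(\<lambda>\<tau>. norm (p \<tau>)) integrable_on {0..T}"
    using absint_integrable[OF absolutely_integrable_norm[OF pa]] by (simp add: o_def)
  have "control_mass T p \<le> integral {0..T} (\<lambda>\<tau>. real CARD('n) * norm (p \<tau>))"
    unfolding control_mass_def
  proof (rule integral_le)
    show "(\<lambda>\<tau>. real CARD('n) * norm (p \<tau>)) integrable_on {0..T}" using na by (rule integrable_on_mult_right)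
    show "(\<Sum>k\<in>UNIV. \<bar>p \<tau> $ k\<bar>) \<le> real CARD('n) * norm (p \<tau>)" for \<tau>
      using sum_bounded_above[of UNIV "\<lambda>k. \<bar>p \<tau> $ k\<bar>" "norm (p \<tau>)"] component_le_norm_cart[of "p \<tau>"] by simp
  qed (rule absint_integrable[OF mass_absint[OF pa]])
  also have "\<dots> = real CARD('n) * integral {0..T} (\<lambda>\<tau>. norm (p \<tau>))" by simp
  also have "integral {0..T} (\<lambda>\<tau>. norm (p \<tau>)) \<le> sqrt (T - 0) * L2norm {0..T} p"
    using T by (intro norm_integral_ivl_le' p) auto
  finally show ?thesis by (simp add: mult_left_mono)
qed

context transport_system
begin

lemma trajectory_family_continuous:
  assumes u: "u absolutely_integrable_on {0..T}"
    and X: "\<And>s. s \<in> S \<Longrightarrow> trajectory u (\<gamma> s) (\<lambda>t. X t s)" and \<gamma>: "continuous_on S \<gamma>"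
  shows "continuous_on ({0..T} \<times> S) (\<lambda>(t, s). X t (s::real))"
proof (rule continuous_on_Times_uniform)
  show "continuous_on {0..T} (\<lambda>t. X t s)" if "s \<in> S" for s
    using X[OF that] unfolding trajectory_iff[OF u] by blast
  fix s0 e assume s0: "s0 \<in> S" and e: "(0::real) < e"
  define E where "E = exp (L * control_mass T u)"
  have E: "E > 0" by (simp add: E_def)
  obtain d where d: "d > 0" "\<And>s. s \<in> S \<Longrightarrow> dist s s0 < d \<Longrightarrow> dist (\<gamma> s) (\<gamma> s0) < e / E"
    using \<gamma>[unfolded continuous_on_iff, rule_format, OF s0, of "e / E"] e E by auto
  have "dist (X t s) (X t s0) < e" if s: "s \<in> S" "dist s s0 < d" and t: "t \<in> {0..T}" for s t
  proof -
    have "norm (X t s - X t s0) \<le> (norm (\<gamma> s - \<gamma> s0) + 0) * exp (L * control_mass T u)"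
      by (rule trajectory_diff_le[OF u u X[OF s(1)] X[OF s0] _ t]) (simp add: control_integral_def)
    also have "\<dots> < e" using d(2)[OF s] E by (simp add: dist_norm E_def pos_less_divide_eq)
    finally show ?thesis by (simp add: dist_norm)
  qed
  then show "\<exists>d>0. \<forall>s\<in>S. dist s s0 < d \<longrightarrow> (\<forall>t\<in>{0..T}. dist (X t s) (X t s0) < e)" using d(1) by blast
qed

lemma linearised_family_continuous:
  assumes u: "u absolutely_integrable_on {0..T}"
    and X: "\<And>s. s \<in> S \<Longrightarrow> trajectory u (\<gamma> s) (\<lambda>t. X t s)" and \<gamma>: "continuous_on S \<gamma>"
    and a: "\<And>s. s \<in> S \<Longrightarrow> linearised u (\<lambda>t. X t s) (a0 s) (\<lambda>t. a t s)" and a0: "continuous_on S a0"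
  shows "continuous_on ({0..T} \<times> S) (\<lambda>(t, s). a t (s::real))"
proof (rule continuous_on_Times_uniform)
  have X': "continuous_on {0..T} (\<lambda>t. X t s)" "\<And>t. t \<in> {0..T} \<Longrightarrow> X t s \<in> K" if "s \<in> S" for s
    using X[OF that] unfolding trajectory_iff[OF u] by blast+
  show "continuous_on {0..T} (\<lambda>t. a t s)" if "s \<in> S" for s
    using a[OF that] linearised_iff[OF u X'[OF that]] by blast
  fix s0 e assume s0: "s0 \<in> S" and e: "(0::real) < e"
  define E where "E = exp (L * control_mass T u)"
  define E' where "E' = exp (\<beta> * control_mass T u)"
  define \<alpha> where "\<alpha> = norm (a0 s0) * exp (\<beta> * control_mass T u)"
  have "((\<lambda>s. (norm (a0 s - a0 s0) + control_mass T u * (L * (norm (\<gamma> s - \<gamma> s0) * E) * \<alpha>) + 0) * E') \<longlongrightarrow>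
    (norm (a0 s0 - a0 s0) + control_mass T u * (L * (norm (\<gamma> s0 - \<gamma> s0) * E) * \<alpha>) + 0) * E') (at s0 within S)"
    using \<gamma> a0 s0 unfolding continuous_on_def by (intro tendsto_intros) auto
  then have "\<forall>\<^sub>F s in at s0 within S. dist ((norm (a0 s - a0 s0) + control_mass T u * (L * (norm (\<gamma> s - \<gamma> s0) * E) * \<alpha>) + 0) * E') 0 < e"
    using e unfolding tendsto_iff by simp
  then obtain d where d: "d > 0" "\<And>s. s \<in> S \<Longrightarrow> s \<noteq> s0 \<Longrightarrow> dist s s0 < d \<Longrightarrow>
     dist ((norm (a0 s - a0 s0) + control_mass T u * (L * (norm (\<gamma> s - \<gamma> s0) * E) * \<alpha>) + 0) * E') 0 < e"
    unfolding eventually_at by auto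
  have "dist (a t s) (a t s0) < e" if s: "s \<in> S" "dist s s0 < d" and t: "t \<in> {0..T}" for s t
  proof (cases "s = s0")
    case False
    have \<xi>: "norm (X r s - X r s0) \<le> norm (\<gamma> s - \<gamma> s0) * E" if "r \<in> {0..T}" for r
    proof -
      have "norm (X r s - X r s0) \<le> (norm (\<gamma> s - \<gamma> s0) + 0) * exp (L * control_mass T u)"
        by (rule trajectory_diff_le[OF u u X[OF s(1)] X[OF s0] _ that]) (simp add: control_integral_def)
      then show ?thesis by (simp add: E_def)
    qed
    have "norm (a t s - a t s0) \<le> (norm (a0 s - a0 s0) + control_mass T u * (L * (norm (\<gamma> s - \<gamma> s0) * E) * \<alpha>) + 0) * E'"
      unfolding E'_def \<alpha>_def
    proof (rule linearised_diff_le[OF u u X'[OF s(1)] X'[OF s0] a[OF s(1)] a[OF s0] \<xi> _ _ t])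
      show "norm (a r s0) \<le> norm (a0 s0) * exp (\<beta> * control_mass T u)" if "r \<in> {0..T}" for r
        by (rule linearised_bound[OF u X'[OF s0] a[OF s0] that])
    qed (auto simp: control_integral_def)
    then show ?thesis using d(2)[OF s(1) False s(2)] unfolding dist_norm by simp
  qed (use e in simp)
  then show "\<exists>d>0. \<forall>s\<in>S. dist s s0 < d \<longrightarrow> (\<forall>t\<in>{0..T}. dist (a t s) (a t s0) < e)" using d(1) by blast
qed

end

section \<open>The cost as a function of the control\<close>

text \<open>The transport system of the stream functions \<open>\<Sum>\<^sub>k u\<^sub>k h\<^sub>k\<close>: the velocity \<open>J \<nabla>\<psi>\<close> and its derivative \<open>J \<nabla>\<^sup>2\<psi>\<close> have the
components \<open>V\<^sub>k\<close> and \<open>B\<^sub>k\<close>. The constant \<open>W\<close> bounds all \<open>h\<^sub>k\<close> on \<open>\<Omega>\<close>.\<close>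

locale stream_control = transport_system T "closure \<Omega>" V B L \<beta>
  for T :: real and \<Omega> :: "(real^2) set" and V :: "'n::finite \<Rightarrow> real^2 \<Rightarrow> real^2"
    and B :: "'n \<Rightarrow> real^2 \<Rightarrow> real^2 \<Rightarrow> real^2" and L \<beta> :: real +
  fixes h :: "'n \<Rightarrow> real^2 \<Rightarrow> real" and \<gamma>0 :: "real \<Rightarrow> real^2" and lam eps W :: real
  assumes velocity: "\<And>u t y. y \<in> closure \<Omega> \<Longrightarrow> Jmat *v grad \<Omega> (stream h u t) y = (\<Sum>k\<in>UNIV. u t $ k *\<^sub>R V k y)"
    and velocity_jacobian: "\<And>u t y b. y \<in> closure \<Omega> \<Longrightarrow> Jmat *v (hess \<Omega> (stream h u t) y *v b) = (\<Sum>k\<in>UNIV. u t $ k *\<^sub>R B k y b)"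
    and \<gamma>0: "continuous_on {0..1} \<gamma>0" "\<And>s. s \<in> {0..1} \<Longrightarrow> \<gamma>0 s \<in> closure \<Omega>"
    and \<gamma>0': "continuous_on {0..1} (curve_deriv \<gamma>0)"
    and eps: "0 < eps" and lam: "0 < lam"
    and \<Omega>: "\<Omega> \<in> lmeasurable"
    and h_meas: "\<And>k. h k \<in> borel_measurable (lebesgue_on \<Omega>)"
    and h_bound: "\<And>k x. x \<in> \<Omega> \<Longrightarrow> \<bar>h k x\<bar> \<le> W"
begin

lemma is_flow_iff: "is_flow \<Omega> T (stream h u) \<Phi> \<longleftrightarrow> (\<forall>x\<in>closure \<Omega>. trajectory u x (\<lambda>t. \<Phi> t x))"
  unfolding is_flow_def trajectory_def
  by (intro ball_cong refl caratheodory_solution_cong) (simp add: velocity)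

lemma state_solution_iff:
  "state_solution \<Omega> T \<gamma>0 (stream h u) X a \<longleftrightarrow>
     continuous_on ({0..T} \<times> {0..1}) (\<lambda>(t, s). X t s) \<and>
     continuous_on ({0..T} \<times> {0..1}) (\<lambda>(t, s). a t s) \<and>
     (\<forall>s\<in>{0..1}. trajectory u (\<gamma>0 s) (\<lambda>t. X t s) \<and> linearised u (\<lambda>t. X t s) (curve_deriv \<gamma>0 s) (\<lambda>t. a t s))"
proof -
  have 1: "caratheodory_solution (closure \<Omega>) T (\<lambda>t y. Jmat *v grad \<Omega> (stream h u t) y) x Y \<longleftrightarrow> trajectory u x Y" for x Y
    unfolding trajectory_def by (intro caratheodory_solution_cong) (simp add: velocity)
  have 2: "caratheodory_solution UNIV T (\<lambda>t b. Jmat *v (hess \<Omega> (stream h u t) (Y t) *v b)) a0 b \<longleftrightarrow> linearised u Y a0 b"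
    if "trajectory u x Y" for x Y a0 b
  proof -
    have "Y t \<in> closure \<Omega>" if "t \<in> {0..T}" for t
      using \<open>trajectory u x Y\<close> that unfolding trajectory_def caratheodory_solution_def by blast
    then show ?thesis unfolding linearised_def by (intro caratheodory_solution_cong) (simp add: velocity_jacobian)
  qed
  show ?thesis unfolding state_solution_def 1 using 2 by blast
qed

lemma state_solution_exists:
  assumes u: "u absolutely_integrable_on {0..T}"
  shows "\<exists>X a. state_solution \<Omega> T \<gamma>0 (stream h u) X a"
proof -
  have "\<forall>s\<in>{0..1}. \<exists>X. trajectory u (\<gamma>0 s) X" using trajectory_exists[OF u] \<gamma>0(2) by blast
  then obtain X where X: "\<And>s. s \<in> {0..1} \<Longrightarrow> trajectory u (\<gamma>0 s) (X s)" by metis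
  have X': "continuous_on {0..T} (X s)" "\<And>t. t \<in> {0..T} \<Longrightarrow> X s t \<in> closure \<Omega>" if "s \<in> {0..1}" for s
    using X[OF that] unfolding trajectory_iff[OF u] by blast+
  have "\<forall>s\<in>{0..1}. \<exists>a. linearised u (X s) (curve_deriv \<gamma>0 s) a" using linearised_exists[OF u X'] by blast
  then obtain a where a: "\<And>s. s \<in> {0..1} \<Longrightarrow> linearised u (X s) (curve_deriv \<gamma>0 s) (a s)" by metis
  have "state_solution \<Omega> T \<gamma>0 (stream h u) (\<lambda>t s. X s t) (\<lambda>t s. a s t)"
    unfolding state_solution_iff
    using X a trajectory_family_continuous[OF u, of "{0..1}" \<gamma>0 "\<lambda>t s. X s t"] \<gamma>0(1) \<gamma>0'
      linearised_family_continuous[OF u, of "{0..1}" \<gamma>0 "\<lambda>t s. X s t" "curve_deriv \<gamma>0" "\<lambda>t s. a s t"] by blast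
  then show ?thesis by blast
qed

lemma state_solution_unique:
  assumes u: "u absolutely_integrable_on {0..T}"
    and X: "state_solution \<Omega> T \<gamma>0 (stream h u) X a" and Y: "state_solution \<Omega> T \<gamma>0 (stream h u) Y b"
    and t: "t \<in> {0..T}" and s: "s \<in> {0..1}"
  shows "Y t s = X t s \<and> b t s = a t s"
proof
  have tX: "trajectory u (\<gamma>0 s) (\<lambda>t. X t s)" and la: "linearised u (\<lambda>t. X t s) (curve_deriv \<gamma>0 s) (\<lambda>t. a t s)"
    using X s unfolding state_solution_iff by blast+
  have tY: "trajectory u (\<gamma>0 s) (\<lambda>t. Y t s)" and lb: "linearised u (\<lambda>t. Y t s) (curve_deriv \<gamma>0 s) (\<lambda>t. b t s)"
    using Y s unfolding state_solution_iff by blast+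
  have eq: "Y t s = X t s" if "t \<in> {0..T}" for t by (rule trajectory_unique[OF u tY tX that])
  show "Y t s = X t s" by (rule eq[OF t])
  have "linearised u (\<lambda>t. Y t s) (curve_deriv \<gamma>0 s) (\<lambda>t. a t s)"
    using la unfolding linearised_def by (rule caratheodory_solution_cong[THEN iffD1, rotated]) (simp add: eq)
  moreover have "continuous_on {0..T} (\<lambda>t. Y t s)" "\<And>t. t \<in> {0..T} \<Longrightarrow> Y t s \<in> closure \<Omega>"
    using tY unfolding trajectory_iff[OF u] by blast+
  ultimately show "b t s = a t s" using linearised_unique[OF u _ _ lb _ t] by blast
qed

text \<open>The final value \<open>s \<mapsto> a(T,s)\<close> of the linearised state. The choice is immaterial on \<open>[0,1]\<close>, where the
solution is unique.\<close>

definition stretch :: "(real \<Rightarrow> real^'n) \<Rightarrow> real \<Rightarrow> real^2" where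
  "stretch u = (SOME f. \<exists>X a. state_solution \<Omega> T \<gamma>0 (stream h u) X a \<and> f = a T)"

text \<open>The part of the cost that rewards stretching of the curve, with positive sign.\<close>

definition stretch_gain :: "(real \<Rightarrow> real^'n) \<Rightarrow> real" where
  "stretch_gain u = (LINT s|lebesgue_on {0..1}. sqrt ((norm (stretch u s))\<^sup>2 + eps\<^sup>2))"

text \<open>The penalty term of the cost without its factor \<open>\<lambda>/2\<close>.\<close>

definition energy :: "(real \<Rightarrow> real^'n) \<Rightarrow> real" where
  "energy u = (LINT t|lebesgue_on {0..T}. (L2norm \<Omega> (stream h u t))\<^sup>2)"

lemma stretch_solution:
  assumes u: "u absolutely_integrable_on {0..T}"
  obtains X a where "state_solution \<Omega> T \<gamma>0 (stream h u) X a" "stretch u = a T"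
  using someI_ex[of "\<lambda>f. \<exists>X a. state_solution \<Omega> T \<gamma>0 (stream h u) X a \<and> f = a T"] state_solution_exists[OF u]
  unfolding stretch_def by blast

lemma state_solution_terminal_continuous:
  assumes "state_solution \<Omega> T \<gamma>0 (stream h u) X a"
  shows "continuous_on {0..1} (a T)"
proof -
  have "continuous_on ({0..T} \<times> {0..1}) (\<lambda>(t, s). a t s)" using assms unfolding state_solution_iff by blast
  moreover have "continuous_on {0..1::real} (\<lambda>s. (T, s))" by (intro continuous_intros)
  ultimately have "continuous_on {0..1} (\<lambda>s. case (T, s) of (t, s) \<Rightarrow> a t s)"
    by (rule continuous_on_compose2) (use T in auto)
  then show ?thesis by (simp add: eta_contract_eq)
qed

lemma stretch_integrable:
  assumes "continuous_on {0..1} f"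
  shows "integrable (lebesgue_on {0..1::real}) (\<lambda>s. sqrt ((norm (f s :: real^2))\<^sup>2 + eps\<^sup>2))"
  by (intro continuous_imp_integrable_real continuous_intros assms)

lemma stretch_continuous:
  assumes u: "u absolutely_integrable_on {0..T}"
  shows "continuous_on {0..1} (stretch u)"
  by (rule stretch_solution[OF u]) (metis state_solution_terminal_continuous)

text \<open>By uniqueness of the state, the cost has exactly one value.\<close>

lemma cost_value_iff:
  assumes u: "u absolutely_integrable_on {0..T}"
  shows "cost_value \<Omega> T \<gamma>0 lam eps (stream h u) c \<longleftrightarrow> c = - stretch_gain u + lam / 2 * energy u"
proof -
  obtain X a where X: "state_solution \<Omega> T \<gamma>0 (stream h u) X a" "stretch u = a T" by (rule stretch_solution[OF u])
  have "(LINT s|lebesgue_on {0..1}. sqrt ((norm (b T s))\<^sup>2 + eps\<^sup>2)) = stretch_gain u"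
    if Y: "state_solution \<Omega> T \<gamma>0 (stream h u) Y b" for Y b
    unfolding stretch_gain_def X(2)
  proof (rule Bochner_Integration.integral_cong[OF refl])
    fix s assume "s \<in> space (lebesgue_on {0..1::real})"
    then have "b T s = a T s" using state_solution_unique[OF u X(1) Y, of T s] T by simp
    then show "sqrt ((norm (b T s))\<^sup>2 + eps\<^sup>2) = sqrt ((norm (a T s))\<^sup>2 + eps\<^sup>2)" by simp
  qed
  then show ?thesis unfolding cost_value_def energy_def using X(1) by metis
qed

lemma cost_eq:
  assumes u: "u absolutely_integrable_on {0..T}"
  shows "cost \<Omega> T \<gamma>0 lam eps (stream h u) = - stretch_gain u + lam / 2 * energy u"
  unfolding cost_def cost_value_iff[OF u] by simp

lemma stretch_bound:
  obtains \<alpha> where "0 \<le> \<alpha>"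
    "\<And>u s. u absolutely_integrable_on {0..T} \<Longrightarrow> s \<in> {0..1} \<Longrightarrow> norm (stretch u s) \<le> \<alpha> * exp (\<beta> * control_mass T u)"
proof -
  obtain \<alpha> where \<alpha>: "\<And>s. s \<in> {0..1} \<Longrightarrow> norm (curve_deriv \<gamma>0 s) \<le> \<alpha>"
    using compact_imp_bounded[OF compact_continuous_image[OF \<gamma>0' compact_Icc]] unfolding bounded_iff by blast
  have \<alpha>0: "0 \<le> \<alpha>" using order_trans[OF norm_ge_zero \<alpha>[of 0]] by simp
  have "norm (stretch u s) \<le> \<alpha> * exp (\<beta> * control_mass T u)"
    if u: "u absolutely_integrable_on {0..T}" and s: "s \<in> {0..1}" for u s
  proof -
    obtain X a where X: "state_solution \<Omega> T \<gamma>0 (stream h u) X a" "stretch u = a T" by (rule stretch_solution[OF u])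
    have tX: "trajectory u (\<gamma>0 s) (\<lambda>t. X t s)" and la: "linearised u (\<lambda>t. X t s) (curve_deriv \<gamma>0 s) (\<lambda>t. a t s)"
      using X(1) s unfolding state_solution_iff by blast+
    have X': "continuous_on {0..T} (\<lambda>t. X t s)" "\<And>t. t \<in> {0..T} \<Longrightarrow> X t s \<in> closure \<Omega>"
      using tX unfolding trajectory_iff[OF u] by blast+
    have "norm (a T s) \<le> norm (curve_deriv \<gamma>0 s) * exp (\<beta> * control_mass T u)"
      by (rule linearised_bound[OF u X' la]) (use T in auto)
    also have "\<dots> \<le> \<alpha> * exp (\<beta> * control_mass T u)" using \<alpha>[OF s] by (intro mult_right_mono) auto
    finally show ?thesis by (simp add: X(2))
  qed
  with \<alpha>0 show ?thesis by (rule that)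
qed

lemma sqrt_norm_eps_le: "sqrt ((norm (x :: real^2))\<^sup>2 + eps\<^sup>2) \<le> norm x + eps"
  using sqrt_sum_squares_le_sum[of "norm x" eps] eps by simp

text \<open>Pointwise convergence of the final values, with a bound that is uniform in \<open>s\<close> and in the controls.\<close>

lemma stretch_gain_converges:
  fixes v :: "nat \<Rightarrow> real \<Rightarrow> real^'n"
  assumes u: "u absolutely_integrable_on {0..T}" and v: "\<And>n. v n absolutely_integrable_on {0..T}"
    and M: "\<And>n. control_mass T (v n) \<le> M" "\<And>n. control_mass T (\<lambda>\<tau>. v n \<tau> - u \<tau>) \<le> M"
    and prim: "\<And>e. e > 0 \<Longrightarrow> \<exists>N. \<forall>n\<ge>N. \<forall>t\<in>{0..T}. norm (integral {0..t} (\<lambda>\<tau>. v n \<tau> - u \<tau>)) \<le> e"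
  shows "(\<lambda>n. stretch_gain (v n)) \<longlonglongrightarrow> stretch_gain u"
proof -
  have lim: "(\<lambda>n. stretch (v n) s) \<longlonglongrightarrow> stretch u s" if s: "s \<in> {0..1}" for s
  proof -
    obtain X a where X: "state_solution \<Omega> T \<gamma>0 (stream h u) X a" "stretch u = a T" by (rule stretch_solution[OF u])
    have "\<forall>n. \<exists>Y b. state_solution \<Omega> T \<gamma>0 (stream h (v n)) Y b \<and> stretch (v n) = b T"
      using stretch_solution[OF v] by metis
    then obtain Y b where Y: "\<And>n. state_solution \<Omega> T \<gamma>0 (stream h (v n)) (Y n) (b n)" "\<And>n. stretch (v n) = b n T" by metis
    have tX: "trajectory u (\<gamma>0 s) (\<lambda>t. X t s)" and la: "linearised u (\<lambda>t. X t s) (curve_deriv \<gamma>0 s) (\<lambda>t. a t s)"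
      using X(1) s unfolding state_solution_iff by blast+
    have tY: "trajectory (v n) (\<gamma>0 s) (\<lambda>t. Y n t s)" and lb: "linearised (v n) (\<lambda>t. Y n t s) (curve_deriv \<gamma>0 s) (\<lambda>t. b n t s)" for n
      using Y(1)[of n] s unfolding state_solution_iff by blast+
    have "(\<lambda>n. b n T s) \<longlonglongrightarrow> a T s"
      by (rule linearised_weakly_continuous[OF u v M prim tX tY la lb]) (use T in auto)
    then show ?thesis by (simp add: X(2) Y(2))
  qed
  obtain \<alpha> where \<alpha>: "0 \<le> \<alpha>"
    "\<And>u s. u absolutely_integrable_on {0..T} \<Longrightarrow> s \<in> {0..1} \<Longrightarrow> norm (stretch u s) \<le> \<alpha> * exp (\<beta> * control_mass T u)"
    by (rule stretch_bound) (rule that, assumption+)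
  have bound: "norm (stretch (v n) s) \<le> \<alpha> * exp (\<beta> * M)" if "s \<in> {0..1}" for n s
  proof -
    have "norm (stretch (v n) s) \<le> \<alpha> * exp (\<beta> * control_mass T (v n))" by (rule \<alpha>(2)[OF v that])
    also have "\<dots> \<le> \<alpha> * exp (\<beta> * M)" using M(1)[of n] \<alpha>(1) \<beta> by (auto intro!: mult_left_mono)
    finally show ?thesis .
  qed
  show ?thesis
    unfolding stretch_gain_def
  proof (rule integral_dominated_convergence[where w="\<lambda>s. \<alpha> * exp (\<beta> * M) + eps"])
    show "integrable (lebesgue_on {0..1::real}) (\<lambda>s. \<alpha> * exp (\<beta> * M) + eps)"
      by (intro continuous_imp_integrable_real continuous_intros)
    show "(\<lambda>s. sqrt ((norm (stretch (v n) s))\<^sup>2 + eps\<^sup>2)) \<in> borel_measurable (lebesgue_on {0..1})" for n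
      using stretch_integrable[OF stretch_continuous[OF v]] by blast
    show "(\<lambda>s. sqrt ((norm (stretch u s))\<^sup>2 + eps\<^sup>2)) \<in> borel_measurable (lebesgue_on {0..1})"
      using stretch_integrable[OF stretch_continuous[OF u]] by blast
    show "AE s in lebesgue_on {0..1}. (\<lambda>n. sqrt ((norm (stretch (v n) s))\<^sup>2 + eps\<^sup>2)) \<longlonglongrightarrow> sqrt ((norm (stretch u s))\<^sup>2 + eps\<^sup>2)"
      by (intro AE_I2 tendsto_intros lim) simp
    show "AE s in lebesgue_on {0..1}. norm (sqrt ((norm (stretch (v n) s))\<^sup>2 + eps\<^sup>2)) \<le> \<alpha> * exp (\<beta> * M) + eps" for n
    proof (rule AE_I2)
      fix s assume "s \<in> space (lebesgue_on {0..1::real})"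
      then show "norm (sqrt ((norm (stretch (v n) s))\<^sup>2 + eps\<^sup>2)) \<le> \<alpha> * exp (\<beta> * M) + eps"
        using bound[of s n] sqrt_norm_eps_le[of "stretch (v n) s"] by simp
    qed
  qed
qed

text \<open>The stream function at a fixed time, as a function of the coefficient vector.\<close>

definition stream_of :: "real^'n \<Rightarrow> real^2 \<Rightarrow> real" where
  "stream_of c x = (\<Sum>k\<in>UNIV. c $ k * h k x)"

lemma stream_eq: "stream h u t = stream_of (u t)"
  by (simp add: stream_def stream_of_def fun_eq_iff)

lemma stream_of_bound: "x \<in> \<Omega> \<Longrightarrow> \<bar>stream_of c x\<bar> \<le> real CARD('n) * \<bar>W\<bar> * norm c"
proof -
  assume x: "x \<in> \<Omega>"
  have "\<bar>stream_of c x\<bar> \<le> (\<Sum>k\<in>(UNIV::'n set). \<bar>c $ k * h k x\<bar>)" unfolding stream_of_def by (rule sum_abs)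
  also have "\<dots> \<le> (\<Sum>k\<in>(UNIV::'n set). norm c * \<bar>W\<bar>)"
  proof (rule sum_mono)
    fix k
    have "\<bar>h k x\<bar> \<le> \<bar>W\<bar>" using h_bound[OF x, of k] by linarith
    then show "\<bar>c $ k * h k x\<bar> \<le> norm c * \<bar>W\<bar>"
      unfolding abs_mult using component_le_norm_cart[of c k] by (intro mult_mono) auto
  qed
  finally show ?thesis by (simp add: mult_ac)
qed

lemma stream_of_measurable: "stream_of c \<in> borel_measurable (lebesgue_on \<Omega>)"
  unfolding stream_of_def[abs_def] using h_meas by measurable

lemma stream_of_L2: "L2_on \<Omega> (stream_of c)"
proof -
  have "integrable (lebesgue_on \<Omega>) (\<lambda>x. (norm (stream_of c x))\<^sup>2)"
  proof (rule finite_measure.integrable_const_bound[OF finite_measure_lebesgue_on[OF \<Omega>]])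
    show "AE x in lebesgue_on \<Omega>. norm ((norm (stream_of c x))\<^sup>2) \<le> (real CARD('n) * \<bar>W\<bar> * norm c)\<^sup>2"
    proof (rule AE_I2)
      fix x assume "x \<in> space (lebesgue_on \<Omega>)"
      then have "\<bar>stream_of c x\<bar> \<le> real CARD('n) * \<bar>W\<bar> * norm c" by (intro stream_of_bound) auto
      then show "norm ((norm (stream_of c x))\<^sup>2) \<le> (real CARD('n) * \<bar>W\<bar> * norm c)\<^sup>2"
        using power_mono[of "\<bar>stream_of c x\<bar>" _ 2] by simp
    qed
    show "(\<lambda>x. (norm (stream_of c x))\<^sup>2) \<in> borel_measurable (lebesgue_on \<Omega>)"
      using stream_of_measurable by measurable
  qed
  then show ?thesis using stream_of_measurable by (simp add: L2_on_def)
qed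

text \<open>The quadratic form \<open>c \<mapsto> \<parallel>\<Sum>\<^sub>k c\<^sub>k h\<^sub>k\<parallel>\<^sup>2\<close> on coefficient vectors, for the norm of \<open>L\<^sup>2(\<Omega>)\<close>.\<close>

definition energy_density :: "real^'n \<Rightarrow> real" where
  "energy_density c = sqint \<Omega> (stream_of c)"

lemma energy_eq: "energy u = (LINT t|lebesgue_on {0..T}. energy_density (u t))"
  by (simp add: energy_def energy_density_def stream_eq L2norm_sq)

lemma energy_density_nonneg: "0 \<le> energy_density c"
  unfolding energy_density_def by (rule sqint_nonneg)

text \<open>A bound for the quadratic form \<open>energy_density\<close>, from the bound \<open>W\<close> for the \<open>h\<^sub>k\<close> and the area of \<open>\<Omega>\<close>.\<close>

definition energy_const :: real where
  "energy_const = (real CARD('n) * \<bar>W\<bar>)\<^sup>2 * measure lebesgue \<Omega>"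

lemma energy_const_nonneg: "0 \<le> energy_const" by (simp add: energy_const_def)

lemma energy_density_diff_le:
  "\<bar>energy_density c - energy_density d\<bar> \<le> energy_const * norm (c - d) * (norm c + norm d)"
proof -
  let ?w = "real CARD('n) * \<bar>W\<bar>"
  have i: "integrable (lebesgue_on \<Omega>) (\<lambda>x. (norm (stream_of c x))\<^sup>2)" for c using stream_of_L2 by (simp add: L2_on_def)
  have ic: "integrable (lebesgue_on \<Omega>) (\<lambda>x. r)" for r :: real
    by (rule finite_measure.integrable_const[OF finite_measure_lebesgue_on[OF \<Omega>]])
  have "energy_density c - energy_density d = (LINT x|lebesgue_on \<Omega>. (norm (stream_of c x))\<^sup>2 - (norm (stream_of d x))\<^sup>2)"
    unfolding energy_density_def using i by simp
  also have "\<bar>\<dots>\<bar> \<le> (LINT x|lebesgue_on \<Omega>. (?w * norm (c - d)) * (?w * (norm c + norm d)))"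
  proof (rule integral_abs_bound_integral)
    show "integrable (lebesgue_on \<Omega>) (\<lambda>x. (norm (stream_of c x))\<^sup>2 - (norm (stream_of d x))\<^sup>2)" using i by simp
    show "integrable (lebesgue_on \<Omega>) (\<lambda>x. (?w * norm (c - d)) * (?w * (norm c + norm d)))" by (rule ic)
    fix x assume "x \<in> space (lebesgue_on \<Omega>)"
    then have x: "x \<in> \<Omega>" by simp
    have "(norm (stream_of c x))\<^sup>2 - (norm (stream_of d x))\<^sup>2 = stream_of (c - d) x * (stream_of c x + stream_of d x)"
      by (simp add: stream_of_def sum_subtractf left_diff_distrib power2_eq_square algebra_simps)
    moreover have "\<bar>stream_of (c - d) x * (stream_of c x + stream_of d x)\<bar> \<le> (?w * norm (c - d)) * (?w * (norm c + norm d))"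
      unfolding abs_mult
    proof (rule mult_mono)
      show "\<bar>stream_of c x + stream_of d x\<bar> \<le> ?w * (norm c + norm d)"
        using stream_of_bound[OF x, of c] stream_of_bound[OF x, of d] by (simp add: distrib_left)
    qed (use stream_of_bound[OF x, of "c - d"] in auto)
    ultimately show "\<bar>(norm (stream_of c x))\<^sup>2 - (norm (stream_of d x))\<^sup>2\<bar> \<le> (?w * norm (c - d)) * (?w * (norm c + norm d))"
      by simp
  qed
  also have "\<dots> = energy_const * norm (c - d) * (norm c + norm d)"
    using \<Omega> by (simp add: energy_const_def measure_restrict_space fmeasurableD power2_eq_square)
  finally show ?thesis .
qed

lemma energy_density_zero: "energy_density 0 = 0"
  by (simp add: energy_density_def stream_of_def)

lemma energy_density_le: "\<bar>energy_density c\<bar> \<le> energy_const * (norm c)\<^sup>2"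
  using energy_density_diff_le[of c 0] by (simp add: energy_density_zero power2_eq_square)

lemma energy_density_measurable: "energy_density \<in> borel_measurable borel"
proof (rule borel_measurable_continuous_onI)
  show "continuous_on UNIV energy_density"
    unfolding continuous_on_def
  proof
    fix c :: "real^'n"
    have "((\<lambda>d. energy_const * norm (d - c) * (norm d + norm c)) \<longlongrightarrow> energy_const * norm (c - c) * (norm c + norm c)) (at c)"
      by (intro tendsto_intros)
    then have lim: "((\<lambda>d. energy_const * norm (d - c) * (norm d + norm c)) \<longlongrightarrow> 0) (at c)" by simp
    have "((\<lambda>d. energy_density d - energy_density c) \<longlongrightarrow> 0) (at c)"
      by (rule Lim_null_comparison[OF always_eventually lim]) (auto intro: energy_density_diff_le)
    then show "(energy_density \<longlongrightarrow> energy_density c) (at c)" by (rule LIM_zero_cancel)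
  qed
qed

lemma energy_density_integrable:
  assumes u: "L2_on {0..T} u"
  shows "integrable (lebesgue_on {0..T}) (\<lambda>t. energy_density (u t))"
proof (rule Bochner_Integration.integrable_bound)
  show "integrable (lebesgue_on {0..T}) (\<lambda>t. energy_const * (norm (u t))\<^sup>2)" using u by (auto simp: L2_on_def)
  show "(\<lambda>t. energy_density (u t)) \<in> borel_measurable (lebesgue_on {0..T})"
    using u energy_density_measurable by (auto simp: L2_on_def)
  show "AE t in lebesgue_on {0..T}. norm (energy_density (u t)) \<le> norm (energy_const * (norm (u t))\<^sup>2)"
    using energy_density_le energy_const_nonneg by (intro AE_I2) auto
qed

text \<open>Midpoint convexity is all that is needed of the convexity of the penalty term.\<close>

lemma energy_density_midpoint: "energy_density ((1/2) *\<^sub>R (c + d)) \<le> (energy_density c + energy_density d) / 2"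
proof -
  have eq: "stream_of ((1/2) *\<^sub>R (c + d)) = (\<lambda>x. (1/2) *\<^sub>R (stream_of c x + stream_of d x))"
    by (simp add: stream_of_def fun_eq_iff sum.distrib[symmetric] sum_distrib_left algebra_simps sum_divide_distrib add_divide_distrib)
  show ?thesis
    using sqint_parallelogram[OF stream_of_L2 stream_of_L2, of c d] sqint_nonneg[of \<Omega> "\<lambda>x. stream_of c x - stream_of d x"]
    unfolding energy_density_def eq by linarith
qed

lemma energy_nonneg: "0 \<le> energy u"
  unfolding energy_eq by (rule integral_nonneg_AE) (simp add: energy_density_nonneg)

lemma energy_le:
  assumes u: "L2_on {0..T} u"
  shows "energy u \<le> energy_const * sqint {0..T} u"
proof -
  have "energy u \<le> (LINT t|lebesgue_on {0..T}. energy_const * (norm (u t))\<^sup>2)"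
    unfolding energy_eq using u energy_density_le
    by (intro integral_mono energy_density_integrable) (auto simp: L2_on_def dest: abs_le_D1)
  then show ?thesis using u by (simp add: L2_on_def)
qed

lemma energy_midpoint:
  assumes u: "L2_on {0..T} u" "L2_on {0..T} w"
  shows "energy (\<lambda>t. (1/2) *\<^sub>R (u t + w t)) \<le> (energy u + energy w) / 2"
proof -
  have L: "L2_on {0..T} (\<lambda>t. (1/2) *\<^sub>R (u t + w t))" by (intro L2_on_scaleR L2_on_add u)
  have "energy (\<lambda>t. (1/2) *\<^sub>R (u t + w t)) \<le> (LINT t|lebesgue_on {0..T}. (energy_density (u t) + energy_density (w t)) / 2)"
    unfolding energy_eq
    using energy_density_integrable[OF L] energy_density_integrable[OF u(1)] energy_density_integrable[OF u(2)]
    by (intro integral_mono energy_density_midpoint) auto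
  also have "\<dots> = (energy u + energy w) / 2"
    unfolding energy_eq using energy_density_integrable[OF u(1)] energy_density_integrable[OF u(2)] by simp
  finally show ?thesis .
qed

lemma energy_converges:
  assumes f: "\<And>n::nat. L2_on {0..T} (f n)" and g: "L2_on {0..T} g"
    and lim: "(\<lambda>n. sqint {0..T} (\<lambda>x. f n x - g x)) \<longlonglongrightarrow> 0"
  shows "(\<lambda>n. energy (f n)) \<longlonglongrightarrow> energy g"
  unfolding energy_eq
  by (rule quadratic_integral_continuous[OF energy_density_measurable energy_density_le energy_const_nonneg
        energy_density_diff_le f g lim])

lemma L2_absint: "L2_on {0..T} u \<Longrightarrow> u absolutely_integrable_on {0..T}" for u :: "real \<Rightarrow> real^'n"
  by (rule L2_on_absolutely_integrable) auto

lemma primitive_bound: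
  fixes p :: "real \<Rightarrow> real^'n"
  assumes p: "L2_on {0..T} p" and t: "t \<in> {0..T}"
  shows "norm (integral {0..t} p) \<le> sqrt T * L2norm {0..T} p"
proof -
  have "norm (integral {0..t} p) \<le> sqrt (t - 0) * L2norm {0..T} p" using t by (intro norm_integral_ivl_le' p) auto
  also have "\<dots> \<le> sqrt T * L2norm {0..T} p" using t by (intro mult_right_mono) (auto simp: L2norm_def sqint_nonneg)
  finally show ?thesis .
qed

text \<open>The bound on the masses required above follows from a bound in \<open>L\<^sup>2\<close>.\<close>

lemma gain_converges_of_primitives:
  fixes v :: "nat \<Rightarrow> real \<Rightarrow> real^'n"
  assumes u: "L2_on {0..T} u" and v: "\<And>n. L2_on {0..T} (v n)" and R: "\<And>n. sqint {0..T} (v n) \<le> R"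
    and prim: "\<And>e. e > 0 \<Longrightarrow> \<exists>N. \<forall>n\<ge>N. \<forall>t\<in>{0..T}. norm (integral {0..t} (\<lambda>\<tau>. v n \<tau> - u \<tau>)) \<le> e"
  shows "(\<lambda>n. stretch_gain (v n)) \<longlonglongrightarrow> stretch_gain u"
proof -
  have m: "control_mass T p \<le> real CARD('n) * (sqrt T * sqrt r)" if "L2_on {0..T} p" "sqint {0..T} p \<le> r" for p :: "real \<Rightarrow> real^'n" and r
  proof -
    have "control_mass T p \<le> real CARD('n) * (sqrt T * L2norm {0..T} p)" by (rule control_mass_le_L2norm[OF that(1) T_nonneg])
    also have "L2norm {0..T} p \<le> sqrt r" unfolding L2norm_def using that(2) by simp
    finally show ?thesis using T_nonneg by (simp add: mult_left_mono)
  qed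
  have R0: "0 \<le> R" using R[of 0] sqint_nonneg[of "{0..T}" "v 0"] by linarith
  define r where "r = 2 * R + 2 * sqint {0..T} u"
  have vr: "sqint {0..T} (v n) \<le> r" for n using R[of n] R0 sqint_nonneg[of "{0..T}" u] unfolding r_def by linarith
  have dr: "sqint {0..T} (\<lambda>\<tau>. v n \<tau> - u \<tau>) \<le> r" for n
  proof -
    have "L2_on {0..T} (\<lambda>x. 0 :: real^'n)" by (simp add: L2_on_def)
    then have "sqint {0..T} (\<lambda>x. v n x - u x) \<le> 2 * sqint {0..T} (\<lambda>x. v n x - 0) + 2 * sqint {0..T} (\<lambda>x. 0 - u x)"
      by (rule sqint_triangle[OF v _ u])
    then show ?thesis using R[of n] by (simp add: r_def)
  qed
  show ?thesis
    by (rule stretch_gain_converges[OF L2_absint[OF u] L2_absint[OF v] m[OF v vr] m[OF L2_on_diff[OF v u] dr] prim])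
qed

lemma cost_sequentially_continuous:
  fixes v :: "nat \<Rightarrow> real \<Rightarrow> real^'n"
  assumes u: "L2_on {0..T} u" and v: "\<And>n. L2_on {0..T} (v n)"
    and lim: "(\<lambda>n. L2norm {0..T} (\<lambda>t. v n t - u t)) \<longlonglongrightarrow> 0"
  shows "(\<lambda>n. cost \<Omega> T \<gamma>0 lam eps (stream h (v n))) \<longlonglongrightarrow> cost \<Omega> T \<gamma>0 lam eps (stream h u)"
proof -
  have sq: "(\<lambda>n. sqint {0..T} (\<lambda>t. v n t - u t)) \<longlonglongrightarrow> 0"
    using tendsto_power[OF lim, of 2] by (simp add: L2norm_sq)
  then have "Bseq (\<lambda>n. sqint {0..T} (\<lambda>t. v n t - u t))" by (intro convergent_imp_Bseq convergentI)
  then obtain S where S: "\<And>n. sqint {0..T} (\<lambda>t. v n t - u t) \<le> S"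
    unfolding Bseq_def real_norm_def by (meson abs_le_D1)
  have R: "sqint {0..T} (v n) \<le> 2 * S + 2 * sqint {0..T} u" for n
  proof -
    have "L2_on {0..T} (\<lambda>x. 0 :: real^'n)" by (simp add: L2_on_def)
    then have "sqint {0..T} (\<lambda>x. v n x - 0) \<le> 2 * sqint {0..T} (\<lambda>x. v n x - u x) + 2 * sqint {0..T} (\<lambda>x. u x - 0)"
      by (rule sqint_triangle[OF v u])
    then show ?thesis using S[of n] by simp
  qed
  have "\<exists>N. \<forall>n\<ge>N. \<forall>t\<in>{0..T}. norm (integral {0..t} (\<lambda>\<tau>. v n \<tau> - u \<tau>)) \<le> e" if e: "e > 0" for e
  proof -
    have "(\<lambda>n. sqrt T * L2norm {0..T} (\<lambda>t. v n t - u t)) \<longlonglongrightarrow> sqrt T * 0" by (intro tendsto_intros lim)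
    then have "\<forall>\<^sub>F n in sequentially. sqrt T * L2norm {0..T} (\<lambda>t. v n t - u t) < e" using e by (intro order_tendstoD) auto
    then obtain N where N: "\<And>n. n \<ge> N \<Longrightarrow> sqrt T * L2norm {0..T} (\<lambda>t. v n t - u t) < e" unfolding eventually_sequentially by blast
    have "norm (integral {0..t} (\<lambda>\<tau>. v n \<tau> - u \<tau>)) \<le> e" if "n \<ge> N" "t \<in> {0..T}" for n t
      using primitive_bound[OF L2_on_diff[OF v u] that(2), of n] N[OF that(1)] by simp
    then show ?thesis by blast
  qed
  then have "(\<lambda>n. stretch_gain (v n)) \<longlonglongrightarrow> stretch_gain u" by (rule gain_converges_of_primitives[OF u v R])
  moreover have "(\<lambda>n. energy (v n)) \<longlonglongrightarrow> energy u" by (rule energy_converges[OF v u sq])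
  ultimately show ?thesis
    unfolding cost_eq[OF L2_absint[OF v]] cost_eq[OF L2_absint[OF u]] by (intro tendsto_intros)
qed

lemma cost_continuous:
  assumes u: "L2_on {0..T} u" and e: "0 < e"
  shows "\<exists>d>0. \<forall>w. L2_on {0..T} w \<and> L2norm {0..T} (\<lambda>t. w t - u t) < d \<longrightarrow>
    \<bar>cost \<Omega> T \<gamma>0 lam eps (stream h w) - cost \<Omega> T \<gamma>0 lam eps (stream h u)\<bar> < e"
proof (rule ccontr)
  assume neg: "\<not> ?thesis"
  have *: "\<exists>w. L2_on {0..T} w \<and> L2norm {0..T} (\<lambda>t. w t - u t) < d \<and>
    \<not> \<bar>cost \<Omega> T \<gamma>0 lam eps (stream h w) - cost \<Omega> T \<gamma>0 lam eps (stream h u)\<bar> < e" if "0 < d" for d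
    using neg that by blast
  have "\<forall>n::nat. \<exists>w. L2_on {0..T} w \<and> L2norm {0..T} (\<lambda>t. w t - u t) < 1 / real (Suc n) \<and>
    \<not> \<bar>cost \<Omega> T \<gamma>0 lam eps (stream h w) - cost \<Omega> T \<gamma>0 lam eps (stream h u)\<bar> < e"
    by (intro allI *) simp
  then obtain v where v: "\<And>n. L2_on {0..T} (v n)" "\<And>n. L2norm {0..T} (\<lambda>t. v n t - u t) < 1 / real (Suc n)"
    and far: "\<And>n. \<not> \<bar>cost \<Omega> T \<gamma>0 lam eps (stream h (v n)) - cost \<Omega> T \<gamma>0 lam eps (stream h u)\<bar> < e"
    by metis
  have "(\<lambda>n. L2norm {0..T} (\<lambda>t. v n t - u t)) \<longlonglongrightarrow> 0"
  proof (rule tendsto_sandwich[OF _ _ tendsto_const LIMSEQ_inverse_real_of_nat])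
    show "\<forall>\<^sub>F n in sequentially. 0 \<le> L2norm {0..T} (\<lambda>t. v n t - u t)" by (simp add: L2norm_def sqint_nonneg)
    show "\<forall>\<^sub>F n in sequentially. L2norm {0..T} (\<lambda>t. v n t - u t) \<le> inverse (real (Suc n))"
      using v(2) by (auto simp: inverse_eq_divide intro!: always_eventually less_imp_le)
  qed
  from LIMSEQ_D[OF cost_sequentially_continuous[OF u v(1) this] e] far show False by auto
qed

text \<open>The primitives of a minimizing sequence in the ball are equicontinuous, so by Arzela--Ascoli they
converge uniformly along a subsequence, and the energies may be taken to converge to some \<open>q\<close>. The limit of
the primitives is the primitive of a control \<open>w\<close> in the ball with energy at most \<open>q\<close>: the sets \<open>K j\<close> of controls
in the ball that have these properties up to \<open>1 / (j + 1)\<close> are nonempty, closed, convex and decreasing, and \<open>w\<close> is a common point. The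
gain converges along the subsequence, so the cost of \<open>w\<close> does not exceed the infimum.\<close>

lemma minimizer_exists:
  assumes R: "0 \<le> R"
  shows "\<exists>u. L2_on {0..T} u \<and> L2norm {0..T} u \<le> R \<and>
    (\<forall>w. L2_on {0..T} w \<and> L2norm {0..T} w \<le> R \<longrightarrow> cost \<Omega> T \<gamma>0 lam eps (stream h u) \<le> cost \<Omega> T \<gamma>0 lam eps (stream h w))"
proof -
  define U where "U = {u :: real \<Rightarrow> real^'n. L2_on {0..T} u \<and> sqint {0..T} u \<le> R\<^sup>2}"
  have U_iff: "u \<in> U \<longleftrightarrow> L2_on {0..T} u \<and> L2norm {0..T} u \<le> R" for u
    using L2norm_le_iff[OF R, of "{0..T}" u] by (auto simp: U_def)
  define F where "F = (\<lambda>u. - stretch_gain u + lam / 2 * energy u)"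
  have costF: "cost \<Omega> T \<gamma>0 lam eps (stream h u) = F u" if "u \<in> U" for u
    unfolding F_def using that by (intro cost_eq L2_absint) (auto simp: U_def)
  have UL: "L2_on {0..T} u" if "u \<in> U" for u using that by (simp add: U_def)
  have zero_U: "(\<lambda>t. 0) \<in> U" by (simp add: U_def L2_on_def)
  have prim_le: "norm (integral {s..t} u) \<le> sqrt (t - s) * R" if "u \<in> U" "0 \<le> s" "s \<le> t" "t \<le> T" for u s t
  proof -
    have "norm (integral {s..t} u) \<le> sqrt (t - s) * L2norm {0..T} u" using that UL by (intro norm_integral_ivl_le') auto
    also have "\<dots> \<le> sqrt (t - s) * R" using that U_iff by (intro mult_left_mono) auto
    finally show ?thesis .
  qed
  obtain \<alpha> where \<alpha>: "0 \<le> \<alpha>"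
    "\<And>u s. u absolutely_integrable_on {0..T} \<Longrightarrow> s \<in> {0..1} \<Longrightarrow> norm (stretch u s) \<le> \<alpha> * exp (\<beta> * control_mass T u)"
    by (rule stretch_bound) (rule that, assumption+)
  \<comment> \<open>The gain is bounded on the ball, so the cost is bounded below.\<close>
  define m0 where "m0 = \<alpha> * exp (\<beta> * (real CARD('n) * (sqrt T * R))) + eps"
  have Flow: "- m0 \<le> F u" if u: "u \<in> U" for u
  proof -
    have ua: "u absolutely_integrable_on {0..T}" by (rule L2_absint[OF UL[OF u]])
    have "control_mass T u \<le> real CARD('n) * (sqrt T * L2norm {0..T} u)" by (rule control_mass_le_L2norm[OF UL[OF u] T_nonneg])
    also have "\<dots> \<le> real CARD('n) * (sqrt T * R)" using u U_iff T_nonneg by (intro mult_left_mono) auto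
    finally have mass: "control_mass T u \<le> real CARD('n) * (sqrt T * R)" .
    have "stretch_gain u \<le> (LINT s|lebesgue_on {0..1::real}. m0)"
      unfolding stretch_gain_def
    proof (rule integral_mono)
      show "integrable (lebesgue_on {0..1}) (\<lambda>s. sqrt ((norm (stretch u s))\<^sup>2 + eps\<^sup>2))"
        by (rule stretch_integrable[OF stretch_continuous[OF ua]])
      show "integrable (lebesgue_on {0..1::real}) (\<lambda>s. m0)" by (intro continuous_imp_integrable_real continuous_intros)
      fix s assume "s \<in> space (lebesgue_on {0..1::real})"
      then have "norm (stretch u s) \<le> \<alpha> * exp (\<beta> * control_mass T u)" by (intro \<alpha> ua) auto
      also have "\<dots> \<le> \<alpha> * exp (\<beta> * (real CARD('n) * (sqrt T * R)))"
        using mass \<beta> \<alpha>(1) by (intro mult_left_mono) (auto intro!: mult_left_mono)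
      finally show "sqrt ((norm (stretch u s))\<^sup>2 + eps\<^sup>2) \<le> m0"
        using sqrt_norm_eps_le[of "stretch u s"] by (simp add: m0_def)
    qed
    also have "\<dots> = m0" by (simp add: measure_restrict_space)
    finally have "stretch_gain u \<le> m0" .
    moreover have "0 \<le> lam / 2 * energy u" using lam energy_nonneg by simp
    ultimately show ?thesis unfolding F_def by linarith
  qed
  define m where "m = Inf (F ` U)"
  have bb: "bdd_below (F ` U)" using Flow by (intro bdd_belowI2)
  have m_le: "m \<le> F u" if "u \<in> U" for u unfolding m_def using that bb by (intro cInf_lower) auto
  have "\<exists>u. u \<in> U \<and> F u < m + 1 / real (Suc n)" for n :: nat
  proof -
    have "\<exists>y\<in>F ` U. y < m + 1 / real (Suc n)" unfolding m_def using zero_U by (intro cInf_lessD) auto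
    then show ?thesis by auto
  qed
  then obtain u where u: "\<And>n. u n \<in> U" "\<And>n. F (u n) < m + 1 / real (Suc n)" by metis
  have Flim: "(\<lambda>n. F (u n)) \<longlonglongrightarrow> m"
  proof (rule tendsto_sandwich[OF _ _ tendsto_const])
    show "\<forall>\<^sub>F n in sequentially. m \<le> F (u n)" using m_le u(1) by simp
    show "\<forall>\<^sub>F n in sequentially. F (u n) \<le> m + inverse (real (Suc n))"
      using u(2) by (auto simp: inverse_eq_divide intro!: always_eventually less_imp_le)
    show "(\<lambda>n. m + inverse (real (Suc n))) \<longlonglongrightarrow> m"
      using tendsto_add[OF tendsto_const LIMSEQ_inverse_real_of_nat, of m] by simp
  qed
  define P where "P = (\<lambda>n t. integral {0..t} (u n))"
  have ua: "u n absolutely_integrable_on {0..T}" for n by (rule L2_absint[OF UL[OF u(1)]])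
  have Pdiff: "norm (P n t - P n s) \<le> sqrt \<bar>t - s\<bar> * R" if "s \<in> {0..T}" "t \<in> {0..T}" for n s t
  proof -
    have *: "norm (P n t - P n s) \<le> sqrt (t - s) * R" if "0 \<le> s" "s \<le> t" "t \<le> T" for s t
      using prim_le[OF u(1) that, of n] integral_split[OF ua that, of n] by (simp add: P_def)
    show ?thesis using *[of s t] *[of t s] that by (cases "s \<le> t") (auto simp: norm_minus_commute)
  qed
  obtain Plim r1 where r1: "continuous_on {0..T} Plim" "strict_mono (r1 :: nat \<Rightarrow> nat)"
    "\<And>e. 0 < e \<Longrightarrow> \<exists>N. \<forall>n x. n \<ge> N \<and> x \<in> {0..T} \<longrightarrow> norm (P (r1 n) x - Plim x) < e"
  proof (rule Arzela_Ascoli[of "{0..T}" P "sqrt T * R"])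
    show "norm (P n x) \<le> sqrt T * R" if "x \<in> {0..T}" for n x
    proof -
      have "norm (P n x - P n 0) \<le> sqrt \<bar>x - 0\<bar> * R" using that by (intro Pdiff) auto
      also have "\<dots> \<le> sqrt T * R" using that R by (intro mult_right_mono) auto
      finally show ?thesis by (simp add: P_def)
    qed
    show "\<exists>d. 0 < d \<and> (\<forall>n y. y \<in> {0..T} \<and> norm (x - y) < d \<longrightarrow> norm (P n x - P n y) < e)"
      if x: "x \<in> {0..T}" and e: "0 < e" for x e
    proof (intro exI[of _ "(e / (R + 1))\<^sup>2"] conjI allI impI)
      show "0 < (e / (R + 1))\<^sup>2" using e R by simp
      fix n y assume y: "y \<in> {0..T} \<and> norm (x - y) < (e / (R + 1))\<^sup>2"
      have "norm (P n x - P n y) \<le> sqrt \<bar>x - y\<bar> * R" using x y by (intro Pdiff) auto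
      also have "\<dots> \<le> sqrt \<bar>x - y\<bar> * (R + 1)" by (intro mult_left_mono) auto
      also have "sqrt \<bar>x - y\<bar> < e / (R + 1)" using y e R by (intro real_less_lsqrt) auto
      then have "sqrt \<bar>x - y\<bar> * (R + 1) < e" using R by (simp add: pos_less_divide_eq)
      finally show "norm (P n x - P n y) < e" .
    qed
  qed auto
  have "bounded (range (\<lambda>n. energy (u (r1 n))))"
  proof (rule boundedI)
    fix x assume "x \<in> range (\<lambda>n. energy (u (r1 n)))"
    then obtain n where x: "x = energy (u (r1 n))" by blast
    have "energy (u (r1 n)) \<le> energy_const * sqint {0..T} (u (r1 n))" by (rule energy_le[OF UL[OF u(1)]])
    also have "\<dots> \<le> energy_const * R\<^sup>2" using u(1)[of "r1 n"] energy_const_nonneg by (intro mult_left_mono) (auto simp: U_def)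
    finally show "norm x \<le> energy_const * R\<^sup>2" using energy_nonneg[of "u (r1 n)"] x by simp
  qed
  then obtain q r2 where r2: "strict_mono (r2 :: nat \<Rightarrow> nat)" "((\<lambda>n. energy (u (r1 n))) \<circ> r2) \<longlonglongrightarrow> q"
    using bounded_imp_convergent_subsequence[of "\<lambda>n. energy (u (r1 n))"] by blast
  define v where "v = (\<lambda>n. u (r1 (r2 n)))"
  have vU: "v n \<in> U" for n by (simp add: v_def u)
  have vL: "L2_on {0..T} (v n)" for n by (rule UL[OF vU])
  have vq: "(\<lambda>n. energy (v n)) \<longlonglongrightarrow> q" using r2(2) by (simp add: v_def o_def)
  have vF: "(\<lambda>n. F (v n)) \<longlonglongrightarrow> m"
    using LIMSEQ_subseq_LIMSEQ[OF LIMSEQ_subseq_LIMSEQ[OF Flim r1(2)] r2(1)] by (simp add: v_def o_def)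
  have vprim: "\<exists>N. \<forall>n\<ge>N. \<forall>t\<in>{0..T}. norm (integral {0..t} (v n) - Plim t) < e" if e: "0 < e" for e
  proof -
    obtain N where N: "\<And>n x. n \<ge> N \<Longrightarrow> x \<in> {0..T} \<Longrightarrow> norm (P (r1 n) x - Plim x) < e" using r1(3)[OF e] by blast
    have "norm (integral {0..t} (v n) - Plim t) < e" if "n \<ge> N" "t \<in> {0..T}" for n t
      using N[of "r2 n" t] that seq_suble[OF r2(1), of n] by (simp add: P_def v_def)
    then show ?thesis by blast
  qed
  \<comment> \<open>Tolerances are needed because the members of the sequence satisfy the limiting conditions only approximately.\<close>
  define K where "K = (\<lambda>j::nat. {w \<in> U. energy w \<le> q + 1 / real (Suc j) \<and>
      (\<forall>t\<in>{0..T}. norm (integral {0..t} w - Plim t) \<le> 1 / real (Suc j))})"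
  have "\<exists>w. \<forall>j. w \<in> K j"
  proof (rule L2_nested_convex_nonempty[OF T_nonneg, where B="R\<^sup>2"])
    fix j
    have j0: "0 < 1 / real (Suc j)" by simp
    obtain N1 where N1: "\<And>n t. n \<ge> N1 \<Longrightarrow> t \<in> {0..T} \<Longrightarrow> norm (integral {0..t} (v n) - Plim t) < 1 / real (Suc j)"
      using vprim[OF j0] by blast
    have "\<forall>\<^sub>F n in sequentially. energy (v n) < q + 1 / real (Suc j)" using vq j0 by (intro order_tendstoD(2)) auto
    then obtain N2 where N2: "\<And>n. n \<ge> N2 \<Longrightarrow> energy (v n) < q + 1 / real (Suc j)" unfolding eventually_sequentially by blast
    have "v (max N1 N2) \<in> K j" unfolding K_def using vU N1 N2 by (auto intro: less_imp_le)
    then show "K j \<noteq> {}" by blast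
    show "K (Suc j) \<subseteq> K j"
    proof
      fix w assume "w \<in> K (Suc j)"
      moreover have "1 / real (Suc (Suc j)) \<le> 1 / real (Suc j)" by (simp add: frac_le)
      ultimately show "w \<in> K j" unfolding K_def by (auto intro: order_trans add_left_mono)
    qed
  next
    show "L2_on {0..T} w" "sqint {0..T} w \<le> R\<^sup>2" if "w \<in> K j" for j w using that by (auto simp: K_def U_def)
  next
    fix j w1 w2 assume w: "w1 \<in> K j" "w2 \<in> K j"
    have L: "L2_on {0..T} w1" "L2_on {0..T} w2" using w by (auto simp: K_def U_def)
    let ?w = "\<lambda>t. (1/2) *\<^sub>R (w1 t + w2 t)"
    have Lw: "L2_on {0..T} ?w" by (intro L2_on_scaleR L2_on_add L)
    have s: "sqint {0..T} w1 \<le> R\<^sup>2" "sqint {0..T} w2 \<le> R\<^sup>2" using w by (auto simp: K_def U_def)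
    have conv: "a \<le> r" if "a + 1/4 * b = (c + d) / 2" "0 \<le> b" "c \<le> r" "d \<le> r" for a b c d r :: real
      using that by argo
    have "sqint {0..T} ?w \<le> R\<^sup>2"
      by (rule conv[OF sqint_parallelogram[OF L] sqint_nonneg s])
    moreover have "energy ?w \<le> q + 1 / real (Suc j)" using energy_midpoint[OF L] w by (auto simp: K_def)
    moreover have "norm (integral {0..t} ?w - Plim t) \<le> 1 / real (Suc j)" if t: "t \<in> {0..T}" for t
    proof -
      have i: "w1 integrable_on {0..t}" "w2 integrable_on {0..t}"
        using t by (auto intro!: absint_integrable absint_sub[OF L2_absint] L)
      have "integral {0..t} ?w = (1/2) *\<^sub>R (integral {0..t} w1 + integral {0..t} w2)"
        unfolding Henstock_Kurzweil_Integration.integral_add[OF i, symmetric] by (rule integral_cmul)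
      then have "integral {0..t} ?w - Plim t = (1/2) *\<^sub>R ((integral {0..t} w1 - Plim t) + (integral {0..t} w2 - Plim t))"
        by (simp add: scaleR_add_right scaleR_diff_right flip: scaleR_add_left)
      also have "norm \<dots> \<le> (1/2) * (1 / real (Suc j) + 1 / real (Suc j))"
        unfolding norm_scaleR using w t norm_triangle_mono[of "integral {0..t} w1 - Plim t" "1 / real (Suc j)" "integral {0..t} w2 - Plim t" "1 / real (Suc j)"]
        by (auto simp: K_def)
      finally show ?thesis by simp
    qed
    ultimately show "?w \<in> K j" unfolding K_def U_def using Lw by blast
  next
    fix j w f assume f: "\<And>i. f i \<in> K j" and w: "L2_on {0..T} w"
      and lim: "(\<lambda>i. sqint {0..T} (\<lambda>t. f i t - w t)) \<longlonglongrightarrow> 0"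
    have fL: "L2_on {0..T} (f i)" for i using f by (auto simp: K_def U_def)
    have "(\<lambda>i. energy (f i)) \<longlonglongrightarrow> energy w" by (rule energy_converges[OF fL w lim])
    then have "energy w \<le> q + 1 / real (Suc j)" by (rule LIMSEQ_le_const2) (use f in \<open>auto simp: K_def\<close>)
    moreover have "(\<lambda>i. LINT x|lebesgue_on {0..T}. (norm (f i x))\<^sup>2) \<longlonglongrightarrow> (LINT x|lebesgue_on {0..T}. (norm (w x))\<^sup>2)"
    proof (rule quadratic_integral_continuous[where C=1, OF _ _ _ _ fL w lim])
      show "\<bar>(norm x)\<^sup>2 - (norm y)\<^sup>2\<bar> \<le> 1 * norm (x - y) * (norm x + norm y)" for x y :: "real^'n"
      proof -
        have "(norm x)\<^sup>2 - (norm y)\<^sup>2 = (norm x - norm y) * (norm x + norm y)" by (simp add: power2_eq_square algebra_simps)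
        then show ?thesis using norm_triangle_ineq3[of x y] by (simp add: abs_mult mult_right_mono)
      qed
    qed auto
    then have "sqint {0..T} w \<le> R\<^sup>2" by (rule LIMSEQ_le_const2) (use f in \<open>auto simp: K_def U_def\<close>)
    moreover have "norm (integral {0..t} w - Plim t) \<le> 1 / real (Suc j)" if t: "t \<in> {0..T}" for t
    proof -
      have dL: "L2_on {0..T} (\<lambda>x. f i x - w x)" for i by (rule L2_on_diff[OF fL w])
      have l0: "(\<lambda>i. sqrt T * sqrt (sqint {0..T} (\<lambda>x. f i x - w x))) \<longlonglongrightarrow> sqrt T * sqrt 0"
        by (intro tendsto_intros lim)
      have "norm (integral {0..t} w - Plim t) \<le> 1 / real (Suc j) + sqrt T * sqrt (sqint {0..T} (\<lambda>x. f i x - w x))" for i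
      proof -
        have i: "f i integrable_on {0..t}" "w integrable_on {0..t}"
          using t by (auto intro!: absint_integrable absint_sub[OF L2_absint] fL w)
        have "integral {0..t} w - Plim t = (integral {0..t} (f i) - Plim t) - integral {0..t} (\<lambda>x. f i x - w x)"
          by (simp add: Henstock_Kurzweil_Integration.integral_diff[OF i])
        also have "norm \<dots> \<le> norm (integral {0..t} (f i) - Plim t) + norm (integral {0..t} (\<lambda>x. f i x - w x))"
          by (rule norm_triangle_ineq4)
        also have "norm (integral {0..t} (f i) - Plim t) \<le> 1 / real (Suc j)" using f[of i] t by (auto simp: K_def)
        also have "norm (integral {0..t} (\<lambda>x. f i x - w x)) \<le> sqrt T * sqrt (sqint {0..T} (\<lambda>x. f i x - w x))"
          using primitive_bound[OF dL t] by (simp add: L2norm_def)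
        finally show ?thesis by simp
      qed
      then have "norm (integral {0..t} w - Plim t) \<le> 1 / real (Suc j) + sqrt T * sqrt 0"
        by (intro LIMSEQ_le_const[OF tendsto_add[OF tendsto_const l0]]) blast
      then show ?thesis by simp
    qed
    ultimately show "w \<in> K j" unfolding K_def U_def using w by blast
  qed
  then obtain w where w: "\<And>j. w \<in> K j" by blast
  have wU: "w \<in> U" using w[of 0] by (simp add: K_def)
  have wL: "L2_on {0..T} w" by (rule UL[OF wU])
  have lim1: "(\<lambda>j. c + 1 / real (Suc j)) \<longlonglongrightarrow> c" for c :: real
    using tendsto_add[OF tendsto_const LIMSEQ_inverse_real_of_nat, of c] by (simp add: inverse_eq_divide)
  have wq: "energy w \<le> q"
    by (rule LIMSEQ_le_const[OF lim1]) (use w in \<open>auto simp: K_def\<close>)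
  have wprim: "integral {0..t} w = Plim t" if t: "t \<in> {0..T}" for t
  proof -
    have "norm (integral {0..t} w - Plim t) \<le> 0"
      by (rule LIMSEQ_le_const[OF lim1[of 0]]) (use w t in \<open>auto simp: K_def\<close>)
    then show ?thesis by simp
  qed
  have "(\<lambda>n. stretch_gain (v n)) \<longlonglongrightarrow> stretch_gain w"
  proof (rule gain_converges_of_primitives[OF wL vL])
    show "sqint {0..T} (v n) \<le> R\<^sup>2" for n using vU[of n] by (simp add: U_def)
    fix e :: real assume "e > 0"
    then obtain N where N: "\<And>n t. n \<ge> N \<Longrightarrow> t \<in> {0..T} \<Longrightarrow> norm (integral {0..t} (v n) - Plim t) < e" using vprim by blast
    have "norm (integral {0..t} (\<lambda>\<tau>. v n \<tau> - w \<tau>)) \<le> e" if "n \<ge> N" and t: "t \<in> {0..T}" for n t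
    proof -
      have i: "v n integrable_on {0..t}" "w integrable_on {0..t}"
        using t by (auto intro!: absint_integrable absint_sub[OF L2_absint] vL wL)
      show ?thesis unfolding Henstock_Kurzweil_Integration.integral_diff[OF i] wprim[OF t] using N[OF that] by simp
    qed
    then show "\<exists>N. \<forall>n\<ge>N. \<forall>t\<in>{0..T}. norm (integral {0..t} (\<lambda>\<tau>. v n \<tau> - w \<tau>)) \<le> e" by blast
  qed
  then have "(\<lambda>n. F (v n)) \<longlonglongrightarrow> - stretch_gain w + lam / 2 * q" unfolding F_def by (intro tendsto_intros vq)
  then have "m = - stretch_gain w + lam / 2 * q" using vF LIMSEQ_unique by blast
  then have "F w \<le> m" unfolding F_def using wq lam by simp
  then have "F w \<le> F w'" if "w' \<in> U" for w' using m_le[OF that] by simp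
  then show ?thesis using wU costF U_iff by metis
qed

end

section \<open>Stream functions that are smooth up to the boundary\<close>

text \<open>A continuous function on the closure that extends \<open>f\<close> is the extension by limits.\<close>

lemma cl_ext_eq:
  fixes F :: "real^2 \<Rightarrow> 'b::t2_space"
  assumes cont: "continuous_on (closure \<Omega>) F" and eq: "\<And>x. x \<in> \<Omega> \<Longrightarrow> F x = f x" and x: "x \<in> closure \<Omega>"
  shows "cl_ext \<Omega> f x = F x"
proof (cases "x \<in> \<Omega>")
  case False
  have "(F \<longlongrightarrow> F x) (at x within closure \<Omega>)" using cont x by (simp add: continuous_on_def)
  then have "(F \<longlongrightarrow> F x) (at x within \<Omega>)" using closure_subset by (rule tendsto_within_subset)
  moreover have "\<forall>\<^sub>F y in at x within \<Omega>. F y = f y" unfolding eventually_at_filter by (simp add: eq)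
  ultimately have "(f \<longlongrightarrow> F x) (at x within \<Omega>)" by (rule Lim_transform_eventually)
  moreover have "\<not> trivial_limit (at x within \<Omega>)"
    using x False by (simp add: trivial_limit_within closure_def)
  ultimately have "Lim (at x within \<Omega>) f = F x" by (intro tendsto_Lim)
  then show ?thesis using False by (simp add: cl_ext_def)
qed (simp add: cl_ext_def eq)

lemma pd_linear_combination:
  fixes f :: "'n::finite \<Rightarrow> 'a::euclidean_space \<Rightarrow> real"
  assumes "\<And>k. f k differentiable (at x)"
  shows "pd b (\<lambda>x. \<Sum>k\<in>UNIV. c k * f k x) x = (\<Sum>k\<in>UNIV. c k * pd b (f k) x)"
proof -
  have "((\<lambda>x. \<Sum>k\<in>UNIV. c k * f k x) has_derivative (\<lambda>v. \<Sum>k\<in>UNIV. c k * frechet_derivative (f k) (at x) v)) (at x)"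
    using assms frechet_derivative_works by (intro has_derivative_sum has_derivative_mult_right) blast
  from pd_eq[OF this] show ?thesis by (simp add: pd_def)
qed

lemma onorm_frechet_derivative_le:
  fixes f :: "'a::euclidean_space \<Rightarrow> real"
  assumes "f differentiable (at x)"
  shows "onorm (frechet_derivative f (at x)) \<le> (\<Sum>b\<in>Basis. \<bar>pd b f x\<bar>)"
proof (rule onorm_le)
  fix v
  have "\<bar>frechet_derivative f (at x) v\<bar> \<le> (\<Sum>b\<in>Basis. \<bar>(v \<bullet> b) * pd b f x\<bar>)"
    unfolding frechet_derivative_eq_sum_pd[OF assms] by (rule sum_abs)
  also have "\<dots> \<le> (\<Sum>b\<in>Basis. norm v * \<bar>pd b f x\<bar>)"
    unfolding abs_mult by (intro sum_mono mult_right_mono Basis_le_norm) auto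
  finally show "norm (frechet_derivative f (at x) v) \<le> (\<Sum>b\<in>Basis. \<bar>pd b f x\<bar>) * norm v"
    by (simp add: sum_distrib_left mult.commute)
qed

lemma Cinf_closure_bounded:
  fixes f :: "'a::euclidean_space \<Rightarrow> real"
  assumes f: "Cinf_closure \<Omega> f" and bd: "bounded \<Omega>" and \<alpha>: "set \<alpha> \<subseteq> Basis"
  shows "\<exists>C. \<forall>x\<in>\<Omega>. norm (ipd \<alpha> f x) \<le> C"
proof -
  obtain F where F: "continuous_on (closure \<Omega>) F" "\<And>x. x \<in> \<Omega> \<Longrightarrow> F x = ipd \<alpha> f x"
    using f \<alpha> unfolding Cinf_closure_def by blast
  have "bounded (F ` closure \<Omega>)"
    using F(1) bd by (intro compact_imp_bounded compact_continuous_image) (simp_all add: compact_closure)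
  then obtain C where C: "\<And>x. x \<in> closure \<Omega> \<Longrightarrow> norm (F x) \<le> C"
    unfolding bounded_iff by blast
  have "norm (ipd \<alpha> f x) \<le> C" if "x \<in> \<Omega>" for x
    using C[of x] F(2)[OF that] that closure_subset[of \<Omega>] by auto
  then show ?thesis by blast
qed

text \<open>Every derivative extends to a Lipschitz function on the closure, because the derivatives of one order
higher are bounded.\<close>

lemma Cinf_closure_lipschitz_extension:
  fixes \<Omega> :: "(real^2) set" and f :: "real^2 \<Rightarrow> real"
  assumes op: "open \<Omega>" and C2: "C2_boundary \<Omega>" and bd: "bounded \<Omega>"
    and f: "Cinf_closure \<Omega> f" and \<alpha>: "set \<alpha> \<subseteq> Basis"
  shows "\<exists>F L. L-lipschitz_on (closure \<Omega>) F \<and> (\<forall>x\<in>\<Omega>. F x = ipd \<alpha> f x)"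
proof -
  obtain F where F: "continuous_on (closure \<Omega>) F" "\<And>x. x \<in> \<Omega> \<Longrightarrow> F x = ipd \<alpha> f x"
    using f \<alpha> unfolding Cinf_closure_def by blast
  have C: "Cinf \<Omega> f" using f by (simp add: Cinf_closure_def)
  have d: "ipd \<alpha> f differentiable (at x)" if "x \<in> \<Omega>" for x
    by (rule Cinf_differentiable[OF Cinf_ipd[OF C \<alpha>] op that])
  have "\<forall>b\<in>Basis. \<exists>Cb. \<forall>x\<in>\<Omega>. norm (ipd (b # \<alpha>) f x) \<le> Cb"
    using Cinf_closure_bounded[OF f bd, of "_ # \<alpha>"] \<alpha> by simp
  then obtain Cb where Cb: "\<And>b x. b \<in> Basis \<Longrightarrow> x \<in> \<Omega> \<Longrightarrow> norm (ipd (b # \<alpha>) f x) \<le> Cb b" by metis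
  have FD: "frechet_derivative F (at x) = frechet_derivative (ipd \<alpha> f) (at x)" if "x \<in> \<Omega>" for x
    by (rule frechet_derivative_cong_open[OF op that F(2)])
  have dF: "F differentiable (at x)" if "x \<in> \<Omega>" for x
  proof -
    have "(F has_derivative frechet_derivative (ipd \<alpha> f) (at x)) (at x)"
      by (rule has_derivative_transform_within_open[OF _ op that F(2)[symmetric]])
        (use d[OF that] frechet_derivative_works in blast)
    then show ?thesis by (auto simp: differentiable_def)
  qed
  have "\<exists>L. L-lipschitz_on (closure \<Omega>) F"
  proof (rule lipschitz_on_closure_of_bounded_derivative[OF op C2 bd F(1) dF])
    fix x assume x: "x \<in> \<Omega>"
    have "onorm (frechet_derivative F (at x)) \<le> (\<Sum>b\<in>Basis. \<bar>pd b (ipd \<alpha> f) x\<bar>)"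
      unfolding FD[OF x] by (rule onorm_frechet_derivative_le[OF d[OF x]])
    also have "\<dots> \<le> (\<Sum>b\<in>Basis. Cb b)" using Cb[OF _ x] by (intro sum_mono) simp
    finally show "onorm (frechet_derivative F (at x)) \<le> (\<Sum>b\<in>Basis. Cb b)" .
  qed
  then show ?thesis using F(2) by blast
qed

lemma norm_Jmat_mult: "norm (Jmat *v z) = norm z"
  by (simp add: norm_eq_sqrt_inner inner_vec_def sum_2 Jmat_mult)

lemma norm_matrix_vector_le:
  fixes A :: "real^'n^'m"
  shows "norm (A *v b) \<le> (\<Sum>i\<in>UNIV. \<Sum>j\<in>UNIV. \<bar>A $ i $ j\<bar>) * norm b"
proof -
  have "norm (A *v b) \<le> (\<Sum>i\<in>UNIV. \<bar>(A *v b) $ i\<bar>)" by (rule norm_le_l1_cart)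
  also have "\<dots> \<le> (\<Sum>i\<in>UNIV. \<Sum>j\<in>UNIV. \<bar>A $ i $ j\<bar> * norm b)"
  proof (rule sum_mono)
    fix i
    have "\<bar>(A *v b) $ i\<bar> \<le> (\<Sum>j\<in>UNIV. \<bar>A $ i $ j * b $ j\<bar>)"
      unfolding matrix_vector_mult_def by (simp add: sum_abs)
    also have "\<dots> \<le> (\<Sum>j\<in>UNIV. \<bar>A $ i $ j\<bar> * norm b)"
      unfolding abs_mult by (intro sum_mono mult_left_mono component_le_norm_cart) auto
    finally show "\<bar>(A *v b) $ i\<bar> \<le> (\<Sum>j\<in>UNIV. \<bar>A $ i $ j\<bar> * norm b)" .
  qed
  finally show ?thesis by (simp add: sum_distrib_right)
qed

lemma has_derivative_gradient:
  fixes f :: "real^'n \<Rightarrow> real"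
  assumes "f differentiable (at x)"
  shows "(f has_derivative (\<lambda>v. (\<chi> i. pd (axis i 1) f x) \<bullet> v)) (at x)"
proof -
  let ?D = "frechet_derivative f (at x)"
  have D: "(f has_derivative ?D) (at x)" using assms frechet_derivative_works by blast
  have lin: "linear ?D" by (rule has_derivative_linear[OF D])
  have "?D v = (\<chi> i. pd (axis i 1) f x) \<bullet> v" for v
  proof -
    have "?D v = ?D (\<Sum>i\<in>UNIV. v $ i *\<^sub>R axis i 1)"
      using basis_expansion[of v] by (simp add: scalar_mult_eq_scaleR)
    also have "\<dots> = (\<Sum>i\<in>UNIV. v $ i * pd (axis i 1) f x)"
      by (simp add: linear_sum[OF lin] linear_scale[OF lin] pd_def)
    finally show ?thesis by (simp add: inner_vec_def mult.commute)
  qed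
  then have "?D = (\<lambda>v. (\<chi> i. pd (axis i 1) f x) \<bullet> v)" by (rule ext)
  with D show ?thesis by simp
qed

text \<open>At interior points only the zero vector is a proximal normal.\<close>

lemma proximal_normal_interior:
  fixes n :: "'a::euclidean_space"
  assumes op: "open \<Omega>" and y: "y \<in> \<Omega>" and n: "\<And>z. z \<in> \<Omega> \<Longrightarrow> 2 * (n \<bullet> (z - y)) \<le> (norm (z - y))\<^sup>2"
  shows "n = 0"
proof (rule ccontr)
  assume n0: "n \<noteq> 0"
  obtain r where r: "r > 0" "ball y r \<subseteq> \<Omega>" using op y openE by blast
  define t where "t = min 1 (r / (2 * norm n))"
  have t: "t > 0" "t \<le> 1" "t * norm n < r" using r n0 by (auto simp: t_def min_def field_simps)
  have "y + t *\<^sub>R n \<in> \<Omega>" using r(2) t by (auto simp: dist_norm)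
  from n[OF this] have "2 * (t * (n \<bullet> n)) \<le> t\<^sup>2 * (n \<bullet> n)"
    by (simp add: power_mult_distrib power2_norm_eq_inner)
  then have "2 * t \<le> t\<^sup>2" using n0 by (simp flip: mult.assoc)
  then have "2 \<le> t" using t by (simp add: power2_eq_square)
  then show False using t by simp
qed

text \<open>The components of the velocity are \<open>V\<^sub>k = J \<nabla> h\<^sub>k\<close>, extended continuously to the closure, and \<open>B\<^sub>k = J \<nabla>\<^sup>2 h\<^sub>k\<close>.\<close>

lemma stream_control_instance:
  fixes \<Omega> :: "(real^2) set" and h :: "'n::finite \<Rightarrow> real^2 \<Rightarrow> real"
  assumes dom: "C2_simply_connected_domain \<Omega>" and T: "T > 0" and eps: "eps > 0" and lam: "lam > 0"
    and h_smooth: "\<And>k. Cinf_closure \<Omega> (h k)" and h_H10: "\<And>k. H10 \<Omega> (h k)"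
    and \<gamma>_W: "W_inf 2 {0<..<1} \<gamma>0" and \<gamma>_cont: "continuous_on {0..1} \<gamma>0"
    and \<gamma>_range: "\<And>s. s \<in> {0..1} \<Longrightarrow> \<gamma>0 s \<in> closure \<Omega>"
  obtains V B L \<beta> W where "stream_control T \<Omega> V B L \<beta> h \<gamma>0 lam eps W" "\<And>k. bounded_weak_derivs \<Omega> (V k)"
proof -
  have op: "open \<Omega>" and bd: "bounded \<Omega>" and C2: "C2_boundary \<Omega>"
    using dom by (auto simp: C2_simply_connected_domain_def)
  have C: "Cinf \<Omega> (h k)" for k using h_smooth[of k] by (simp add: Cinf_closure_def)
  have hc: "continuous_on (closure \<Omega>) (h k)" for k using h_smooth[of k] by (simp add: Cinf_closure_def)
  have ax: "axis i 1 \<in> (Basis :: (real^2) set)" for i :: 2 by (simp add: axis_in_Basis_iff)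
  have dh: "h k differentiable (at x)" if "x \<in> \<Omega>" for k x by (rule Cinf_differentiable[OF C op that])
  have dh2: "pd (axis i 1) (h k) differentiable (at x)" if "x \<in> \<Omega>" for k i x
    by (rule Cinf_differentiable[OF Cinf_pd[OF C ax] op that])
  \<comment> \<open>Lipschitz extensions \<open>g k i\<close> and \<open>m k i j\<close> of the first and second derivatives of \<open>h k\<close>, with
    constants \<open>Lg k i\<close> and \<open>Lm k i j\<close>.\<close>
  have "\<forall>p. \<exists>q. (snd q)-lipschitz_on (closure \<Omega>) (fst q) \<and> (\<forall>x\<in>\<Omega>. fst q x = pd (axis (snd p :: 2) 1) (h (fst p)) x)"
  proof
    fix p :: "'n \<times> 2"
    show "\<exists>q. (snd q)-lipschitz_on (closure \<Omega>) (fst q) \<and> (\<forall>x\<in>\<Omega>. fst q x = pd (axis (snd p) 1) (h (fst p)) x)"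
      using Cinf_closure_lipschitz_extension[OF op C2 bd h_smooth[of "fst p"], of "[axis (snd p) 1]"] ax by simp
  qed
  from choice[OF this] obtain q1 where q1: "(snd (q1 p))-lipschitz_on (closure \<Omega>) (fst (q1 p))"
      "x \<in> \<Omega> \<Longrightarrow> fst (q1 p) x = pd (axis (snd p) 1) (h (fst p)) x" for p :: "'n \<times> 2" and x by blast
  define g where "g = (\<lambda>k i. fst (q1 (k, i)))"
  define Lg where "Lg = (\<lambda>k i. snd (q1 (k, i)))"
  have g: "(Lg k i)-lipschitz_on (closure \<Omega>) (g k i)" "x \<in> \<Omega> \<Longrightarrow> g k i x = pd (axis i 1) (h k) x" for k i x
    using q1[where p="(k, i)"] by (simp_all add: g_def Lg_def)
  have "\<forall>p. \<exists>q. (snd q)-lipschitz_on (closure \<Omega>) (fst q) \<and>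
      (\<forall>x\<in>\<Omega>. fst q x = pd (axis (snd (snd p) :: 2) 1) (pd (axis (fst (snd p) :: 2) 1) (h (fst p))) x)"
  proof
    fix p :: "'n \<times> 2 \<times> 2"
    show "\<exists>q. (snd q)-lipschitz_on (closure \<Omega>) (fst q) \<and>
      (\<forall>x\<in>\<Omega>. fst q x = pd (axis (snd (snd p)) 1) (pd (axis (fst (snd p)) 1) (h (fst p))) x)"
      using Cinf_closure_lipschitz_extension[OF op C2 bd h_smooth[of "fst p"],
          of "[axis (snd (snd p)) 1, axis (fst (snd p)) 1]"] ax by simp
  qed
  from choice[OF this] obtain q2 where q2: "(snd (q2 p))-lipschitz_on (closure \<Omega>) (fst (q2 p))"
      "x \<in> \<Omega> \<Longrightarrow> fst (q2 p) x = pd (axis (snd (snd p)) 1) (pd (axis (fst (snd p)) 1) (h (fst p))) x"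
    for p :: "'n \<times> 2 \<times> 2" and x by blast
  define m where "m = (\<lambda>k i j. fst (q2 (k, i, j)))"
  define Lm where "Lm = (\<lambda>k i j. snd (q2 (k, i, j)))"
  have m: "(Lm k i j)-lipschitz_on (closure \<Omega>) (m k i j)"
      "x \<in> \<Omega> \<Longrightarrow> m k i j x = pd (axis j 1) (pd (axis i 1) (h k)) x" for k i j x
    using q2[where p="(k, i, j)"] by (simp_all add: m_def Lm_def)
  define G where "G = (\<lambda>k x. \<chi> i. g k i x)"
  define H where "H = (\<lambda>k x. \<chi> i j. m k i j x)"
  define V where "V = (\<lambda>k x. Jmat *v G k x)"
  define B where "B = (\<lambda>k x b. Jmat *v (H k x *v b))"
  define L where "L = (\<Sum>k\<in>UNIV. \<Sum>i\<in>UNIV. Lg k i) + (\<Sum>k\<in>UNIV. \<Sum>i\<in>UNIV. \<Sum>j\<in>UNIV. Lm k i j)"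
  have Lg0: "0 \<le> Lg k i" and Lm0: "0 \<le> Lm k i j" for k i j
    using lipschitz_on_nonneg[OF g(1)] lipschitz_on_nonneg[OF m(1)] by auto
  have Lg: "(\<Sum>i\<in>UNIV. Lg k i) \<le> L" for k
  proof -
    have "(\<Sum>i\<in>UNIV. Lg k i) \<le> (\<Sum>k\<in>UNIV. \<Sum>i\<in>UNIV. Lg k i)"
      by (intro member_le_sum[of k UNIV "\<lambda>k. \<Sum>i\<in>UNIV. Lg k i"] sum_nonneg) (auto simp: Lg0)
    also have "\<dots> \<le> L" unfolding L_def by (simp add: sum_nonneg Lm0)
    finally show ?thesis .
  qed
  have Lm: "(\<Sum>i\<in>UNIV. \<Sum>j\<in>UNIV. Lm k i j) \<le> L" for k
  proof -
    have "(\<Sum>i\<in>UNIV. \<Sum>j\<in>UNIV. Lm k i j) \<le> (\<Sum>k\<in>UNIV. \<Sum>i\<in>UNIV. \<Sum>j\<in>UNIV. Lm k i j)"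
      by (intro member_le_sum[of k UNIV "\<lambda>k. \<Sum>i\<in>UNIV. \<Sum>j\<in>UNIV. Lm k i j"] sum_nonneg) (auto simp: Lm0)
    also have "\<dots> \<le> L" unfolding L_def by (simp add: sum_nonneg Lg0)
    finally show ?thesis .
  qed
  have L0: "0 \<le> L" unfolding L_def by (intro add_nonneg_nonneg sum_nonneg Lg0 Lm0)
  have gc: "continuous_on (closure \<Omega>) (g k i)" for k i by (rule lipschitz_on_continuous_on[OF g(1)])
  have mc: "continuous_on (closure \<Omega>) (m k i j)" for k i j by (rule lipschitz_on_continuous_on[OF m(1)])
  have Gc: "continuous_on (closure \<Omega>) (G k)" for k unfolding G_def by (intro continuous_intros gc)
  have Hc: "continuous_on (closure \<Omega>) (H k)" for k unfolding H_def by (intro continuous_intros mc)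
  have V_lip: "L-lipschitz_on (closure \<Omega>) (V k)" for k
  proof (rule lipschitz_onI)
    fix x y assume xy: "x \<in> closure \<Omega>" "y \<in> closure \<Omega>"
    have "dist (V k x) (V k y) = norm (G k x - G k y)"
      using norm_Jmat_mult[of "G k x - G k y"] by (simp add: V_def dist_norm matrix_vector_mult_diff_distrib)
    also have "\<dots> \<le> (\<Sum>i\<in>UNIV. \<bar>(G k x - G k y) $ i\<bar>)" by (rule norm_le_l1_cart)
    also have "\<dots> \<le> (\<Sum>i\<in>UNIV. Lg k i * dist x y)"
      using lipschitz_onD[OF g(1) xy] by (intro sum_mono) (simp add: G_def dist_real_def)
    also have "\<dots> = (\<Sum>i\<in>UNIV. Lg k i) * dist x y" by (simp add: sum_distrib_right)
    also have "\<dots> \<le> L * dist x y" by (intro mult_right_mono Lg) auto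
    finally show "dist (V k x) (V k y) \<le> L * dist x y" .
  qed (rule L0)
  have "\<exists>b. \<forall>x\<in>closure \<Omega>. \<bar>m k i j x\<bar> \<le> b" for k i j
  proof -
    have "bounded (m k i j ` closure \<Omega>)"
      using mc bd by (intro compact_imp_bounded compact_continuous_image) (simp_all add: compact_closure)
    then show ?thesis unfolding bounded_iff real_norm_def by blast
  qed
  then obtain mb where mb: "\<And>k i j x. x \<in> closure \<Omega> \<Longrightarrow> \<bar>m k i j x\<bar> \<le> mb k i j" by metis
  define \<beta> where "\<beta> = (\<Sum>k\<in>UNIV. \<Sum>i\<in>UNIV. \<Sum>j\<in>UNIV. \<bar>mb k i j\<bar>)"
  have \<beta>0: "0 \<le> \<beta>" unfolding \<beta>_def by (intro sum_nonneg) auto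
  have B_bound: "norm (B k x b) \<le> \<beta> * norm b" if x: "x \<in> closure \<Omega>" for k x b
  proof -
    have "norm (B k x b) = norm (H k x *v b)" by (simp add: B_def norm_Jmat_mult)
    also have "\<dots> \<le> (\<Sum>i\<in>UNIV. \<Sum>j\<in>UNIV. \<bar>H k x $ i $ j\<bar>) * norm b" by (rule norm_matrix_vector_le)
    also have "(\<Sum>i\<in>UNIV. \<Sum>j\<in>UNIV. \<bar>H k x $ i $ j\<bar>) \<le> (\<Sum>i\<in>UNIV. \<Sum>j\<in>UNIV. \<bar>mb k i j\<bar>)"
      by (intro sum_mono) (simp add: H_def order_trans[OF mb[OF x] abs_ge_self])
    also have "\<dots> \<le> \<beta>" unfolding \<beta>_def
      by (intro member_le_sum[of k UNIV "\<lambda>k. \<Sum>i\<in>UNIV. \<Sum>j\<in>UNIV. \<bar>mb k i j\<bar>"] sum_nonneg) auto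
    finally show ?thesis by (simp add: mult_right_mono)
  qed
  have B_lip: "norm (B k x b - B k y b) \<le> L * norm (x - y) * norm b"
    if xy: "x \<in> closure \<Omega>" "y \<in> closure \<Omega>" for k x y b
  proof -
    have "B k x b - B k y b = Jmat *v ((H k x - H k y) *v b)"
      by (simp add: B_def matrix_vector_mult_diff_rdistrib matrix_vector_mult_diff_distrib)
    then have "norm (B k x b - B k y b) = norm ((H k x - H k y) *v b)" by (simp add: norm_Jmat_mult)
    also have "\<dots> \<le> (\<Sum>i\<in>UNIV. \<Sum>j\<in>UNIV. \<bar>(H k x - H k y) $ i $ j\<bar>) * norm b" by (rule norm_matrix_vector_le)
    also have "(\<Sum>i\<in>UNIV. \<Sum>j\<in>UNIV. \<bar>(H k x - H k y) $ i $ j\<bar>) \<le> (\<Sum>i\<in>UNIV. \<Sum>j\<in>UNIV. Lm k i j * norm (x - y))"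
      using lipschitz_onD[OF m(1) xy] by (intro sum_mono) (simp add: H_def dist_real_def dist_norm)
    also have "\<dots> = (\<Sum>i\<in>UNIV. \<Sum>j\<in>UNIV. Lm k i j) * norm (x - y)" by (simp add: sum_distrib_right)
    also have "\<dots> \<le> L * norm (x - y)" by (intro mult_right_mono Lm) auto
    finally show ?thesis by (simp add: mult_right_mono)
  qed
  have Geq: "G k x = (\<chi> i. pd (axis i 1) (h k) x)" if "x \<in> \<Omega>" for k x by (simp add: G_def g(2)[OF that])
  have tang: "n \<bullet> V k y = 0" if y: "y \<in> closure \<Omega>"
    and n: "\<And>z. z \<in> closure \<Omega> \<Longrightarrow> 2 * (n \<bullet> (z - y)) \<le> (norm (z - y))\<^sup>2" for k y n
  proof (cases "y \<in> \<Omega>")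
    case True
    have "n = 0" by (rule proximal_normal_interior[OF op True]) (use n closure_subset in blast)
    then show ?thesis by simp
  next
    case False
    then have yf: "y \<in> frontier \<Omega>" using y op by (simp add: frontier_def interior_open)
    show ?thesis unfolding V_def
    proof (rule perp_grad_tangential[OF op C2 hc Gc _ _ yf n])
      show "(h k has_derivative (\<lambda>v. G k x \<bullet> v)) (at x)" if "x \<in> \<Omega>" for x
        unfolding Geq[OF that] by (rule has_derivative_gradient[OF dh[OF that]])
      show "h k x = 0" if "x \<in> frontier \<Omega>" for x by (rule H10_trace_zero[OF op C2 hc h_H10 that])
    qed
  qed
  have stream_eq: "stream h u t = (\<lambda>x. \<Sum>k\<in>UNIV. u t $ k * h k x)" for u t by (simp add: stream_def fun_eq_iff)
  have pd_stream: "pd (axis i 1) (stream h u t) x = (\<Sum>k\<in>UNIV. u t $ k * pd (axis i 1) (h k) x)" if "x \<in> \<Omega>" for u t x and i :: 2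
    unfolding stream_eq by (rule pd_linear_combination[OF dh[OF that]])
  have pd_pd_stream: "pd (axis j 1) (pd (axis i 1) (stream h u t)) x = (\<Sum>k\<in>UNIV. u t $ k * pd (axis j 1) (pd (axis i 1) (h k)) x)"
    if x: "x \<in> \<Omega>" for u t x and i j :: 2
  proof -
    have "pd (axis j 1) (pd (axis i 1) (stream h u t)) x = pd (axis j 1) (\<lambda>x. \<Sum>k\<in>UNIV. u t $ k * pd (axis i 1) (h k) x) x"
      by (rule pd_cong_open[OF op x pd_stream])
    also have "\<dots> = (\<Sum>k\<in>UNIV. u t $ k * pd (axis j 1) (pd (axis i 1) (h k)) x)"
      by (rule pd_linear_combination[OF dh2[OF x]])
    finally show ?thesis .
  qed
  have grad_eq: "grad \<Omega> (stream h u t) y = (\<Sum>k\<in>UNIV. u t $ k *\<^sub>R G k y)" if "y \<in> closure \<Omega>" for u t y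
    unfolding grad_def
  proof (rule cl_ext_eq[OF _ _ that])
    show "continuous_on (closure \<Omega>) (\<lambda>y. \<Sum>k\<in>UNIV. u t $ k *\<^sub>R G k y)" by (intro continuous_intros Gc)
    show "(\<Sum>k\<in>UNIV. u t $ k *\<^sub>R G k x) = (\<chi> i. pd (axis i 1) (stream h u t) x)" if "x \<in> \<Omega>" for x
      by (simp add: vec_eq_iff Geq[OF that] pd_stream[OF that])
  qed
  have hess_eq: "hess \<Omega> (stream h u t) y = (\<Sum>k\<in>UNIV. u t $ k *\<^sub>R H k y)" if "y \<in> closure \<Omega>" for u t y
    unfolding hess_def
  proof (rule cl_ext_eq[OF _ _ that])
    show "continuous_on (closure \<Omega>) (\<lambda>y. \<Sum>k\<in>UNIV. u t $ k *\<^sub>R H k y)" by (intro continuous_intros Hc)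
    show "(\<Sum>k\<in>UNIV. u t $ k *\<^sub>R H k x) = (\<chi> i j. pd (axis j 1) (pd (axis i 1) (stream h u t)) x)" if "x \<in> \<Omega>" for x
      by (simp add: vec_eq_iff H_def m(2)[OF that] pd_pd_stream[OF that])
  qed
  have Jlin: "Jmat *v (\<Sum>k\<in>UNIV. c k *\<^sub>R z k) = (\<Sum>k\<in>UNIV. c k *\<^sub>R (Jmat *v z k))" for c :: "'n \<Rightarrow> real" and z
    by (simp add: linear_sum[OF matrix_vector_mul_linear] matrix_vector_mult_scaleR)
  have Hlin: "(\<Sum>k\<in>UNIV. c k *\<^sub>R A k) *v b = (\<Sum>k\<in>UNIV. c k *\<^sub>R (A k *v b))" for c :: "'n \<Rightarrow> real" and A :: "'n \<Rightarrow> real^2^2" and b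
  proof -
    have "linear (\<lambda>A :: real^2^2. A *v b)"
      by (rule linearI) (simp_all add: matrix_vector_mult_add_rdistrib scaleR_matrix_vector_assoc)
    from linear_sum[OF this, of "\<lambda>k. c k *\<^sub>R A k" UNIV] show ?thesis by (simp add: scaleR_matrix_vector_assoc)
  qed
  have "\<exists>w. \<forall>x\<in>\<Omega>. \<bar>h k x\<bar> \<le> w" for k
    using Cinf_closure_bounded[OF h_smooth bd, of "[]" k] by simp
  then obtain w where w: "\<And>k x. x \<in> \<Omega> \<Longrightarrow> \<bar>h k x\<bar> \<le> w k" by metis
  define W where "W = (\<Sum>k\<in>UNIV. \<bar>w k\<bar>)"
  have hW: "\<bar>h k x\<bar> \<le> W" if "x \<in> \<Omega>" for k x
  proof -
    have "\<bar>h k x\<bar> \<le> \<bar>w k\<bar>" using w[OF that, of k] by linarith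
    also have "\<dots> \<le> W" unfolding W_def by (rule member_le_sum) auto
    finally show ?thesis .
  qed
  have velocity: "Jmat *v grad \<Omega> (stream h u t) y = (\<Sum>k\<in>UNIV. u t $ k *\<^sub>R V k y)" if "y \<in> closure \<Omega>" for u t y
    unfolding grad_eq[OF that] Jlin V_def ..
  have "stream_control T \<Omega> V B L \<beta> h \<gamma>0 lam eps W"
  proof (intro stream_control.intro transport_system.intro stream_control_axioms.intro)
    show "compact (closure \<Omega>)" using bd by (simp add: compact_closure)
    show "linear (B k x)" for k x
      unfolding B_def by (rule linearI) (simp_all add: matrix_vector_right_distrib matrix_vector_mult_scaleR)
    show "Jmat *v (hess \<Omega> (stream h u t) y *v b) = (\<Sum>k\<in>UNIV. u t $ k *\<^sub>R B k y b)" if "y \<in> closure \<Omega>" for u t y b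
      unfolding hess_eq[OF that] Hlin Jlin B_def ..
    show "continuous_on {0..1} (curve_deriv \<gamma>0)" by (rule continuous_on_curve_deriv[OF \<gamma>_W \<gamma>_cont])
    show "\<Omega> \<in> lmeasurable" using op bd by (intro bounded_set_imp_lmeasurable) auto
    show "h k \<in> borel_measurable (lebesgue_on \<Omega>)" for k
      using op by (intro continuous_imp_measurable_on_sets_lebesgue Cinf_continuous[OF C]) auto
  qed (use T \<beta>0 V_lip tang B_bound B_lip velocity \<gamma>_cont \<gamma>_range eps lam hW in auto)
  moreover have "bounded_weak_derivs \<Omega> (V k)" for k
  proof -
    have "bounded_weak_derivs \<Omega> (pd (axis i 1) (h k))" for i :: 2
    proof (rule Cinf_bounded_weak_derivs[OF op Cinf_pd[OF C ax]])
      show "\<exists>C. \<forall>x\<in>\<Omega>. norm (ipd \<alpha> (pd (axis i 1) (h k)) x) \<le> C" if "set \<alpha> \<subseteq> Basis" for \<alpha>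
        using Cinf_closure_bounded[OF h_smooth bd, of "\<alpha> @ [axis i 1]" k] that ax by (simp add: ipd_append)
    qed
    then have sum: "bounded_weak_derivs \<Omega> (\<lambda>x. \<Sum>i\<in>UNIV. pd (axis i 1) (h k) x *\<^sub>R (Jmat *v axis (i :: 2) 1))"
      by (intro bounded_weak_derivs_sum bounded_weak_derivs_scaleR_const) auto
    have Vk: "V k x = (\<Sum>i\<in>UNIV. pd (axis i 1) (h k) x *\<^sub>R (Jmat *v axis (i :: 2) 1))" if "x \<in> \<Omega>" for x
    proof -
      have ax12: "axis (1 :: 2) 1 $ (2 :: 2) = (0 :: real)" "axis (2 :: 2) 1 $ (1 :: 2) = (0 :: real)" by (simp_all add: axis_def)
      have J: "Jmat *v (\<chi> i. p i) = (\<Sum>i\<in>UNIV. p i *\<^sub>R (Jmat *v axis (i :: 2) 1))" for p :: "2 \<Rightarrow> real"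
        by (simp add: vec_eq_iff[where 'b=2] forall_2 sum_2 Jmat_mult ax12)
      show ?thesis unfolding V_def Geq[OF that] by (rule J)
    qed
    show ?thesis by (rule iffD2[OF bounded_weak_derivs_cong sum]) (rule Vk)
  qed
  ultimately show ?thesis by (rule that)
qed

section \<open>Well-posedness and existence of a minimizer\<close>

theorem theorem3p3:
  fixes \<Omega> :: "(real^2) set"
    and T eps lam Ru :: real
    and h :: "'n::finite \<Rightarrow> real^2 \<Rightarrow> real"
    and \<gamma>0 :: "real \<Rightarrow> real^2"
  assumes dom: "C2_simply_connected_domain \<Omega>"
    and T: "T > 0" and eps: "eps > 0" and lam: "lam > 0" and Ru: "Ru > 0"
    and h_smooth: "\<And>k. Cinf_closure \<Omega> (h k)"
    and h_H10: "\<And>k. H10 \<Omega> (h k)"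
    and h_indep: "\<And>c :: real^'n. (\<And>x. x \<in> closure \<Omega> \<Longrightarrow> (\<Sum>k\<in>UNIV. c $ k * h k x) = 0) \<Longrightarrow> c = 0"
    and \<gamma>_W: "W_inf 2 {0<..<1} \<gamma>0"
    and \<gamma>_cont: "continuous_on {0..1} \<gamma>0"
    and \<gamma>_range: "\<And>s. s \<in> {0..1} \<Longrightarrow> \<gamma>0 s \<in> closure \<Omega>"
  shows
    "(\<forall>u. L2_on {0..T} u \<longrightarrow>
        bochner_L2 T (Wnorm 3 \<Omega>) (stream h u) \<and>
        bochner_L2 T (Wnorm 2 \<Omega>) (\<lambda>t. perp_grad \<Omega> (stream h u t)) \<and>
        (\<exists>\<Phi>. is_flow \<Omega> T (stream h u) \<Phi> \<and>
           (\<forall>\<Psi>. is_flow \<Omega> T (stream h u) \<Psi> \<longrightarrow> (\<forall>t\<in>{0..T}. \<forall>x\<in>closure \<Omega>. \<Psi> t x = \<Phi> t x)) \<and>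
           (\<forall>t\<in>{0..T}. \<Phi> t ` closure \<Omega> \<subseteq> closure \<Omega>)) \<and>
        (\<exists>X a. state_solution \<Omega> T \<gamma>0 (stream h u) X a \<and>
           (\<forall>Y b. state_solution \<Omega> T \<gamma>0 (stream h u) Y b \<longrightarrow>
              (\<forall>t\<in>{0..T}. \<forall>s\<in>{0..1}. Y t s = X t s \<and> b t s = a t s)) \<and>
           integrable (lebesgue_on {0..1}) (\<lambda>s. sqrt ((norm (a T s))\<^sup>2 + eps\<^sup>2))) \<and>
        (\<forall>t\<in>{0..T}. L2_on \<Omega> (stream h u t)) \<and>
        integrable (lebesgue_on {0..T}) (\<lambda>t. (L2norm \<Omega> (stream h u t))\<^sup>2) \<and>
        (\<exists>!c. cost_value \<Omega> T \<gamma>0 lam eps (stream h u) c)) \<and>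
     (\<forall>u. L2_on {0..T} u \<longrightarrow>
        (\<forall>e>0. \<exists>d>0. \<forall>w. L2_on {0..T} w \<and> L2norm {0..T} (\<lambda>t. w t - u t) < d \<longrightarrow>
           \<bar>cost \<Omega> T \<gamma>0 lam eps (stream h w) - cost \<Omega> T \<gamma>0 lam eps (stream h u)\<bar> < e)) \<and>
     (\<exists>\<psi>s\<in>U_ad T h Ru. \<forall>\<psi>\<in>U_ad T h Ru. cost \<Omega> T \<gamma>0 lam eps \<psi>s \<le> cost \<Omega> T \<gamma>0 lam eps \<psi>)"
proof -
  obtain V B L \<beta> W where sc: "stream_control T \<Omega> V B L \<beta> h \<gamma>0 lam eps W" and Vb: "\<And>k. bounded_weak_derivs \<Omega> (V k)"
    by (rule stream_control_instance[where h = h, OF dom T eps lam h_smooth h_H10 \<gamma>_W \<gamma>_cont \<gamma>_range]) (assumption, rule that, assumption+)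
  interpret stream_control T \<Omega> V B L \<beta> h \<gamma>0 lam eps W by (rule sc)
  have op: "open \<Omega>" and bd: "bounded \<Omega>" using dom by (auto simp: C2_simply_connected_domain_def)
  have hb: "bounded_weak_derivs \<Omega> (h k)" for k
  proof (rule Cinf_bounded_weak_derivs[OF op])
    show "Cinf \<Omega> (h k)" using h_smooth[of k] by (simp add: Cinf_closure_def)
  qed (rule Cinf_closure_bounded[OF h_smooth bd])
  have part1: "bochner_L2 T (Wnorm 3 \<Omega>) (stream h u)" if u: "L2_on {0..T} u" for u
  proof -
    have "bochner_L2 T (Wnorm 3 \<Omega>) (\<lambda>t. stream_of (u t))"
      by (rule bochner_L2_linear_combination[OF hb _ u]) (simp add: stream_of_def)
    then show ?thesis by (simp add: stream_eq[symmetric])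
  qed
  have part2: "bochner_L2 T (Wnorm 2 \<Omega>) (\<lambda>t. perp_grad \<Omega> (stream h u t))" if u: "L2_on {0..T} u" for u
  proof -
    have "bochner_L2 T (Wnorm 2 \<Omega>) (\<lambda>t. perp_grad \<Omega> (stream_of (u t)))"
    proof (rule bochner_L2_linear_combination[OF Vb _ u])
      fix c :: "real^'n" and x assume "x \<in> \<Omega>"
      then have "x \<in> closure \<Omega>" using closure_subset by blast
      from velocity[OF this, of "\<lambda>_. c" 0] show "perp_grad \<Omega> (stream_of c) x = (\<Sum>i\<in>UNIV. c $ i *\<^sub>R V i x)"
        by (simp add: perp_grad_def stream_eq)
    qed
    then show ?thesis by (simp add: stream_eq)
  qed
  have part3: "\<exists>\<Phi>. is_flow \<Omega> T (stream h u) \<Phi> \<and>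
           (\<forall>\<Psi>. is_flow \<Omega> T (stream h u) \<Psi> \<longrightarrow> (\<forall>t\<in>{0..T}. \<forall>x\<in>closure \<Omega>. \<Psi> t x = \<Phi> t x)) \<and>
           (\<forall>t\<in>{0..T}. \<Phi> t ` closure \<Omega> \<subseteq> closure \<Omega>)" if u: "L2_on {0..T} u" for u
  proof -
    have ua: "u absolutely_integrable_on {0..T}" by (rule L2_absint[OF u])
    obtain \<Phi> where \<Phi>: "\<And>x. x \<in> closure \<Omega> \<Longrightarrow> trajectory u x (\<Phi> x)" using trajectory_exists[OF ua] by metis
    have "is_flow \<Omega> T (stream h u) (\<lambda>t x. \<Phi> x t)" unfolding is_flow_iff using \<Phi> by simp
    moreover have "\<Psi> t x = \<Phi> x t" if "is_flow \<Omega> T (stream h u) \<Psi>" "t \<in> {0..T}" "x \<in> closure \<Omega>" for \<Psi> t x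
      using trajectory_unique[OF ua _ \<Phi>[OF that(3)] that(2)] that(1,3) unfolding is_flow_iff by blast
    moreover have "\<Phi> x t \<in> closure \<Omega>" if "t \<in> {0..T}" "x \<in> closure \<Omega>" for t x
      using \<Phi>[OF that(2)] that(1) unfolding trajectory_iff[OF ua] by blast
    ultimately show ?thesis by (intro exI[of _ "\<lambda>t x. \<Phi> x t"]) blast
  qed
  have part4: "\<exists>X a. state_solution \<Omega> T \<gamma>0 (stream h u) X a \<and>
           (\<forall>Y b. state_solution \<Omega> T \<gamma>0 (stream h u) Y b \<longrightarrow>
              (\<forall>t\<in>{0..T}. \<forall>s\<in>{0..1}. Y t s = X t s \<and> b t s = a t s)) \<and>
           integrable (lebesgue_on {0..1}) (\<lambda>s. sqrt ((norm (a T s))\<^sup>2 + eps\<^sup>2))" if u: "L2_on {0..T} u" for u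
  proof -
    have ua: "u absolutely_integrable_on {0..T}" by (rule L2_absint[OF u])
    obtain X a where X: "state_solution \<Omega> T \<gamma>0 (stream h u) X a" using state_solution_exists[OF ua] by blast
    show ?thesis
      using X state_solution_unique[OF ua X] stretch_integrable[OF state_solution_terminal_continuous[OF X]] by blast
  qed
  have part5: "L2_on \<Omega> (stream h u t)" for u t unfolding stream_eq by (rule stream_of_L2)
  have part6: "integrable (lebesgue_on {0..T}) (\<lambda>t. (L2norm \<Omega> (stream h u t))\<^sup>2)" if u: "L2_on {0..T} u" for u
    using energy_density_integrable[OF u] by (simp add: stream_eq L2norm_sq energy_density_def)
  have part7: "\<exists>!c. cost_value \<Omega> T \<gamma>0 lam eps (stream h u) c" if u: "L2_on {0..T} u" for u
    unfolding cost_value_iff[OF L2_absint[OF u]] by simp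
  have part8: "\<exists>\<psi>s\<in>U_ad T h Ru. \<forall>\<psi>\<in>U_ad T h Ru. cost \<Omega> T \<gamma>0 lam eps \<psi>s \<le> cost \<Omega> T \<gamma>0 lam eps \<psi>"
  proof -
    obtain u where u: "L2_on {0..T} u" "L2norm {0..T} u \<le> Ru"
      "\<And>w. L2_on {0..T} w \<Longrightarrow> L2norm {0..T} w \<le> Ru \<Longrightarrow> cost \<Omega> T \<gamma>0 lam eps (stream h u) \<le> cost \<Omega> T \<gamma>0 lam eps (stream h w)"
      using minimizer_exists[of Ru] Ru by auto
    then show ?thesis unfolding U_ad_def by (intro bexI[of _ "stream h u"]) auto
  qed
  show ?thesis
    using part1 part2 part3 part4 part5 part6 part7 cost_continuous part8 by (intro conjI allI impI ballI) simp_all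
qed

end
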